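(* Let $k\ge 3$ be a fixed integer and let $m_{\omega^k}(x):=\sum_{n\le x}\frac{\mu(n)\omega(n)^k}{n}$. (i) As $x\to\infty$, $$m_{\omega^k}(x)=O\!\left(\frac{(\log\log x)^{\frac{2k-1}{2}}}{\log x}\right).$$ Consequently $\sum_{n=1}^{\infty}\frac{\mu(n)\omega(n)^k}{n}=\sum_{n=2}^{\infty}\frac{\mu(n)\omega(n)^k}{n}=0$ (the series converging as the limit of its partial sums). (ii) More precisely, there exist polynomials $F^*_{j,k}(X)$ ($j\ge1$) of degree at most $k-1$, with $F^*_{1,k}$ of degree exactly $k-1$, such that for each positive integer $\nu$, $$m_{\omega^k}(x)=\sum_{j=1}^{\nu}\frac{F^*_{j,k}(\log\log x)}{\log^j x}+O_\nu\!\left(\frac{(\log\log x)^{k\nu+3k}}{\log^{\nu+1}x}\right).$$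
   Context: $\mu$ is the Möbius function and $\omega(n)$ is the number of distinct prime factors of $n$ (with $\omega(1)=0$). Implied constants may depend on the fixed $k$; $O_\nu$ indicates dependence on $\nu$ as well. *)

theory Defs
  imports
    "HOL-Analysis.Analysis"
    "HOL-Computational_Algebra.Computational_Algebra"
    "HOL-Library.Landau_Symbols"
begin

definition omega :: "nat \<Rightarrow> nat" where
  "omega n = card (prime_factors n)"

text \<open>For squarefree \<open>n\<close> the exponent \<open>omega n\<close> is the number of primes in the factorization
  of \<open>n\<close>. The value at \<open>0\<close> is \<open>0\<close>, as \<open>squarefree 0\<close> is false.\<close>

definition moebius_mu :: "nat \<Rightarrow> int" where
  "moebius_mu n = (if squarefree n then (-1) ^ omega n else 0)"

definition mu_omega_term :: "nat \<Rightarrow> nat \<Rightarrow> real" where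
  "mu_omega_term k n = of_int (moebius_mu n) * real (omega n) ^ k / real n"

definition m_omega :: "nat \<Rightarrow> real \<Rightarrow> real" where
  "m_omega k x = (\<Sum>n | 1 \<le> n \<and> real n \<le> x. mu_omega_term k n)"

end

theory Submission
  imports
    Defs
    "HOL-Complex_Analysis.Complex_Analysis"
    "HOL-Probability.Probability"
    "HOL-Number_Theory.Prime_Powers"
    "HOL-Real_Asymp.Real_Asymp"
begin

text \<open>The function \<open>m_omega k (exp v)\<close> of \<open>v \<ge> 0\<close> has the Laplace transform \<open>D k w / w\<close>, where
  \<open>D k w\<close> is the Dirichlet series of \<open>\<mu>(n) \<omega>(n)^k\<close> at \<open>1 + w\<close>. Expanding \<open>\<omega>(n)^(k+1)\<close> along the
  prime powers dividing \<open>n\<close> expresses \<open>D (k+1)\<close> through \<open>D i\<close> with \<open>i \<le> k\<close> and the sums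
  \<open>\<Sum> l^j p^(-l(1+w))\<close> over prime powers. Each of these sums is \<open>log (1/w)\<close> plus a function that is
  analytic at \<open>0\<close>, so \<open>D k w / w\<close> is a polynomial of degree \<open>k\<close> in \<open>log (1/w)\<close>. All derivatives of
  its coefficients are \<open>O(|t|^\<epsilon>)\<close> as \<open>w\<close> approaches the imaginary axis: this only needs
  \<open>1 / \<zeta>(1+w) = O(|t|^\<epsilon>)\<close>, which is the 3-4-1 inequality applied near the line.

  The functions \<open>\<integral> r^j (log 1/r)^l exp (-rX) dr\<close> over \<open>0 < r < 1\<close> have the transforms
  \<open>\<integral> r^j (log 1/r)^l / (w + r) dr\<close>, which behave like \<open>(log 1/w)^(l+1) (-w)^j / (l+1)\<close> at the origin. A
  combination with \<open>j < J\<close> removes the singularity up to \<open>O(|w|^J (log 1/|w|)^k)\<close>. They are asymptotic to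
  \<open>X^(-j-1)\<close> times a polynomial in \<open>log X\<close> and give the main terms. The remainder has a transform with
  many derivatives of at most linear growth, that is, it is small on average against a Gaussian. Since \<open>m_omega k\<close> oscillates
  slowly, the remainder is then small pointwise; the loss in this step is harmless as \<open>J\<close> is arbitrary.\<close>

subsection \<open>Laplace transforms\<close>

text \<open>No zero-free region to the left of \<open>Re s = 1\<close> is established, so no contour
  can be moved across the axis. All saving must come from derivatives of the transform, that is,
  from a weight \<open>v ^ n\<close> on the time side; hence the bookkeeping of bounds for every
  derivative. With \<open>n = 3 * N\<close> and a Gaussian window of width \<open>X ^ (- N)\<close>,
  the window costs \<open>X ^ (2 * N)\<close>, and the weight pays for it and leaves
  \<open>X ^ (- N)\<close> up to a fixed power of \<open>X\<close>.

  Division by \<open>w\<close> creates no pole: the series for \<open>k = 0\<close> is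
  \<open>1 / zeta\<close>, which vanishes at the origin, and the recurrence passes this factor on to
  all \<open>k\<close>. So the expansion has no constant term, and the series converges to 0.

  A singularity \<open>log (1/w) ^ k\<close> has a density on the negative axis with only
  \<open>k - 1\<close> logarithms. This accounts for the degree \<open>k - 1\<close>; the top
  coefficient of the first polynomial comes out as \<open>k * (-1) ^ k\<close>, which is not
  0.\<close>

definition rhp :: "complex set" where
  "rhp = {w. Re w > 0}"

lemma open_rhp [simp, intro]: "open rhp"
  unfolding rhp_def by (rule open_halfspace_Re_gt)

lemma convex_rhp [simp, intro]: "convex rhp"
  unfolding rhp_def by (rule convex_halfspace_Re_gt)

text \<open>The common form of Laplace integrals and of Dirichlet series, where \<open>M\<close> counts natural numbers and \<open>l n = ln n\<close>.\<close>

definition lap :: "'a measure \<Rightarrow> ('a \<Rightarrow> real) \<Rightarrow> ('a \<Rightarrow> complex) \<Rightarrow> complex \<Rightarrow> complex" where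
  "lap M l c w = (\<integral>x. c x * exp (- w * of_real (l x)) \<partial>M)"

text \<open>Convergence is required for every \<open>u > 0\<close>, though not at 0. This makes the
  class closed under multiplying \<open>c\<close> by \<open>l\<close>, hence under differentiation
  of the transform.\<close>

definition lap_ok :: "'a measure \<Rightarrow> ('a \<Rightarrow> real) \<Rightarrow> ('a \<Rightarrow> complex) \<Rightarrow> bool" where
  "lap_ok M l c \<longleftrightarrow> l \<in> borel_measurable M \<and> c \<in> borel_measurable M \<and> (\<forall>x\<in>space M. 0 \<le> l x) \<and>
     (\<forall>u>0. integrable M (\<lambda>x. norm (c x) * exp (- u * l x)))"

lemma norm_integral_le:
  fixes f :: "'a \<Rightarrow> 'b::{banach,second_countable_topology}"
  assumes "integrable M f" "integrable M g" "\<And>x. x \<in> space M \<Longrightarrow> norm (f x) \<le> g x"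
  shows "norm (\<integral>x. f x \<partial>M) \<le> (\<integral>x. g x \<partial>M)"
  using assms by (intro order.trans [OF integral_norm_bound integral_mono]) auto

lemma lap_integrable:
  assumes "lap_ok M l c" "w \<in> rhp"
  shows "integrable M (\<lambda>x. c x * exp (- w * of_real (l x)))"
proof (rule Bochner_Integration.integrable_bound)
  show "integrable M (\<lambda>x. norm (c x) * exp (- (Re w) * l x))"
    using assms by (simp add: lap_ok_def rhp_def)
  show "(\<lambda>x. c x * exp (- w * of_real (l x))) \<in> borel_measurable M"
    using assms unfolding lap_ok_def by (auto intro!: borel_measurable_times measurable_compose [OF _ borel_measurable_exp] borel_measurable_of_real)
qed (auto simp: norm_mult)

text \<open>Half of the exponential decay absorbs the new factor, because
  \<open>(u/2) * l \<le> exp ((u/2) * l)\<close>; the other half is covered by the hypothesis at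
  \<open>u/2\<close>.\<close>

lemma lap_ok_times:
  assumes ok: "lap_ok M l c"
  shows "lap_ok M l (\<lambda>x. of_real (l x) * c x)"
  unfolding lap_ok_def
proof (intro conjI allI impI)
  show "l \<in> borel_measurable M" "\<forall>x\<in>space M. 0 \<le> l x"
    using ok by (auto simp: lap_ok_def)
  show "(\<lambda>x. of_real (l x) * c x) \<in> borel_measurable M"
    using ok unfolding lap_ok_def by (auto intro!: borel_measurable_times borel_measurable_of_real)
  fix u :: real assume u: "u > 0"
  have meas [measurable]: "l \<in> borel_measurable M" "c \<in> borel_measurable M"
    using ok by (auto simp: lap_ok_def)
  show "integrable M (\<lambda>x. norm (of_real (l x) * c x) * exp (- u * l x))"
  proof (rule Bochner_Integration.integrable_bound)
    show "integrable M (\<lambda>x. (2 / u) * (norm (c x) * exp (- (u/2) * l x)))"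
      using ok half_gt_zero [OF u] unfolding lap_ok_def by (intro integrable_mult_right) blast
    show "AE x in M. norm (norm (of_real (l x) * c x) * exp (- u * l x))
        \<le> norm ((2 / u) * (norm (c x) * exp (- (u/2) * l x)))"
    proof (rule AE_I2)
      fix x assume "x \<in> space M"
      hence l: "l x \<ge> 0" using ok by (auto simp: lap_ok_def)
      have "(u/2) * l x \<le> exp ((u/2) * l x)"
        by (meson add_increasing exp_ge_add_one_self order_trans zero_le_one order_refl)
      hence "(u/2) * l x * exp (- u * l x) \<le> exp ((u/2) * l x) * exp (- u * l x)"
        by (rule mult_right_mono) auto
      also have "\<dots> = exp (- (u/2) * l x)"
        by (simp add: exp_add [symmetric] field_simps)
      finally have "l x * exp (- u * l x) \<le> (2/u) * exp (- (u/2) * l x)"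
        using u by (simp add: field_simps)
      hence "norm (c x) * (l x * exp (- u * l x)) \<le> norm (c x) * ((2/u) * exp (- (u/2) * l x))"
        by (rule mult_left_mono) auto
      thus "norm (norm (of_real (l x) * c x) * exp (- u * l x))
        \<le> norm ((2 / u) * (norm (c x) * exp (- (u/2) * l x)))"
        using l u by (simp add: norm_mult mult_ac)
    qed
  qed measurable
qed

lemma exp_linear_approx:
  fixes z :: complex
  shows "norm (exp z - 1 - z) \<le> norm z ^ 2 * exp (norm z)"
proof -
  have "norm (exp z - (\<Sum>k\<le>1. z ^ k / fact k)) \<le> exp \<bar>Re z\<bar> * norm z ^ Suc 1 / fact 1"
    by (rule Taylor_exp)
  also have "exp \<bar>Re z\<bar> * norm z ^ Suc 1 / fact 1 \<le> exp (norm z) * norm z ^ 2"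
    by (simp add: numeral_2_eq_2 mult_right_mono abs_Re_le_cmod)
  finally show ?thesis by (simp add: algebra_simps)
qed

text \<open>The difference quotient misses the derivative by at most \<open>norm h * K\<close>,
  where \<open>K\<close> is the integral of the coefficient with weight \<open>l ^ 2\<close> at
  abscissa \<open>u/2\<close>. The other half of \<open>u\<close> pays for the factor
  \<open>exp (norm h * l x)\<close> in the quadratic Taylor error.\<close>

lemma lap_has_field_derivative:
  assumes ok: "lap_ok M l c" and w: "w \<in> rhp"
  shows "(lap M l c has_field_derivative - lap M l (\<lambda>x. of_real (l x) * c x) w) (at w)"
proof -
  define u where "u = Re w"
  have u: "u > 0" using w by (simp add: u_def rhp_def)
  have ok1: "lap_ok M l (\<lambda>x. of_real (l x) * c x)" by (rule lap_ok_times [OF ok])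
  have ok2: "lap_ok M l (\<lambda>x. of_real (l x) * (of_real (l x) * c x))" by (rule lap_ok_times [OF ok1])
  define g where "g = (\<lambda>x. norm (of_real (l x) * (of_real (l x) * c x)) * exp (- (u/2) * l x))"
  have g: "integrable M g" using ok2 half_gt_zero [OF u] unfolding g_def lap_ok_def by blast
  define K where "K = (\<integral>x. g x \<partial>M)"
  have bound: "norm ((lap M l c (w + h) - lap M l c w) / h + lap M l (\<lambda>x. of_real (l x) * c x) w) \<le> norm h * K"
    if h: "h \<noteq> 0" "norm h < u / 2" for h
  proof -
    have "\<bar>Re h\<bar> < u / 2" using h abs_Re_le_cmod [of h] by linarith
    hence wh: "w + h \<in> rhp" using u by (auto simp: rhp_def u_def)
    let ?d = "\<lambda>x. (c x * exp (- (w + h) * of_real (l x)) - c x * exp (- w * of_real (l x))) / h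
        + of_real (l x) * c x * exp (- w * of_real (l x))"
    have int: "integrable M ?d"
      using lap_integrable [OF ok wh] lap_integrable [OF ok w] lap_integrable [OF ok1 w]
      by (intro Bochner_Integration.integrable_add integrable_divide Bochner_Integration.integrable_diff) auto
    have "(lap M l c (w + h) - lap M l c w) / h + lap M l (\<lambda>x. of_real (l x) * c x) w = (\<integral>x. ?d x \<partial>M)"
      unfolding lap_def
      using lap_integrable [OF ok wh] lap_integrable [OF ok w] lap_integrable [OF ok1 w] h
      by (subst Bochner_Integration.integral_add) (auto simp: integral_diff)
    also have "norm \<dots> \<le> (\<integral>x. norm h * g x \<partial>M)"
    proof (rule norm_integral_le)
      show "integrable M ?d" by (rule int)
      show "integrable M (\<lambda>x. norm h * g x)" using g by simp
      fix x assume "x \<in> space M"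
      hence l: "l x \<ge> 0" using ok by (auto simp: lap_ok_def)
      have "?d x = c x * exp (- w * of_real (l x)) * (exp (- h * of_real (l x)) - 1 - (- h * of_real (l x))) / h"
        using h by (simp add: field_simps exp_add [symmetric] exp_diff exp_minus)
      also have "norm \<dots> \<le> norm (c x) * exp (- u * l x) * (norm (- h * of_real (l x)) ^ 2 * exp (norm (- h * of_real (l x)))) / norm h"
      proof -
        have "norm (c x * exp (- w * of_real (l x)) * (exp (- h * of_real (l x)) - 1 - (- h * of_real (l x))) / h)
          = norm (c x) * exp (- u * l x) * norm (exp (- h * of_real (l x)) - 1 - (- h * of_real (l x))) / norm h"
          by (simp add: norm_mult norm_divide u_def)
        also have "\<dots> \<le> norm (c x) * exp (- u * l x) * (norm (- h * of_real (l x)) ^ 2 * exp (norm (- h * of_real (l x)))) / norm h"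
          by (intro divide_right_mono mult_left_mono exp_linear_approx) auto
        finally show ?thesis .
      qed
      also have "\<dots> = norm h * (norm (c x) * l x ^ 2 * exp (- u * l x + norm h * l x))"
        using h l by (simp add: norm_mult power_mult_distrib power2_eq_square mult_exp_exp)
      also have "\<dots> \<le> norm h * (norm (c x) * l x ^ 2 * exp (- (u/2) * l x))"
      proof -
        have "norm h * l x \<le> u / 2 * l x" using h l by (intro mult_right_mono) auto
        hence "- u * l x + norm h * l x \<le> - (u/2) * l x" by (simp add: field_simps)
        thus ?thesis by (intro mult_left_mono) auto
      qed
      also have "\<dots> = norm h * g x" using l by (simp add: g_def norm_mult power2_eq_square)
      finally show "norm (?d x) \<le> norm h * g x" .
    qed
    also have "\<dots> = norm h * K" by (simp add: K_def)
    finally show ?thesis .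
  qed
  have "((\<lambda>h. (lap M l c (w + h) - lap M l c w) / h + lap M l (\<lambda>x. of_real (l x) * c x) w) \<longlongrightarrow> 0) (at 0)"
  proof (rule Lim_null_comparison)
    show "\<forall>\<^sub>F h in at 0. norm ((lap M l c (w + h) - lap M l c w) / h + lap M l (\<lambda>x. of_real (l x) * c x) w) \<le> norm h * K"
      unfolding eventually_at using u by (intro exI[of _ "u/2"]) (auto intro!: bound)
    show "((\<lambda>h. norm h * K) \<longlongrightarrow> 0) (at (0::complex))"
      by (auto intro!: tendsto_eq_intros)
  qed
  hence "((\<lambda>h. ((lap M l c (w + h) - lap M l c w) / h + lap M l (\<lambda>x. of_real (l x) * c x) w) - lap M l (\<lambda>x. of_real (l x) * c x) w) \<longlongrightarrow> 0 - lap M l (\<lambda>x. of_real (l x) * c x) w) (at 0)"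
    by (rule tendsto_diff) simp
  thus ?thesis unfolding DERIV_def by simp
qed

lemma lap_holomorphic: "lap_ok M l c \<Longrightarrow> lap M l c holomorphic_on rhp"
  by (meson field_differentiable_at_within field_differentiable_def holomorphic_on_def
      lap_has_field_derivative)

lemma lap_deriv: "lap_ok M l c \<Longrightarrow> w \<in> rhp \<Longrightarrow> deriv (lap M l c) w = - lap M l (\<lambda>x. of_real (l x) * c x) w"
  by (rule DERIV_imp_deriv [OF lap_has_field_derivative])

text \<open>This is the dictionary between both sides of the Tauberian argument: bounds for the
  \<open>n\<close>th derivative are bounds for the transform of the function with weight
  \<open>l ^ n\<close>.\<close>

lemma lap_higher_deriv:
  assumes "lap_ok M l c" "w \<in> rhp"
  shows "(deriv ^^ n) (lap M l c) w = (-1) ^ n * lap M l (\<lambda>x. of_real (l x) ^ n * c x) w"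
  using assms
proof (induction n arbitrary: c w)
  case (Suc n)
  have "(deriv ^^ Suc n) (lap M l c) w = (deriv ^^ n) (deriv (lap M l c)) w"
    by (simp add: funpow_swap1)
  also have "\<dots> = (deriv ^^ n) (\<lambda>w. - lap M l (\<lambda>x. of_real (l x) * c x) w) w"
    by (rule higher_deriv_transform_within_open [OF _ _ open_rhp])
       (use Suc.prems in \<open>auto intro!: holomorphic_deriv holomorphic_on_minus lap_holomorphic
          lap_ok_times lap_deriv\<close>)
  also have "\<dots> = - (deriv ^^ n) (lap M l (\<lambda>x. of_real (l x) * c x)) w"
    by (rule higher_deriv_uminus [OF _ open_rhp])
       (use Suc.prems in \<open>auto intro!: lap_holomorphic lap_ok_times\<close>)
  also have "\<dots> = (-1) ^ Suc n * lap M l (\<lambda>x. of_real (l x) ^ Suc n * c x) w"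
    using Suc.IH [OF lap_ok_times [OF Suc.prems(1)] Suc.prems(2)] by (simp add: mult_ac)
  finally show ?case .
qed (auto simp: )

lemma norm_lap_le:
  assumes "lap_ok M l c" "w \<in> rhp"
  shows "norm (lap M l c w) \<le> (\<integral>x. norm (c x) * exp (- Re w * l x) \<partial>M)"
proof -
  have "norm (lap M l c w) \<le> (\<integral>x. norm (c x * exp (- w * of_real (l x))) \<partial>M)"
    unfolding lap_def by (rule integral_norm_bound)
  thus ?thesis by (simp add: norm_mult)
qed

subsection \<open>Functions of slow growth near the imaginary axis\<close>

text \<open>All positive exponents at once make the class closed under products, each factor being
  used with \<open>e/2\<close>.\<close>

definition slow :: "complex set \<Rightarrow> (complex \<Rightarrow> complex) \<Rightarrow> bool" where
  "slow A f \<longleftrightarrow> (\<forall>e>0. \<exists>C. \<forall>w\<in>A. norm (f w) \<le> C * (1 + \<bar>Im w\<bar>) powr e)"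

lemma slow_nonneg_constE:
  assumes "slow A f" "e > 0"
  obtains C where "C \<ge> 0" "\<And>w. w \<in> A \<Longrightarrow> norm (f w) \<le> C * (1 + \<bar>Im w\<bar>) powr e"
proof -
  obtain C where C: "\<And>w. w \<in> A \<Longrightarrow> norm (f w) \<le> C * (1 + \<bar>Im w\<bar>) powr e"
    using assms unfolding slow_def by blast
  have "norm (f w) \<le> \<bar>C\<bar> * (1 + \<bar>Im w\<bar>) powr e" if "w \<in> A" for w
    by (rule order.trans [OF C [OF that]]) (simp add: mult_right_mono)
  thus ?thesis by (intro that [of "\<bar>C\<bar>"]) auto
qed

lemma slow_cong: "(\<And>w. w \<in> A \<Longrightarrow> f w = g w) \<Longrightarrow> slow A f = slow A g"
  unfolding slow_def by auto

lemma slow_mono: "slow B f \<Longrightarrow> A \<subseteq> B \<Longrightarrow> slow A f"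
  unfolding slow_def by (meson subset_iff)

lemma slow_bounded:
  assumes "\<And>w. w \<in> A \<Longrightarrow> norm (f w) \<le> C"
  shows "slow A f"
  unfolding slow_def
proof (intro allI impI exI ballI)
  fix e :: real and w assume e: "e > 0" and w: "w \<in> A"
  have "norm (f w) \<le> \<bar>C\<bar> * 1" using assms [OF w] by auto
  also have "\<dots> \<le> \<bar>C\<bar> * (1 + \<bar>Im w\<bar>) powr e"
    using e by (intro mult_left_mono ge_one_powr_ge_zero) auto
  finally show "norm (f w) \<le> \<bar>C\<bar> * (1 + \<bar>Im w\<bar>) powr e" .
qed

lemma slow_const: "slow A (\<lambda>w. c)"
  by (rule slow_bounded [of _ _ "norm c"]) auto

lemma slow_add:
  assumes "slow A f" "slow A g"
  shows "slow A (\<lambda>w. f w + g w)"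
  unfolding slow_def
proof (intro allI impI)
  fix e :: real assume e: "e > 0"
  obtain C where C: "\<And>w. w \<in> A \<Longrightarrow> norm (f w) \<le> C * (1 + \<bar>Im w\<bar>) powr e"
    using slow_nonneg_constE [OF assms(1) e] by metis
  obtain D where D: "\<And>w. w \<in> A \<Longrightarrow> norm (g w) \<le> D * (1 + \<bar>Im w\<bar>) powr e"
    using slow_nonneg_constE [OF assms(2) e] by metis
  have "norm (f w + g w) \<le> (C + D) * (1 + \<bar>Im w\<bar>) powr e" if "w \<in> A" for w
    using norm_triangle_ineq [of "f w" "g w"] C [OF that] D [OF that] by (simp add: algebra_simps)
  thus "\<exists>C. \<forall>w\<in>A. norm (f w + g w) \<le> C * (1 + \<bar>Im w\<bar>) powr e" by blast
qed

lemma slow_mult: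
  assumes "slow A f" "slow A g"
  shows "slow A (\<lambda>w. f w * g w)"
  unfolding slow_def
proof (intro allI impI)
  fix e :: real assume e: "e > 0"
  obtain C where C: "C \<ge> 0" "\<And>w. w \<in> A \<Longrightarrow> norm (f w) \<le> C * (1 + \<bar>Im w\<bar>) powr (e/2)"
    using slow_nonneg_constE [OF assms(1), of "e/2"] e by auto
  obtain D where D: "D \<ge> 0" "\<And>w. w \<in> A \<Longrightarrow> norm (g w) \<le> D * (1 + \<bar>Im w\<bar>) powr (e/2)"
    using slow_nonneg_constE [OF assms(2), of "e/2"] e by auto
  have "norm (f w * g w) \<le> (C * D) * (1 + \<bar>Im w\<bar>) powr e" if "w \<in> A" for w
  proof -
    have "norm (f w * g w) \<le> (C * (1 + \<bar>Im w\<bar>) powr (e/2)) * (D * (1 + \<bar>Im w\<bar>) powr (e/2))"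
      unfolding norm_mult using C D that by (intro mult_mono) auto
    also have "\<dots> = (C * D) * (1 + \<bar>Im w\<bar>) powr (e/2 + e/2)"
      by (subst powr_add) (simp add: mult_ac)
    finally show ?thesis by simp
  qed
  thus "\<exists>C. \<forall>w\<in>A. norm (f w * g w) \<le> C * (1 + \<bar>Im w\<bar>) powr e" by blast
qed

text \<open>The recursion through \<open>deriv f\<close> suits inductions with the product rule;
  \<open>dbd_iff\<close> gives the equivalent form by iterated derivatives.\<close>

primrec dbd :: "nat \<Rightarrow> complex set \<Rightarrow> (complex \<Rightarrow> complex) \<Rightarrow> bool" where
  "dbd 0 A f = slow A f"
| "dbd (Suc n) A f = (slow A f \<and> dbd n A (deriv f))"

lemma dbd_iff: "dbd n A f \<longleftrightarrow> (\<forall>m\<le>n. slow A ((deriv ^^ m) f))"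
proof (induction n arbitrary: f)
  case (Suc n)
  have "(\<forall>m\<le>Suc n. slow A ((deriv ^^ m) f)) \<longleftrightarrow>
      slow A f \<and> (\<forall>m\<le>n. slow A ((deriv ^^ Suc m) f))"
    by (metis Suc_le_mono funpow_0 not0_implies_Suc zero_le)
  also have "\<dots> = dbd (Suc n) A f"
    by (simp only: dbd.simps Suc.IH funpow_Suc_right o_def)
  finally show ?case by blast
qed auto

lemma dbd_Suc_D: "dbd (Suc n) A f \<Longrightarrow> dbd n A f"
  unfolding dbd_iff by auto

lemma dbd_mono: "dbd n B f \<Longrightarrow> A \<subseteq> B \<Longrightarrow> dbd n A f"
  unfolding dbd_iff using slow_mono by blast

text \<open>Agreement is asked for on the open set \<open>rhp\<close> rather than on
  \<open>A\<close>, because derivatives see a neighbourhood of each point.\<close>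

lemma dbd_cong:
  assumes "A \<subseteq> rhp" "\<And>w. w \<in> rhp \<Longrightarrow> f w = g w"
  shows "dbd n A f = dbd n A g"
  using assms(2)
proof (induction n arbitrary: f g)
  case 0
  show ?case using 0 assms(1) by (auto intro!: slow_cong)
next
  case (Suc n)
  have "deriv f w = deriv g w" if "w \<in> rhp" for w
    by (rule deriv_cong_ev) (use that Suc.prems in \<open>auto intro!: eventually_nhds_in_open simp: eventually_nhds_conv_at\<close>,
       metis (mono_tags, lifting) eventually_at_topological open_rhp Suc.prems)
  hence "dbd n A (deriv f) = dbd n A (deriv g)" by (rule Suc.IH)
  moreover have "slow A f = slow A g" using Suc.prems assms(1) by (auto intro!: slow_cong)
  ultimately show ?case by simp
qed

lemma dbd_add:
  assumes "A \<subseteq> rhp" "f holomorphic_on rhp" "g holomorphic_on rhp" "dbd n A f" "dbd n A g"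
  shows "dbd n A (\<lambda>w. f w + g w)"
  using assms(2-)
proof (induction n arbitrary: f g)
  case 0
  thus ?case by (auto intro: slow_add)
next
  case (Suc n)
  have "dbd n A (\<lambda>w. deriv f w + deriv g w)"
    using Suc by (intro Suc.IH holomorphic_deriv) auto
  also have "dbd n A (\<lambda>w. deriv f w + deriv g w) = dbd n A (deriv (\<lambda>w. f w + g w))"
    by (rule dbd_cong [OF assms(1)])
       (use Suc.prems in \<open>auto intro!: deriv_add [symmetric] simp: holomorphic_on_open field_differentiable_def\<close>)
  finally show ?case using Suc.prems by (auto intro: slow_add)
qed

lemma dbd_mult:
  assumes "A \<subseteq> rhp" "f holomorphic_on rhp" "g holomorphic_on rhp" "dbd n A f" "dbd n A g"
  shows "dbd n A (\<lambda>w. f w * g w)"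
  using assms(2-)
proof (induction n arbitrary: f g)
  case 0
  thus ?case by (auto intro: slow_mult)
next
  case (Suc n)
  have h: "deriv f holomorphic_on rhp" "deriv g holomorphic_on rhp"
    using Suc.prems by (auto intro!: holomorphic_deriv)
  have "dbd n A (\<lambda>w. f w * deriv g w + deriv f w * g w)"
    using Suc.prems h dbd_Suc_D[OF Suc.prems(3)] dbd_Suc_D[OF Suc.prems(4)]
    by (intro dbd_add assms(1) Suc.IH holomorphic_on_mult) auto
  also have "dbd n A (\<lambda>w. f w * deriv g w + deriv f w * g w) = dbd n A (deriv (\<lambda>w. f w * g w))"
    by (rule dbd_cong [OF assms(1)])
       (use Suc.prems in \<open>auto intro!: deriv_mult [symmetric] simp: holomorphic_on_open field_differentiable_def\<close>)
  finally show ?case using Suc.prems by (auto intro: slow_mult)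
qed

text \<open>Holomorphy lives on the open half plane, while the bounds hold on \<open>A\<close>,
  which may come arbitrarily close to the imaginary axis. Nothing is asserted on the axis
  itself.\<close>

definition tame :: "complex set \<Rightarrow> (complex \<Rightarrow> complex) \<Rightarrow> bool" where
  "tame A f \<longleftrightarrow> A \<subseteq> rhp \<and> f holomorphic_on rhp \<and> (\<forall>n. dbd n A f)"

lemma tame_D:
  assumes "tame A f"
  shows "A \<subseteq> rhp" "f holomorphic_on rhp" "dbd n A f" "slow A ((deriv ^^ n) f)" "slow A f"
  using assms dbd_iff dbd.simps(1) unfolding tame_def by blast+

lemma tame_cong:
  assumes "\<And>w. w \<in> rhp \<Longrightarrow> f w = g w"
  shows "tame A f = tame A g"
  using dbd_cong [of A f g] holomorphic_cong [OF refl assms] assms unfolding tame_def by auto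

lemma tame_mono: "tame B f \<Longrightarrow> A \<subseteq> B \<Longrightarrow> tame A f"
  unfolding tame_def using dbd_mono by blast

lemma tame_add: "tame A f \<Longrightarrow> tame A g \<Longrightarrow> tame A (\<lambda>w. f w + g w)"
  unfolding tame_def by (auto intro: dbd_add holomorphic_on_add)

lemma tame_mult: "tame A f \<Longrightarrow> tame A g \<Longrightarrow> tame A (\<lambda>w. f w * g w)"
  unfolding tame_def by (auto intro: dbd_mult holomorphic_on_mult)

lemma tame_const:
  assumes "A \<subseteq> rhp"
  shows "tame A (\<lambda>w. c)"
proof -
  have "slow A ((deriv ^^ n) (\<lambda>w. c))" for n
  proof -
    have "(deriv ^^ n) (\<lambda>w. c) = (\<lambda>w. if n = 0 then c else 0)"
      by (induction n) (auto simp: fun_eq_iff)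
    thus ?thesis by (simp add: slow_const)
  qed
  thus ?thesis using assms unfolding tame_def dbd_iff by auto
qed

lemma tame_uminus: "tame A f \<Longrightarrow> tame A (\<lambda>w. - f w)"
  using tame_mult [OF tame_const [of A "-1"], of f] tame_D(1) [of A f] by auto

lemma tame_diff: "tame A f \<Longrightarrow> tame A g \<Longrightarrow> tame A (\<lambda>w. f w - g w)"
  using tame_add [OF _ tame_uminus, of A f g] by simp

lemma tame_power: "tame A f \<Longrightarrow> tame A (\<lambda>w. f w ^ n)"
  by (induction n) (auto intro: tame_mult tame_const dest: tame_D(1))

lemma tame_sum:
  assumes "A \<subseteq> rhp" "\<And>i. i \<in> I \<Longrightarrow> tame A (f i)"
  shows "tame A (\<lambda>w. \<Sum>i\<in>I. f i w)"
  using assms(2)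
  by (induction I rule: infinite_finite_induct) (auto intro!: tame_add tame_const assms(1))

lemma tame_deriv: "tame A f \<Longrightarrow> tame A (deriv f)"
  unfolding tame_def by (metis dbd.simps(2) holomorphic_deriv open_rhp)

lemma tame_primitive:
  assumes "f holomorphic_on rhp" "slow A f" "tame A (deriv f)"
  shows "tame A f"
  unfolding tame_def
proof (intro conjI allI)
  fix n show "dbd n A f" using assms tame_D[OF assms(3)] by (cases n) auto
qed (use assms tame_D in auto)

text \<open>As the derivative of \<open>1 / f\<close> is
  \<open>- deriv f * (1 / f) * (1 / f)\<close>, slow growth of \<open>1 / f\<close> alone propagates
  to all its derivatives by induction.\<close>

lemma tame_inverse:
  assumes f: "tame A f" and nz: "\<And>w. w \<in> rhp \<Longrightarrow> f w \<noteq> 0" and s: "slow A (\<lambda>w. 1 / f w)"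
  shows "tame A (\<lambda>w. 1 / f w)"
proof -
  have hol: "f holomorphic_on rhp" and A: "A \<subseteq> rhp" using f by (auto simp: tame_def)
  have hol': "(\<lambda>w. 1 / f w) holomorphic_on rhp"
    using hol nz by (intro holomorphic_intros) auto
  have "dbd n A (\<lambda>w. 1 / f w)" for n
  proof (induction n)
    case 0
    thus ?case using s by simp
  next
    case (Suc n)
    have "dbd n A (\<lambda>w. (- deriv f w * (1 / f w)) * (1 / f w))"
      using Suc hol hol' f tame_deriv [OF f]
      by (intro dbd_mult A tame_D(3) [OF tame_uminus] holomorphic_on_mult holomorphic_on_minus
          holomorphic_deriv) auto
    also have "dbd n A (\<lambda>w. (- deriv f w * (1 / f w)) * (1 / f w)) = dbd n A (deriv (\<lambda>w. 1 / f w))"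
    proof (rule dbd_cong [OF A])
      fix w assume w: "w \<in> rhp"
      have "(f has_field_derivative deriv f w) (at w)"
        using hol w by (auto simp: holomorphic_on_open DERIV_deriv_iff_has_field_derivative)
      hence "((\<lambda>w. 1 / f w) has_field_derivative (- deriv f w * (1 / f w)) * (1 / f w)) (at w)"
        using nz [OF w] by (auto intro!: derivative_eq_intros simp: field_simps)
      thus "(- deriv f w * (1 / f w)) * (1 / f w) = deriv (\<lambda>w. 1 / f w) w"
        by (metis DERIV_imp_deriv)
    qed
    finally show ?case using s by simp
  qed
  thus ?thesis using A hol' by (auto simp: tame_def)
qed

text \<open>Cauchy's estimate on discs of a fixed radius. The discs may leave the half plane, whence
  the second domain \<open>S\<close>, and the radius may depend on \<open>e\<close>: for zeta, a
  smaller loss in growth forces smaller discs.\<close>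

lemma tame_Cauchy:
  assumes A: "A \<subseteq> rhp" and hol: "f holomorphic_on rhp" and S: "f holomorphic_on S"
    and b: "\<And>e. e > 0 \<Longrightarrow> \<exists>r>0. \<exists>C. \<forall>w\<in>A. cball w r \<subseteq> S \<and>
      (\<forall>z\<in>cball w r. norm (f z) \<le> C * (1 + \<bar>Im w\<bar>) powr e)"
  shows "tame A f"
proof -
  have "slow A ((deriv ^^ n) f)" for n
    unfolding slow_def
  proof (intro allI impI)
    fix e :: real assume "e > 0"
    then obtain r C where r: "r > 0" and rC: "\<And>w. w \<in> A \<Longrightarrow> cball w r \<subseteq> S"
      "\<And>w z. w \<in> A \<Longrightarrow> z \<in> cball w r \<Longrightarrow> norm (f z) \<le> C * (1 + \<bar>Im w\<bar>) powr e"
      using b [of e] by metis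
    have "norm ((deriv ^^ n) f w) \<le> (fact n * C / r ^ n) * (1 + \<bar>Im w\<bar>) powr e" if w: "w \<in> A" for w
    proof -
      have "f holomorphic_on cball w r" using S rC(1) [OF w] holomorphic_on_subset by blast
      hence "norm ((deriv ^^ n) f w) \<le> fact n * (C * (1 + \<bar>Im w\<bar>) powr e) / r ^ n"
        by (intro Cauchy_inequality r rC(2) [OF w])
           (auto intro: holomorphic_on_imp_continuous_on elim: holomorphic_on_subset simp: dist_norm)
      thus ?thesis by (simp add: mult_ac)
    qed
    thus "\<exists>C. \<forall>w\<in>A. norm ((deriv ^^ n) f w) \<le> C * (1 + \<bar>Im w\<bar>) powr e" by blast
  qed
  thus ?thesis using A hol unfolding tame_def dbd_iff by blast
qed

section \<open>Slow growth up to the axis together with analytic continuation at the origin\<close>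

definition strip :: "complex set" where
  "strip = {w. 0 < Re w \<and> Re w \<le> 1}"

lemma strip_subset_rhp [simp]: "strip \<subseteq> rhp"
  by (auto simp: strip_def rhp_def)

text \<open>Equality near \<open>0\<close> is required in the right half plane only, as \<open>f\<close> carries no information elsewhere.\<close>

definition extends0 :: "(complex \<Rightarrow> complex) \<Rightarrow> (complex \<Rightarrow> complex) \<Rightarrow> bool" where
  "extends0 f g \<longleftrightarrow> g analytic_on {0} \<and> (\<forall>\<^sub>F w in nhds 0. w \<in> rhp \<longrightarrow> f w = g w)"

definition good :: "(complex \<Rightarrow> complex) \<Rightarrow> (complex \<Rightarrow> complex) \<Rightarrow> bool" where
  "good f g \<longleftrightarrow> tame strip f \<and> extends0 f g"

lemma good_D: "good f g \<Longrightarrow> tame strip f" "good f g \<Longrightarrow> extends0 f g"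
  "good f g \<Longrightarrow> g analytic_on {0}" "good f g \<Longrightarrow> f holomorphic_on rhp"
  by (auto simp: good_def extends0_def tame_def)

lemma good_add: "good f f' \<Longrightarrow> good g g' \<Longrightarrow> good (\<lambda>w. f w + g w) (\<lambda>w. f' w + g' w)"
  unfolding good_def extends0_def
  by (auto intro: tame_add analytic_on_add elim: eventually_elim2)

lemma good_mult: "good f f' \<Longrightarrow> good g g' \<Longrightarrow> good (\<lambda>w. f w * g w) (\<lambda>w. f' w * g' w)"
  unfolding good_def extends0_def
  by (auto intro: tame_mult analytic_on_mult elim: eventually_elim2)

lemma good_const: "good (\<lambda>w. c) (\<lambda>w. c)"
  unfolding good_def extends0_def by (auto intro!: tame_const strip_subset_rhp analytic_on_const)

lemma good_uminus: "good f f' \<Longrightarrow> good (\<lambda>w. - f w) (\<lambda>w. - f' w)"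
  using good_mult [OF good_const[of "-1"], of f f'] by simp

lemma good_diff: "good f f' \<Longrightarrow> good g g' \<Longrightarrow> good (\<lambda>w. f w - g w) (\<lambda>w. f' w - g' w)"
  using good_add [OF _ good_uminus, of f f' g g'] by simp

lemma good_cong:
  assumes "good f f'" "\<And>w. w \<in> rhp \<Longrightarrow> f w = g w"
  shows "good g f'"
proof -
  have "\<forall>\<^sub>F w in nhds 0. w \<in> rhp \<longrightarrow> g w = f' w"
    using assms(1) unfolding good_def extends0_def by (auto elim!: eventually_mono simp: assms(2))
  thus ?thesis using assms tame_cong [of f g strip] unfolding good_def extends0_def by auto
qed

lemma good_inverse:
  assumes f: "good f f'" and nz: "\<And>w. w \<in> rhp \<Longrightarrow> f w \<noteq> 0" "f' 0 \<noteq> 0"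
    and s: "slow strip (\<lambda>w. 1 / f w)"
  shows "good (\<lambda>w. 1 / f w) (\<lambda>w. 1 / f' w)"
  unfolding good_def extends0_def
proof (intro conjI)
  show "tame strip (\<lambda>w. 1 / f w)" by (rule tame_inverse) (use assms good_D in auto)
  show "(\<lambda>w. 1 / f' w) analytic_on {0}"
    using nz good_D(3) [OF f] by (intro analytic_on_divide) auto
  show "\<forall>\<^sub>F w in nhds 0. w \<in> rhp \<longrightarrow> 1 / f w = 1 / f' w"
    using f unfolding good_def extends0_def by (auto elim!: eventually_mono)
qed

lemma good_deriv:
  assumes f: "good f f'"
  shows "good (deriv f) (deriv f')"
  unfolding good_def extends0_def
proof (intro conjI)
  show "tame strip (deriv f)" using f by (simp add: good_def tame_deriv)
  show "deriv f' analytic_on {0}" using f by (auto simp: good_def extends0_def intro: analytic_deriv)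
  have "\<forall>\<^sub>F w in nhds 0. \<forall>\<^sub>F z in nhds w. z \<in> rhp \<longrightarrow> f z = f' z"
    using f unfolding good_def extends0_def by (simp add: eventually_eventually)
  thus "\<forall>\<^sub>F w in nhds 0. w \<in> rhp \<longrightarrow> deriv f w = deriv f' w"
  proof (rule eventually_mono, intro impI)
    fix w assume *: "\<forall>\<^sub>F z in nhds w. z \<in> rhp \<longrightarrow> f z = f' z" and w: "w \<in> rhp"
    have "\<forall>\<^sub>F z in nhds w. z \<in> rhp" using w by (intro eventually_nhds_in_open) auto
    with * show "deriv f w = deriv f' w" by (intro deriv_cong_ev) (auto elim: eventually_elim2)
  qed
qed

subsection \<open>Dirichlet series\<close>

text \<open>A Dirichlet series with coefficients \<open>a n\<close> enters as \<open>dir (\<lambda>n. a n / n)\<close>, which moves the line \<open>Re s = 1\<close>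
  to the imaginary axis. The term \<open>n = 0\<close> is \<open>c 0\<close>, because \<open>ln 0 = 0\<close>.\<close>

definition dir :: "(nat \<Rightarrow> complex) \<Rightarrow> complex \<Rightarrow> complex" where
  "dir c = lap (count_space UNIV) (\<lambda>n. ln (real n)) c"

abbreviation dir_ok :: "(nat \<Rightarrow> complex) \<Rightarrow> bool" where
  "dir_ok c \<equiv> lap_ok (count_space UNIV) (\<lambda>n. ln (real n)) c"

lemma ln_real_nonneg [simp]: "ln (real n) \<ge> 0"
  by (cases "n = 0") auto

lemma dir_altdef: "dir c w = infsetsum (\<lambda>n. c n * exp (- w * of_real (ln (real n)))) UNIV"
  by (simp add: dir_def lap_def infsetsum_def)

lemma power_le_fact_exp:
  fixes x :: real
  assumes "x \<ge> 0"
  shows "x ^ k \<le> fact k * exp x"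
proof -
  have "(\<Sum>n\<in>{k}. x ^ n /\<^sub>R fact n) \<le> (\<Sum>n. x ^ n /\<^sub>R fact n)"
    using assms by (intro sum_le_suminf summable_exp_generic) auto
  hence "x ^ k / fact k \<le> exp x" by (simp add: exp_def divide_inverse mult_ac)
  thus ?thesis by (simp add: field_simps)
qed

lemma power_le_exp:
  fixes x a :: real
  assumes "x \<ge> 0" "a > 0"
  shows "x ^ k \<le> fact k / a ^ k * exp (a * x)"
  using power_le_fact_exp [of "a * x" k] assms by (simp add: power_mult_distrib field_simps)

lemma summable_nat_powr:
  assumes "a > 1"
  shows "summable (\<lambda>n. real n powr (- a))"
  using assms summable_real_powr_iff [of "-a"] by simp

text \<open>A power of \<open>ln n\<close> costs no more than a constant times
  \<open>n powr (u/2)\<close>, which is half of the decay that \<open>exp (- u * ln n)\<close>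
  provides.\<close>

lemma dir_okI:
  assumes c: "\<And>n. n > 0 \<Longrightarrow> norm (c n) \<le> K * (1 + ln (real n)) ^ k / real n" and c0: "c 0 = 0"
  shows "dir_ok c"
  unfolding lap_ok_def
proof (intro conjI allI impI)
  fix u :: real assume u: "u > 0"
  define C where "C = \<bar>K\<bar> * (fact k / (u/2) ^ k * exp (u/2))"
  have "Infinite_Set_Sum.abs_summable_on (\<lambda>n. norm (c n) * exp (- u * ln (real n))) UNIV"
    unfolding abs_summable_on_nat_iff'
  proof (rule summable_comparison_test)
    show "summable (\<lambda>n. C * real n powr (- (1 + u/2)))"
      using u by (intro summable_mult summable_nat_powr) auto
    show "\<exists>N. \<forall>n\<ge>N. norm (norm (norm (c n) * exp (- u * ln (real n)))) \<le> C * real n powr (- (1 + u / 2))"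
    proof (intro exI[of _ 1] allI impI)
      fix n :: nat assume n: "n \<ge> 1"
      have "(1 + ln (real n)) ^ k \<le> fact k / (u/2) ^ k * exp ((u/2) * (1 + ln (real n)))"
        using u n by (intro power_le_exp) (auto simp: add_nonneg_nonneg)
      also have "exp ((u/2) * (1 + ln (real n))) = exp (u/2) * real n powr (u/2)"
        using n by (simp add: powr_def exp_add [symmetric] algebra_simps)
      finally have *: "(1 + ln (real n)) ^ k \<le> fact k / (u/2) ^ k * exp (u/2) * real n powr (u/2)"
        by (simp only: mult.assoc)
      have "norm (c n) \<le> \<bar>K\<bar> * (1 + ln (real n)) ^ k / real n"
        using n by (intro order.trans [OF c] divide_right_mono mult_right_mono) (auto simp: add_nonneg_nonneg)
      also have "\<dots> \<le> \<bar>K\<bar> * (fact k / (u/2) ^ k * exp (u/2) * real n powr (u/2)) / real n"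
        by (intro divide_right_mono mult_left_mono *) auto
      also have "\<dots> = C * (real n powr (u/2) * real n powr (-1))"
        using n by (simp add: C_def powr_minus divide_simps)
      also have "real n powr (u/2) * real n powr (-1) = real n powr (u/2 - 1)"
        using n by (simp add: powr_diff)
      finally have "norm (c n) * exp (- u * ln (real n)) \<le> C * real n powr (u/2 - 1) * real n powr (- u)"
        using n by (simp add: powr_def mult_right_mono)
      also have "\<dots> = C * real n powr (- (1 + u/2))"
      proof -
        have "real n powr (u/2 - 1) * real n powr (- u) = real n powr (- (1 + u/2))"
          unfolding powr_add [symmetric] by (rule arg_cong [of _ _ "(powr) (real n)"]) simp
        thus ?thesis by simp
      qed
      finally show "norm (norm (norm (c n) * exp (- u * ln (real n)))) \<le> C * real n powr (- (1 + u / 2))"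
        by simp
    qed
  qed
  thus "integrable (count_space UNIV) (\<lambda>n. norm (c n) * exp (- u * ln (real n)))"
    by (simp add: abs_summable_on_def)
qed auto

text \<open>Pairs of positive numbers \<open>(d, m)\<close> correspond to pairs
  \<open>(n, d)\<close> with \<open>d dvd n\<close> and \<open>n = d * m\<close>. Absolute
  summability over the product, transported along this bijection, yields the product formula and
  also the absolute convergence of the convolution. The index 0 has to stay outside, since every
  number divides it.\<close>

lemma dir_mult_aux:
  assumes b: "dir_ok b" "b 0 = 0" and c: "dir_ok c" "c 0 = 0" and w: "w \<in> rhp"
    and a: "\<And>n. n > 0 \<Longrightarrow> a n = (\<Sum>d | d dvd n. b d * c (n div d))" and a0: "a 0 = 0"
  shows "dir b w * dir c w = dir a w"
    and "Infinite_Set_Sum.abs_summable_on (\<lambda>n. a n * exp (- w * of_real (ln (real n)))) {1..}"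
proof -
  define e where "e = (\<lambda>n. exp (- w * of_real (ln (real n))))"
  have e: "e (m * n) = e m * e n" if "m > 0" "n > 0" for m n
    using that by (simp add: e_def ln_mult exp_add [symmetric] algebra_simps)
  define A where "A = {1::nat..}"
  define f where "f = (\<lambda>n. b n * e n)"
  define g where "g = (\<lambda>n. c n * e n)"
  have [simp]: "Infinite_Set_Sum.abs_summable_on f A" "Infinite_Set_Sum.abs_summable_on g A"
    using lap_integrable [OF b(1) w] lap_integrable [OF c(1) w]
    unfolding f_def g_def e_def abs_summable_on_def [symmetric]
    by (auto intro: abs_summable_on_subset)
  have f: "dir b w = infsetsum f A" unfolding dir_altdef f_def e_def A_def
    by (rule infsetsum_cong_neutral) (use b in \<open>auto simp: not_le\<close>)
  have g: "dir c w = infsetsum g A" unfolding dir_altdef g_def e_def A_def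
    by (rule infsetsum_cong_neutral) (use c in \<open>auto simp: not_le\<close>)
  define \<phi> where "\<phi> = (\<lambda>(n::nat,d::nat). (d, n div d))"
  have bij: "bij_betw \<phi> (Sigma A (\<lambda>n. {d. d dvd n})) (A \<times> A)"
    by (rule bij_betwI [where g = "\<lambda>(d,m). (d * m, d)"])
       (auto simp: \<phi>_def A_def Suc_le_eq dvd_pos_nat dvd_imp_le elim!: dvdE)
  have sm: "Infinite_Set_Sum.abs_summable_on (\<lambda>(x,y). f x * g y) (A \<times> A)"
    by (rule abs_summable_on_product) auto
  have sm': "Infinite_Set_Sum.abs_summable_on (\<lambda>z. (\<lambda>(x,y). f x * g y) (\<phi> z)) (Sigma A (\<lambda>n. {d. d dvd n}))"
    using abs_summable_on_reindex_bij_betw [OF bij, of "\<lambda>(x,y). f x * g y"] sm by simp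
  have inner: "infsetsum (\<lambda>d. (\<lambda>(x,y). f x * g y) (\<phi> (n,d))) {d. d dvd n} = a n * e n" if "n \<in> A" for n
  proof -
    from that have n: "n > 0" by (auto simp: A_def)
    have "infsetsum (\<lambda>d. (\<lambda>(x,y). f x * g y) (\<phi> (n,d))) {d. d dvd n} = (\<Sum>d | d dvd n. f d * g (n div d))"
      using n by (simp add: \<phi>_def)
    also have "\<dots> = (\<Sum>d | d dvd n. b d * c (n div d) * e n)"
    proof (rule sum.cong [OF refl])
      fix d assume "d \<in> {d. d dvd n}"
      hence "n = d * (n div d)" "d > 0" "n div d > 0" using n by (auto elim!: dvdE)
      hence "e n = e d * e (n div d)" by (metis e)
      thus "f d * g (n div d) = b d * c (n div d) * e n" by (simp add: f_def g_def)
    qed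
    finally show "infsetsum (\<lambda>d. (\<lambda>(x,y). f x * g y) (\<phi> (n,d))) {d. d dvd n} = a n * e n"
      using a [OF n] by (simp add: sum_distrib_right)
  qed
  have "dir b w * dir c w = infsetsum (\<lambda>(x,y). f x * g y) (A \<times> A)"
    unfolding f g by (rule infsetsum_product [symmetric]) auto
  also have "\<dots> = infsetsum (\<lambda>z. (\<lambda>(x,y). f x * g y) (\<phi> z)) (Sigma A (\<lambda>n. {d. d dvd n}))"
    by (rule infsetsum_reindex_bij_betw [OF bij, symmetric])
  also have "\<dots> = infsetsum (\<lambda>n. infsetsum (\<lambda>d. (\<lambda>(x,y). f x * g y) (\<phi> (n,d))) {d. d dvd n}) A"
    by (rule infsetsum_Sigma [OF _ _ sm']) auto
  also have "\<dots> = infsetsum (\<lambda>n. a n * e n) A"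
    by (rule infsetsum_cong [OF inner refl])
  also have "\<dots> = dir a w" unfolding dir_altdef e_def A_def
    by (rule infsetsum_cong_neutral) (use a0 in \<open>auto simp: not_le\<close>)
  finally show "dir b w * dir c w = dir a w" .
  have "Infinite_Set_Sum.abs_summable_on (\<lambda>n. infsetsum (\<lambda>d. (\<lambda>(x,y). f x * g y) (\<phi> (n,d))) {d. d dvd n}) A"
    using sm' by (intro abs_summable_on_Sigma_project1') (auto simp: case_prod_unfold)
  also have "?this \<longleftrightarrow> Infinite_Set_Sum.abs_summable_on (\<lambda>n. a n * e n) A"
    by (rule Infinite_Set_Sum.abs_summable_on_cong [OF inner refl])
  finally show "Infinite_Set_Sum.abs_summable_on (\<lambda>n. a n * exp (- w * of_real (ln (real n)))) {1..}"
    by (simp add: A_def e_def)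
qed

lemma dir_mult:
  assumes b: "dir_ok b" "b 0 = 0" and c: "dir_ok c" "c 0 = 0"
    and a: "\<And>n. n > 0 \<Longrightarrow> a n = (\<Sum>d | d dvd n. b d * c (n div d))" and a0: "a 0 = 0"
  shows dir_ok_mult: "dir_ok a" and "w \<in> rhp \<Longrightarrow> dir b w * dir c w = dir a w"
proof -
  show "dir_ok a"
    unfolding lap_ok_def
  proof (intro conjI allI impI)
    fix u :: real assume u: "u > 0"
    have "Infinite_Set_Sum.abs_summable_on (\<lambda>n. a n * exp (- of_real u * of_real (ln (real n)))) {1..}"
      by (rule dir_mult_aux(2) [OF b c _ a a0]) (use u in \<open>auto simp: rhp_def\<close>)
    hence "Infinite_Set_Sum.abs_summable_on (\<lambda>n. norm (a n * exp (- of_real u * of_real (ln (real n))))) {1..}"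
      by (rule abs_summable_on_normI)
    also have "?this \<longleftrightarrow> Infinite_Set_Sum.abs_summable_on (\<lambda>n. norm (a n) * exp (- u * ln (real n))) UNIV"
      by (rule abs_summable_on_cong_neutral) (auto simp: norm_mult a0 not_le)
    finally show "integrable (count_space UNIV) (\<lambda>n. norm (a n) * exp (- u * ln (real n)))"
      by (simp add: Infinite_Set_Sum.abs_summable_on_def)
  qed auto
qed (rule dir_mult_aux(1) [OF b c _ a a0])

subsection \<open>The recurrence for the Moebius function weighted by powers of omega\<close>

lemma omega_prime_power_mult:
  assumes "prime p" "\<not> p dvd m" "i > 0" "m > 0"
  shows "omega (p ^ i * m) = Suc (omega m)"
proof -
  have "prime_factors (p ^ i * m) = insert p (prime_factors m)"
    using assms by (subst prime_factors_product) (auto simp: prime_factorization_prime_power)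
  moreover have "p \<notin> prime_factors m" using assms by auto
  ultimately show ?thesis by (simp add: omega_def)
qed

lemma moebius_prime_mult:
  assumes "prime p" "\<not> p dvd m" "m > 0"
  shows "moebius_mu (p * m) = - moebius_mu m"
proof -
  have cop: "coprime p m" using assms by (simp add: prime_imp_coprime)
  have "squarefree (p * m) \<longleftrightarrow> squarefree m"
    using assms cop by (auto simp: squarefree_mult_coprime squarefree_prime dest: squarefree_multD)
  thus ?thesis using omega_prime_power_mult [of p m 1] assms by (simp add: moebius_mu_def)
qed

lemma moebius_prime_power_mult:
  assumes "prime p" "i \<ge> 2"
  shows "moebius_mu (p ^ i * m) = 0"
proof -
  have "p ^ 2 dvd p ^ i * m" using assms by (meson dvd_mult2 le_imp_power_dvd)
  moreover have "\<not> is_unit p" using assms by auto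
  ultimately have "\<not> squarefree (p ^ i * m)" by (auto simp: squarefree_def)
  thus ?thesis by (simp add: moebius_mu_def)
qed

text \<open>For a prime \<open>p\<close> dividing \<open>n\<close>, the divisors \<open>d\<close>
  prime to \<open>p\<close> cancel against the divisors \<open>p * d\<close>, and all further
  divisors are divisible by \<open>p ^ 2\<close> and contribute 0.\<close>

lemma sum_moebius_divisors:
  assumes n: "n > 0"
  shows "(\<Sum>d | d dvd n. moebius_mu d) = (if n = 1 then 1 else 0)"
proof (cases "n = 1")
  case False
  then obtain p where p: "prime p" "p dvd n" using prime_factor_nat by blast
  define A where "A = {d. d dvd n \<and> \<not> p dvd d}"
  have fin: "finite {d. d dvd n}" using n by simp
  hence finA: "finite A" by (rule rev_finite_subset) (auto simp: A_def)
  have pos: "d > 0" if "d dvd n" for d using n that by (auto intro: Nat.gr0I)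
  have "(\<Sum>d | d dvd n. moebius_mu d) = (\<Sum>d\<in>A \<union> (\<lambda>d. p * d) ` A. moebius_mu d)"
  proof (rule sum.mono_neutral_right [OF fin])
    show "A \<union> (\<lambda>d. p * d) ` A \<subseteq> {d. d dvd n}"
      using p by (auto simp: A_def intro!: divides_mult prime_imp_coprime)
    show "\<forall>d\<in>{d. d dvd n} - (A \<union> (\<lambda>d. p * d) ` A). moebius_mu d = 0"
    proof
      fix d assume d: "d \<in> {d. d dvd n} - (A \<union> (\<lambda>d. p * d) ` A)"
      hence "p dvd d" by (auto simp: A_def)
      then obtain e where e: "d = p * e" by auto
      have "e \<notin> A" using d e by auto
      hence "p dvd e" using d e by (auto simp: A_def dest: dvd_mult_right)
      then obtain f where "e = p * f" by auto
      hence "d = p ^ 2 * f" using e by (simp add: power2_eq_square)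
      thus "moebius_mu d = 0" using moebius_prime_power_mult [of p 2 f] p by simp
    qed
  qed
  also have "\<dots> = (\<Sum>d\<in>A. moebius_mu d) + (\<Sum>d\<in>(\<lambda>d. p * d) ` A. moebius_mu d)"
    using finA by (intro sum.union_disjoint) (auto simp: A_def)
  also have "(\<Sum>d\<in>(\<lambda>d. p * d) ` A. moebius_mu d) = (\<Sum>d\<in>A. moebius_mu (p * d))"
    using p by (subst sum.reindex) (auto simp: inj_on_def prime_gt_0_nat)
  also have "\<dots> = (\<Sum>d\<in>A. - moebius_mu d)"
    by (intro sum.cong refl moebius_prime_mult) (use p pos in \<open>auto simp: A_def\<close>)
  finally show ?thesis using False by (simp add: sum_negf)
qed (simp add: moebius_mu_def omega_def)

text \<open>The exponent \<open>l\<close> of a prime power \<open>p ^ l\<close>.\<close>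

definition ppexp :: "nat \<Rightarrow> nat" where
  "ppexp q = multiplicity (aprimedivisor q) q"

lemma ppexp_prime_power: "prime p \<Longrightarrow> l > 0 \<Longrightarrow> ppexp (p ^ l) = l"
  by (simp add: ppexp_def aprimedivisor_prime_power)

text \<open>The identity is logarithmic differentiation in \<open>z\<close> of the product of
  \<open>1 - z * p powr (- s)\<close> over all primes, followed by \<open>k\<close> applications of
  the operator \<open>z d/dz\<close> at \<open>z = 1\<close>; a prime power \<open>p ^ l\<close>
  carries \<open>z ^ l\<close>, which explains the sum \<open>ppexp q + omega (n div q)\<close>.

  The direct proof shows that each prime \<open>p\<close> dividing \<open>n\<close> contributes
  \<open>- moebius_mu n * omega n ^ k\<close>. If \<open>e\<close> is its multiplicity, only
  \<open>l = e\<close> and \<open>l = e - 1\<close> leave a quotient not divisible by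
  \<open>p ^ 2\<close>; for \<open>e \<ge> 2\<close> these two terms cancel, and for
  \<open>e = 1\<close> only the first one occurs.\<close>

lemma moebius_omega_power_recurrence:
  assumes n: "n > 0"
  shows "moebius_mu n * int (omega n) ^ Suc k =
    - (\<Sum>q | q dvd n. if primepow q then moebius_mu (n div q) * int (ppexp q + omega (n div q)) ^ k else 0)"
proof -
  define g where "g = (\<lambda>q. moebius_mu (n div q) * int (ppexp q + omega (n div q)) ^ k)"
  define S where "S = (SIGMA p:prime_factors n. {1..multiplicity p n})"
  have fin: "finite {q. q dvd n}" using n by simp
  have bij: "bij_betw (\<lambda>(p,l). p ^ l) S {q. q dvd n \<and> primepow q}"
  proof (rule bij_betwI [where g = "\<lambda>q. (aprimedivisor q, ppexp q)"])
    show "(\<lambda>(p,l). p ^ l) \<in> S \<rightarrow> {q. q dvd n \<and> primepow q}"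
      using n by (auto simp: S_def in_prime_factors_iff multiplicity_dvd' intro!: primepow_prime_power [THEN iffD2])
    show "(\<lambda>q. (aprimedivisor q, ppexp q)) \<in> {q. q dvd n \<and> primepow q} \<rightarrow> S"
    proof (rule funcsetI)
      fix q assume q: "q \<in> {q. q dvd n \<and> primepow q}"
      then obtain p l where pl: "prime p" "l > 0" "q = p ^ l" by (auto simp: primepow_def)
      have "p dvd n" using q pl by (metis dvd_power dvd_trans mem_Collect_eq)
      moreover have "l \<le> multiplicity p n"
        using q pl n by (intro multiplicity_geI) auto
      ultimately show "(aprimedivisor q, ppexp q) \<in> S"
        using pl n by (simp add: S_def in_prime_factors_iff ppexp_prime_power aprimedivisor_prime_power)
    qed
  qed (auto simp: S_def in_prime_factors_iff ppexp_prime_power aprimedivisor_prime_power primepow_def)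
  have inner: "(\<Sum>l=1..multiplicity p n. g (p ^ l)) = - moebius_mu n * int (omega n) ^ k"
    if p: "p \<in> prime_factors n" for p
  proof -
    define e where "e = multiplicity p n"
    have pp: "prime p" "p dvd n" using p by (auto simp: in_prime_factors_iff)
    have e: "e > 0" using pp n unfolding e_def by (simp add: prime_multiplicity_gt_zero_iff)
    obtain m where m: "n = p ^ e * m" "\<not> p dvd m"
      using multiplicity_decompose' [of n p] n prime_gt_1_nat [OF pp(1)] unfolding e_def by auto
    have m0: "m > 0" using n m by (auto intro: Nat.gr0I)
    have p0: "p > 0" using pp prime_gt_0_nat by blast
    have div: "n div p ^ l = p ^ (e - l) * m" if "l \<le> e" for l
    proof -
      have "p ^ e * m = p ^ l * (p ^ (e - l) * m)"
        using that by (simp add: power_add [symmetric] mult.assoc [symmetric])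
      with m(1) have "n = p ^ l * (p ^ (e - l) * m)" by (rule trans)
      moreover have "(p ^ l * (p ^ (e - l) * m)) div p ^ l = p ^ (e - l) * m" using p0 by simp
      ultimately show ?thesis by (rule ssubst)
    qed
    have gl: "g (p ^ l) = 0" if "l \<in> {1..e}" "l \<noteq> e" "l \<noteq> e - 1" for l
    proof -
      have "e - l \<ge> 2" using that by auto
      thus ?thesis using that div [of l] pp by (simp add: g_def moebius_prime_power_mult)
    qed
    have ge: "g (p ^ e) = moebius_mu m * int (e + omega m) ^ k"
      using div [of e] pp e by (simp add: g_def ppexp_prime_power)
    show ?thesis
    proof (cases "e = 1")
      case True
      have "n = p * m" using m True by simp
      hence "moebius_mu n = - moebius_mu m" "omega n = Suc (omega m)"
        using moebius_prime_mult [OF pp(1) m(2) m0] omega_prime_power_mult [OF pp(1) m(2) _ m0, of 1] by auto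
      thus ?thesis using ge True unfolding e_def by simp
    next
      case False
      hence e2: "e \<ge> 2" using e by auto
      have "(\<Sum>l=1..e. g (p ^ l)) = (\<Sum>l\<in>{e - 1, e}. g (p ^ l))"
        by (rule sum.mono_neutral_right) (use e2 gl in auto)
      also have "\<dots> = g (p ^ (e - 1)) + g (p ^ e)" using e2 by simp
      \<comment> \<open>The exponent of the prime power is smaller by one, but the quotient
        \<open>p * m\<close> has one prime factor more than \<open>m\<close>. So the base of the
        power is the same as for \<open>l = e\<close>, and only the sign of the Moebius factor
        differs.\<close>
      also have "g (p ^ (e - 1)) = moebius_mu (p * m) * int (e - 1 + Suc (omega m)) ^ k"
        using div [of "e - 1"] pp e2 omega_prime_power_mult [OF pp(1) m(2) _ m0, of 1]
        by (simp add: g_def ppexp_prime_power)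
      also have "\<dots> = - g (p ^ e)"
      proof -
        have "e - 1 + Suc (omega m) = e + omega m" using e2 by linarith
        thus ?thesis by (simp only: ge moebius_prime_mult [OF pp(1) m(2) m0] mult_minus_left)
      qed
      finally have "(\<Sum>l=1..e. g (p ^ l)) = 0" by simp
      moreover have "moebius_mu n = 0"
        using moebius_prime_power_mult [OF pp(1) e2, of m] m(1) by metis
      ultimately show ?thesis unfolding e_def by simp
    qed
  qed
  have "(\<Sum>q | q dvd n. if primepow q then g q else 0) = (\<Sum>q\<in>{q. q dvd n \<and> primepow q}. g q)"
    using fin by (simp add: sum.inter_filter [symmetric] sum.If_cases Int_def)
  also have "\<dots> = (\<Sum>(p,l)\<in>S. g (p ^ l))"
    using sum.reindex_bij_betw [OF bij, of g] by (simp add: case_prod_unfold)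
  also have "\<dots> = (\<Sum>p\<in>prime_factors n. \<Sum>l=1..multiplicity p n. g (p ^ l))"
    unfolding S_def by (rule sum.Sigma [symmetric]) auto
  also have "\<dots> = (\<Sum>p\<in>prime_factors n. - moebius_mu n * int (omega n) ^ k)"
    by (rule sum.cong [OF refl inner])
  also have "\<dots> = - moebius_mu n * int (omega n) ^ Suc k"
    by (simp add: omega_def)
  finally show ?thesis unfolding g_def by linarith
qed


section \<open>Logarithmic bounds for the coefficients, and the Dirichlet series built from
  them\<close>

lemma ln_ge_half_of_two_power:
  assumes "2 ^ l \<le> n"
  shows "real l \<le> 2 * ln (real n)"
proof -
  have "real l * (1/2) \<le> real l * ln 2" using ln2_ge_two_thirds by (intro mult_left_mono) auto
  also have "\<dots> = ln (2 ^ l)" by (simp add: ln_realpow)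
  also have "\<dots> \<le> ln (real n)"
  proof -
    have "(2::real) ^ l \<le> real n" using of_nat_mono [OF assms, where ?'a = real] by simp
    moreover from this have "0 < real n" using zero_less_power [of "2::real" l] by linarith
    ultimately show ?thesis by (subst ln_le_cancel_iff) auto
  qed
  finally show ?thesis by simp
qed

text \<open>The crude inequality \<open>2 ^ omega n \<le> n\<close> is enough, as absolute
  convergence only needs some power of \<open>ln n\<close>.\<close>

lemma omega_le_ln:
  assumes "n > 0"
  shows "real (omega n) \<le> 2 * ln (real n)"
proof (rule ln_ge_half_of_two_power)
  have "2 ^ omega n = (\<Prod>p\<in>prime_factors n. 2)" by (simp add: omega_def)
  also have "\<dots> \<le> (\<Prod>p\<in>prime_factors n. p ^ multiplicity p n)"
  proof (rule prod_mono, safe)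
    fix p assume p: "p \<in> prime_factors n"
    hence "p \<ge> 2" "multiplicity p n > 0"
      using assms by (auto simp: in_prime_factors_iff prime_multiplicity_gt_zero_iff prime_ge_2_nat)
    thus "2 \<le> p ^ multiplicity p n" by (meson le_trans self_le_power one_le_numeral)
  qed
  also have "\<dots> = n" using prime_factorization_nat [of n] assms by simp
  finally show "2 ^ omega n \<le> n" .
qed

lemma ppexp_le_ln:
  assumes "primepow n"
  shows "real (ppexp n) \<le> 2 * ln (real n)"
proof (rule ln_ge_half_of_two_power)
  obtain p l where pl: "prime p" "l > 0" "n = p ^ l" using assms by (auto simp: primepow_def)
  thus "2 ^ ppexp n \<le> n" by (simp add: ppexp_prime_power power_mono prime_ge_2_nat)
qed

text \<open>These are \<open>\<zeta>(1+w)\<close>, \<open>- \<zeta>'/\<zeta>(1+w)\<close>, the coefficients of \<open>\<Sum> l^j p^(-l(1+w))\<close>, and the Dirichlet series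
  of \<open>\<mu> \<omega>^k\<close> at \<open>1+w\<close>.\<close>

definition zeta1 :: "complex \<Rightarrow> complex" where
  "zeta1 = dir (\<lambda>n. 1 / of_nat n)"

definition mangs :: "complex \<Rightarrow> complex" where
  "mangs = dir (\<lambda>n. mangoldt n / of_nat n)"

definition hcoef :: "nat \<Rightarrow> nat \<Rightarrow> complex" where
  "hcoef j n = (if primepow n then of_nat (ppexp n) ^ j / of_nat n else 0)"

definition muom :: "nat \<Rightarrow> complex \<Rightarrow> complex" where
  "muom k = dir (\<lambda>n. of_real (mu_omega_term k n))"

lemma dir_ok_one: "dir_ok (\<lambda>n. 1 / of_nat n)"
  by (rule dir_okI [of _ 1 0]) (auto simp: norm_divide)

lemma dir_ok_mangoldt: "dir_ok (\<lambda>n. mangoldt n / of_nat n)"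
proof (rule dir_okI [of _ 1 1])
  fix n :: nat assume "n > 0"
  hence "norm (mangoldt n :: complex) \<le> 1 + ln (real n)"
    using mangoldt_le [of n] mangoldt_nonneg [of n] by (simp add: add_increasing)
  thus "norm (mangoldt n / of_nat n :: complex) \<le> 1 * (1 + ln (real n)) ^ 1 / real n"
    by (simp add: norm_divide divide_right_mono)
qed auto

lemma dir_ok_hcoef: "dir_ok (hcoef j)"
proof (rule dir_okI [of _ "2 ^ j" j])
  fix n :: nat assume n: "n > 0"
  show "norm (hcoef j n) \<le> 2 ^ j * (1 + ln (real n)) ^ j / real n"
  proof (cases "primepow n")
    case True
    have "real (ppexp n) ^ j \<le> (2 * (1 + ln (real n))) ^ j"
      using ppexp_le_ln [OF True] by (intro power_mono) auto
    also have "\<dots> = 2 ^ j * (1 + ln (real n)) ^ j" by (rule power_mult_distrib)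
    finally show ?thesis using True by (simp add: hcoef_def norm_divide norm_power divide_right_mono)
  qed (auto simp: hcoef_def add_nonneg_nonneg)
qed (auto simp: hcoef_def)

lemma abs_mu_omega_term_le:
  assumes "n > 0"
  shows "\<bar>mu_omega_term k n\<bar> \<le> 2 ^ k * (1 + ln (real n)) ^ k / real n"
proof -
  have "real (omega n) ^ k \<le> (2 * (1 + ln (real n))) ^ k"
    using omega_le_ln [OF assms] by (intro power_mono) auto
  moreover have "\<bar>real_of_int (moebius_mu n)\<bar> \<le> 1" by (simp add: moebius_mu_def)
  ultimately have "\<bar>real_of_int (moebius_mu n)\<bar> * real (omega n) ^ k \<le> 1 * (2 * (1 + ln (real n))) ^ k"
    by (intro mult_mono) auto
  also have "\<dots> = 2 ^ k * (1 + ln (real n)) ^ k" by (simp only: power_mult_distrib mult_1)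
  finally show ?thesis by (simp add: mu_omega_term_def abs_mult divide_right_mono)
qed

lemma dir_ok_muom: "dir_ok (\<lambda>n. of_real (mu_omega_term k n))"
proof (rule dir_okI [of _ "2 ^ k" k])
  fix n :: nat assume "n > 0"
  thus "norm (complex_of_real (mu_omega_term k n)) \<le> 2 ^ k * (1 + ln (real n)) ^ k / real n"
    unfolding norm_of_real by (rule abs_mu_omega_term_le)
qed (simp add: mu_omega_term_def)

text \<open>Besides identifying \<open>muom 0\<close> with \<open>1 / zeta\<close>, this shows that
  \<open>zeta1\<close> has no zero in the half plane, without recourse to an Euler product.\<close>

lemma zeta1_times_muom_0:
  assumes w: "w \<in> rhp"
  shows "zeta1 w * muom 0 w = 1"
proof -
  have "muom 0 w * zeta1 w = dir (\<lambda>n. if n = 1 then 1 else 0) w"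
    unfolding zeta1_def muom_def
  proof (rule dir_mult(2) [OF dir_ok_muom _ dir_ok_one _ _ _ w])
    fix n :: nat assume n: "n > 0"
    have "(\<Sum>d | d dvd n. complex_of_real (mu_omega_term 0 d) * (1 / of_nat (n div d))) =
        (\<Sum>d | d dvd n. of_int (moebius_mu d) / of_nat n)"
      by (rule sum.cong) (use n in \<open>auto simp: mu_omega_term_def field_simps of_nat_div elim!: dvdE\<close>)
    also have "\<dots> = of_int (\<Sum>d | d dvd n. moebius_mu d) / of_nat n"
      by (simp add: sum_divide_distrib)
    also have "\<dots> = (if n = 1 then 1 else 0)" using sum_moebius_divisors [OF n] by simp
    finally show "(if n = 1 then 1 else 0) =
      (\<Sum>d | d dvd n. complex_of_real (mu_omega_term 0 d) * (1 / of_nat (n div d)))" by simp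
  qed (auto simp: mu_omega_term_def)
  also have "dir (\<lambda>n. if n = 1 then 1 else 0) w = infsetsum (\<lambda>n. if n = 1 then 1 else 0) {1::nat}"
    unfolding dir_altdef by (rule infsetsum_cong_neutral) auto
  finally show ?thesis by (simp add: mult.commute)
qed

lemma zeta1_times_mangs:
  assumes w: "w \<in> rhp"
  shows "zeta1 w * mangs w = - deriv zeta1 w"
proof -
  have "mangs w * zeta1 w = dir (\<lambda>n. of_real (ln (real n)) * (1 / of_nat n)) w"
    unfolding zeta1_def mangs_def
  proof (rule dir_mult(2) [OF dir_ok_mangoldt _ dir_ok_one _ _ _ w])
    fix n :: nat assume n: "n > 0"
    have "(\<Sum>d | d dvd n. mangoldt d / of_nat d * (1 / of_nat (n div d))) =
        (\<Sum>d | d dvd n. (mangoldt d :: complex) / of_nat n)"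
      by (rule sum.cong) (use n in \<open>auto simp: field_simps elim!: dvdE\<close>)
    also have "\<dots> = of_real (ln (real n)) / of_nat n"
      using mangoldt_sum [of n, where ?'a = complex] n by (simp add: sum_divide_distrib [symmetric])
    finally show "complex_of_real (ln (real n)) * (1 / of_nat n) =
      (\<Sum>d | d dvd n. mangoldt d / of_nat d * (1 / of_nat (n div d)))" by simp
  qed auto
  thus ?thesis using lap_deriv [OF dir_ok_one w] by (simp add: zeta1_def dir_def mult.commute)
qed

lemma dir_sum:
  assumes "\<And>i. i \<in> I \<Longrightarrow> dir_ok (a i)" "w \<in> rhp"
  shows "dir (\<lambda>n. \<Sum>i\<in>I. a i n) w = (\<Sum>i\<in>I. dir (a i) w)"
  unfolding dir_def lap_def sum_distrib_right
  by (rule Bochner_Integration.integral_sum) (use lap_integrable assms in blast)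

lemma dir_cmult: "dir (\<lambda>n. c * a n) w = c * dir a w"
  unfolding dir_def lap_def by (simp add: mult.assoc)

lemma dir_ok_cmult: "dir_ok a \<Longrightarrow> dir_ok (\<lambda>n. c * a n)"
  unfolding lap_ok_def by (auto simp: norm_mult mult.assoc)

text \<open>The binomial theorem separates the prime power from the cofactor in
  \<open>(ppexp d + omega m) ^ k\<close>, so the recurrence becomes a sum of Dirichlet convolutions,
  one for each \<open>i\<close>.\<close>

lemma muom_Suc:
  assumes w: "w \<in> rhp"
  shows "muom (Suc k) w = - (\<Sum>i\<le>k. of_nat (k choose i) * muom i w * dir (hcoef (k - i)) w)"
proof -
  define a where "a = (\<lambda>i n. if n = 0 then 0 else
    \<Sum>d | d dvd n. hcoef (k - i) d * complex_of_real (mu_omega_term i (n div d)))"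
  have a1: "dir_ok (a i)" for i
    by (rule dir_mult(1) [OF dir_ok_hcoef _ dir_ok_muom, of "k - i" i])
       (auto simp: a_def hcoef_def mu_omega_term_def)
  have a2: "dir (hcoef (k - i)) w * muom i w = dir (a i) w" for i
    unfolding muom_def
    by (rule dir_mult(2) [OF dir_ok_hcoef _ dir_ok_muom _ _ _ w])
       (simp_all add: a_def hcoef_def, simp_all add: mu_omega_term_def)
  have "(\<Sum>i\<le>k. of_nat (k choose i) * muom i w * dir (hcoef (k - i)) w) =
      (\<Sum>i\<le>k. dir (\<lambda>n. of_nat (k choose i) * a i n) w)"
    by (rule sum.cong [OF refl]) (simp only: dir_cmult a2 [symmetric], simp only: mult_ac)
  also have "\<dots> = dir (\<lambda>n. \<Sum>i\<le>k. of_nat (k choose i) * a i n) w"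
    by (rule dir_sum [symmetric]) (rule dir_ok_cmult [OF a1], rule w)
  also have "(\<lambda>n. \<Sum>i\<le>k. of_nat (k choose i) * a i n) = (\<lambda>n. (-1) * complex_of_real (mu_omega_term (Suc k) n))"
  proof
    fix n :: nat
    show "(\<Sum>i\<le>k. of_nat (k choose i) * a i n) = (-1) * complex_of_real (mu_omega_term (Suc k) n)"
    proof (cases "n = 0")
      case False
      hence n: "n > 0" by simp
      have "(\<Sum>i\<le>k. of_nat (k choose i) * a i n) = (\<Sum>d | d dvd n. \<Sum>i\<le>k. of_nat (k choose i) *
          (hcoef (k - i) d * complex_of_real (mu_omega_term i (n div d))))"
        using n unfolding a_def by (simp add: sum_distrib_left) (rule sum.swap)
      also have "\<dots> = (\<Sum>d | d dvd n. of_int (if primepow d then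
          moebius_mu (n div d) * int (ppexp d + omega (n div d)) ^ k else 0) / of_nat n)"
      proof (rule sum.cong [OF refl])
        fix d assume "d \<in> {d. d dvd n}"
        then obtain m where m: "n = d * m" by auto
        hence m0: "m > 0" "d > 0" using n by auto
        show "(\<Sum>i\<le>k. of_nat (k choose i) * (hcoef (k - i) d * complex_of_real (mu_omega_term i (n div d)))) =
          of_int (if primepow d then moebius_mu (n div d) * int (ppexp d + omega (n div d)) ^ k else 0) / of_nat n"
        proof (cases "primepow d")
          case True
          have "(\<Sum>i\<le>k. of_nat (k choose i) * (hcoef (k - i) d * complex_of_real (mu_omega_term i (n div d)))) =
            (\<Sum>i\<le>k. (of_nat (k choose i) * of_nat (omega m) ^ i * of_nat (ppexp d) ^ (k - i)) * (of_int (moebius_mu m) / of_nat n))"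
            by (rule sum.cong) (use True m0 m in \<open>simp_all add: hcoef_def mu_omega_term_def field_simps\<close>)
          also have "\<dots> = (of_nat (omega m) + of_nat (ppexp d) :: complex) ^ k * (of_int (moebius_mu m) / of_nat n)"
            by (simp only: sum_distrib_right [symmetric] binomial_ring [symmetric])
          finally show ?thesis using True m0 m by (simp add: add.commute mult.commute)
        qed (auto simp: hcoef_def)
      qed
      also have "\<dots> = of_int (\<Sum>d | d dvd n. (if primepow d then
          moebius_mu (n div d) * int (ppexp d + omega (n div d)) ^ k else 0)) / of_nat n"
        by (simp add: sum_divide_distrib)
      also have "\<dots> = of_int (- (moebius_mu n * int (omega n) ^ Suc k)) / of_nat n"
        by (subst moebius_omega_power_recurrence [OF n]) simp
      finally show ?thesis by (simp add: mu_omega_term_def)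
    next
      case True
      thus ?thesis by (simp add: a_def mu_omega_term_def)
    qed
  qed
  also have "dir \<dots> w = (-1) * muom (Suc k) w" unfolding muom_def by (rule dir_cmult)
  finally show ?thesis by simp
qed

subsection \<open>Continuation and lower bound of the zeta function\<close>

lemma norm_diff_le_vector_derivative:
  fixes f :: "real \<Rightarrow> 'b::real_normed_vector"
  assumes "\<And>x. x \<in> {a..b} \<Longrightarrow> (f has_vector_derivative f' x) (at x within {a..b})"
    and "\<And>x. x \<in> {a..b} \<Longrightarrow> norm (f' x) \<le> B" and "x \<in> {a..b}" "y \<in> {a..b}"
  shows "norm (f x - f y) \<le> B * \<bar>x - y\<bar>"
proof -
  have "norm (f x - f y) \<le> B * norm (x - y)"
  proof (rule differentiable_bound [where S = "{a..b}"])
    fix z assume z: "z \<in> {a..b}"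
    show "(f has_derivative (\<lambda>h. h *\<^sub>R f' z)) (at z within {a..b})"
      using assms(1) [OF z] by (simp add: has_vector_derivative_def)
    show "onorm (\<lambda>h. h *\<^sub>R f' z) \<le> B"
    proof (rule onorm_le)
      fix h :: real
      show "norm (h *\<^sub>R f' z) \<le> B * norm h"
        using mult_right_mono [OF assms(2) [OF z] abs_ge_zero [of h]] by (simp add: mult.commute)
    qed
  qed (use assms in auto)
  thus ?thesis by simp
qed

abbreviation npow :: "real \<Rightarrow> complex \<Rightarrow> complex" where
  "npow x s \<equiv> exp (s * of_real (ln x))"

lemma norm_npow: "x > 0 \<Longrightarrow> norm (npow x s) = x powr Re s"
  by (simp add: powr_def)

lemma npow_vector_derivative:
  assumes "x > 0"
  shows "((\<lambda>x. npow x s) has_vector_derivative s * npow x (s - 1)) (at x within S)"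
proof -
  have "((\<lambda>x. complex_of_real (ln x)) has_vector_derivative of_real (1 / x)) (at x within S)"
    using assms by (intro has_vector_derivative_of_real) (auto intro!: derivative_eq_intros)
  hence "((\<lambda>x. of_real (ln x) * s) has_vector_derivative of_real (1 / x) * s) (at x within S)"
    by (rule has_vector_derivative_mult_left)
  hence "((exp \<circ> (\<lambda>x. of_real (ln x) * s)) has_vector_derivative (of_real (1 / x) * s) * exp (of_real (ln x) * s)) (at x within S)"
    by (rule field_vector_diff_chain_within) (auto intro: has_field_derivative_at_within DERIV_exp)
  hence "((\<lambda>x. npow x s) has_vector_derivative (of_real (1 / x) * s) * npow x s) (at x within S)"
    by (simp add: o_def mult.commute)
  also have "of_real (1 / x) = npow x (-1)"
    using assms by (simp add: exp_minus exp_of_real inverse_eq_divide)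
  also have "npow x (-1) * s * npow x s = s * npow x (s - 1)"
    by (simp add: exp_diff exp_minus algebra_simps inverse_eq_divide)
  finally show ?thesis .
qed

text \<open>The error of replacing \<open>\<integral> w x^(-w-1) dx\<close> over \<open>[n+1, n+2]\<close> by the left end point value, so that \<open>xi w = w \<zeta>(1+w)\<close>.\<close>

definition zterm :: "nat \<Rightarrow> complex \<Rightarrow> complex" where
  "zterm n w = npow (Suc (Suc n)) (-w) - npow (Suc n) (-w) + w * npow (Suc n) (-w-1)"

text \<open>\<open>zterm n w\<close> is the first order Taylor error of \<open>x powr (- w)\<close>
  between \<open>n + 1\<close> and \<open>n + 2\<close>, so it is governed by the second derivative
  \<open>w * (w + 1) * x powr (- w - 2)\<close>. The additional power of \<open>x\<close> makes the
  series converge as far as \<open>Re w > -1\<close>.\<close>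

lemma norm_zterm_le:
  assumes "Re w > -1"
  shows "norm (zterm n w) \<le> norm w * norm (w + 1) * real (Suc n) powr (- 2 - Re w)"
proof -
  define m where "m = real (Suc n)"
  have m: "m \<ge> 1" by (simp add: m_def)
  define D where "D = norm w * norm (w + 1) * m powr (- 2 - Re w)"
  have "norm (npow (m + 1) (-w) - npow m (-w) - ((m + 1) - m) *\<^sub>R ((-w) * npow m (-w-1))) \<le> norm ((m + 1) - m) * D"
  proof (rule vector_differentiable_bound_linearization [where S = "{m..m+1}" and f = "\<lambda>x. npow x (-w)"
        and f' = "\<lambda>x. (-w) * npow x (-w-1)"])
    show "((\<lambda>x. npow x (-w)) has_vector_derivative (-w) * npow x (-w-1)) (at x within {m..m+1})"
      if "x \<in> {m..m+1}" for x using that m by (intro npow_vector_derivative) auto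
    show "closed_segment m (m + 1) \<subseteq> {m..m+1}" by (simp add: closed_segment_eq_real_ivl)
    show "norm ((-w) * npow x (-w-1) - (-w) * npow m (-w-1)) \<le> D" if x: "x \<in> {m..m+1}" for x
    proof -
      have "norm (npow x (-w-1) - npow m (-w-1)) \<le> norm (w + 1) * m powr (- 2 - Re w) * \<bar>x - m\<bar>"
      proof (rule norm_diff_le_vector_derivative [where a = m and b = "m + 1"])
        fix y assume y: "y \<in> {m..m+1}"
        show "((\<lambda>x. npow x (-w-1)) has_vector_derivative (-w-1) * npow y (-w-1-1)) (at y within {m..m+1})"
          using y m by (intro npow_vector_derivative) auto
        have "norm ((-w-1) * npow y (-w-1-1)) = norm (w + 1) * y powr (- 2 - Re w)"
        proof -
          have 1: "norm (npow y (-w-1-1)) = y powr Re (-w-1-1)" using y m by (intro norm_npow) auto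
          have 2: "Re (-w-1-1) = - 2 - Re w" by simp
          have 3: "norm (-w-1) = norm (w + 1)" using norm_minus_cancel [of "w + 1"] by (simp del: norm_minus_cancel)
          show ?thesis unfolding norm_mult 1 2 3 ..
        qed
        also have "\<dots> \<le> norm (w + 1) * m powr (- 2 - Re w)"
          using y m assms by (intro mult_left_mono powr_mono2') auto
        finally show "norm ((-w-1) * npow y (-w-1-1)) \<le> norm (w + 1) * m powr (- 2 - Re w)" .
      qed (use x in auto)
      also have "\<dots> \<le> norm (w + 1) * m powr (- 2 - Re w) * 1"
        using x by (intro mult_left_mono) auto
      finally have "norm w * norm (npow x (-w-1) - npow m (-w-1)) \<le> norm w * (norm (w + 1) * m powr (- 2 - Re w))"
        by (intro mult_left_mono) auto
      moreover have "norm ((-w) * npow x (-w-1) - (-w) * npow m (-w-1)) = norm w * norm (npow x (-w-1) - npow m (-w-1))"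
      proof -
        have "(-w) * npow x (-w-1) - (-w) * npow m (-w-1) = - (w * (npow x (-w-1) - npow m (-w-1)))"
          by (simp only: right_diff_distrib mult_minus_left minus_diff_eq) simp
        thus ?thesis by (simp only: norm_minus_cancel norm_mult)
      qed
      ultimately show ?thesis by (simp add: D_def mult.assoc)
    qed
  qed (use m in auto)
  moreover have "m + 1 = real (Suc (Suc n))" by (simp add: m_def)
  ultimately show ?thesis by (simp add: zterm_def D_def m_def add_ac)
qed

lemma zterm_holomorphic: "zterm n holomorphic_on S"
  unfolding zterm_def by (intro holomorphic_intros)

lemma ex_xi:
  "\<exists>g. \<forall>w\<in>{w. Re w > -1}. (\<lambda>n. zterm n w) sums g w \<and> g field_differentiable (at w)"
proof -
  have op: "open {w::complex. Re w > -1}" by (rule open_halfspace_Re_gt)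
  obtain g where "\<forall>w\<in>{w. Re w > -1}. (\<lambda>n. zterm n w) sums g w \<and> g field_differentiable (at w)"
  proof (rule series_differentiable_comparison_complex [OF op, of zterm])
    show "zterm n field_differentiable at x" for n x
      using zterm_holomorphic [of n UNIV] by (simp add: holomorphic_on_def)
    fix x :: complex assume "x \<in> {w. Re w > -1}"
    hence x: "Re x > -1" by simp
    \<comment> \<open>Half the distance from the line \<open>Re w = -1\<close>: on the ball of this
      radius the exponent \<open>2 + (Re x - d)\<close> is still greater than 1.\<close>
    define d where "d = (1 + Re x) / 2"
    define R where "R = norm x + d"
    have d: "d > 0" using x by (simp add: d_def)
    define h where "h = (\<lambda>n. complex_of_real (R * (R + 1) * real (Suc n) powr (- (2 + (Re x - d)))))"
    have "summable (\<lambda>n. real n powr (- (2 + (Re x - d))))"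
      by (rule summable_nat_powr) (use x in \<open>simp add: d_def field_simps\<close>)
    hence "summable (\<lambda>n. real (Suc n) powr (- (2 + (Re x - d))))" by (subst summable_Suc_iff)
    hence "summable h" unfolding h_def by (intro summable_of_real summable_mult)
    moreover have "range h \<subseteq> \<real>\<^sub>\<ge>\<^sub>0"
      unfolding h_def R_def using d by (auto intro!: mult_nonneg_nonneg)
    moreover have "norm (zterm n y) \<le> norm (h n)" if y: "y \<in> ball x d \<inter> {w. Re w > -1}" for y n
    proof -
      have "norm y \<le> R" using y norm_triangle_ineq2 [of y x] by (simp add: R_def dist_norm norm_minus_commute)
      moreover have "norm (y + 1) \<le> R + 1" using calculation norm_triangle_ineq [of y 1] by simp
      moreover have "Re y \<ge> Re x - d"
        using y abs_Re_le_cmod [of "x - y"] by (auto simp: dist_norm)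
      hence "real (Suc n) powr (- 2 - Re y) \<le> real (Suc n) powr (- (2 + (Re x - d)))"
        by (intro powr_mono) auto
      ultimately have "norm y * norm (y + 1) * real (Suc n) powr (- 2 - Re y)
          \<le> R * (R + 1) * real (Suc n) powr (- (2 + (Re x - d)))"
        using d by (intro mult_mono) (auto simp: R_def intro!: mult_nonneg_nonneg add_nonneg_nonneg)
      also have "\<dots> = norm (h n)" using d unfolding h_def norm_of_real
        by (subst abs_of_nonneg) (auto simp: R_def intro!: mult_nonneg_nonneg add_nonneg_nonneg)
      finally show ?thesis using norm_zterm_le [of y n] y by simp
    qed
    ultimately show "\<exists>d h. 0 < d \<and> summable h \<and> range h \<subseteq> \<real>\<^sub>\<ge>\<^sub>0 \<and>
        (\<forall>\<^sub>F n in sequentially. \<forall>y\<in>ball x d \<inter> {w. - 1 < Re w}. cmod (zterm n y) \<le> cmod (h n))"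
      using d by (intro exI[of _ d] exI[of _ h]) auto
  qed auto
  thus ?thesis by blast
qed

definition xi :: "complex \<Rightarrow> complex" where
  "xi w = 1 + (\<Sum>n. zterm n w)"

lemma summable_zterm: "Re w > -1 \<Longrightarrow> summable (\<lambda>n. zterm n w)"
  using ex_xi by (auto simp: summable_def)

lemma xi_holomorphic: "xi holomorphic_on {w. Re w > -1}"
proof -
  obtain g where g: "\<forall>w\<in>{w. Re w > -1}. (\<lambda>n. zterm n w) sums g w \<and> g field_differentiable (at w)"
    using ex_xi by blast
  hence "g holomorphic_on {w. Re w > -1}"
    by (auto simp: holomorphic_on_def field_differentiable_at_within)
  hence "(\<lambda>w. 1 + g w) holomorphic_on {w. Re w > -1}"
    by (intro holomorphic_intros)
  thus ?thesis
    by (rule holomorphic_transform) (use g in \<open>auto simp: xi_def sums_unique\<close>)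
qed

lemma xi_0: "xi 0 = 1"
  by (simp add: xi_def zterm_def)

lemma sum_zterm:
  "(\<Sum>n<N. zterm n w) = npow (Suc N) (-w) - 1 + w * (\<Sum>n<N. npow (Suc n) (-w-1))"
  by (induction N) (simp_all add: zterm_def algebra_simps)

lemma xi_eq_zeta1:
  assumes w: "w \<in> rhp"
  shows "xi w = w * zeta1 w"
proof -
  have "Infinite_Set_Sum.abs_summable_on (\<lambda>n. 1 / of_nat n * exp (- w * of_real (ln (real n)))) UNIV"
    using lap_integrable [OF dir_ok_one w] by (simp add: Infinite_Set_Sum.abs_summable_on_def)
  from sums_infsetsum_nat' [OF this]
  have "(\<lambda>n. 1 / of_nat n * exp (- w * of_real (ln (real n)))) sums zeta1 w"
    by (simp add: zeta1_def dir_altdef)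
  hence "(\<lambda>n. 1 / of_nat (Suc n) * exp (- w * of_real (ln (real (Suc n))))) sums zeta1 w"
    by (subst sums_Suc_iff) simp
  also have "(\<lambda>n. 1 / of_nat (Suc n) * exp (- w * of_real (ln (real (Suc n))))) = (\<lambda>n. npow (Suc n) (-w-1))"
  proof
    fix n
    have "npow (Suc n) (-w-1) = npow (Suc n) (-w) * npow (Suc n) (-1)"
      by (simp add: exp_diff exp_minus algebra_simps inverse_eq_divide)
    also have "npow (Suc n) (-1) = 1 / of_nat (Suc n)"
      by (simp add: exp_minus exp_of_real inverse_eq_divide del: of_nat_Suc)
    finally show "1 / of_nat (Suc n) * exp (- w * of_real (ln (real (Suc n)))) = npow (Suc n) (-w-1)"
      by simp
  qed
  finally have z: "(\<lambda>N. \<Sum>n<N. npow (Suc n) (-w-1)) \<longlonglongrightarrow> zeta1 w" by (simp add: sums_def)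
  have "(\<lambda>N. npow (Suc N) (-w)) \<longlonglongrightarrow> 0"
  proof (rule tendsto_norm_zero_cancel)
    have "(\<lambda>N. real (Suc N) powr (- Re w)) \<longlonglongrightarrow> 0"
      using w by (intro tendsto_neg_powr filterlim_compose [OF filterlim_real_sequentially filterlim_Suc])
        (auto simp: rhp_def)
    thus "(\<lambda>N. norm (npow (Suc N) (-w))) \<longlonglongrightarrow> 0" by (subst norm_npow) auto
  qed
  hence A: "(\<lambda>N. npow (Suc N) (-w) - 1 + w * (\<Sum>n<N. npow (Suc n) (-w-1))) \<longlonglongrightarrow> 0 - 1 + w * zeta1 w"
    by (intro tendsto_intros z)
  have B: "(\<lambda>N. \<Sum>n<N. zterm n w) \<longlonglongrightarrow> (\<Sum>n. zterm n w)"
    using summable_zterm [of w] w by (intro summable_LIMSEQ) (auto simp: rhp_def)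
  have "(\<Sum>n. zterm n w) = 0 - 1 + w * zeta1 w"
    by (rule LIMSEQ_unique [OF B [unfolded sum_zterm] A])
  thus ?thesis by (simp add: xi_def)
qed

text \<open>The series is cut at an index \<open>M\<close> comparable to
  \<open>1 + \<bar>Im w\<bar>\<close>. Up to there the telescoped form \<open>sum_zterm\<close> is
  estimated trivially, costing a factor \<open>norm w\<close>; beyond it the terms gain one more
  power of the index, which compensates the additional factor \<open>norm (w + 1)\<close>. The bound
  reaches to the left of the axis by \<open>a\<close>, which later gives room for Cauchy
  discs.\<close>

lemma norm_xi_le:
  fixes a :: real
  assumes a: "0 < a" "a \<le> 1/4"
  obtains C where "C \<ge> 0"
    "\<And>w. - a \<le> Re w \<Longrightarrow> Re w \<le> 2 \<Longrightarrow> norm (xi w) \<le> C * (1 + \<bar>Im w\<bar>) powr (1 + 2 * a)"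
proof -
  have sm: "summable (\<lambda>n. real (Suc n) powr (- (1 + a)))"
    using a by (subst summable_Suc_iff, intro summable_nat_powr) auto
  define K where "K = (\<Sum>n. real (Suc n) powr (- (1 + a)))"
  have K: "K \<ge> 0" unfolding K_def by (rule suminf_nonneg [OF sm]) auto
  have pK: "(\<Sum>n<N. real (Suc n) powr (- (1 + a))) \<le> K" for N
    unfolding K_def by (rule sum_le_suminf [OF sm]) auto
  have main: "norm (xi w) \<le> (24 + 60 * K) * (1 + \<bar>Im w\<bar>) powr (1 + 2 * a)"
    if w: "- a \<le> Re w" "Re w \<le> 2" for w
  proof -
    define M where "M = nat \<lceil>\<bar>Im w\<bar>\<rceil> + 1"
    define m where "m = real M"
    have mlo: "\<bar>Im w\<bar> \<le> m" "m \<ge> 1" and mhi: "m \<le> 2 * (1 + \<bar>Im w\<bar>)"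
    proof -
      have "real (nat \<lceil>\<bar>Im w\<bar>\<rceil>) = real_of_int \<lceil>\<bar>Im w\<bar>\<rceil>" by simp
      hence "m = real_of_int \<lceil>\<bar>Im w\<bar>\<rceil> + 1" by (simp only: m_def M_def of_nat_add of_nat_1)
      moreover have "t \<le> m \<and> m \<ge> 1 \<and> m \<le> 2 * (1 + t)"
        if "m = c + 1" "t \<le> c" "c \<le> t + 1" "0 \<le> t" for t c :: real using that by auto
      ultimately have "\<bar>Im w\<bar> \<le> m \<and> m \<ge> 1 \<and> m \<le> 2 * (1 + \<bar>Im w\<bar>)"
        using le_of_int_ceiling of_int_ceiling_le_add_one abs_ge_zero by blast
      thus "\<bar>Im w\<bar> \<le> m" "m \<ge> 1" "m \<le> 2 * (1 + \<bar>Im w\<bar>)" by simp_all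
    qed
    have M: "M \<ge> 1" by (simp add: M_def)
    have nw: "norm w \<le> 3 * m" "norm (w + 1) \<le> 4 * m"
      using cmod_le [of w] cmod_le [of "w + 1"] w a mlo by auto
    have "xi w = 1 + (\<Sum>n<M - 1. zterm n w) + (\<Sum>n. zterm (n + (M - 1)) w)"
      unfolding xi_def using suminf_split_initial_segment [OF summable_zterm, of w "M - 1"] w a by simp
    also have "1 + (\<Sum>n<M - 1. zterm n w) = npow M (-w) + w * (\<Sum>n<M - 1. npow (Suc n) (-w-1))"
      unfolding sum_zterm using M by simp
    finally have eq: "xi w = npow M (-w) + w * (\<Sum>n<M - 1. npow (Suc n) (-w-1)) + (\<Sum>n. zterm (n + (M - 1)) w)" .
    have 1: "norm (npow M (-w)) \<le> m powr (1 + 2 * a)"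
    proof -
      have "norm (npow M (-w)) = m powr (- Re w)" using M by (subst norm_npow) (auto simp: m_def)
      also have "\<dots> \<le> m powr (1 + 2 * a)" using mlo w a by (intro powr_mono) auto
      finally show ?thesis .
    qed
    have 2: "norm (w * (\<Sum>n<M - 1. npow (Suc n) (-w-1))) \<le> 3 * K * m powr (1 + 2 * a)"
    proof -
      have "norm (\<Sum>n<M - 1. npow (Suc n) (-w-1)) \<le> (\<Sum>n<M - 1. m powr (2 * a) * real (Suc n) powr (- (1 + a)))"
      proof (rule sum_norm_le)
        fix n assume n: "n \<in> {..<M - 1}"
        have "norm (npow (Suc n) (-w-1)) = real (Suc n) powr (- Re w - 1)" by (subst norm_npow) auto
        \<comment> \<open>The worst exponent \<open>a - 1\<close>, attained at
          \<open>Re w = - a\<close>, is written as \<open>2 * a - (1 + a)\<close>: the second part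
          is summable, and the first one is bounded by \<open>m powr (2 * a)\<close>.\<close>
        also have "\<dots> \<le> real (Suc n) powr (2 * a + - (1 + a))" using w a by (intro powr_mono) auto
        also have "\<dots> = real (Suc n) powr (2 * a) * real (Suc n) powr (- (1 + a))" by (rule powr_add)
        also have "\<dots> \<le> m powr (2 * a) * real (Suc n) powr (- (1 + a))"
          using n a by (intro mult_right_mono powr_mono2) (auto simp: m_def)
        finally show "norm (npow (Suc n) (-w-1)) \<le> m powr (2 * a) * real (Suc n) powr (- (1 + a))" .
      qed
      also have "\<dots> \<le> m powr (2 * a) * K"
        unfolding sum_distrib_left [symmetric] by (intro mult_left_mono pK) auto
      finally have "norm (w * (\<Sum>n<M - 1. npow (Suc n) (-w-1))) \<le> (3 * m) * (m powr (2 * a) * K)"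
        unfolding norm_mult using nw K mlo by (intro mult_mono) auto
      thus ?thesis using mlo by (simp add: powr_add mult_ac)
    qed
    have 3: "norm (\<Sum>n. zterm (n + (M - 1)) w) \<le> 12 * K * m powr (1 + 2 * a)"
    proof -
      \<comment> \<open>Here \<open>12 * m ^ 2\<close> comes from \<open>norm w \<le> 3 * m\<close>
        and \<open>norm (w + 1) \<le> 4 * m\<close>. In the tail the index is at least
        \<open>M\<close>, and \<open>- 1 + 2 * a\<close> is negative, so this power can be replaced
        by its value at \<open>m\<close>.\<close>
      define D where "D = 12 * m ^ 2 * m powr (- 1 + 2 * a)"
      have le: "norm (zterm (n + (M - 1)) w) \<le> D * real (Suc (n + (M - 1))) powr (- (1 + a))" for n
      proof -
        have "norm (zterm (n + (M - 1)) w) \<le> norm w * norm (w + 1) * real (Suc (n + (M - 1))) powr (- 2 - Re w)"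
          using w a by (intro norm_zterm_le) auto
        also have "\<dots> \<le> (3 * m) * (4 * m) * (m powr (- 1 + 2 * a) * real (Suc (n + (M - 1))) powr (- (1 + a)))"
        proof (intro mult_mono nw)
          have "real (Suc (n + (M - 1))) powr (- 2 - Re w) \<le> real (Suc (n + (M - 1))) powr ((- 1 + 2 * a) + - (1 + a))"
            using w a by (intro powr_mono) auto
          also have "\<dots> = real (Suc (n + (M - 1))) powr (- 1 + 2 * a) * real (Suc (n + (M - 1))) powr (- (1 + a))"
            by (rule powr_add)
          also have "\<dots> \<le> m powr (- 1 + 2 * a) * real (Suc (n + (M - 1))) powr (- (1 + a))"
            using a M by (intro mult_right_mono powr_mono2') (auto simp: m_def)
          finally show "real (Suc (n + (M - 1))) powr (- 2 - Re w) \<le> m powr (- 1 + 2 * a) * real (Suc (n + (M - 1))) powr (- (1 + a))" .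
        qed (use mlo in auto)
        also have "\<dots> = D * real (Suc (n + (M - 1))) powr (- (1 + a))"
          by (simp add: D_def power2_eq_square mult_ac)
        finally show ?thesis .
      qed
      have sm': "summable (\<lambda>n. real (Suc (n + (M - 1))) powr (- (1 + a)))"
        using summable_iff_shift [of "\<lambda>n. real (Suc n) powr (- (1 + a))" "M - 1"] sm by simp
      have "norm (\<Sum>n. zterm (n + (M - 1)) w) \<le> (\<Sum>n. D * real (Suc (n + (M - 1))) powr (- (1 + a)))"
        by (rule norm_suminf_le [OF le]) (rule summable_mult [OF sm'])
      also have "\<dots> = D * (\<Sum>n. real (Suc (n + (M - 1))) powr (- (1 + a)))"
        by (rule suminf_mult [OF sm'])
      also have "\<dots> \<le> D * K"
      proof (rule mult_left_mono)
        have "K = (\<Sum>n. real (Suc (n + (M - 1))) powr (- (1 + a))) + (\<Sum>n<M - 1. real (Suc n) powr (- (1 + a)))"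
          unfolding K_def by (rule suminf_split_initial_segment [OF sm])
        moreover have "(\<Sum>n<M - 1. real (Suc n) powr (- (1 + a))) \<ge> 0" by (intro sum_nonneg) auto
        ultimately show "(\<Sum>n. real (Suc (n + (M - 1))) powr (- (1 + a))) \<le> K" by linarith
      qed (auto simp: D_def)
      also have "D = 12 * (m powr 2 * m powr (- 1 + 2 * a))" using mlo by (simp add: D_def powr_numeral)
      also have "m powr 2 * m powr (- 1 + 2 * a) = m powr (1 + 2 * a)"
        by (simp add: powr_add [symmetric])
      finally show ?thesis by (simp add: mult_ac)
    qed
    have "norm (xi w) \<le> (1 + 15 * K) * m powr (1 + 2 * a)"
      unfolding eq using 1 2 3 norm_triangle_ineq [of "npow M (-w)" "w * (\<Sum>n<M - 1. npow (Suc n) (-w-1))"]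
        norm_triangle_ineq [of "npow M (-w) + w * (\<Sum>n<M - 1. npow (Suc n) (-w-1))" "\<Sum>n. zterm (n + (M - 1)) w"]
      by (simp add: algebra_simps)
    also have "m powr (1 + 2 * a) \<le> (2 * (1 + \<bar>Im w\<bar>)) powr (1 + 2 * a)"
      using mlo mhi a by (intro powr_mono2) auto
    also have "\<dots> = 2 powr (1 + 2 * a) * (1 + \<bar>Im w\<bar>) powr (1 + 2 * a)"
      by (rule powr_mult)
    also have "(2::real) powr (1 + 2 * a) \<le> 2 powr 2" using a by (intro powr_mono) auto
    also have "(2::real) powr 2 = 4" by (simp add: powr_numeral)
    finally have "norm (xi w) \<le> (1 + 15 * K) * (4 * (1 + \<bar>Im w\<bar>) powr (1 + 2 * a))"
      using K by (simp add: mult_left_mono mult_right_mono)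
    also have "\<dots> \<le> (24 + 60 * K) * (1 + \<bar>Im w\<bar>) powr (1 + 2 * a)"
      unfolding mult.assoc [symmetric] by (rule mult_right_mono) (use K in auto)
    finally show ?thesis .
  qed
  show ?thesis by (rule that [of "24 + 60 * K"]) (use K main in auto)
qed

text \<open>The factor \<open>1 / (1 + w)\<close> makes this comparable to \<open>\<zeta>(1+w)\<close> for large \<open>w\<close> while the pole is still removed.\<close>

definition ztil :: "complex \<Rightarrow> complex" where
  "ztil w = xi w / (1 + w)"

lemma ztil_holomorphic: "ztil holomorphic_on {w. Re w > -1}"
  unfolding ztil_def
proof (intro holomorphic_intros xi_holomorphic)
  fix w :: complex assume "w \<in> {w. Re w > -1}"
  thus "1 + w \<noteq> 0" by (auto simp: complex_eq_iff)
qed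

lemma ztil_analytic_0: "ztil analytic_on {0}"
  using ztil_holomorphic open_halfspace_Re_gt [of "-1"]
  by (auto simp: analytic_at)

text \<open>To the left of the axis by \<open>a\<close>, the bound for \<open>xi\<close> exceeds
  linear growth by \<open>2 * a\<close> only, and division by \<open>1 + w\<close> removes the
  linear part. Thus discs of radius \<open>a\<close> serve every exponent
  \<open>e \<ge> 2 * a\<close>.\<close>

lemma tame_ztil: "tame strip ztil"
proof (rule tame_Cauchy [where S = "{w. Re w > -1}"])
  show "ztil holomorphic_on rhp" by (rule holomorphic_on_subset [OF ztil_holomorphic]) (auto simp: rhp_def)
  fix e :: real assume e: "e > 0"
  define a where "a = min (1/4) (e/2)"
  have a: "0 < a" "a \<le> 1/4" "2 * a \<le> e" using e by (auto simp: a_def)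
  obtain C where C: "C \<ge> 0" "\<And>w. - a \<le> Re w \<Longrightarrow> Re w \<le> 2 \<Longrightarrow> norm (xi w) \<le> C * (1 + \<bar>Im w\<bar>) powr (1 + 2 * a)"
    using norm_xi_le [OF a(1,2)] by blast
  have "cball w a \<subseteq> {w. Re w > -1} \<and> (\<forall>z\<in>cball w a. norm (ztil z) \<le> 4 * C * 2 powr e * (1 + \<bar>Im w\<bar>) powr e)"
    if w: "w \<in> strip" for w
  proof -
    have *: "- a \<le> Re z \<and> Re z \<le> 2 \<and> \<bar>Im z\<bar> \<le> \<bar>Im w\<bar> + 1" if "z \<in> cball w a" for z
      using that w a abs_Re_le_cmod [of "w - z"] abs_Im_le_cmod [of "w - z"]
      by (auto simp: strip_def dist_norm)
    have "norm (ztil z) \<le> 4 * C * 2 powr e * (1 + \<bar>Im w\<bar>) powr e" if z: "z \<in> cball w a" for z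
    proof -
      have n1: "norm (1 + z) \<ge> (1 + \<bar>Im z\<bar>) / 4"
        using abs_Re_le_cmod [of "1 + z"] abs_Im_le_cmod [of "1 + z"] * [OF z] a by auto
      have "norm (ztil z) = norm (xi z) / norm (1 + z)" by (simp add: ztil_def norm_divide)
      also have "\<dots> \<le> (C * (1 + \<bar>Im z\<bar>) powr (1 + 2 * a)) / ((1 + \<bar>Im z\<bar>) / 4)"
        using C * [OF z] n1 by (intro frac_le) auto
      also have "\<dots> = 4 * C * (1 + \<bar>Im z\<bar>) powr (2 * a)"
        by (simp add: powr_add)
      also have "\<dots> \<le> 4 * C * (2 * (1 + \<bar>Im w\<bar>)) powr e"
      proof -
        have "(1 + \<bar>Im z\<bar>) powr (2 * a) \<le> (1 + \<bar>Im z\<bar>) powr e" using a by (intro powr_mono) auto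
        also have "\<dots> \<le> (2 * (1 + \<bar>Im w\<bar>)) powr e" using * [OF z] e by (intro powr_mono2) auto
        finally show ?thesis using C by (intro mult_left_mono) auto
      qed
      also have "\<dots> = 4 * C * 2 powr e * (1 + \<bar>Im w\<bar>) powr e"
        using powr_mult [of 2 "1 + \<bar>Im w\<bar>" e] by simp
      finally show ?thesis .
    qed
    moreover have "cball w a \<subseteq> {w. Re w > -1}" using * a by fastforce
    ultimately show ?thesis by blast
  qed
  thus "\<exists>r>0. \<exists>C. \<forall>w\<in>strip. cball w r \<subseteq> {w. Re w > -1} \<and>
      (\<forall>z\<in>cball w r. norm (ztil z) \<le> C * (1 + \<bar>Im w\<bar>) powr e)"
    using a by (intro exI[of _ a] conjI exI[of _ "4 * C * 2 powr e"] ballI) auto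
qed (auto simp: ztil_holomorphic)

lemma good_ztil: "good ztil ztil"
  unfolding good_def extends0_def by (simp add: tame_ztil ztil_analytic_0)

lemma ztil_0 [simp]: "ztil 0 = 1"
  by (simp add: ztil_def xi_0)

lemma ztil_eq: "w \<in> rhp \<Longrightarrow> ztil w = w * zeta1 w / (1 + w)"
  by (simp add: ztil_def xi_eq_zeta1)

lemma zeta1_nonzero: "w \<in> rhp \<Longrightarrow> zeta1 w \<noteq> 0"
  using zeta1_times_muom_0 [of w] by auto

lemma ztil_nonzero:
  assumes "w \<in> rhp"
  shows "ztil w \<noteq> 0"
proof -
  have "w \<noteq> 0" "1 + w \<noteq> 0" using assms by (auto simp: rhp_def complex_eq_iff)
  thus ?thesis using assms zeta1_nonzero ztil_eq by auto
qed

lemma zeta1_holomorphic: "zeta1 holomorphic_on rhp"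
  unfolding zeta1_def dir_def by (rule lap_holomorphic [OF dir_ok_one])

section \<open>The 3-4-1 inequality and the size of 1 / zeta near the line\<close>

lemma three_four_one_nonneg: "3 + 4 * cos x + cos (2 * x :: real) \<ge> 0"
proof -
  have "3 + 4 * cos x + cos (2 * x) = 2 * (1 + cos x) ^ 2"
    unfolding cos_double_cos power2_eq_square by (simp add: algebra_simps)
  thus ?thesis by simp
qed

lemma mangs_three_four_one:
  assumes u: "u > 0"
  shows "3 * Re (mangs (of_real u)) + 4 * Re (mangs (Complex u t)) + Re (mangs (Complex u (2 * t))) \<ge> 0"
proof -
  let ?M = "count_space UNIV :: nat measure"
  define f where "f = (\<lambda>w n. mangoldt n / of_nat n * exp (- w * complex_of_real (ln (real n))))"
  have rhp: "of_real u \<in> rhp" "Complex u t \<in> rhp" "Complex u (2 * t) \<in> rhp"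
    using u by (auto simp: rhp_def)
  have int: "integrable ?M (\<lambda>n. Re (f w n))" and eq: "Re (mangs w) = (\<integral>n. Re (f w n) \<partial>?M)"
    if "w \<in> rhp" for w
  proof -
    have i: "integrable ?M (f w)" unfolding f_def by (rule lap_integrable [OF dir_ok_mangoldt that])
    show "integrable ?M (\<lambda>n. Re (f w n))" by (rule integrable_Re [OF i])
    show "Re (mangs w) = (\<integral>n. Re (f w n) \<partial>?M)"
      unfolding integral_Re [OF i] by (simp only: mangs_def dir_def lap_def f_def)
  qed
  have "3 * Re (mangs (of_real u)) + 4 * Re (mangs (Complex u t)) + Re (mangs (Complex u (2 * t))) =
    (\<integral>n. 3 * Re (f (of_real u) n) + 4 * Re (f (Complex u t) n) + Re (f (Complex u (2 * t)) n) \<partial>?M)"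
    using int rhp by (simp add: eq)
  also have "\<dots> \<ge> 0"
  proof (rule Bochner_Integration.integral_nonneg)
    fix n
    have f: "Re (f (Complex u y) n) = mangoldt n / real n * exp (- u * ln (real n)) * cos (y * ln (real n))" for y
    proof -
      have 1: "(mangoldt n / of_nat n :: complex) = of_real (mangoldt n / real n)" by simp
      have 2: "Re (exp (- Complex u y * complex_of_real (ln (real n)))) = exp (- u * ln (real n)) * cos (y * ln (real n))"
        by (simp add: Re_exp)
      have 3: "Re (of_real a * z) = a * Re z" for a z by simp
      show ?thesis unfolding f_def 1 3 2 by (simp only: mult.assoc)
    qed
    have "of_real u = Complex u 0" by (simp add: complex_eq_iff)
    hence "3 * Re (f (of_real u) n) + 4 * Re (f (Complex u t) n) + Re (f (Complex u (2 * t)) n) =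
        mangoldt n / real n * exp (- u * ln (real n)) * (3 + 4 * cos (t * ln (real n)) + cos (2 * (t * ln (real n))))"
      by (simp add: f algebra_simps)
    also have "\<dots> \<ge> 0" using three_four_one_nonneg mangoldt_nonneg by (intro mult_nonneg_nonneg) auto
    finally show "0 \<le> 3 * Re (f (of_real u) n) + 4 * Re (f (Complex u t) n) + Re (f (Complex u (2 * t)) n)" .
  qed
  finally show ?thesis .
qed

lemma norm_muom_le:
  obtains B where "B > 0" "\<And>w. Re w \<ge> r \<Longrightarrow> r > 0 \<Longrightarrow> norm (muom k w) \<le> B"
proof -
  define c where "c = (\<lambda>n. complex_of_real (mu_omega_term k n))"
  define B where "B = (\<integral>n. norm (c n) * exp (- r * ln (real n)) \<partial>count_space UNIV)"
  have "norm (muom k w) \<le> \<bar>B\<bar> + 1" if "Re w \<ge> r" "r > 0" for w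
  proof -
    have int: "integrable (count_space UNIV) (\<lambda>n. norm (c n) * exp (- u * ln (real n)))" if "u > 0" for u
      using dir_ok_muom [of k] that unfolding lap_ok_def c_def by blast
    have "norm (muom k w) \<le> (\<integral>n. norm (c n) * exp (- Re w * ln (real n)) \<partial>count_space UNIV)"
      unfolding muom_def dir_def c_def by (rule norm_lap_le [OF dir_ok_muom]) (use that in \<open>auto simp: rhp_def\<close>)
    also have "\<dots> \<le> B" unfolding B_def
      by (rule integral_mono [OF int int]) (use that in \<open>auto intro!: mult_left_mono mult_right_mono\<close>)
    finally show ?thesis by linarith
  qed
  thus ?thesis by (intro that [of "\<bar>B\<bar> + 1"]) auto
qed

text \<open>Instead of a series for the logarithm of zeta, a holomorphic logarithm \<open>L\<close>
  with derivative \<open>- mangs\<close> is used. By the 3-4-1 inequality for \<open>mangs\<close>,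
  the combination \<open>\<phi>\<close> of real parts decreases in \<open>u\<close>, so its value is
  at least the one at \<open>u = 1\<close>. There absolute convergence of \<open>1 / zeta\<close>
  bounds each \<open>Re L\<close> from below by \<open>- ln B\<close>, with total weight
  \<open>3 + 4 + 1 = 8\<close>.\<close>

lemma norm_zeta1_three_four_one:
  obtains c where "c > 0" "\<And>u t. 0 < u \<Longrightarrow> u \<le> 1 \<Longrightarrow>
    norm (zeta1 (of_real u)) ^ 3 * norm (zeta1 (Complex u t)) ^ 4 * norm (zeta1 (Complex u (2 * t))) \<ge> c"
proof -
  obtain L where L: "L holomorphic_on rhp" "\<And>w. w \<in> rhp \<Longrightarrow> zeta1 w = exp (L w)"
    using contractible_imp_holomorphic_log [OF zeta1_holomorphic convex_imp_contractible [OF convex_rhp] zeta1_nonzero]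
    by blast
  have L': "(L has_field_derivative (- mangs w)) (at w)" if w: "w \<in> rhp" for w
  proof -
    have d: "(L has_field_derivative deriv L w) (at w)"
      using L(1) w holomorphic_derivI open_rhp by blast
    have "deriv zeta1 w = deriv (\<lambda>w. exp (L w)) w"
      by (rule complex_derivative_transform_within_open [where s = rhp])
         (use L w zeta1_holomorphic in \<open>auto intro!: holomorphic_intros\<close>)
    also have "\<dots> = exp (L w) * deriv L w"
      by (rule DERIV_imp_deriv) (use d in \<open>auto intro!: derivative_eq_intros\<close>)
    finally have "deriv zeta1 w = zeta1 w * deriv L w" using L(2) [OF w] by simp
    moreover have "deriv zeta1 w = zeta1 w * (- mangs w)" using zeta1_times_mangs [OF w] by simp
    ultimately have "deriv L w = - mangs w" using zeta1_nonzero [OF w] by (metis mult_left_cancel)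
    thus ?thesis using d by simp
  qed
  obtain B where B: "B > 0" "\<And>w. Re w \<ge> 1 \<Longrightarrow> norm (muom 0 w) \<le> B"
    using norm_muom_le [of 1 0] by auto
  have lower: "Re (L w) \<ge> - ln B" if "Re w = 1" for w
  proof -
    have w: "w \<in> rhp" using that by (simp add: rhp_def)
    have "1 = norm (zeta1 w) * norm (muom 0 w)" using zeta1_times_muom_0 [OF w] by (metis norm_mult norm_one)
    also have "\<dots> \<le> norm (zeta1 w) * B" using B that by (intro mult_left_mono) auto
    finally have "1 / B \<le> exp (Re (L w))" using B L(2) [OF w] by (simp add: field_simps)
    hence "ln (1 / B) \<le> ln (exp (Re (L w)))" using B by (subst ln_le_cancel_iff) auto
    thus ?thesis using B by (simp add: ln_div)
  qed
  have main: "norm (zeta1 (of_real u)) ^ 3 * norm (zeta1 (Complex u t)) ^ 4 * norm (zeta1 (Complex u (2 * t))) \<ge> exp (- 8 * ln B)"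
    if u: "0 < u" "u \<le> 1" for u t
  proof -
    define \<phi> where "\<phi> = (\<lambda>u. 3 * Re (L (Complex u 0)) + 4 * Re (L (Complex u t)) + Re (L (Complex u (2 * t))))"
    have dL: "((\<lambda>x. Re (L (Complex x y))) has_real_derivative - Re (mangs (Complex x y))) (at x)" if "x > 0" for x y
    proof -
      have "Complex x y \<in> rhp" using that by (simp add: rhp_def)
      from L' [OF this] have "(L has_field_derivative - mangs (Complex x y)) (at (Complex x y) within (range (\<lambda>x. Complex x y)))"
        by (rule has_field_derivative_at_within)
      moreover have "((\<lambda>x. Complex x y) has_vector_derivative 1) (at x)"
      proof -
        have "((\<lambda>x. of_real x + Complex 0 y) has_vector_derivative 1 + 0) (at x)"
          by (intro has_vector_derivative_add has_vector_derivative_const has_vector_derivative_of_real [where D = 1, simplified]) auto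
        moreover have "(\<lambda>x. of_real x + Complex 0 y) = (\<lambda>x. Complex x y)" by (auto simp: complex_eq_iff)
        ultimately show ?thesis by simp
      qed
      ultimately have "((L \<circ> (\<lambda>x. Complex x y)) has_vector_derivative 1 * (- mangs (Complex x y))) (at x)"
        by (intro field_vector_diff_chain_within) auto
      hence "((\<lambda>x. Re (L (Complex x y))) has_vector_derivative Re (1 * (- mangs (Complex x y)))) (at x)"
        unfolding o_def by (rule bounded_linear.has_vector_derivative [OF bounded_linear_Re])
      thus ?thesis by (simp add: has_real_derivative_iff_has_vector_derivative)
    qed
    have "\<phi> u \<ge> \<phi> 1"
    proof (rule DERIV_nonpos_imp_nonincreasing [OF u(2)])
      fix x assume x: "u \<le> x" "x \<le> 1"
      hence x0: "x > 0" using u by simp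
      have "(\<phi> has_real_derivative (3 * (- Re (mangs (Complex x 0))) + 4 * (- Re (mangs (Complex x t))) + (- Re (mangs (Complex x (2 * t)))))) (at x)"
        unfolding \<phi>_def by (intro DERIV_add DERIV_cmult dL x0)
      moreover have "3 * (- Re (mangs (Complex x 0))) + 4 * (- Re (mangs (Complex x t))) + (- Re (mangs (Complex x (2 * t)))) \<le> 0"
        using mangs_three_four_one [OF x0, of t] by (simp add: complex_of_real_def)
      ultimately show "\<exists>y. (\<phi> has_real_derivative y) (at x) \<and> y \<le> 0" by blast
    qed
    moreover have "\<phi> 1 \<ge> - 8 * ln B"
      using lower [of "Complex 1 0"] lower [of "Complex 1 t"] lower [of "Complex 1 (2 * t)"] by (simp add: \<phi>_def)
    ultimately have "exp (- 8 * ln B) \<le> exp (\<phi> u)" by simp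
    also have "\<dots> = norm (zeta1 (of_real u)) ^ 3 * norm (zeta1 (Complex u t)) ^ 4 * norm (zeta1 (Complex u (2 * t)))"
    proof -
      have n: "norm (zeta1 (Complex u y)) = exp (Re (L (Complex u y)))" for y
        using L(2) [of "Complex u y"] u by (simp add: rhp_def)
      show ?thesis unfolding complex_of_real_def n \<phi>_def exp_of_nat_mult [symmetric] exp_add [symmetric]
        by simp
    qed
    finally show ?thesis .
  qed
  show ?thesis by (rule that [OF exp_gt_zero main])
qed

text \<open>In the inequality for zeta the pole contributes \<open>u powr (-3)\<close> and the point
  at height \<open>2 * t\<close> contributes a factor \<open>(1 + \<bar>t\<bar>) powr e\<close>.
  Solving for the fourth power and taking fourth roots produces the exponents \<open>3/4\<close> and
  \<open>- e / 4\<close>.\<close>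

lemma ztil_three_four_one:
  assumes r: "0 < r" and e: "e > 0"
  obtains c where "c > 0" "\<And>u t. 0 < u \<Longrightarrow> u \<le> 1 \<Longrightarrow> \<bar>t\<bar> \<ge> r \<Longrightarrow>
    norm (ztil (Complex u t)) \<ge> c * u powr (3/4) * (1 + \<bar>t\<bar>) powr (- e / 4)"
proof -
  obtain c0 where c0: "c0 > 0" "\<And>u t. 0 < u \<Longrightarrow> u \<le> 1 \<Longrightarrow>
    norm (zeta1 (of_real u)) ^ 3 * norm (zeta1 (Complex u t)) ^ 4 * norm (zeta1 (Complex u (2 * t))) \<ge> c0"
    using norm_zeta1_three_four_one by blast
  obtain C where C: "C \<ge> 0" "\<And>w. w \<in> strip \<Longrightarrow> norm (ztil w) \<le> C * (1 + \<bar>Im w\<bar>) powr e"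
    using slow_nonneg_constE [OF tame_D(5) [OF tame_ztil] e] by blast
  \<comment> \<open>This bounds \<open>(1 + w) / w\<close>, the quotient of \<open>zeta1\<close> and
    \<open>ztil\<close>, once \<open>\<bar>Im w\<bar> \<ge> r\<close>.\<close>
  define k where "k = 1 + 1 / r"
  have k: "k > 0" using r by (simp add: k_def add_pos_pos)
  define D where "D = (2 * (C + 1)) ^ 3 * k ^ 4 * (k * (C + 1) * 2 powr e)"
  have D: "D > 0" using C k by (simp add: D_def)
  define c where "c = (c0 / D) powr (1/4)"
  have c: "c > 0" using c0 D by (simp add: c_def)
  have "norm (ztil (Complex u t)) \<ge> c * u powr (3/4) * (1 + \<bar>t\<bar>) powr (- e / 4)"
    if u: "0 < u" "u \<le> 1" and t: "\<bar>t\<bar> \<ge> r" for u t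
  proof -
    define \<tau> where "\<tau> = 1 + \<bar>t\<bar>"
    have \<tau>: "\<tau> \<ge> 1" by (simp add: \<tau>_def)
    have strip: "Complex u y \<in> strip" "Complex u y \<in> rhp" for y using u by (auto simp: strip_def rhp_def)
    have z: "norm (zeta1 (Complex u y)) = norm (ztil (Complex u y)) * (norm (1 + Complex u y) / norm (Complex u y))" for y
    proof -
      have "Complex u y \<noteq> 0" "1 + Complex u y \<noteq> 0" using u by (auto simp: complex_eq_iff)
      thus ?thesis using ztil_eq [OF strip(2) [of y]] by (simp add: norm_mult norm_divide)
    qed
    have zk: "norm (zeta1 (Complex u y)) \<le> k * norm (ztil (Complex u y))" if y: "\<bar>y\<bar> \<ge> r" for y
    proof -
      have n: "norm (Complex u y) \<ge> r" using abs_Im_le_cmod [of "Complex u y"] y by simp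
      have "norm (1 + Complex u y) / norm (Complex u y) \<le> (1 + norm (Complex u y)) / norm (Complex u y)"
        using norm_triangle_ineq [of 1 "Complex u y"] by (intro divide_right_mono) auto
      also have "\<dots> = 1 + 1 / norm (Complex u y)"
      proof -
        have "norm (Complex u y) \<noteq> 0" using n r by linarith
        thus ?thesis by (metis add_divide_distrib divide_self add.commute)
      qed
      also have "\<dots> \<le> k" unfolding k_def using n r by (intro add_left_mono divide_left_mono mult_pos_pos) linarith+
      finally show ?thesis unfolding z
        by (subst mult.commute) (rule mult_right_mono, auto)
    qed
    have z1: "norm (zeta1 (of_real u)) \<le> 2 * (C + 1) / u"
    proof -
      have "norm (ztil (Complex u 0)) \<le> C + 1" using C(2) [OF strip(1) [of 0]] C(1) by simp
      moreover have "norm (1 + Complex u 0) / norm (Complex u 0) \<le> 2 / u"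
      proof -
        have "Complex u 0 = of_real u" "1 + Complex u 0 = of_real (1 + u)" by (simp_all add: complex_eq_iff)
        hence "norm (Complex u 0) = u" "norm (1 + Complex u 0) = 1 + u" using u by (simp_all only: norm_of_real)
        thus ?thesis using u by (simp add: divide_right_mono)
      qed
      ultimately have "norm (zeta1 (Complex u 0)) \<le> (C + 1) * (2 / u)"
        unfolding z using C u by (intro mult_mono) auto
      thus ?thesis by (simp add: complex_of_real_def mult.commute)
    qed
    have z3: "norm (zeta1 (Complex u (2 * t))) \<le> k * (C + 1) * 2 powr e * \<tau> powr e"
    proof -
      have "norm (ztil (Complex u (2 * t))) \<le> C * (1 + \<bar>2 * t\<bar>) powr e" using C(2) [OF strip(1) [of "2 * t"]] by simp
      also have "\<dots> \<le> (C + 1) * (2 * \<tau>) powr e"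
        using C e by (intro mult_mono powr_mono2) (auto simp: \<tau>_def)
      also have "\<dots> = (C + 1) * 2 powr e * \<tau> powr e" using powr_mult [of 2 \<tau> e] \<tau> by simp
      finally have "k * norm (ztil (Complex u (2 * t))) \<le> k * ((C + 1) * 2 powr e * \<tau> powr e)"
        using k by (intro mult_left_mono) auto
      moreover have "\<bar>2 * t\<bar> \<ge> r" using t r by simp
      ultimately show ?thesis using zk [of "2 * t"] by (simp add: mult_ac)
    qed
    define Z where "Z = norm (ztil (Complex u t))"
    have "c0 \<le> norm (zeta1 (of_real u)) ^ 3 * norm (zeta1 (Complex u t)) ^ 4 * norm (zeta1 (Complex u (2 * t)))"
      using c0(2) u by blast
    also have "\<dots> \<le> (2 * (C + 1) / u) ^ 3 * (k * Z) ^ 4 * (k * (C + 1) * 2 powr e * \<tau> powr e)"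
      using z1 z3 zk [OF t] C k u by (intro mult_mono power_mono) (auto simp: Z_def)
    also have "\<dots> = D * Z ^ 4 * \<tau> powr e / u ^ 3"
      by (simp add: D_def power_mult_distrib power_divide mult_ac)
    finally have "c0 * u ^ 3 \<le> D * Z ^ 4 * \<tau> powr e" using u by (simp add: field_simps)
    hence "c0 * u ^ 3 \<le> D * (Z ^ 4 * \<tau> powr e)" by (simp add: mult_ac)
    hence "c0 / D * u ^ 3 \<le> Z ^ 4 * \<tau> powr e" using D by (simp add: field_simps)
    hence "c0 / D * u ^ 3 * \<tau> powr (- e) \<le> Z ^ 4 * \<tau> powr e * \<tau> powr (- e)" by (intro mult_right_mono) auto
    also have "\<dots> = Z ^ 4" using \<tau> by (simp add: powr_minus field_simps)
    finally have "(c0 / D * u ^ 3 * \<tau> powr (- e)) powr (1/4) \<le> (Z ^ 4) powr (1/4)"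
      using c0 D u by (intro powr_mono2) auto
    also have "(Z ^ 4) powr (1/4) = Z"
    proof (cases "Z = 0")
      case False
      hence "Z > 0" by (simp add: Z_def)
      thus ?thesis by (simp add: powr_powr powr_numeral [symmetric] del: powr_numeral)
    qed auto
    also have "(c0 / D * u ^ 3 * \<tau> powr (- e)) powr (1/4) = c * u powr (3/4) * \<tau> powr (- e / 4)"
    proof -
      have "(c0 / D * u ^ 3 * \<tau> powr (- e)) powr (1/4) = (c0 / D) powr (1/4) * (u powr 3) powr (1/4) * (\<tau> powr (- e)) powr (1/4)"
      proof -
        have "u ^ 3 = u powr 3" using u by (simp add: powr_numeral)
        thus ?thesis by (simp only: powr_mult)
      qed
      thus ?thesis by (simp add: c_def powr_powr del: powr_numeral)
    qed
    finally show ?thesis by (simp add: Z_def \<tau>_def)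
  qed
  thus ?thesis using that c by blast
qed

text \<open>The 3-4-1 inequality bounds \<open>ztil\<close> from below at some distance from the axis; the slow growth of its derivative
  carries the bound up to the axis.\<close>

lemma ztil_lower_bound:
  assumes r: "0 < r" and e: "e > 0"
  obtains K where "\<And>w. w \<in> strip \<Longrightarrow> \<bar>Im w\<bar> \<ge> r \<Longrightarrow> norm (1 / ztil w) \<le> K * (1 + \<bar>Im w\<bar>) powr e"
proof -
  define d where "d = e / 4"
  have d: "d > 0" using e by (simp add: d_def)
  obtain c where c: "c > 0" "\<And>u t. 0 < u \<Longrightarrow> u \<le> 1 \<Longrightarrow> \<bar>t\<bar> \<ge> r \<Longrightarrow>
    norm (ztil (Complex u t)) \<ge> c * u powr (3/4) * (1 + \<bar>t\<bar>) powr (- d / 4)"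
    using ztil_three_four_one [OF r d] by blast
  obtain C where C: "C \<ge> 0" "\<And>w. w \<in> strip \<Longrightarrow> norm (deriv ztil w) \<le> C * (1 + \<bar>Im w\<bar>) powr d"
    using slow_nonneg_constE [OF tame_D(5) [OF tame_deriv [OF tame_ztil]] d] by blast
  \<comment> \<open>Chosen so that \<open>(C + 1) * a \<le> c / 2 * a powr (3/4)\<close>: the change
    of \<open>ztil\<close> over a horizontal segment of length \<open>u0\<close> is then at most
    half of its lower bound at the right end.\<close>
  define a where "a = min 1 ((c / (2 * (C + 1))) powr 4)"
  have a: "0 < a" "a \<le> 1" using c C by (auto simp: a_def)
  have a4: "(C + 1) * a powr (1/4) \<le> c / 2"
  proof -
    have "a powr (1/4) \<le> ((c / (2 * (C + 1))) powr 4) powr (1/4)"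
      using a by (intro powr_mono2) (auto simp: a_def)
    also have "\<dots> = c / (2 * (C + 1))" unfolding powr_powr using c C by simp
    finally show ?thesis using C by (simp add: field_simps)
  qed
  define K where "K = 1 / (c / 2 * a powr (3/4))"
  have "norm (1 / ztil w) \<le> K * (1 + \<bar>Im w\<bar>) powr e" if w: "w \<in> strip" "\<bar>Im w\<bar> \<ge> r" for w
  proof -
    define u where "u = Re w"
    define t where "t = Im w"
    have u: "0 < u" "u \<le> 1" using w by (auto simp: u_def strip_def)
    have wut: "w = Complex u t" by (simp add: u_def t_def)
    define \<tau> where "\<tau> = 1 + \<bar>t\<bar>"
    have \<tau>: "\<tau> \<ge> 1" by (simp add: \<tau>_def)
    \<comment> \<open>The exponent 5 balances both losses. The lower bound at \<open>u0\<close>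
      decays with exponent \<open>15 * d / 4 + d / 4\<close>, and the derivative bound times
      \<open>u0\<close> with exponent \<open>5 * d - d\<close>; both are
      \<open>4 * d = e\<close>.\<close>
    define u0 where "u0 = a * \<tau> powr (- 5 * d)"
    have "\<tau> powr (- 5 * d) \<le> \<tau> powr 0" using \<tau> d by (intro powr_mono) auto
    hence "\<tau> powr (- 5 * d) \<le> 1" using \<tau> by simp
    hence u0: "0 < u0" "u0 \<le> 1" using a \<tau> mult_mono [of a 1 "\<tau> powr (- 5 * d)" 1] by (auto simp: u0_def)
    have u0p: "c * u0 powr (3/4) * \<tau> powr (- d / 4) = c * a powr (3/4) * \<tau> powr (- e)"
    proof -
      have "u0 powr (3/4) = a powr (3/4) * \<tau> powr (- 15 * d / 4)"
        using a \<tau> by (simp add: u0_def powr_mult powr_powr)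
      hence "c * u0 powr (3/4) * \<tau> powr (- d / 4) = c * a powr (3/4) * (\<tau> powr (- 15 * d / 4) * \<tau> powr (- d / 4))"
        by simp
      also have "\<tau> powr (- 15 * d / 4) * \<tau> powr (- d / 4) = \<tau> powr (- e)"
        unfolding powr_add [symmetric] by (rule arg_cong [of _ _ "(powr) \<tau>"]) (simp add: d_def)
      finally show ?thesis .
    qed
    have "norm (ztil w) \<ge> c / 2 * a powr (3/4) * \<tau> powr (- e)"
    proof (cases "u \<ge> u0")
      case True
      have "c / 2 * a powr (3/4) * \<tau> powr (- e) \<le> c * a powr (3/4) * \<tau> powr (- e)"
        using c a by (intro mult_right_mono) auto
      also have "\<dots> = c * u0 powr (3/4) * \<tau> powr (- d / 4)" by (rule u0p [symmetric])
      also have "\<dots> \<le> c * u powr (3/4) * \<tau> powr (- d / 4)"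
        using True u0 c by (intro mult_right_mono mult_left_mono powr_mono2) auto
      also have "\<dots> \<le> norm (ztil w)" unfolding wut \<tau>_def using c(2) [OF u, of t] w by (simp add: t_def)
      finally show ?thesis .
    next
      case False
      define w0 where "w0 = Complex u0 t"
      define S where "S = {z \<in> strip. Im z = t}"
      have cv: "convex S"
      proof -
        have "S = {z. Re z > 0} \<inter> {z. Re z \<le> 1} \<inter> {z. Im z = t}" by (auto simp: S_def strip_def)
        thus ?thesis using convex_halfspace_Re_gt convex_halfspace_Re_le convex_hyperplane [of \<i> t]
          by (simp add: inner_complex_def convex_Int)
      qed
      have "norm (ztil w0 - ztil w) \<le> (C * \<tau> powr d) * norm (w0 - w)"
      proof (rule field_differentiable_bound [OF cv])
        fix z assume z: "z \<in> S"
        have "z \<in> rhp" using z by (auto simp: S_def strip_def rhp_def)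
        thus "(ztil has_field_derivative deriv ztil z) (at z within S)"
          using tame_D(2) [OF tame_ztil] holomorphic_derivI open_rhp by blast
        show "norm (deriv ztil z) \<le> C * \<tau> powr d" using C(2) [of z] z by (auto simp: S_def \<tau>_def)
      qed (use u u0 w in \<open>auto simp: S_def w0_def strip_def t_def\<close>)
      also have "norm (w0 - w) = u0 - u"
      proof -
        have "w0 - w = of_real (u0 - u)" by (simp add: w0_def wut complex_eq_iff)
        thus ?thesis using False by (simp only: norm_of_real)
      qed
      also have "C * \<tau> powr d * (u0 - u) \<le> (C + 1) * \<tau> powr d * u0"
        using u0 u C False by (intro mult_mono) auto
      also have "\<dots> = (C + 1) * a * (\<tau> powr d * \<tau> powr (- 5 * d))" by (simp add: u0_def mult_ac)
      also have "\<tau> powr d * \<tau> powr (- 5 * d) = \<tau> powr (- e)"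
        unfolding powr_add [symmetric] by (rule arg_cong [of _ _ "(powr) \<tau>"]) (simp add: d_def)
      also have "(C + 1) * a * \<tau> powr (- e) = ((C + 1) * a powr (1/4)) * (a powr (3/4) * \<tau> powr (- e))"
      proof -
        have "a = a powr (1/4) * a powr (3/4)" using a by (simp add: powr_add [symmetric])
        thus ?thesis by (metis mult.assoc)
      qed
      also have "\<dots> \<le> (c / 2) * (a powr (3/4) * \<tau> powr (- e))" by (intro mult_right_mono a4) auto
      finally have 1: "norm (ztil w0 - ztil w) \<le> c / 2 * a powr (3/4) * \<tau> powr (- e)" by (simp add: mult.assoc)
      have 2: "norm (ztil w0) \<ge> c * a powr (3/4) * \<tau> powr (- e)"
      proof -
        have "r \<le> \<bar>t\<bar>" using w by (simp add: t_def)
        from c(2) [OF u0 this] show ?thesis unfolding w0_def \<tau>_def [symmetric] u0p .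
      qed
      have "c * a powr (3/4) * \<tau> powr (- e) = 2 * (c / 2 * a powr (3/4) * \<tau> powr (- e))" by simp
      thus ?thesis using 1 2 norm_triangle_ineq2 [of "ztil w0" "ztil w"] by linarith
    qed
    moreover have "c / 2 * a powr (3/4) * \<tau> powr (- e) > 0"
      using c a \<tau> by (intro mult_pos_pos) auto
    ultimately have "norm (1 / ztil w) \<le> 1 / (c / 2 * a powr (3/4) * \<tau> powr (- e))"
      unfolding norm_divide norm_one by (rule frac_le [OF zero_le_one order_refl, rotated])
    also have "\<dots> = K * \<tau> powr e" using \<tau> by (simp add: K_def powr_minus field_simps)
    finally show ?thesis by (simp add: \<tau>_def t_def)
  qed
  thus ?thesis by (rule that)
qed

text \<open>Three regions are covered separately: \<open>\<bar>Im w\<bar> \<ge> r\<close> by the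
  lower bound just shown, small imaginary part with \<open>Re w \<ge> r\<close> by the absolutely
  convergent series for \<open>1 / zeta\<close>, and the rest by continuity at the origin, where
  \<open>ztil\<close> is 1. As \<open>r = r0 / 2\<close>, the remaining box lies in the ball of
  radius \<open>r0\<close>.\<close>

lemma slow_inverse_ztil: "slow strip (\<lambda>w. 1 / ztil w)"
  unfolding slow_def
proof (intro allI impI)
  fix e :: real assume e: "e > 0"
  have "isCont ztil 0"
    using ztil_analytic_0 by (auto intro: analytic_at_imp_isCont)
  then obtain r0 where r0: "r0 > 0" "\<And>w. norm w < r0 \<Longrightarrow> norm (ztil w - 1) < 1 / 2"
    unfolding continuous_at_eps_delta using ztil_0 by (auto simp: dist_norm dest: spec[of _ "1/2"])
  define r where "r = r0 / 2"
  have r: "r > 0" using r0 by (simp add: r_def)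
  obtain K where K: "\<And>w. w \<in> strip \<Longrightarrow> \<bar>Im w\<bar> \<ge> r \<Longrightarrow> norm (1 / ztil w) \<le> K * (1 + \<bar>Im w\<bar>) powr e"
    using ztil_lower_bound [OF r e] by blast
  obtain B where B: "B > 0" "\<And>w. Re w \<ge> r \<Longrightarrow> norm (muom 0 w) \<le> B"
    using norm_muom_le [of r 0] r by auto
  define M where "M = 2 + (1 + 1 / r) * B"
  have Mge: "norm (1 / ztil w) \<le> M" if w: "w \<in> strip" "\<bar>Im w\<bar> < r" for w
  proof (cases "Re w \<ge> r")
    case True
    have rhp: "w \<in> rhp" using w strip_subset_rhp by blast
    have n: "norm w \<ge> r" using abs_Re_le_cmod [of w] True by linarith
    have "w \<noteq> 0" using n r by auto
    have "zeta1 w * muom 0 w = 1" by (rule zeta1_times_muom_0 [OF rhp])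
    hence "1 / ztil w = (1 + w) / w * muom 0 w"
      unfolding ztil_eq [OF rhp] using \<open>w \<noteq> 0\<close> zeta1_nonzero [OF rhp] by (simp add: field_simps)
    hence "norm (1 / ztil w) = norm (1 + 1 / w) * norm (muom 0 w)"
      using \<open>w \<noteq> 0\<close> by (simp add: norm_mult [symmetric] add_divide_distrib add.commute)
    also have "\<dots> \<le> (1 + 1 / r) * B"
    proof (intro mult_mono B True)
      have "norm (1 + 1 / w) \<le> 1 + 1 / norm w" using norm_triangle_ineq [of 1 "1 / w"] by (simp add: norm_divide)
      also have "\<dots> \<le> 1 + 1 / r" using n r by (intro add_left_mono divide_left_mono mult_pos_pos) linarith+
      finally show "norm (1 + 1 / w) \<le> 1 + 1 / r" .
    qed (use r in auto)
    finally show ?thesis by (simp add: M_def)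
  next
    case False
    have "norm w < r0" using cmod_le [of w] w False by (auto simp: r_def strip_def)
    hence "norm (ztil w - 1) < 1 / 2" by (rule r0(2))
    hence "norm (ztil w) \<ge> 1 / 2" using norm_triangle_ineq2 [of 1 "1 - ztil w"] by (simp add: norm_minus_commute)
    hence "norm (1 / ztil w) \<le> 1 / (1 / 2)"
      unfolding norm_divide norm_one by (intro divide_left_mono mult_pos_pos) linarith+
    also have "\<dots> \<le> M" using B r by (simp add: M_def)
    finally show ?thesis .
  qed
  have "norm (1 / ztil w) \<le> (\<bar>K\<bar> + \<bar>M\<bar>) * (1 + \<bar>Im w\<bar>) powr e" if w: "w \<in> strip" for w
  proof (cases "\<bar>Im w\<bar> \<ge> r")
    case True
    show ?thesis by (rule order.trans [OF K [OF w True]]) (intro mult_right_mono, auto)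
  next
    case False
    have "norm (1 / ztil w) \<le> (\<bar>K\<bar> + \<bar>M\<bar>) * 1" using Mge [OF w] False by auto
    also have "\<dots> \<le> (\<bar>K\<bar> + \<bar>M\<bar>) * (1 + \<bar>Im w\<bar>) powr e"
      using e by (intro mult_left_mono ge_one_powr_ge_zero) auto
    finally show ?thesis .
  qed
  thus "\<exists>C. \<forall>w\<in>strip. norm (1 / ztil w) \<le> C * (1 + \<bar>Im w\<bar>) powr e" by blast
qed

lemma good_inverse_ztil: "good (\<lambda>w. 1 / ztil w) (\<lambda>w. 1 / ztil w)"
  by (rule good_inverse [OF good_ztil ztil_nonzero _ slow_inverse_ztil]) auto

subsection \<open>The series over prime powers\<close>

text \<open>The coefficients \<open>ln n * hcoef j n - mangoldt n / n\<close> vanish at primes, so their series converges for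
  \<open>Re w > - 1 / 2\<close>; the shift by \<open>1 / 4\<close> in \<open>ysum\<close> below makes this visible.\<close>

definition ycoef :: "nat \<Rightarrow> nat \<Rightarrow> complex" where
  "ycoef j n = (if primepow n then of_nat (ppexp n ^ Suc j - 1) * mangoldt n / of_nat n else 0)"

lemma ln_times_hcoef: "of_real (ln (real n)) * hcoef j n = mangoldt n / of_nat n + ycoef j n"
proof (cases "primepow n")
  case True
  then obtain p l where pl: "prime p" "l > 0" "n = p ^ l" by (auto simp: primepow_def)
  have p: "p > 0" using pl prime_gt_0_nat by blast
  have ln: "ln (real n) = real l * ln (real p)" using pl p by (simp add: ln_realpow)
  have l: "ppexp n = l" using pl by (simp add: ppexp_prime_power)
  have m: "mangoldt n = complex_of_real (ln (real p))" using pl by simp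
  have "mangoldt n / of_nat n + ycoef j n = of_real (ln (real p)) / of_nat n * (1 + of_nat (l ^ Suc j - 1))"
    using True by (simp add: ycoef_def l m algebra_simps del: power_Suc of_nat_diff)
  also have "1 + of_nat (l ^ Suc j - 1) = (of_nat (Suc (l ^ Suc j - 1)) :: complex)" by (rule of_nat_Suc [symmetric])
  also have "Suc (l ^ Suc j - 1) = l ^ Suc j" using pl by (simp del: power_Suc)
  finally show ?thesis using True by (simp add: hcoef_def l ln)
qed (simp add: hcoef_def ycoef_def mangoldt_def)

text \<open>The exponents \<open>Suc k\<close> start at 2, and \<open>2 * 3/4 > 1\<close>, so
  \<open>ln p * p powr (- 3/2)\<close> is summable even over all integers \<open>p \<ge> 2\<close>.
  The remaining factor \<open>p powr (- 3/4 * (k - 1))\<close> is largest at \<open>p = 2\<close>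
  and decays geometrically in \<open>k\<close>.\<close>

lemma abs_summable_prime_powers:
  "Infinite_Set_Sum.abs_summable_on (\<lambda>(p, k). real (Suc k) ^ j * ln (real p) * real p powr (- 3/4 * real (Suc k)))
     ({2..} \<times> {1..})"
proof (rule abs_summable_on_comparison_test)
  define f where "f = (\<lambda>p::nat. 4 * real p powr (- (5/4)))"
  \<comment> \<open>The ratio of the geometric series after \<open>exp (1/4)\<close> per step has
    been spent on the polynomial factor \<open>Suc k ^ j\<close>; it stays below 1 because
    \<open>ln 2 \<ge> 2/3\<close>.\<close>
  define x where "x = exp (1/4) * 2 powr (- 3/4 :: real)"
  define g where "g = (\<lambda>k::nat. fact j / (1/4) ^ j * exp (1/4) * 2 powr (3/4) * x ^ k :: real)"
  have x: "0 \<le> x" "x < 1"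
  proof -
    have "exp (1/4) < (2::real) powr (3/4)"
      using ln2_ge_two_thirds by (simp add: powr_def)
    hence "exp (1/4) * (2::real) powr (- 3/4) < 2 powr (3/4) * 2 powr (- 3/4)"
      by (intro mult_strict_right_mono) auto
    thus "x < 1" by (simp add: x_def powr_add [symmetric])
  qed (simp add: x_def)
  have "summable f" unfolding f_def by (intro summable_mult summable_nat_powr) auto
  hence f: "Infinite_Set_Sum.abs_summable_on f {2..}"
    unfolding f_def by (intro abs_summable_on_subset [OF abs_summable_on_nat_iff' [THEN iffD2]]) simp_all
  have "summable g" unfolding g_def using x by (intro summable_mult summable_geometric) auto
  hence g: "Infinite_Set_Sum.abs_summable_on g {1..}"
    using x unfolding g_def by (intro abs_summable_on_subset [OF abs_summable_on_nat_iff' [THEN iffD2]]) simp_all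
  show "Infinite_Set_Sum.abs_summable_on (\<lambda>(p, k). f p * g k) ({2..} \<times> {1..})"
    by (rule abs_summable_on_product [OF _ _ f g]) auto
  fix z :: "nat \<times> nat" assume z: "z \<in> {2..} \<times> {1..}"
  obtain p k where pk: "z = (p, k)" "p \<ge> 2" "k \<ge> 1" using z by auto
  have "real p powr (- 3/4 * real (Suc k)) = real p powr (- 3/2) * real p powr (- 3/4 * (real k - 1))"
    unfolding powr_add [symmetric] by (rule arg_cong [of _ _ "(powr) (real p)"]) (simp add: field_simps)
  also have "real p powr (- 3/4 * (real k - 1)) \<le> 2 powr (- 3/4 * (real k - 1))"
    using pk by (intro powr_mono2') auto
  also have "2 powr (- 3/4 * (real k - 1)) = (2::real) powr (3/4) * 2 powr (- 3/4 * real k)"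
    unfolding powr_add [symmetric] by (rule arg_cong [of _ _ "(powr) 2"]) (simp add: field_simps)
  finally have 1: "real p powr (- 3/4 * real (Suc k)) \<le> real p powr (- 3/2) * (2 powr (3/4) * 2 powr (- 3/4 * real k))"
    by (simp add: mult_left_mono)
  have "ln (real p) \<le> real p powr (1/4) / (1/4)" using pk by (intro ln_powr_bound) auto
  hence "ln (real p) * real p powr (- 3/2) \<le> (real p powr (1/4) / (1/4)) * real p powr (- 3/2)"
    by (rule mult_right_mono) auto
  also have "\<dots> = f p" by (simp add: f_def powr_add [symmetric])
  finally have 2: "ln (real p) * real p powr (- 3/2) \<le> f p" .
  have "real (Suc k) ^ j \<le> fact j / (1/4) ^ j * exp (1/4 * real (Suc k))"
    by (rule power_le_exp) auto
  hence "real (Suc k) ^ j * 2 powr (- 3/4 * real k) \<le> fact j / (1/4) ^ j * exp (1/4 * real (Suc k)) * 2 powr (- 3/4 * real k)"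
    by (rule mult_right_mono) auto
  also have "\<dots> = fact j / (1/4) ^ j * exp (1/4) * x ^ k"
    by (simp add: x_def power_mult_distrib powr_realpow [symmetric] powr_powr exp_add [symmetric] exp_of_nat_mult [symmetric] mult_ac)
  finally have 3: "real (Suc k) ^ j * 2 powr (- 3/4 * real k) \<le> fact j / (1/4) ^ j * exp (1/4) * x ^ k" .
  have "real (Suc k) ^ j * ln (real p) * real p powr (- 3/4 * real (Suc k))
     \<le> real (Suc k) ^ j * ln (real p) * (real p powr (- 3/2) * (2 powr (3/4) * 2 powr (- 3/4 * real k)))"
    by (intro mult_left_mono 1) auto
  also have "\<dots> = (ln (real p) * real p powr (- 3/2)) * ((real (Suc k) ^ j * 2 powr (- 3/4 * real k)) * 2 powr (3/4))"
    by (simp add: mult_ac)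
  also have "\<dots> \<le> f p * ((fact j / (1/4) ^ j * exp (1/4) * x ^ k) * 2 powr (3/4))"
    by (rule mult_mono [OF 2 mult_right_mono [OF 3]]) (simp_all add: f_def)
  also have "\<dots> = f p * g k" by (simp add: g_def mult_ac)
  finally have "real (Suc k) ^ j * ln (real p) * real p powr (- 3/4 * real (Suc k)) \<le> f p * g k" .
  moreover have "0 \<le> real (Suc k) ^ j * ln (real p) * real p powr (- 3/4 * real (Suc k))" by auto
  ultimately show "norm (case z of (p, k) \<Rightarrow> real (Suc k) ^ j * ln (real p) * real p powr (- 3/4 * real (Suc k)))
     \<le> norm (case z of (p, k) \<Rightarrow> f p * g k)"
    unfolding pk by simp
qed

lemma dir_ok_ycoef_shift: "dir_ok (\<lambda>n. ycoef j n * of_real (real n powr (1/4)))"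
proof -
  define h where "h = (\<lambda>n. norm (ycoef j n) * real n powr (1/4))"
  define P where "P = {(p::nat, k::nat). prime p \<and> k \<ge> 1}"
  have inj: "inj_on (\<lambda>(p, k). p ^ Suc k) P"
    by (rule inj_on_subset [OF bij_betw_imp_inj_on [OF bij_betw_primepows]]) (auto simp: P_def)
  have "Infinite_Set_Sum.abs_summable_on h ((\<lambda>(p, k). p ^ Suc k) ` P)"
    unfolding abs_summable_on_reindex_iff [OF inj, symmetric]
  proof (rule abs_summable_on_comparison_test)
    show "Infinite_Set_Sum.abs_summable_on (\<lambda>(p, k). real (Suc k) ^ Suc j * ln (real p) * real p powr (- 3/4 * real (Suc k))) P"
      by (rule abs_summable_on_subset [OF abs_summable_prime_powers]) (auto simp: P_def prime_ge_2_nat)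
    fix z :: "nat \<times> nat" assume "z \<in> P"
    then obtain p k where pk: "z = (p, k)" "prime p" "k \<ge> 1" by (auto simp: P_def)
    have p: "p > 0" using pk prime_gt_0_nat by blast
    have n: "norm (ycoef j (p ^ Suc k)) = real (Suc k ^ Suc j - 1) * ln (real p) / real (p ^ Suc k)"
    proof -
      have "primepow (p ^ Suc k)" "ppexp (p ^ Suc k) = Suc k" "mangoldt (p ^ Suc k) = complex_of_real (ln (real p))"
        using pk primepow_prime_power [of p "Suc k"] ppexp_prime_power [of p "Suc k"] mangoldt_primepow' [of p "Suc k"]
        by (simp_all del: power_Suc primepow_prime_power)
      hence "norm (ycoef j (p ^ Suc k)) = norm (of_nat (Suc k ^ Suc j - 1) * complex_of_real (ln (real p)) / of_nat (p ^ Suc k))"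
        by (simp only: ycoef_def if_True)
      also have "\<dots> = real (Suc k ^ Suc j - 1) * ln (real p) / real (p ^ Suc k)"
        by (simp only: norm_divide norm_mult norm_of_nat norm_of_real) simp
      finally show ?thesis .
    qed
    have "h (p ^ Suc k) = real (Suc k ^ Suc j - 1) * ln (real p) * (real (p ^ Suc k) powr (1/4) / real (p ^ Suc k))"
      unfolding h_def n by simp
    also have "real (p ^ Suc k) powr (1/4) / real (p ^ Suc k) = real p powr (- 3/4 * real (Suc k))"
    proof -
      have "real (p ^ Suc k) = real p powr real (Suc k)" using p by (subst powr_realpow) auto
      hence "real (p ^ Suc k) powr (1/4) / real (p ^ Suc k) = real p powr (real (Suc k) * (1/4) - real (Suc k))"
        by (simp only: powr_powr powr_diff)
      also have "\<dots> = real p powr (- 3/4 * real (Suc k))"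
        by (rule arg_cong [of _ _ "(powr) (real p)"]) (simp add: field_simps)
      finally show ?thesis .
    qed
    finally have "h (p ^ Suc k) = real (Suc k ^ Suc j - 1) * ln (real p) * real p powr (- 3/4 * real (Suc k))" .
    also have "\<dots> \<le> real (Suc k) ^ Suc j * ln (real p) * real p powr (- 3/4 * real (Suc k))"
    proof (intro mult_right_mono)
      show "real (Suc k ^ Suc j - 1) \<le> real (Suc k) ^ Suc j"
        unfolding of_nat_power [symmetric] of_nat_le_iff by (rule diff_le_self)
    qed auto
    finally have "h (p ^ Suc k) \<le> real (Suc k) ^ Suc j * ln (real p) * real p powr (- 3/4 * real (Suc k))" .
    moreover have "h (p ^ Suc k) \<ge> 0" by (simp add: h_def)
    ultimately show "norm (h (case z of (p, k) \<Rightarrow> p ^ Suc k)) \<le>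
        norm (case z of (p, k) \<Rightarrow> real (Suc k) ^ Suc j * ln (real p) * real p powr (- 3/4 * real (Suc k)))"
      unfolding pk by (simp del: power_Suc of_nat_Suc)
  qed
  also have "?this \<longleftrightarrow> Infinite_Set_Sum.abs_summable_on h UNIV"
  proof (rule abs_summable_on_cong_neutral)
    fix n assume "n \<in> UNIV - (\<lambda>(p, k). p ^ Suc k) ` P"
    hence n: "\<And>p k. prime p \<Longrightarrow> k \<ge> 1 \<Longrightarrow> n \<noteq> p ^ Suc k" by (auto simp: P_def image_iff)
    show "h n = 0"
    proof (cases "primepow n")
      case True
      then obtain p l where pl: "prime p" "l > 0" "n = p ^ l" by (auto simp: primepow_def)
      have "l = 1"
      proof (rule ccontr)
        assume "l \<noteq> 1"
        hence "l = Suc (l - 1)" "l - 1 \<ge> 1" using pl by auto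
        thus False using n [of p "l - 1"] pl by metis
      qed
      hence "ppexp n = 1" using ppexp_prime_power [OF pl(1,2)] pl(3) by simp
      thus ?thesis using pl by (simp add: h_def ycoef_def)
    qed (simp add: h_def ycoef_def)
  qed auto
  finally have h: "Infinite_Set_Sum.abs_summable_on h UNIV" .
  show ?thesis
    unfolding lap_ok_def
  proof (intro conjI allI impI)
    fix u :: real assume u: "u > 0"
    have "Infinite_Set_Sum.abs_summable_on (\<lambda>n. norm (ycoef j n * of_real (real n powr (1/4))) * exp (- u * ln (real n))) UNIV"
    proof (rule abs_summable_on_comparison_test [OF h])
      fix n :: nat
      have "exp (- u * ln (real n)) \<le> 1" using u by simp
      thus "norm (norm (ycoef j n * of_real (real n powr (1/4))) * exp (- u * ln (real n))) \<le> norm (h n)"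
        by (simp add: h_def norm_mult mult_left_le)
    qed
    thus "integrable (count_space UNIV) (\<lambda>n. norm (ycoef j n * of_real (real n powr (1/4))) * exp (- u * ln (real n)))"
      by (simp add: Infinite_Set_Sum.abs_summable_on_def)
  qed auto
qed

definition ysum :: "nat \<Rightarrow> complex \<Rightarrow> complex" where
  "ysum j w = dir (\<lambda>n. ycoef j n * of_real (real n powr (1/4))) (w + 1/4)"

lemma ycoef_0 [simp]: "ycoef j 0 = 0"
  by (simp add: ycoef_def)

lemma ysum_eq: "ysum j w = dir (ycoef j) w"
proof -
  have "ycoef j n * of_real (real n powr (1/4)) * exp (- (w + 1/4) * of_real (ln (real n))) =
     ycoef j n * exp (- w * of_real (ln (real n)))" for n
  proof (cases "n = 0")
    case False
    hence "complex_of_real (real n powr (1/4)) = exp (1/4 * of_real (ln (real n)))"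
      by (simp add: powr_def exp_of_real [symmetric])
    thus ?thesis by (simp add: exp_add [symmetric] mult.assoc algebra_simps)
  qed auto
  thus ?thesis by (simp only: ysum_def dir_altdef)
qed

lemma ysum_holomorphic: "ysum j holomorphic_on {w. Re w > - 1/4}"
proof -
  have "dir (\<lambda>n. ycoef j n * of_real (real n powr (1/4))) holomorphic_on rhp"
    unfolding dir_def by (rule lap_holomorphic [OF dir_ok_ycoef_shift])
  hence "(dir (\<lambda>n. ycoef j n * of_real (real n powr (1/4))) \<circ> (\<lambda>w. w + 1/4)) holomorphic_on {w. Re w > - 1/4}"
    by (intro holomorphic_on_compose_gen) (auto intro!: holomorphic_intros simp: rhp_def)
  thus ?thesis by (simp add: ysum_def [abs_def] o_def)
qed

text \<open>Absolute convergence makes \<open>ysum j\<close> bounded on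
  \<open>Re z \<ge> - 1/8\<close>, so Cauchy discs of radius \<open>1/8\<close> around points of the
  strip give all derivatives at once.\<close>

lemma good_ysum: "good (ysum j) (ysum j)"
  unfolding good_def extends0_def
proof (intro conjI)
  have op: "open {w. Re w > - 1/4}" by (rule open_halfspace_Re_gt)
  thus "ysum j analytic_on {0}"
    using ysum_holomorphic [of j] by (auto simp: analytic_at intro!: exI[of _ "{w. Re w > - 1/4}"])
  show "tame strip (ysum j)"
  proof (rule tame_Cauchy [where S = "{w. Re w > - 1/4}"])
    show "ysum j holomorphic_on rhp"
      by (rule holomorphic_on_subset [OF ysum_holomorphic]) (auto simp: rhp_def)
    fix e :: real assume e: "e > 0"
    define c where "c = (\<lambda>n. ycoef j n * of_real (real n powr (1/4)))"
    have ok: "dir_ok c" unfolding c_def by (rule dir_ok_ycoef_shift)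
    define B where "B = (\<integral>n. norm (c n) * exp (- (1/8) * ln (real n)) \<partial>count_space UNIV)"
    have int: "integrable (count_space UNIV) (\<lambda>n. norm (c n) * exp (- u * ln (real n)))" if "u > 0" for u
      using ok that unfolding lap_ok_def by blast
    have B: "norm (ysum j z) \<le> B" if "Re z \<ge> - 1/8" for z
    proof -
      have "norm (ysum j z) \<le> (\<integral>n. norm (c n) * exp (- Re (z + 1/4) * ln (real n)) \<partial>count_space UNIV)"
        unfolding ysum_def dir_def c_def
        by (rule norm_lap_le [OF dir_ok_ycoef_shift]) (use that in \<open>auto simp: rhp_def\<close>)
      also have "\<dots> \<le> B" unfolding B_def
      proof (rule integral_mono [OF int int])
        fix n :: nat
        have "(1/8) * ln (real n) \<le> Re (z + 1/4) * ln (real n)" using that by (intro mult_right_mono) auto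
        hence "- Re (z + 1/4) * ln (real n) \<le> - (1/8) * ln (real n)"
          by (simp only: mult_minus_left neg_le_iff_le)
        thus "norm (c n) * exp (- Re (z + 1/4) * ln (real n)) \<le> norm (c n) * exp (- (1/8) * ln (real n))"
          by (intro mult_left_mono norm_ge_zero) (simp only: exp_le_cancel_iff)
      qed (use that in auto)
      finally show ?thesis .
    qed
    have "B \<ge> 0" unfolding B_def by (rule Bochner_Integration.integral_nonneg) auto
    show "\<exists>r>0. \<exists>C. \<forall>w\<in>strip. cball w r \<subseteq> {w. Re w > - 1/4} \<and>
      (\<forall>z\<in>cball w r. norm (ysum j z) \<le> C * (1 + \<bar>Im w\<bar>) powr e)"
    proof (rule exI [of _ "1/8"], intro conjI, simp, rule exI [of _ B], intro ballI conjI)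
      fix w assume w: "w \<in> strip"
      have re: "Re z \<ge> - 1/8" if "z \<in> cball w (1/8)" for z
        using that w abs_Re_le_cmod [of "w - z"] by (auto simp: strip_def dist_norm)
      thus "cball w (1/8) \<subseteq> {w. Re w > - 1/4}" by fastforce
      fix z assume "z \<in> cball w (1/8)"
      hence "norm (ysum j z) \<le> B * 1" using B re by auto
      also have "\<dots> \<le> B * (1 + \<bar>Im w\<bar>) powr e"
        using e \<open>B \<ge> 0\<close> by (intro mult_left_mono ge_one_powr_ge_zero) auto
      finally show "norm (ysum j z) \<le> B * (1 + \<bar>Im w\<bar>) powr e" .
    qed
  qed (simp, rule ysum_holomorphic)
qed auto

lemma deriv_dir_hcoef:
  assumes w: "w \<in> rhp"
  shows "(dir (hcoef j) has_field_derivative - (mangs w + ysum j w)) (at w)"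
proof -
  have 1: "integrable (count_space UNIV) (\<lambda>n. mangoldt n / of_nat n * exp (- w * of_real (ln (real n))))"
    by (rule lap_integrable [OF dir_ok_mangoldt w])
  have 2: "integrable (count_space UNIV) (\<lambda>n. of_real (ln (real n)) * hcoef j n * exp (- w * of_real (ln (real n))))"
    by (rule lap_integrable [OF lap_ok_times [OF dir_ok_hcoef] w])
  have "lap (count_space UNIV) (\<lambda>n. ln (real n)) (\<lambda>n. of_real (ln (real n)) * hcoef j n) w - mangs w =
    (\<integral>n. of_real (ln (real n)) * hcoef j n * exp (- w * of_real (ln (real n))) -
       mangoldt n / of_nat n * exp (- w * of_real (ln (real n))) \<partial>count_space UNIV)"
    unfolding lap_def mangs_def dir_def by (rule Bochner_Integration.integral_diff [OF 2 1, symmetric])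
  also have "\<dots> = dir (ycoef j) w"
    unfolding dir_def lap_def by (rule Bochner_Integration.integral_cong) (simp_all only: ln_times_hcoef distrib_right add_diff_cancel_left')
  finally have "lap (count_space UNIV) (\<lambda>n. ln (real n)) (\<lambda>n. of_real (ln (real n)) * hcoef j n) w = mangs w + ysum j w"
    by (simp add: ysum_eq algebra_simps)
  thus ?thesis using lap_has_field_derivative [OF dir_ok_hcoef w, of j] unfolding dir_def by simp
qed

text \<open>Logarithmic differentiation of \<open>zeta1 = ztil * (1 + w) / w\<close>. The only part
  that is singular at the origin is \<open>1 / w\<close>, the negative of the derivative of
  \<open>Lg\<close>.\<close>

lemma mangs_eq:
  assumes w: "w \<in> rhp"
  shows "mangs w = 1 / w - 1 / (1 + w) - deriv ztil w * (1 / ztil w)"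
proof -
  have nz: "w \<noteq> 0" "1 + w \<noteq> 0" "zeta1 w \<noteq> 0" using w zeta1_nonzero by (auto simp: rhp_def complex_eq_iff)
  have z: "(zeta1 has_field_derivative - (zeta1 w * mangs w)) (at w)"
    using holomorphic_derivI [OF zeta1_holomorphic open_rhp w] zeta1_times_mangs [OF w] by simp
  have "deriv ztil w = deriv (\<lambda>w. w * zeta1 w / (1 + w)) w"
  proof (rule complex_derivative_transform_within_open [where s = rhp])
    show "(\<lambda>w. w * zeta1 w / (1 + w)) holomorphic_on rhp"
      by (intro holomorphic_intros zeta1_holomorphic) (auto simp: rhp_def complex_eq_iff)
  qed (use w ztil_eq tame_D(2) [OF tame_ztil] in auto)
  also have "\<dots> = ((zeta1 w - w * (zeta1 w * mangs w)) * (1 + w) - w * zeta1 w) / (1 + w) ^ 2"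
    by (rule DERIV_imp_deriv)
       (use nz in \<open>auto intro!: derivative_eq_intros z simp: power2_eq_square algebra_simps\<close>)
  finally have "deriv ztil w * (1 / ztil w) = ((zeta1 w - w * (zeta1 w * mangs w)) * (1 + w) - w * zeta1 w) / (1 + w) ^ 2 * ((1 + w) / (w * zeta1 w))"
    using ztil_eq [OF w] nz by simp
  also have "\<dots> = 1 / w - 1 / (1 + w) - mangs w"
    using nz by (simp add: divide_simps power2_eq_square) (simp add: algebra_simps)?
  finally show ?thesis by simp
qed

lemma good_inverse_1_plus: "good (\<lambda>w. 1 / (1 + w)) (\<lambda>w. 1 / (1 + w))"
  unfolding good_def extends0_def
proof (intro conjI)
  show "(\<lambda>w. 1 / (1 + w)) analytic_on {0}" by (intro analytic_intros) auto
  show "tame strip (\<lambda>w. 1 / (1 + w))"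
  proof (rule tame_Cauchy [where S = "{w. Re w > -1}"])
    show "(\<lambda>w. 1 / (1 + w)) holomorphic_on rhp" "(\<lambda>w. 1 / (1 + w)) holomorphic_on {w. Re w > -1}"
      by (intro holomorphic_intros; auto simp: rhp_def complex_eq_iff)+
    fix e :: real assume e: "e > 0"
    show "\<exists>r>0. \<exists>C. \<forall>w\<in>strip. cball w r \<subseteq> {w. Re w > -1} \<and>
      (\<forall>z\<in>cball w r. norm (1 / (1 + z)) \<le> C * (1 + \<bar>Im w\<bar>) powr e)"
    proof (rule exI [of _ "1/2"], intro conjI, simp, rule exI [of _ 2], intro ballI conjI)
      fix w assume w: "w \<in> strip"
      have re: "Re z \<ge> - 1/2" if "z \<in> cball w (1/2)" for z
        using that w abs_Re_le_cmod [of "w - z"] by (auto simp: strip_def dist_norm)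
      thus "cball w (1/2) \<subseteq> {w. Re w > - 1}" by fastforce
      fix z assume "z \<in> cball w (1/2)"
      hence "norm (1 + z) \<ge> 1 / 2" using re [of z] abs_Re_le_cmod [of "1 + z"] by auto
      hence "norm (1 / (1 + z)) \<le> 1 / (1 / 2)"
        unfolding norm_divide norm_one by (intro divide_left_mono mult_pos_pos) linarith+
      also have "\<dots> = 2 * 1" by simp
      also have "\<dots> \<le> 2 * (1 + \<bar>Im w\<bar>) powr e"
        using e by (intro mult_left_mono ge_one_powr_ge_zero) auto
      finally show "norm (1 / (1 + z)) \<le> 2 * (1 + \<bar>Im w\<bar>) powr e" .
    qed
  qed auto
qed auto

lemma norm_Ln_le:
  assumes "z \<noteq> 0"
  shows "norm (Ln z) \<le> \<bar>ln (norm z)\<bar> + pi"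
  using cmod_le [of "Ln z"] mpi_less_Im_Ln [OF assms] Im_Ln_le_pi [OF assms] assms by auto

lemma slow_Ln:
  assumes \<rho>: "\<rho> > 0" and e: "e > 0"
  obtains C where "C \<ge> 0" "\<And>z. norm z \<ge> \<rho> \<Longrightarrow> \<bar>Re z\<bar> \<le> 2 \<Longrightarrow> norm (Ln z) \<le> C * (1 + \<bar>Im z\<bar>) powr e"
proof -
  define C where "C = \<bar>ln \<rho>\<bar> + 3 powr e / e + pi"
  have C: "C \<ge> 0" using e by (simp add: C_def)
  have "norm (Ln z) \<le> C * (1 + \<bar>Im z\<bar>) powr e" if z: "norm z \<ge> \<rho>" "\<bar>Re z\<bar> \<le> 2" for z
  proof -
    have z0: "norm z > 0" "z \<noteq> 0" using z \<rho> by auto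
    have one: "1 \<le> (1 + \<bar>Im z\<bar>) powr e" using e by (intro ge_one_powr_ge_zero) auto
    have nz: "norm z \<le> 3 * (1 + \<bar>Im z\<bar>)" using cmod_le [of z] z abs_ge_zero [of "Im z"] unfolding distrib_left by linarith
    have "ln (norm z) \<le> 3 powr e / e * (1 + \<bar>Im z\<bar>) powr e"
    proof -
      have "ln (norm z) \<le> ln (3 * (1 + \<bar>Im z\<bar>))" using nz z0 by (subst ln_le_cancel_iff) auto
      also have "\<dots> \<le> (3 * (1 + \<bar>Im z\<bar>)) powr e / e" using e by (intro ln_powr_bound) auto
      also have "\<dots> = 3 powr e / e * (1 + \<bar>Im z\<bar>) powr e" by (simp only: powr_mult) simp
      finally show ?thesis .
    qed
    moreover have "- ln (norm z) \<le> \<bar>ln \<rho>\<bar>"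
    proof -
      have "ln \<rho> \<le> ln (norm z)" using z \<rho> by (subst ln_le_cancel_iff) auto
      thus ?thesis by linarith
    qed
    moreover have "\<bar>ln \<rho>\<bar> \<le> \<bar>ln \<rho>\<bar> * (1 + \<bar>Im z\<bar>) powr e"
      using mult_left_mono [OF one, of "\<bar>ln \<rho>\<bar>"] by simp
    moreover have "pi \<le> pi * (1 + \<bar>Im z\<bar>) powr e"
      using mult_left_mono [OF one, of pi] by simp
    moreover have "0 \<le> 3 powr e / e * (1 + \<bar>Im z\<bar>) powr e" using e by auto
    ultimately have "\<bar>ln (norm z)\<bar> + pi \<le> C * (1 + \<bar>Im z\<bar>) powr e"
      unfolding C_def distrib_right by linarith
    thus ?thesis using norm_Ln_le [OF z0(2)] by linarith
  qed
  thus ?thesis using that C by blast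
qed

text \<open>A primitive of \<open>g\<close> on a small disc differs from \<open>f\<close> by a
  constant on the convex intersection of the disc with the half plane; adding this constant yields
  the continuation of \<open>f\<close>.\<close>

lemma good_primitive:
  assumes f: "f holomorphic_on rhp" "slow strip f" and g: "good (deriv f) g"
  shows "\<exists>h. good f h"
proof -
  obtain S where S: "open S" "0 \<in> S" "\<And>w. w \<in> S \<Longrightarrow> w \<in> rhp \<Longrightarrow> deriv f w = g w" "g holomorphic_on S"
  proof -
    obtain S1 where "open S1" "0 \<in> S1" "g holomorphic_on S1"
      using good_D(3) [OF g] by (auto simp: analytic_at)
    moreover obtain S2 where "open S2" "0 \<in> S2" "\<And>w. w \<in> S2 \<Longrightarrow> w \<in> rhp \<Longrightarrow> deriv f w = g w"
      using good_D(2) [OF g] unfolding extends0_def eventually_nhds by blast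
    ultimately show ?thesis using that [of "S1 \<inter> S2"] by (auto intro: holomorphic_on_subset)
  qed
  obtain r where r: "r > 0" "ball 0 r \<subseteq> S" using openE [OF S(1,2)] by blast
  obtain p where p: "\<And>w. w \<in> ball 0 r \<Longrightarrow> (p has_field_derivative g w) (at w within ball 0 r)"
  proof -
    have "g holomorphic_on ball 0 r" using S(4) r(2) by (rule holomorphic_on_subset)
    thus ?thesis using that holomorphic_convex_primitive' [OF convex_ball open_ball] by blast
  qed
  have p': "(p has_field_derivative g w) (at w)" if "w \<in> ball 0 r" for w
    using p [OF that] at_within_open [OF that open_ball] by simp
  have "\<exists>c. \<forall>w\<in>rhp \<inter> ball 0 r. f w - p w = c"
  proof (rule has_field_derivative_zero_constant)
    show "convex (rhp \<inter> ball 0 r)" by (intro convex_Int convex_rhp convex_ball)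
    fix w assume w: "w \<in> rhp \<inter> ball 0 r"
    have "(f has_field_derivative g w) (at w)"
      using holomorphic_derivI [OF f(1) open_rhp, of w] S(3) [of w] w r by auto
    hence "((\<lambda>w. f w - p w) has_field_derivative g w - g w) (at w)"
      using p' [of w] w by (intro DERIV_diff) auto
    thus "((\<lambda>w. f w - p w) has_field_derivative 0) (at w within rhp \<inter> ball 0 r)"
      by (simp add: has_field_derivative_at_within)
  qed
  then obtain c where c: "\<And>w. w \<in> rhp \<inter> ball 0 r \<Longrightarrow> f w - p w = c" by blast
  have "good f (\<lambda>w. p w + c)"
    unfolding good_def extends0_def
  proof (intro conjI)
    show "tame strip f" by (rule tame_primitive [OF f good_D(1) [OF g]])
    have "p holomorphic_on ball 0 r" unfolding holomorphic_on_open [OF open_ball] using p' by blast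
    hence "p analytic_on {0}" using r by (auto simp: analytic_at intro!: exI[of _ "ball 0 r"])
    thus "(\<lambda>w. p w + c) analytic_on {0}" by (intro analytic_intros) auto
    show "\<forall>\<^sub>F w in nhds 0. w \<in> rhp \<longrightarrow> f w = p w + c"
      unfolding eventually_nhds
      by (intro exI[of _ "ball 0 r"]) (use c r in \<open>auto simp: algebra_simps\<close>)
  qed
  thus ?thesis by blast
qed

section \<open>Polynomials in log (1/w) with good coefficients\<close>

definition Lg :: "complex \<Rightarrow> complex" where
  "Lg w = - Ln w"

lemma Lg_has_field_derivative:
  "w \<in> rhp \<Longrightarrow> (Lg has_field_derivative - (1 / w)) (at w)"
  unfolding Lg_def
  by (auto intro!: derivative_eq_intros simp: rhp_def complex_nonpos_Reals_iff field_simps)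

text \<open>The derivative is good because \<open>1 / w\<close> cancels. Slow growth of the function
  itself follows by integrating the derivative along a horizontal segment from the line
  \<open>Re w = 1\<close>, where the Dirichlet series is bounded.\<close>

lemma good_hcoef_part: "\<exists>h. good (\<lambda>w. dir (hcoef j) w - Lg w) h"
proof (rule good_primitive)
  define G where "G = (\<lambda>w. dir (hcoef j) w - Lg w)"
  define D where "D = (\<lambda>w. deriv ztil w * (1 / ztil w) + 1 / (1 + w) - ysum j w)"
  have d: "(G has_field_derivative D w) (at w)" if w: "w \<in> rhp" for w
  proof -
    have "(G has_field_derivative - (mangs w + ysum j w) - (- (1 / w))) (at w)"
      unfolding G_def by (intro DERIV_diff deriv_dir_hcoef Lg_has_field_derivative w)
    also have "- (mangs w + ysum j w) - (- (1 / w)) = D w" unfolding D_def mangs_eq [OF w] by simp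
    finally show ?thesis .
  qed
  have gD: "good D D"
    unfolding D_def
    by (intro good_diff good_add good_mult good_deriv good_ztil good_inverse_ztil good_inverse_1_plus good_ysum)
  show hol: "(\<lambda>w. dir (hcoef j) w - Lg w) holomorphic_on rhp"
    using d unfolding G_def by (auto simp: holomorphic_on_open field_differentiable_def)
  show "good (deriv (\<lambda>w. dir (hcoef j) w - Lg w)) D"
    by (rule good_cong [OF gD]) (use DERIV_imp_deriv [OF d] in \<open>simp add: G_def\<close>)
  have "slow strip G"
    unfolding slow_def
  proof (intro allI impI)
    fix e :: real assume e: "e > 0"
    obtain C where C: "C \<ge> 0" "\<And>w. w \<in> strip \<Longrightarrow> norm (D w) \<le> C * (1 + \<bar>Im w\<bar>) powr e"
      using slow_nonneg_constE [OF tame_D(5) [OF good_D(1) [OF gD]] e] by blast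
    obtain C' where C': "C' \<ge> 0" "\<And>z. norm z \<ge> 1 \<Longrightarrow> \<bar>Re z\<bar> \<le> 2 \<Longrightarrow> norm (Ln z) \<le> C' * (1 + \<bar>Im z\<bar>) powr e"
      using slow_Ln [OF zero_less_one e] by blast
    define B where "B = (\<integral>n. norm (hcoef j n) * exp (- 1 * ln (real n)) \<partial>count_space UNIV)"
    have "norm (G w) \<le> (\<bar>B\<bar> + C' + C) * (1 + \<bar>Im w\<bar>) powr e" if w: "w \<in> strip" for w
    proof -
      define w1 where "w1 = Complex 1 (Im w)"
      define S where "S = {z \<in> strip. Im z = Im w}"
      have cv: "convex S"
      proof -
        have "S = {z. Re z > 0} \<inter> {z. Re z \<le> 1} \<inter> {z. Im z = Im w}" by (auto simp: S_def strip_def)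
        thus ?thesis using convex_halfspace_Re_gt convex_halfspace_Re_le convex_hyperplane [of \<i> "Im w"]
          by (simp add: inner_complex_def convex_Int)
      qed
      have "norm (G w - G w1) \<le> (C * (1 + \<bar>Im w\<bar>) powr e) * norm (w - w1)"
      proof (rule field_differentiable_bound [OF cv])
        fix z assume z: "z \<in> S"
        have "z \<in> rhp" using z by (auto simp: S_def strip_def rhp_def)
        thus "(G has_field_derivative D z) (at z within S)" using d has_field_derivative_at_within by blast
        show "norm (D z) \<le> C * (1 + \<bar>Im w\<bar>) powr e" using C(2) [of z] z by (auto simp: S_def)
      qed (use w in \<open>auto simp: S_def w1_def strip_def\<close>)
      also have "norm (w - w1) \<le> 1"
        using cmod_le [of "w - w1"] w by (auto simp: w1_def strip_def)
      finally have 1: "norm (G w - G w1) \<le> C * (1 + \<bar>Im w\<bar>) powr e"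
        using C by (simp add: mult_left_mono)
      have 2: "norm (dir (hcoef j) w1) \<le> \<bar>B\<bar>"
        using norm_lap_le [OF dir_ok_hcoef, of w1 j] unfolding dir_def B_def by (simp add: w1_def rhp_def)
      have "norm w1 \<ge> 1" using abs_Re_le_cmod [of w1] by (simp add: w1_def)
      hence 3: "norm (Lg w1) \<le> C' * (1 + \<bar>Im w\<bar>) powr e"
        using C'(2) [of w1] by (simp add: w1_def Lg_def)
      have 4: "\<bar>B\<bar> \<le> \<bar>B\<bar> * (1 + \<bar>Im w\<bar>) powr e"
        using mult_left_mono [OF ge_one_powr_ge_zero, of "1 + \<bar>Im w\<bar>" e "\<bar>B\<bar>"] e by simp
      have "norm (G w) \<le> norm (G w - G w1) + norm (G w1)" using norm_triangle_ineq [of "G w - G w1" "G w1"] by simp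
      also have "norm (G w1) \<le> norm (dir (hcoef j) w1) + norm (Lg w1)" unfolding G_def by (rule norm_triangle_ineq4)
      finally have "norm (G w) \<le> norm (G w - G w1) + norm (dir (hcoef j) w1) + norm (Lg w1)" by simp
      thus ?thesis using 1 2 3 4 by (simp add: distrib_right)
    qed
    thus "\<exists>C. \<forall>w\<in>strip. norm (G w) \<le> C * (1 + \<bar>Im w\<bar>) powr e" by blast
  qed
  thus "slow strip (\<lambda>w. dir (hcoef j) w - Lg w)" by (simp add: G_def)
qed

text \<open>The number \<open>k\<close> only bounds the degree in \<open>Lg\<close>. Of the
  coefficients just one value is recorded, that of the top one at the origin: it alone decides the
  leading coefficient of the first polynomial of the expansion. It becomes 0 when \<open>k\<close>
  is raised.\<close>

definition lgpoly :: "nat \<Rightarrow> (complex \<Rightarrow> complex) \<Rightarrow> complex \<Rightarrow> bool" where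
  "lgpoly k f c \<longleftrightarrow> (\<exists>V V'. (\<forall>l\<le>k. good (V l) (V' l)) \<and> V' k 0 = c \<and>
     (\<forall>w\<in>rhp. f w = (\<Sum>l\<le>k. Lg w ^ l * V l w)))"

lemma lgpoly_good: "good g g' \<Longrightarrow> lgpoly 0 g (g' 0)"
  unfolding lgpoly_def by (intro exI[of _ "\<lambda>_. g"] exI[of _ "\<lambda>_. g'"]) auto

lemma lgpoly_cong: "(\<And>w. w \<in> rhp \<Longrightarrow> f w = g w) \<Longrightarrow> lgpoly k f c = lgpoly k g c"
  unfolding lgpoly_def by auto

lemma lgpoly_add:
  assumes "lgpoly k f c" "lgpoly k g d"
  shows "lgpoly k (\<lambda>w. f w + g w) (c + d)"
proof -
  obtain V V' where V: "\<And>l. l \<le> k \<Longrightarrow> good (V l) (V' l)" "V' k 0 = c" "\<And>w. w \<in> rhp \<Longrightarrow> f w = (\<Sum>l\<le>k. Lg w ^ l * V l w)"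
    using assms(1) unfolding lgpoly_def by blast
  obtain U U' where U: "\<And>l. l \<le> k \<Longrightarrow> good (U l) (U' l)" "U' k 0 = d" "\<And>w. w \<in> rhp \<Longrightarrow> g w = (\<Sum>l\<le>k. Lg w ^ l * U l w)"
    using assms(2) unfolding lgpoly_def by blast
  show ?thesis unfolding lgpoly_def
    by (intro exI[of _ "\<lambda>l w. V l w + U l w"] exI[of _ "\<lambda>l w. V' l w + U' l w"])
       (use V U in \<open>auto intro: good_add simp: sum.distrib algebra_simps\<close>)
qed

lemma lgpoly_mult_good:
  assumes "lgpoly k f c" "good g g'"
  shows "lgpoly k (\<lambda>w. f w * g w) (c * g' 0)"
proof -
  obtain V V' where V: "\<And>l. l \<le> k \<Longrightarrow> good (V l) (V' l)" "V' k 0 = c" "\<And>w. w \<in> rhp \<Longrightarrow> f w = (\<Sum>l\<le>k. Lg w ^ l * V l w)"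
    using assms(1) unfolding lgpoly_def by blast
  show ?thesis unfolding lgpoly_def
    by (intro exI[of _ "\<lambda>l w. V l w * g w"] exI[of _ "\<lambda>l w. V' l w * g' w"])
       (use V assms(2) in \<open>auto intro: good_mult simp: sum_distrib_right mult.assoc\<close>)
qed

lemma lgpoly_mult_Lg:
  assumes "lgpoly k f c"
  shows "lgpoly (Suc k) (\<lambda>w. f w * Lg w) c"
proof -
  obtain V V' where V: "\<And>l. l \<le> k \<Longrightarrow> good (V l) (V' l)" "V' k 0 = c" "\<And>w. w \<in> rhp \<Longrightarrow> f w = (\<Sum>l\<le>k. Lg w ^ l * V l w)"
    using assms(1) unfolding lgpoly_def by blast
  define U where "U = (\<lambda>l. if l = 0 then (\<lambda>w. 0) else V (l - 1))"
  define U' where "U' = (\<lambda>l. if l = 0 then (\<lambda>w. 0) else V' (l - 1))"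
  have "(\<Sum>l\<le>Suc k. Lg w ^ l * U l w) = f w * Lg w" if "w \<in> rhp" for w
    using V(3) [OF that] by (simp add: sum.atMost_Suc_shift U_def sum_distrib_left sum_distrib_right mult_ac del: sum.atMost_Suc)
  moreover have "good (U l) (U' l)" if "l \<le> Suc k" for l
    using V(1) [of "l - 1"] that by (auto simp: U_def U'_def good_const)
  ultimately show ?thesis unfolding lgpoly_def
    by (intro exI[of _ U] exI[of _ U']) (use V(2) in \<open>auto simp: U'_def\<close>)
qed

lemma lgpoly_Suc:
  assumes "lgpoly k f c"
  shows "lgpoly (Suc k) f 0"
proof -
  obtain V V' where V: "\<And>l. l \<le> k \<Longrightarrow> good (V l) (V' l)" "V' k 0 = c" "\<And>w. w \<in> rhp \<Longrightarrow> f w = (\<Sum>l\<le>k. Lg w ^ l * V l w)"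
    using assms(1) unfolding lgpoly_def by blast
  show ?thesis unfolding lgpoly_def
    by (intro exI[of _ "V(Suc k := (\<lambda>_. 0))"] exI[of _ "V'(Suc k := (\<lambda>_. 0))"])
       (use V in \<open>auto simp: good_const\<close>)
qed

lemma lgpoly_mono:
  assumes "lgpoly k f c" "k < m"
  shows "lgpoly m f 0"
  using assms(2)
proof (induction m)
  case (Suc m)
  show ?case
  proof (cases "k = m")
    case True
    thus ?thesis using lgpoly_Suc [OF assms(1)] by simp
  next
    case False
    thus ?thesis using Suc lgpoly_Suc by auto
  qed
qed auto

lemma lgpoly_sum:
  assumes "finite I" "\<And>i. i \<in> I \<Longrightarrow> lgpoly k (f i) (c i)"
  shows "lgpoly k (\<lambda>w. \<Sum>i\<in>I. f i w) (\<Sum>i\<in>I. c i)"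
  using assms
proof (induction I rule: finite_induct)
  case empty
  have "lgpoly 0 (\<lambda>w. 0) 0" using lgpoly_good [OF good_const [of 0]] .
  thus ?case by (cases "k = 0") (auto intro: lgpoly_mono)
next
  case (insert i I)
  thus ?case using lgpoly_add [of k "f i" "c i" "\<lambda>w. \<Sum>i\<in>I. f i w" "\<Sum>i\<in>I. c i"] by auto
qed

text \<open>For \<open>k = 0\<close> the factor \<open>1 / w\<close> cancels against the zero of
  \<open>1 / zeta\<close>, leaving \<open>1 / ((1 + w) * ztil w)\<close> with value 1 at the origin.
  In the recurrence every series over prime powers is \<open>Lg\<close> plus a good function; only
  the summand \<open>i = m\<close> reaches the degree \<open>Suc m\<close>, and the minus sign of
  the recurrence gives \<open>(-1) ^ k\<close>.\<close>

theorem lgpoly_muom: "lgpoly k (\<lambda>w. muom k w / w) ((-1) ^ k)"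
proof (induction k rule: less_induct)
  case (less k)
  show ?case
  proof (cases k)
    case 0
    have "good (\<lambda>w. (1 / (1 + w)) * (1 / ztil w)) (\<lambda>w. (1 / (1 + w)) * (1 / ztil w))"
      by (intro good_mult good_inverse_1_plus good_inverse_ztil)
    from lgpoly_good [OF this] have "lgpoly 0 (\<lambda>w. (1 / (1 + w)) * (1 / ztil w)) 1" by simp
    also have "?this \<longleftrightarrow> lgpoly 0 (\<lambda>w. muom 0 w / w) 1"
    proof (rule lgpoly_cong)
      fix w assume w: "w \<in> rhp"
      have nz: "w \<noteq> 0" "1 + w \<noteq> 0" "zeta1 w \<noteq> 0" using w zeta1_nonzero by (auto simp: rhp_def complex_eq_iff)
      have "muom 0 w = 1 / zeta1 w" using zeta1_times_muom_0 [OF w] nz by (simp add: field_simps)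
      thus "(1 / (1 + w)) * (1 / ztil w) = muom 0 w / w"
        unfolding ztil_eq [OF w] using nz by (simp add: field_simps)
    qed
    finally show ?thesis using 0 by simp
  next
    case (Suc m)
    obtain G G' where G: "\<And>j. good (\<lambda>w. dir (hcoef j) w - Lg w) (G' j)" and G_def: "G = (\<lambda>j w. dir (hcoef j) w - Lg w)"
      using good_hcoef_part by metis
    define c where "c = (\<lambda>i. if i = m then (-1) ^ m else (0::complex))"
    have part: "lgpoly (Suc m) (\<lambda>w. muom i w / w * (G (m - i) w + Lg w)) (c i)" if i: "i \<le> m" for i
    proof -
      have IH: "lgpoly i (\<lambda>w. muom i w / w) ((-1) ^ i)" using less i Suc by simp
      have 1: "lgpoly (Suc m) (\<lambda>w. muom i w / w * G (m - i) w) 0"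
        using lgpoly_mono [OF lgpoly_mult_good [OF IH G [of "m - i"]], of "Suc m"] i by (simp add: G_def)
      have 2: "lgpoly (Suc m) (\<lambda>w. muom i w / w * Lg w) (c i)"
        using lgpoly_mult_Lg [OF IH] lgpoly_mono [OF lgpoly_mult_Lg [OF IH], of "Suc m"] i
        by (cases "i = m") (auto simp: c_def)
      show ?thesis using lgpoly_add [OF 1 2] by (simp add: distrib_left)
    qed
    have "lgpoly (Suc m) (\<lambda>w. \<Sum>i\<le>m. muom i w / w * (G (m - i) w + Lg w) * (- of_nat (m choose i))) (\<Sum>i\<le>m. c i * (- of_nat (m choose i)))"
      by (intro lgpoly_sum lgpoly_mult_good [OF part good_const, of _ "- of_nat (m choose _)"]) auto
    also have "(\<Sum>i\<le>m. c i * (- of_nat (m choose i))) = (-1) ^ Suc m"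
    proof -
      have "(\<Sum>i\<le>m. c i * (- of_nat (m choose i))) = (\<Sum>i\<le>m. (if i = m then - ((-1) ^ m) else 0))"
        by (rule sum.cong) (auto simp: c_def)
      thus ?thesis by simp
    qed
    also have "lgpoly (Suc m) (\<lambda>w. \<Sum>i\<le>m. muom i w / w * (G (m - i) w + Lg w) * (- of_nat (m choose i))) ((-1) ^ Suc m)
       \<longleftrightarrow> lgpoly (Suc m) (\<lambda>w. muom (Suc m) w / w) ((-1) ^ Suc m)"
    proof (rule lgpoly_cong)
      fix w assume w: "w \<in> rhp"
      show "(\<Sum>i\<le>m. muom i w / w * (G (m - i) w + Lg w) * (- of_nat (m choose i))) = muom (Suc m) w / w"
        unfolding muom_Suc [OF w] by (simp add: G_def sum_negf sum_divide_distrib mult_ac)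
    qed
    finally show ?thesis using Suc by simp
  qed
qed

subsection \<open>A Tauberian theorem with power saving\<close>

lemma fubini_dominated:
  fixes f :: "'a \<Rightarrow> 'b \<Rightarrow> complex"
  assumes "sigma_finite_measure M1" "sigma_finite_measure M2"
    and meas: "case_prod f \<in> borel_measurable (M1 \<Otimes>\<^sub>M M2)"
    and g: "integrable M1 g" and h: "integrable M2 h"
    and le: "\<And>x y. x \<in> space M1 \<Longrightarrow> y \<in> space M2 \<Longrightarrow> norm (f x y) \<le> g x * h y"
  shows "(\<integral>x. (\<integral>y. f x y \<partial>M2) \<partial>M1) = (\<integral>y. (\<integral>x. f x y \<partial>M1) \<partial>M2)"
proof -
  interpret M1: sigma_finite_measure M1 by fact
  interpret M2: sigma_finite_measure M2 by fact
  interpret pair_sigma_finite M1 M2 ..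
  have my: "(\<lambda>y. f x y) \<in> borel_measurable M2" if "x \<in> space M1" for x
    using measurable_compose [OF measurable_Pair1' [OF that] meas] by simp
  have i2: "integrable M2 (\<lambda>y. f x y)" if x: "x \<in> space M1" for x
  proof (rule Bochner_Integration.integrable_bound)
    show "integrable M2 (\<lambda>y. g x * h y)" using h by simp
    show "AE y in M2. norm (f x y) \<le> norm (g x * h y)"
      using order_trans [OF le [OF x] abs_ge_self] by (intro AE_I2) simp
  qed (rule my [OF x])
  have "integrable (M1 \<Otimes>\<^sub>M M2) (case_prod f)"
  proof (rule Fubini_integrable [OF meas])
    show "AE x in M1. integrable M2 (\<lambda>y. case (x, y) of (x, y) \<Rightarrow> f x y)"
      using i2 by (intro AE_I2) simp
    show "integrable M1 (\<lambda>x. \<integral>y. norm (case (x, y) of (x, y) \<Rightarrow> f x y) \<partial>M2)"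
    proof (rule Bochner_Integration.integrable_bound)
      show "integrable M1 (\<lambda>x. g x * (\<integral>y. h y \<partial>M2))" using g by simp
      have "(\<lambda>z. norm (case_prod f z)) \<in> borel_measurable (M1 \<Otimes>\<^sub>M M2)" using meas by measurable
      thus "(\<lambda>x. \<integral>y. norm (case (x, y) of (x, y) \<Rightarrow> f x y) \<partial>M2) \<in> borel_measurable M1"
        using M2.borel_measurable_lebesgue_integral [of "\<lambda>x y. norm (f x y)" M1]
        by (simp add: case_prod_unfold)
      show "AE x in M1. norm (\<integral>y. norm (case (x, y) of (x, y) \<Rightarrow> f x y) \<partial>M2) \<le> norm (g x * (\<integral>y. h y \<partial>M2))"
      proof (rule AE_I2)
        fix x assume x: "x \<in> space M1"
        have "(\<integral>y. norm (f x y) \<partial>M2) \<le> (\<integral>y. g x * h y \<partial>M2)"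
          by (rule integral_mono) (use i2 [OF x] h le [OF x] in auto)
        moreover have "0 \<le> (\<integral>y. norm (f x y) \<partial>M2)" by (rule Bochner_Integration.integral_nonneg) auto
        ultimately show "norm (\<integral>y. norm (case (x, y) of (x, y) \<Rightarrow> f x y) \<partial>M2) \<le> norm (g x * (\<integral>y. h y \<partial>M2))"
          by simp
      qed
    qed
  qed
  from Fubini_integral [OF this] show ?thesis by simp
qed

lemma exp_integrable_lborel:
  assumes "u > 0"
  shows "integrable lborel (\<lambda>v. indicator {0..} v * exp (- u * v) :: real)"
    and "(\<integral>v. indicator {0..} v * exp (- u * v) \<partial>lborel) = (1 / u :: real)"
proof -
  have "has_bochner_integral lborel (\<lambda>v. indicator {0..} v * exp (- u * v) :: real) (1 / u)"
  proof (rule has_bochner_integral_nn_integral)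
    have "(\<integral>\<^sup>+v. ennreal (exp (- u * v)) * indicator {0..} v \<partial>lborel) = ennreal (0 - (- (1 / u) * exp (- u * 0)))"
    proof (rule nn_integral_FTC_atLeast)
      show "((\<lambda>v. - (1 / u) * exp (- u * v)) \<longlongrightarrow> 0) at_top"
        using assms by real_asymp
      show "((\<lambda>v. - (1 / u) * exp (- u * v)) has_real_derivative exp (- u * x)) (at x)" for x
        using assms by (auto intro!: derivative_eq_intros)
    qed auto
    thus "(\<integral>\<^sup>+v. ennreal (indicator {0..} v * exp (- u * v)) \<partial>lborel) = ennreal (1 / u)"
      by (simp add: indicator_mult_ennreal mult.commute)
  qed (use assms in auto)
  thus "integrable lborel (\<lambda>v. indicator {0..} v * exp (- u * v) :: real)"
    and "(\<integral>v. indicator {0..} v * exp (- u * v) \<partial>lborel) = (1 / u :: real)"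
    by (auto simp: has_bochner_integral_iff)
qed

text \<open>The exponent function is \<open>max 0\<close> rather than the identity, because
  \<open>lap_ok\<close> requires it to be nonnegative on the whole line; \<open>R\<close> vanishes
  where the two differ.\<close>

lemma lap_ok_halfline:
  fixes R :: "real \<Rightarrow> complex"
  assumes meas: "R \<in> borel_measurable lborel" and supp: "\<And>v. v < 0 \<Longrightarrow> R v = 0"
    and bd: "\<And>v. v \<ge> 0 \<Longrightarrow> norm (R v) \<le> K * (1 + v) ^ m"
  shows "lap_ok lborel (max 0) R"
  unfolding lap_ok_def
proof (intro conjI allI impI)
  show "max 0 \<in> borel_measurable (lborel :: real measure)" by simp
  fix u :: real assume u: "u > 0"
  define C where "C = \<bar>K\<bar> * (fact m / (u/2) ^ m * exp (u/2))"
  show "integrable lborel (\<lambda>x. norm (R x) * exp (- u * max 0 x))"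
  proof (rule Bochner_Integration.integrable_bound)
    show "integrable lborel (\<lambda>v. C * (indicator {0..} v * exp (- (u/2) * v)))"
      using exp_integrable_lborel [of "u/2"] u by (intro integrable_mult_right) auto
    show "(\<lambda>x. norm (R x) * exp (- u * max 0 x)) \<in> borel_measurable lborel"
      using meas by measurable
    show "AE x in lborel. norm (norm (R x) * exp (- u * max 0 x)) \<le> norm (C * (indicator {0..} x * exp (- (u/2) * x)))"
    proof (rule AE_I2)
      fix x :: real
      show "norm (norm (R x) * exp (- u * max 0 x)) \<le> norm (C * (indicator {0..} x * exp (- (u/2) * x)))"
      proof (cases "x < 0")
        case False
        hence x: "x \<ge> 0" by simp
        have "(1 + x) ^ m \<le> fact m / (u/2) ^ m * exp ((u/2) * (1 + x))"
          using x u by (intro power_le_exp) auto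
        hence "\<bar>K\<bar> * (1 + x) ^ m \<le> \<bar>K\<bar> * (fact m / (u/2) ^ m * exp ((u/2) * (1 + x)))"
          by (rule mult_left_mono) auto
        also have "\<dots> = C * exp ((u/2) * x)"
          by (simp add: C_def exp_add [symmetric] field_simps)
        finally have KC: "\<bar>K\<bar> * (1 + x) ^ m \<le> C * exp ((u/2) * x)" .
        have "norm (R x) \<le> C * exp ((u/2) * x)"
        proof -
          have "K * (1 + x) ^ m \<le> \<bar>K\<bar> * (1 + x) ^ m" using x by (intro mult_right_mono) auto
          thus ?thesis using bd [OF x] KC by linarith
        qed
        hence "norm (R x) * exp (- u * x) \<le> C * exp ((u/2) * x) * exp (- u * x)"
          by (rule mult_right_mono) auto
        also have "\<dots> = C * exp (- (u/2) * x)"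
        proof -
          have "exp ((u/2) * x) * exp (- u * x) = exp (- (u/2) * x)"
            unfolding exp_add [symmetric] by (simp add: field_simps)
          thus ?thesis by simp
        qed
        finally have "norm (R x) * exp (- u * x) \<le> C * exp (- (u/2) * x)" .
        moreover have "C \<ge> 0" using u by (simp add: C_def)
        ultimately show ?thesis using x by (simp add: abs_mult)
      qed (auto simp: supp)
    qed
  qed
qed (use meas in auto)

lemma gaussian_fourier:
  "complex_of_real (exp (- (y\<^sup>2) / 2)) = (\<integral>s. std_normal_density s * iexp (y * s) \<partial>lborel)"
proof -
  have "complex_of_real (exp (- (y\<^sup>2) / 2)) = (\<integral>s. iexp (y * s) \<partial>std_normal_distribution)"
    using char_std_normal_distribution unfolding char_def by metis
  also have "\<dots> = (\<integral>s. std_normal_density s *\<^sub>R iexp (y * s) \<partial>lborel)"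
    by (rule integral_density) (auto intro!: borel_measurable_continuous_onI continuous_intros)
  finally show ?thesis by (simp add: scaleR_conv_of_real)
qed

lemma integrable_gaussian_poly: "integrable lborel (\<lambda>s. std_normal_density s * (1 + \<bar>s\<bar>) ^ q)"
proof -
  have "std_normal_density s * (1 + \<bar>s\<bar>) ^ q = (\<Sum>i\<le>q. of_nat (q choose i) * (std_normal_density s * \<bar>s\<bar> ^ (q - i)))" for s
    unfolding binomial_ring sum_distrib_left by (rule sum.cong) auto
  moreover have "integrable lborel (\<lambda>s. (\<Sum>i\<le>q. of_nat (q choose i) * (std_normal_density s * \<bar>s\<bar> ^ (q - i))))"
    by (intro Bochner_Integration.integrable_sum integrable_mult_right integrable_std_normal_moment_abs)
  ultimately show ?thesis by simp
qed

text \<open>The Gaussian is the Fourier transform of the normal density. After exchanging the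
  integrals, the weighted mean becomes an average of the transform at the points
  \<open>Complex \<epsilon> (s / \<delta>)\<close>, and linear growth in \<open>s / \<delta>\<close>
  costs one factor \<open>1 / \<delta>\<close>.\<close>

lemma lap_gaussian_bound:
  fixes S :: "real \<Rightarrow> complex"
  assumes ok: "lap_ok lborel (max 0) S" and supp: "\<And>v. v < 0 \<Longrightarrow> S v = 0"
    and bd: "\<And>w. w \<in> strip \<Longrightarrow> norm (lap lborel (max 0) S w) \<le> C * (1 + \<bar>Im w\<bar>)"
    and \<delta>: "0 < \<delta>" "\<delta> \<le> 1" and \<epsilon>: "0 < \<epsilon>" "\<epsilon> \<le> 1"
  shows "norm (\<integral>v. S v * exp (- of_real \<epsilon> * of_real v) * of_real (exp (- (((X - v) / \<delta>)\<^sup>2) / 2)) \<partial>lborel)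
     \<le> C * (\<integral>s. std_normal_density s * (1 + \<bar>s\<bar>) \<partial>lborel) / \<delta>"
proof -
  have "0 \<le> C * (1 + \<bar>Im 1\<bar>)" by (rule order_trans [OF norm_ge_zero bd]) (simp add: strip_def)
  hence C: "C \<ge> 0" by simp
  have [measurable]: "S \<in> borel_measurable lborel" using ok by (simp add: lap_ok_def)
  define f where "f = (\<lambda>v s. S v * exp (- of_real \<epsilon> * of_real v) * (of_real (std_normal_density s) * iexp ((X - v) / \<delta> * s)))"
  have lm: "S v * exp (- w * of_real v) = S v * exp (- w * of_real (max 0 v))" for v w
    using supp [of v] by (cases "v < 0") (auto simp: max_def)
  have "(\<integral>v. S v * exp (- of_real \<epsilon> * of_real v) * of_real (exp (- (((X - v) / \<delta>)\<^sup>2) / 2)) \<partial>lborel)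
     = (\<integral>v. (\<integral>s. f v s \<partial>lborel) \<partial>lborel)"
    unfolding f_def gaussian_fourier by simp
  also have "\<dots> = (\<integral>s. (\<integral>v. f v s \<partial>lborel) \<partial>lborel)"
  proof (rule fubini_dominated)
    show "case_prod f \<in> borel_measurable (lborel \<Otimes>\<^sub>M lborel)"
      unfolding f_def by measurable
    show "integrable lborel (\<lambda>v. norm (S v) * exp (- \<epsilon> * max 0 v))" using ok \<epsilon> by (simp add: lap_ok_def)
    show "integrable lborel (\<lambda>s. std_normal_density s * (1 + \<bar>s\<bar>) ^ 0)" by (rule integrable_gaussian_poly)
    show "norm (f v s) \<le> norm (S v) * exp (- \<epsilon> * max 0 v) * (std_normal_density s * (1 + \<bar>s\<bar>) ^ 0)" for v s
    proof -
      show ?thesis using supp [of v] unfolding f_def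
        by (cases "v < 0") (auto simp: max_def norm_mult)
    qed
  qed (auto intro: sigma_finite_lborel)
  also have "\<dots> = (\<integral>s. of_real (std_normal_density s) * iexp (X / \<delta> * s) * lap lborel (max 0) S (Complex \<epsilon> (s / \<delta>)) \<partial>lborel)"
  proof (rule Bochner_Integration.integral_cong [OF refl])
    fix s
    have "f v s = of_real (std_normal_density s) * iexp (X / \<delta> * s) * (S v * exp (- Complex \<epsilon> (s / \<delta>) * of_real (max 0 v)))" for v
    proof -
      have "exp (- of_real \<epsilon> * of_real v) * iexp ((X - v) / \<delta> * s) = iexp (X / \<delta> * s) * exp (- Complex \<epsilon> (s / \<delta>) * of_real v)"
        unfolding exp_add [symmetric] using \<delta> by (intro arg_cong [of _ _ exp]) (simp add: complex_eq_iff field_simps)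
      thus ?thesis unfolding f_def lm [symmetric] by (simp add: mult_ac)
    qed
    thus "(\<integral>v. f v s \<partial>lborel) = of_real (std_normal_density s) * iexp (X / \<delta> * s) * lap lborel (max 0) S (Complex \<epsilon> (s / \<delta>))"
      unfolding lap_def by simp
  qed
  finally have eq: "(\<integral>v. S v * exp (- of_real \<epsilon> * of_real v) * of_real (exp (- (((X - v) / \<delta>)\<^sup>2) / 2)) \<partial>lborel) = \<dots>" .
  have "norm (\<integral>s. of_real (std_normal_density s) * iexp (X / \<delta> * s) * lap lborel (max 0) S (Complex \<epsilon> (s / \<delta>)) \<partial>lborel)
     \<le> (\<integral>s. norm (of_real (std_normal_density s) * iexp (X / \<delta> * s) * lap lborel (max 0) S (Complex \<epsilon> (s / \<delta>))) \<partial>lborel)"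
    by (rule integral_norm_bound)
  also have "\<dots> \<le> (\<integral>s. C / \<delta> * (std_normal_density s * (1 + \<bar>s\<bar>) ^ 1) \<partial>lborel)"
  proof (rule integral_mono')
    show "integrable lborel (\<lambda>s. C / \<delta> * (std_normal_density s * (1 + \<bar>s\<bar>) ^ 1))"
      by (intro integrable_mult_right integrable_gaussian_poly)
    fix s
    have "norm (lap lborel (max 0) S (Complex \<epsilon> (s / \<delta>))) \<le> C * (1 + \<bar>s / \<delta>\<bar>)"
      using bd [of "Complex \<epsilon> (s / \<delta>)"] \<epsilon> by (simp add: strip_def)
    also have "\<dots> \<le> C * ((1 + \<bar>s\<bar>) / \<delta>)"
      using \<delta> C by (intro mult_left_mono) (auto simp: field_simps)
    finally have "std_normal_density s * norm (lap lborel (max 0) S (Complex \<epsilon> (s / \<delta>))) \<le> std_normal_density s * (C * ((1 + \<bar>s\<bar>) / \<delta>))"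
      by (rule mult_left_mono) auto
    thus "norm (of_real (std_normal_density s) * iexp (X / \<delta> * s) * lap lborel (max 0) S (Complex \<epsilon> (s / \<delta>)))
        \<le> C / \<delta> * (std_normal_density s * (1 + \<bar>s\<bar>) ^ 1)"
      by (simp add: norm_mult mult_ac)
    show "0 \<le> C / \<delta> * (std_normal_density s * (1 + \<bar>s\<bar>) ^ 1)" using C \<delta> by auto
  qed
  also have "\<dots> = C * (\<integral>s. std_normal_density s * (1 + \<bar>s\<bar>) \<partial>lborel) / \<delta>" by simp
  finally show ?thesis unfolding eq .
qed

text \<open>The damping factor is removed by dominated convergence along \<open>1 / Suc n\<close>;
  the polynomial growth of \<open>S\<close> provides the majorant. The second factor
  \<open>1 / \<delta>\<close> comes from substituting \<open>v = X + \<delta> * s\<close>, which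
  normalizes the mean.\<close>

lemma lap_gaussian_bound0:
  fixes S :: "real \<Rightarrow> complex"
  assumes meas: "S \<in> borel_measurable lborel" and supp: "\<And>v. v < 0 \<Longrightarrow> S v = 0"
    and gr: "\<And>v. v \<ge> 0 \<Longrightarrow> norm (S v) \<le> K * (1 + v) ^ m"
    and bd: "\<And>w. w \<in> strip \<Longrightarrow> norm (lap lborel (max 0) S w) \<le> C * (1 + \<bar>Im w\<bar>)"
    and \<delta>: "0 < \<delta>" "\<delta> \<le> 1"
  shows "integrable lborel (\<lambda>s. of_real (std_normal_density s) * S (X + \<delta> * s))"
    and "norm (\<integral>s. of_real (std_normal_density s) * S (X + \<delta> * s) \<partial>lborel)
     \<le> C * (\<integral>s. std_normal_density s * (1 + \<bar>s\<bar>) \<partial>lborel) / \<delta>\<^sup>2"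
proof -
  have "0 \<le> K * (1 + 0) ^ m" by (rule order_trans [OF norm_ge_zero gr]) simp
  hence K: "K \<ge> 0" by simp
  have [measurable]: "S \<in> borel_measurable borel" using meas by simp
  define I where "I = (\<integral>s. std_normal_density s * (1 + \<bar>s\<bar>) \<partial>lborel)"
  have ok: "lap_ok lborel (max 0) S" by (rule lap_ok_halfline [OF meas supp gr])
  have gr': "norm (S v) \<le> K * (1 + \<bar>v\<bar>) ^ m" for v
    using gr [of v] supp [of v] K by (cases "v < 0") auto
  define B where "B = (\<lambda>s. K * (1 + \<bar>X\<bar>) ^ m * (std_normal_density s * (1 + \<bar>s\<bar>) ^ m))"
  have B: "integrable lborel B" unfolding B_def by (intro integrable_mult_right integrable_gaussian_poly)
  have bound: "norm (of_real (std_normal_density s) * S (X + \<delta> * s)) \<le> B s" for s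
  proof -
    have "\<bar>\<delta> * s\<bar> \<le> 1 * \<bar>s\<bar>" unfolding abs_mult using \<delta> by (intro mult_right_mono) auto
    hence "1 + \<bar>X + \<delta> * s\<bar> \<le> 1 + \<bar>X\<bar> + \<bar>s\<bar>" by linarith
    also have "\<dots> \<le> (1 + \<bar>X\<bar>) * (1 + \<bar>s\<bar>)" by (simp add: algebra_simps)
    finally have "norm (S (X + \<delta> * s)) \<le> K * ((1 + \<bar>X\<bar>) * (1 + \<bar>s\<bar>)) ^ m"
      using gr' [of "X + \<delta> * s"] K by (meson mult_left_mono order_trans power_mono abs_ge_zero add_nonneg_nonneg zero_le_one)
    hence "std_normal_density s * norm (S (X + \<delta> * s)) \<le> std_normal_density s * (K * ((1 + \<bar>X\<bar>) * (1 + \<bar>s\<bar>)) ^ m)"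
      by (rule mult_left_mono) auto
    thus ?thesis by (simp add: B_def norm_mult power_mult_distrib mult_ac)
  qed
  show int: "integrable lborel (\<lambda>s. of_real (std_normal_density s) * S (X + \<delta> * s))"
  proof (rule Bochner_Integration.integrable_bound [OF B])
    show "AE s in lborel. norm (of_real (std_normal_density s) * S (X + \<delta> * s)) \<le> norm (B s)"
      using order_trans [OF bound abs_ge_self] by (intro AE_I2) simp
  qed measurable
  define e where "e = (\<lambda>n::nat. 1 / real (Suc n))"
  have e: "0 < e n" "e n \<le> 1" for n by (auto simp: e_def)
  define T where "T = (\<lambda>n s. of_real (std_normal_density s) * (S (X + \<delta> * s) * exp (- of_real (e n) * of_real (X + \<delta> * s))))"
  have Tn: "norm (\<integral>s. T n s \<partial>lborel) \<le> C * I / \<delta>\<^sup>2" for n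
  proof -
    let ?g = "\<lambda>v. S v * exp (- of_real (e n) * of_real v) * complex_of_real (exp (- (((X - v) / \<delta>)\<^sup>2) / 2))"
    have "(\<integral>v. ?g v \<partial>lborel) = \<bar>\<delta>\<bar> *\<^sub>R (\<integral>s. ?g (X + \<delta> * s) \<partial>lborel)"
      by (rule lborel_integral_real_affine) (use \<delta> in auto)
    also have "(\<lambda>s. ?g (X + \<delta> * s)) = (\<lambda>s. of_real (sqrt (2 * pi)) * T n s)"
    proof
      fix s
      have "((X - (X + \<delta> * s)) / \<delta>)\<^sup>2 = s\<^sup>2" using \<delta> by (simp add: field_simps)
      moreover have "exp (- (s\<^sup>2) / 2) = sqrt (2 * pi) * std_normal_density s" by (simp add: std_normal_density_def)
      ultimately show "?g (X + \<delta> * s) = of_real (sqrt (2 * pi)) * T n s"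
        by (simp add: T_def mult_ac)
    qed
    finally have "norm (\<integral>v. ?g v \<partial>lborel) = \<delta> * sqrt (2 * pi) * norm (\<integral>s. T n s \<partial>lborel)"
      using \<delta> by (simp add: norm_mult)
    hence "\<delta> * sqrt (2 * pi) * norm (\<integral>s. T n s \<partial>lborel) \<le> C * I / \<delta>"
      using lap_gaussian_bound [OF ok supp bd \<delta> e, of n X] by (simp add: I_def)
    moreover have "\<delta> * 1 * norm (\<integral>s. T n s \<partial>lborel) \<le> \<delta> * sqrt (2 * pi) * norm (\<integral>s. T n s \<partial>lborel)"
    proof (intro mult_right_mono mult_left_mono)
      have "1 \<le> 2 * pi" using pi_gt3 by linarith
      thus "1 \<le> sqrt (2 * pi)" by simp
    qed (use \<delta> in auto)
    ultimately have "\<delta> * norm (\<integral>s. T n s \<partial>lborel) \<le> C * I / \<delta>" by simp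
    thus ?thesis using \<delta> by (simp add: field_simps power2_eq_square)
  qed
  have "(\<lambda>n. \<integral>s. T n s \<partial>lborel) \<longlonglongrightarrow> (\<integral>s. of_real (std_normal_density s) * S (X + \<delta> * s) \<partial>lborel)"
  proof (rule integral_dominated_convergence [OF _ _ B])
    show "AE s in lborel. (\<lambda>n. T n s) \<longlonglongrightarrow> of_real (std_normal_density s) * S (X + \<delta> * s)"
    proof (rule AE_I2)
      fix s
      have "e \<longlonglongrightarrow> 0" unfolding e_def using LIMSEQ_inverse_real_of_nat by (simp add: inverse_eq_divide)
      hence "(\<lambda>n. of_real (std_normal_density s) * (S (X + \<delta> * s) * exp (- of_real (e n) * of_real (X + \<delta> * s))))
         \<longlonglongrightarrow> of_real (std_normal_density s) * (S (X + \<delta> * s) * exp (- of_real 0 * of_real (X + \<delta> * s)))"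
        by (intro tendsto_intros)
      thus "(\<lambda>n. T n s) \<longlonglongrightarrow> of_real (std_normal_density s) * S (X + \<delta> * s)" by (simp add: T_def)
    qed
    fix n
    show "AE s in lborel. norm (T n s) \<le> B s"
    proof (rule AE_I2)
      fix s
      have "norm (S v * exp (- of_real (e n) * of_real v)) \<le> norm (S v)" for v
        using supp [of v] e [of n] by (cases "v < 0") (auto simp: norm_mult mult_left_le)
      hence "norm (T n s) \<le> norm (of_real (std_normal_density s) * S (X + \<delta> * s))"
        unfolding T_def norm_mult [of "of_real _"] by (rule mult_left_mono) auto
      thus "norm (T n s) \<le> B s" using bound [of s] by linarith
    qed
  qed (unfold T_def, measurable)
  from tendsto_norm [OF this]
  show "norm (\<integral>s. of_real (std_normal_density s) * S (X + \<delta> * s) \<partial>lborel)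
     \<le> C * (\<integral>s. std_normal_density s * (1 + \<bar>s\<bar>) \<partial>lborel) / \<delta>\<^sup>2"
    by (rule LIMSEQ_le_const2) (use Tn in \<open>auto simp: I_def\<close>)
qed


text \<open>Taking \<open>3 * N\<close> derivatives amounts to the weight
  \<open>v ^ (3 * N)\<close>. The mean of the weighted function over a window of width
  \<open>\<delta>\<close> is at most of order \<open>\<delta> powr (-2)\<close>, and replacing the
  mean by the value at \<open>X\<close> costs about \<open>\<delta> * X ^ (3 * N + m)\<close>. With
  \<open>\<delta> = 1 / X ^ N\<close>, division by \<open>X ^ (3 * N)\<close> leaves
  \<open>X ^ (- N)\<close> from the first part and \<open>X ^ m / X ^ N\<close> from the
  second.\<close>

theorem tauberian_power_saving:
  fixes R :: "real \<Rightarrow> complex"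
  assumes meas: "R \<in> borel_measurable lborel" and supp: "\<And>v. v < 0 \<Longrightarrow> R v = 0"
    and gr: "\<And>v. v \<ge> 0 \<Longrightarrow> norm (R v) \<le> K * (1 + v) ^ m"
    and osc: "\<And>v X. v \<ge> 0 \<Longrightarrow> X \<ge> 2 \<Longrightarrow> norm (R v - R X) \<le> K * (1 + v + X) ^ m * (\<bar>v - X\<bar> + exp (- X / 2))"
    and bd: "\<And>w. w \<in> strip \<Longrightarrow> norm ((deriv ^^ (3 * N)) (lap lborel (max 0) R) w) \<le> C * (1 + \<bar>Im w\<bar>)"
    and N: "N \<ge> 1"
  obtains B where "\<And>X. X \<ge> 2 \<Longrightarrow> norm (R X) \<le> B * X ^ m / X ^ N"
proof -
  define n where "n = 3 * N"
  have n: "n \<ge> 1" using N by (simp add: n_def)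
  define S where "S = (\<lambda>v. of_real (max 0 v) ^ n * R v)"
  have ok: "lap_ok lborel (max 0) R" by (rule lap_ok_halfline [OF meas supp gr])
  have "0 \<le> K * (1 + 0) ^ m" by (rule order_trans [OF norm_ge_zero gr]) simp
  hence K: "K \<ge> 0" by simp
  have measS: "S \<in> borel_measurable lborel" unfolding S_def using meas by measurable
  have suppS: "S v = 0" if "v < 0" for v using supp [OF that] by (simp add: S_def)
  have S: "S v = of_real (v ^ n) * R v" if "v \<ge> 0" for v using that by (simp add: S_def max_def)
  have grS: "norm (S v) \<le> K * (1 + v) ^ (n + m)" if v: "v \<ge> 0" for v
  proof -
    have "norm (S v) = v ^ n * norm (R v)" using v S [OF v] by (simp add: norm_mult norm_power)
    also have "\<dots> \<le> (1 + v) ^ n * (K * (1 + v) ^ m)"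
      using v gr [OF v] by (intro mult_mono power_mono) auto
    finally show ?thesis by (simp add: power_add mult_ac)
  qed
  have bdS: "norm (lap lborel (max 0) S w) \<le> C * (1 + \<bar>Im w\<bar>)" if w: "w \<in> strip" for w
  proof -
    have "w \<in> rhp" using w strip_subset_rhp by blast
    from lap_higher_deriv [OF ok this, of n] have "norm (lap lborel (max 0) S w) = norm ((deriv ^^ n) (lap lborel (max 0) R) w)"
      by (simp add: norm_mult norm_power S_def)
    thus ?thesis using bd [OF w] by (simp add: n_def)
  qed
  define I where "I = (\<integral>s. std_normal_density s * (1 + \<bar>s\<bar>) \<partial>lborel)"
  define J where "J = (\<integral>s. std_normal_density s * (1 + \<bar>s\<bar>) ^ (n + m + 1) \<partial>lborel)"
  have J: "J \<ge> 0" unfolding J_def by (rule Bochner_Integration.integral_nonneg) auto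
  define L where "L = (2 * K + K * real n) * 3 ^ (n + m)"
  have L: "L \<ge> 0" using K by (simp add: L_def)
  \<comment> \<open>The powers of \<open>X\<close> are separated from those of
    \<open>1 + \<bar>v - X\<bar>\<close>, so that after the substitution the latter are integrated
    against the density as Gaussian moments, collected in \<open>J\<close>.\<close>
  have oscS: "norm (S v - S X) \<le> L * X ^ (n + m) * (1 + \<bar>v - X\<bar>) ^ (n + m) * (\<bar>v - X\<bar> + exp (- X / 2))"
    if X: "X \<ge> 2" for v X
  proof -
    define Q where "Q = 1 + \<bar>v\<bar> + X"
    have Q1: "1 + \<bar>v\<bar> \<le> Q" "X \<le> Q" "1 \<le> Q" using X by (auto simp: Q_def)
    have main: "norm (S v - S X) \<le> (2 * K + K * real n) * Q ^ (n + m) * (\<bar>v - X\<bar> + exp (- X / 2))"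
    proof (cases "v \<ge> 0")
      case False
      \<comment> \<open>On the negative axis \<open>S\<close> jumps to 0, but there \<open>v\<close>
        is farther than 2 from \<open>X\<close>, so the size of \<open>S X\<close> is already an
        admissible bound for the oscillation.\<close>
      have "norm (S v - S X) \<le> K * (1 + X) ^ (n + m)" using suppS [of v] False grS [of X] X by simp
      also have "\<dots> \<le> (2 * K + K * real n) * Q ^ (n + m)"
        using K X by (intro mult_mono power_mono) (auto simp: Q_def)
      also have "\<dots> \<le> (2 * K + K * real n) * Q ^ (n + m) * (\<bar>v - X\<bar> + exp (- X / 2))"
      proof -
        have "1 \<le> \<bar>v - X\<bar> + exp (- X / 2)" using False X by (intro add_increasing2) auto
        from mult_left_mono [OF this, of "(2 * K + K * real n) * Q ^ (n + m)"] show ?thesis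
          using K Q1 by simp
      qed
      finally show ?thesis .
    next
      case True
      have "S v - S X = of_real (v ^ n) * (R v - R X) + of_real (v ^ n - X ^ n) * R X"
        using S [OF True] S [of X] X by (simp add: algebra_simps)
      hence "norm (S v - S X) \<le> norm (of_real (v ^ n) * (R v - R X)) + norm (of_real (v ^ n - X ^ n) * R X)"
        by (metis norm_triangle_ineq)
      also have "norm (of_real (v ^ n) * (R v - R X)) \<le> Q ^ n * (K * Q ^ m * (\<bar>v - X\<bar> + exp (- X / 2)))"
      proof -
        have "norm (of_real (v ^ n) * (R v - R X)) = v ^ n * norm (R v - R X)" using True by (simp add: norm_mult norm_power)
        also have "\<dots> \<le> Q ^ n * (K * (1 + v + X) ^ m * (\<bar>v - X\<bar> + exp (- X / 2)))"
          using True Q1 X by (intro mult_mono power_mono osc) auto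
        finally show ?thesis using True by (simp add: Q_def)
      qed
      also have "norm (of_real (v ^ n - X ^ n) * R X) \<le> (real n * Q ^ n * \<bar>v - X\<bar>) * (K * Q ^ m)"
        unfolding norm_mult norm_of_real
      proof (intro mult_mono)
        have "\<bar>v ^ n - X ^ n\<bar> \<le> real n * Q ^ (n - 1) * \<bar>v - X\<bar>"
        proof -
          have "v ^ n - X ^ n = (v - X) * (\<Sum>i<n. X ^ (n - Suc i) * v ^ i)" by (rule power_diff_sumr2)
          hence e: "\<bar>v ^ n - X ^ n\<bar> = \<bar>v - X\<bar> * \<bar>\<Sum>i<n. X ^ (n - Suc i) * v ^ i\<bar>" by (simp add: abs_mult)
          have "\<bar>\<Sum>i<n. X ^ (n - Suc i) * v ^ i\<bar> \<le> (\<Sum>i<n. Q ^ (n - 1))"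
          proof (rule order_trans [OF sum_abs sum_mono])
            fix i assume i: "i \<in> {..<n}"
            have "\<bar>X ^ (n - Suc i) * v ^ i\<bar> = X ^ (n - Suc i) * v ^ i" using True X by simp
            also have "\<dots> \<le> Q ^ (n - Suc i) * Q ^ i" using True X Q1 by (intro mult_mono power_mono) auto
            also have "\<dots> = Q ^ (n - 1)" using i by (simp add: power_add [symmetric])
            finally show "\<bar>X ^ (n - Suc i) * v ^ i\<bar> \<le> Q ^ (n - 1)" .
          qed
          hence "\<bar>v - X\<bar> * \<bar>\<Sum>i<n. X ^ (n - Suc i) * v ^ i\<bar> \<le> \<bar>v - X\<bar> * (\<Sum>i<n. Q ^ (n - 1))"
            by (rule mult_left_mono) auto
          thus ?thesis unfolding e by (simp add: mult_ac)
        qed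
        also have "\<dots> \<le> real n * Q ^ n * \<bar>v - X\<bar>"
          using Q1 by (intro mult_right_mono mult_left_mono power_increasing) auto
        finally show "\<bar>v ^ n - X ^ n\<bar> \<le> real n * Q ^ n * \<bar>v - X\<bar>" .
        show "norm (R X) \<le> K * Q ^ m"
          using gr [of X] X K Q1 by (intro order_trans [OF gr] mult_left_mono power_mono) (auto simp: Q_def)
      qed (use Q1 in auto)
      finally have "norm (S v - S X) \<le> K * Q ^ (n + m) * (\<bar>v - X\<bar> + exp (- X / 2)) + K * real n * Q ^ (n + m) * \<bar>v - X\<bar>"
        by (simp add: power_add mult_ac)
      also have "\<dots> \<le> 2 * K * Q ^ (n + m) * (\<bar>v - X\<bar> + exp (- X / 2)) + K * real n * Q ^ (n + m) * (\<bar>v - X\<bar> + exp (- X / 2))"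
        using K Q1 by (intro add_mono mult_right_mono mult_left_mono) auto
      finally show ?thesis by (simp add: algebra_simps)
    qed
    have "Q \<le> 3 * X * (1 + \<bar>v - X\<bar>)"
    proof -
      have "Q \<le> 3 * X + \<bar>v - X\<bar>" using X by (auto simp: Q_def)
      also have "\<dots> \<le> 3 * X + 3 * X * \<bar>v - X\<bar>" using X mult_right_mono [of 1 "3 * X" "\<bar>v - X\<bar>"] by simp
      finally show ?thesis by (simp add: algebra_simps)
    qed
    hence "Q ^ (n + m) \<le> (3 * X * (1 + \<bar>v - X\<bar>)) ^ (n + m)" using Q1 by (intro power_mono) auto
    hence "(2 * K + K * real n) * Q ^ (n + m) * (\<bar>v - X\<bar> + exp (- X / 2)) \<le>
       (2 * K + K * real n) * (3 * X * (1 + \<bar>v - X\<bar>)) ^ (n + m) * (\<bar>v - X\<bar> + exp (- X / 2))"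
      using K by (intro mult_right_mono mult_left_mono) auto
    also have "\<dots> = L * X ^ (n + m) * (1 + \<bar>v - X\<bar>) ^ (n + m) * (\<bar>v - X\<bar> + exp (- X / 2))"
      unfolding L_def power_mult_distrib by (simp only: mult_ac)
    finally show ?thesis using main by linarith
  qed
  have C: "C \<ge> 0"
  proof -
    have "0 \<le> C * (1 + \<bar>Im 1\<bar>)" by (rule order_trans [OF norm_ge_zero bdS]) (simp add: strip_def)
    thus ?thesis by simp
  qed
  have I: "I \<ge> 0" unfolding I_def by (rule Bochner_Integration.integral_nonneg) auto
  \<comment> \<open>The density has integral 1, so \<open>S X\<close> is itself a mean of a
    constant; its difference from the window mean is the mean of the oscillation.\<close>
  have key: "norm (R X) * X ^ n \<le> C * I / \<delta>\<^sup>2 + L * X ^ (n + m) * (\<delta> + exp (- X / 2)) * J"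
    if X: "X \<ge> 2" and \<delta>: "0 < \<delta>" "\<delta> \<le> 1" for X \<delta>
  proof -
    have int1: "integrable lborel (\<lambda>s. of_real (std_normal_density s) * S (X + \<delta> * s))"
      by (rule lap_gaussian_bound0(1) [OF measS suppS grS bdS \<delta>])
    have int2: "integrable lborel (\<lambda>s. complex_of_real (std_normal_density s) * S X)"
      using integrable_gaussian_poly [of 0] by (intro integrable_mult_left integrable_of_real) auto
    have "S X = of_real (\<integral>s. std_normal_density s \<partial>lborel) * S X" by simp
    also have "\<dots> = (\<integral>s. of_real (std_normal_density s) * S X \<partial>lborel)"
      by (simp del: integral_normal_density)
    finally have SX: "S X = \<dots>" .
    have "norm (S X - (\<integral>s. of_real (std_normal_density s) * S (X + \<delta> * s) \<partial>lborel)) =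
       norm (\<integral>s. of_real (std_normal_density s) * S X - of_real (std_normal_density s) * S (X + \<delta> * s) \<partial>lborel)"
      by (subst SX) (simp only: Bochner_Integration.integral_diff [OF int2 int1])
    also have "\<dots> \<le> (\<integral>s. L * X ^ (n + m) * (\<delta> + exp (- X / 2)) * (std_normal_density s * (1 + \<bar>s\<bar>) ^ (n + m + 1)) \<partial>lborel)"
    proof (rule norm_integral_le)
      show "integrable lborel (\<lambda>s. of_real (std_normal_density s) * S X - of_real (std_normal_density s) * S (X + \<delta> * s))"
        by (rule Bochner_Integration.integrable_diff [OF int2 int1])
      show "integrable lborel (\<lambda>s. L * X ^ (n + m) * (\<delta> + exp (- X / 2)) * (std_normal_density s * (1 + \<bar>s\<bar>) ^ (n + m + 1)))"
        by (intro integrable_mult_right integrable_gaussian_poly)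
      fix s
      have ds: "\<delta> * \<bar>s\<bar> \<le> \<bar>s\<bar>" using \<delta> by (simp add: mult_left_le_one_le)
      have "norm (S X - S (X + \<delta> * s)) \<le> L * X ^ (n + m) * (1 + \<bar>\<delta> * s\<bar>) ^ (n + m) * (\<bar>\<delta> * s\<bar> + exp (- X / 2))"
        using oscS [OF X, of "X + \<delta> * s"] by (simp add: norm_minus_commute)
      also have "\<dots> \<le> L * X ^ (n + m) * (1 + \<bar>s\<bar>) ^ (n + m) * ((1 + \<bar>s\<bar>) * (\<delta> + exp (- X / 2)))"
      proof (intro mult_mono mult_left_mono power_mono)
        have "\<bar>\<delta> * s\<bar> + exp (- X / 2) \<le> \<delta> * \<bar>s\<bar> + exp (- X / 2) + \<delta> + \<bar>s\<bar> * exp (- X / 2)"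
          using \<delta> by (simp add: abs_mult)
        thus "\<bar>\<delta> * s\<bar> + exp (- X / 2) \<le> (1 + \<bar>s\<bar>) * (\<delta> + exp (- X / 2))" by (simp add: algebra_simps)
      qed (use L X \<delta> ds in \<open>auto simp: abs_mult intro!: mult_nonneg_nonneg\<close>)
      finally have "std_normal_density s * norm (S X - S (X + \<delta> * s)) \<le> std_normal_density s * (L * X ^ (n + m) * (1 + \<bar>s\<bar>) ^ (n + m) * ((1 + \<bar>s\<bar>) * (\<delta> + exp (- X / 2))))"
        by (rule mult_left_mono) auto
      moreover have "norm (of_real (std_normal_density s) * S X - of_real (std_normal_density s) * S (X + \<delta> * s)) = std_normal_density s * norm (S X - S (X + \<delta> * s))"
        unfolding right_diff_distrib [symmetric] norm_mult by simp
      ultimately show "norm (of_real (std_normal_density s) * S X - of_real (std_normal_density s) * S (X + \<delta> * s)) \<le>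
         L * X ^ (n + m) * (\<delta> + exp (- X / 2)) * (std_normal_density s * (1 + \<bar>s\<bar>) ^ (n + m + 1))"
        by (simp add: mult_ac)
    qed
    also have "\<dots> = L * X ^ (n + m) * (\<delta> + exp (- X / 2)) * J" by (simp add: J_def)
    finally have "norm (S X) \<le> C * I / \<delta>\<^sup>2 + L * X ^ (n + m) * (\<delta> + exp (- X / 2)) * J"
      using lap_gaussian_bound0(2) [OF measS suppS grS bdS \<delta>, of X]
        norm_triangle_ineq2 [of "S X" "\<integral>s. of_real (std_normal_density s) * S (X + \<delta> * s) \<partial>lborel"]
      by (simp add: I_def)
    thus ?thesis using S [of X] X by (simp add: norm_mult norm_power mult_ac)
  qed
  define B where "B = C * I + L * (1 + fact N * 2 ^ N) * J"
  show ?thesis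
  proof (rule that [of B])
    fix X :: real assume X: "X \<ge> 2"
    define \<delta> where "\<delta> = 1 / X ^ N"
    have XN: "X ^ N \<ge> 1" "X ^ m \<ge> 1" using X by (auto intro!: one_le_power)
    have \<delta>: "0 < \<delta>" "\<delta> \<le> 1" using X XN by (auto simp: \<delta>_def)
    have "X ^ N \<le> fact N / (1/2) ^ N * exp ((1/2) * X)" using X by (intro power_le_exp) auto
    hence ex: "exp (- X / 2) \<le> fact N * 2 ^ N / X ^ N"
      using X by (simp add: exp_minus field_simps)
    have Xn: "X ^ n = X ^ N * X ^ N * X ^ N" by (simp add: n_def power_mult power3_eq_cube mult.commute [of 3])
    have "norm (R X) * X ^ n \<le> C * I / \<delta>\<^sup>2 + L * X ^ (n + m) * (\<delta> + exp (- X / 2)) * J"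
      by (rule key [OF X \<delta>])
    also have "C * I / \<delta>\<^sup>2 = C * I * (X ^ n / X ^ N)"
      using X unfolding Xn by (simp add: \<delta>_def power2_eq_square)
    also have "\<dots> \<le> C * I * (X ^ n / X ^ N * X ^ m)"
    proof (intro mult_left_mono)
      show "X ^ n / X ^ N \<le> X ^ n / X ^ N * X ^ m"
        using mult_left_mono [OF XN(2), of "X ^ n / X ^ N"] X by simp
    qed (use C I in auto)
    also have "L * X ^ (n + m) * (\<delta> + exp (- X / 2)) * J \<le> L * X ^ (n + m) * (1 / X ^ N + fact N * 2 ^ N / X ^ N) * J"
      using L X J ex by (intro mult_right_mono mult_left_mono add_mono) (auto simp: \<delta>_def)
    also have "C * I * (X ^ n / X ^ N * X ^ m) + L * X ^ (n + m) * (1 / X ^ N + fact N * 2 ^ N / X ^ N) * J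
       = (B * X ^ m / X ^ N) * X ^ n"
      using X by (simp add: B_def power_add field_simps)
    finally show "norm (R X) \<le> B * X ^ m / X ^ N"
      using X by (simp del: times_divide_eq_left add: mult_le_cancel_right)
  qed
qed

subsection \<open>Transforms with logarithmic singularities\<close>

definition mlog :: "nat \<Rightarrow> nat \<Rightarrow> real \<Rightarrow> real" where
  "mlog j l r = indicator {0<..<1} r * (r ^ j * (- ln r) ^ l)"

lemma mlog_measurable [measurable]: "mlog j l \<in> borel_measurable borel"
  unfolding mlog_def by measurable

lemma mlog_nonneg [simp]: "mlog j l r \<ge> 0"
  by (auto simp: mlog_def indicator_def)

lemma power_neg_ln_le:
  assumes "0 < r" "r \<le> (1::real)"
  shows "(- ln r) ^ l \<le> fact l * 2 ^ l * r powr (- 1/2)"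
proof -
  have "(- ln r) ^ l \<le> fact l / (1/2) ^ l * exp ((1/2) * (- ln r))"
    using assms by (intro power_le_exp) auto
  also have "exp ((1/2) * (- ln r)) = r powr (- 1/2)" using assms by (simp add: powr_def)
  finally show ?thesis by (simp add: power_divide)
qed

lemma integrable_inverse_sqrt: "integrable lborel (\<lambda>r::real. indicator {0..1} r * r powr (- 1/2))"
proof -
  have "(\<lambda>r::real. r powr (- 1/2)) integrable_on {0..1}" by (rule integrable_on_powr_from_0) auto
  hence "(\<lambda>r::real. r powr (- 1/2)) absolutely_integrable_on {0..1}"
    by (rule nonnegative_absolutely_integrable_1) auto
  hence "integrable lebesgue (\<lambda>r::real. indicator {0..1} r * r powr (- 1/2))"
    by (simp add: set_integrable_def)
  thus ?thesis by (subst (asm) integrable_completion) auto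
qed

lemma integrable_mlog [simp]: "integrable lborel (mlog j l)"
proof (rule Bochner_Integration.integrable_bound)
  show "integrable lborel (\<lambda>r::real. fact l * 2 ^ l * (indicator {0..1} r * r powr (- 1/2)))"
    using integrable_inverse_sqrt by (rule integrable_mult_right)
  show "AE r in lborel. norm (mlog j l r) \<le> norm (fact l * 2 ^ l * (indicator {0..1} r * r powr (- 1/2)))"
  proof (rule AE_I2)
    fix r :: real
    show "norm (mlog j l r) \<le> norm (fact l * 2 ^ l * (indicator {0..1} r * r powr (- 1/2)))"
    proof (cases "0 < r \<and> r < 1")
      case True
      have "r ^ j * (- ln r) ^ l \<le> 1 * (fact l * 2 ^ l * r powr (- 1/2))"
        using True power_neg_ln_le [of r l] by (intro mult_mono power_le_one) auto
      thus ?thesis using True unfolding real_norm_def abs_of_nonneg [OF mlog_nonneg]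
        by (simp add: mlog_def indicator_def abs_mult)
    qed (auto simp: mlog_def indicator_def)
  qed
qed auto

text \<open>\<open>Er j l\<close> has Laplace transform \<open>Dr j l\<close>, and
  \<open>Im1 j l\<close> is its value at 0, that is, the total mass of the density
  \<open>mlog j l\<close>.\<close>

definition Er :: "nat \<Rightarrow> nat \<Rightarrow> real \<Rightarrow> real" where
  "Er j l v = (\<integral>r. mlog j l r * exp (- r * v) \<partial>lborel)"

definition Dr :: "nat \<Rightarrow> nat \<Rightarrow> complex \<Rightarrow> complex" where
  "Dr j l w = (\<integral>r. of_real (mlog j l r) / (w + of_real r) \<partial>lborel)"

definition Im1 :: "nat \<Rightarrow> nat \<Rightarrow> real" where
  "Im1 j l = (\<integral>r. mlog j l r \<partial>lborel)"

lemma Im1_nonneg: "Im1 j l \<ge> 0"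
  unfolding Im1_def by (rule Bochner_Integration.integral_nonneg) auto

lemma mlog_supp: "mlog j l r \<noteq> 0 \<Longrightarrow> 0 < r \<and> r < 1"
  by (auto simp: mlog_def indicator_def split: if_splits)

lemma mlog_Suc: "r * mlog j l r = mlog (Suc j) l r"
  by (simp add: mlog_def mult_ac)

lemma integrable_Er: "v \<ge> 0 \<Longrightarrow> integrable lborel (\<lambda>r. mlog j l r * exp (- r * v))"
proof (rule Bochner_Integration.integrable_bound [OF integrable_mlog [of j l]])
  assume v: "v \<ge> 0"
  show "AE r in lborel. norm (mlog j l r * exp (- r * v)) \<le> norm (mlog j l r)"
  proof (rule AE_I2)
    fix r
    show "norm (mlog j l r * exp (- r * v)) \<le> norm (mlog j l r)"
      using mlog_supp [of j l r] v by (cases "mlog j l r = 0") (auto simp: abs_mult mult_left_le)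
  qed
qed measurable

lemma Er_bound:
  assumes "v \<ge> 0"
  shows "\<bar>Er j l v\<bar> \<le> Im1 j l"
proof -
  have "norm (\<integral>r. mlog j l r * exp (- r * v) \<partial>lborel) \<le> (\<integral>r. mlog j l r \<partial>lborel)"
  proof (rule norm_integral_le)
    fix r
    show "norm (mlog j l r * exp (- r * v)) \<le> mlog j l r"
      using mlog_supp [of j l r] assms by (cases "mlog j l r = 0") (auto simp: abs_mult mult_left_le)
  qed (use integrable_Er assms in auto)
  thus ?thesis by (simp add: Er_def Im1_def)
qed

lemma abs_exp_diff_le:
  fixes a b :: real
  assumes "a \<ge> 0" "b \<ge> 0"
  shows "\<bar>exp (- a) - exp (- b)\<bar> \<le> \<bar>a - b\<bar>"
proof -
  have le: "exp (- a) - exp (- b) \<le> b - a" if "a \<ge> 0" "a \<le> b" for a b :: real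
  proof -
    have "exp (- a) - exp (- b) = exp (- a) * (1 - exp (- (b - a)))"
      by (simp add: algebra_simps exp_add [symmetric])
    also have "\<dots> \<le> 1 * (1 - exp (- (b - a)))" using that by (intro mult_right_mono) auto
    also have "\<dots> \<le> b - a"
    proof -
      have "1 * (1 - e) \<le> b - a" if "1 + - (b - a) \<le> e" for e :: real using that by simp
      from this [OF exp_ge_add_one_self] show ?thesis .
    qed
    finally show ?thesis .
  qed
  have mono: "exp (- b) \<le> exp (- a)" if "a \<le> b" for a b :: real using that by simp
  show ?thesis using le [of a b] le [of b a] mono [of a b] mono [of b a] assms by (cases "a \<le> b") auto
qed

lemma Er_lipschitz:
  assumes "v \<ge> 0" "X \<ge> 0"
  shows "\<bar>Er j l v - Er j l X\<bar> \<le> Im1 (Suc j) l * \<bar>v - X\<bar>"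
proof -
  have "norm (\<integral>r. mlog j l r * exp (- r * v) - mlog j l r * exp (- r * X) \<partial>lborel) \<le> (\<integral>r. mlog (Suc j) l r * \<bar>v - X\<bar> \<partial>lborel)"
  proof (rule norm_integral_le)
    show "integrable lborel (\<lambda>r. mlog j l r * exp (- r * v) - mlog j l r * exp (- r * X))"
      using assms by (intro Bochner_Integration.integrable_diff integrable_Er)
    fix r
    show "norm (mlog j l r * exp (- r * v) - mlog j l r * exp (- r * X)) \<le> mlog (Suc j) l r * \<bar>v - X\<bar>"
    proof (cases "mlog j l r = 0")
      case False
      hence r: "r > 0" using mlog_supp by blast
      have "\<bar>exp (- (r * v)) - exp (- (r * X))\<bar> \<le> \<bar>r * v - r * X\<bar>"
        using r assms by (intro abs_exp_diff_le) auto
      also have "\<dots> = r * \<bar>v - X\<bar>" using r by (simp add: right_diff_distrib [symmetric] abs_mult)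
      finally have "mlog j l r * \<bar>exp (- (r * v)) - exp (- (r * X))\<bar> \<le> mlog j l r * (r * \<bar>v - X\<bar>)"
        by (rule mult_left_mono) auto
      thus ?thesis by (simp add: right_diff_distrib [symmetric] abs_mult mlog_Suc [symmetric] mult_ac)
    qed (simp add: mlog_Suc [symmetric])
  qed simp
  thus ?thesis using assms unfolding Er_def Im1_def
    by (simp only: Bochner_Integration.integral_diff [OF integrable_Er integrable_Er]) simp
qed

lemma Er_measurable [measurable]: "Er j l \<in> borel_measurable borel"
  unfolding Er_def by measurable

lemma integral_exp_complex:
  assumes z: "Re z > 0"
  shows "(\<integral>v. indicator {0..} v * exp (- z * of_real v) \<partial>lborel) = 1 / z"
proof -
  have nz: "z \<noteq> 0" using z by auto
  have int: "integrable lborel (\<lambda>v. indicator {0..} v * exp (- z * of_real v))"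
  proof (rule Bochner_Integration.integrable_bound [OF exp_integrable_lborel(1) [OF z]])
    show "AE v in lborel. norm (indicator {0..} v * exp (- z * of_real v)) \<le> norm (indicator {0..} v * exp (- Re z * v))"
      by (intro AE_I2) (auto simp: norm_mult indicator_def)
  qed measurable
  have si: "set_integrable lborel {0<..} (\<lambda>v. exp (- z * of_real v))"
    unfolding set_integrable_def
  proof (rule Bochner_Integration.integrable_bound [OF int])
    show "AE v in lborel. norm (indicator {0<..} v *\<^sub>R exp (- z * of_real v)) \<le> norm (indicator {0..} v * exp (- z * of_real v))"
      by (intro AE_I2) (auto simp: norm_mult indicator_def)
  qed measurable
  define F where "F = (\<lambda>v. - exp (- z * complex_of_real v) / z)"
  have "(LBINT v=ereal 0..\<infinity>. exp (- z * of_real v)) = 0 - F 0"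
  proof (rule interval_integral_FTC_integrable)
    show "(F has_vector_derivative exp (- z * of_real v)) (at v)" for v
    proof -
      have "((\<lambda>w. - exp (- z * w) / z) has_field_derivative exp (- z * of_real v)) (at (of_real v))"
        using nz by (auto intro!: derivative_eq_intros)
      thus ?thesis unfolding F_def by (rule has_vector_derivative_real_field)
    qed
    show "isCont (\<lambda>v. exp (- z * complex_of_real v)) x" for x by (intro continuous_intros)
    show "set_integrable lborel (einterval (ereal 0) \<infinity>) (\<lambda>v. exp (- z * of_real v))"
      using si by (simp add: einterval_def greaterThan_def)
    have "isCont F 0" unfolding F_def using nz by (intro continuous_intros) auto
    hence "(F \<longlongrightarrow> F 0) (at_right 0)" by (simp add: isCont_def filterlim_at_split)
    thus "((F \<circ> real_of_ereal) \<longlongrightarrow> F 0) (at_right (ereal 0))"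
      by (simp add: ereal_tendsto_simps)
    have "((\<lambda>v. exp (- Re z * v) / norm z) \<longlongrightarrow> 0) at_top" using z nz by real_asymp
    hence "((\<lambda>v. norm (F v)) \<longlongrightarrow> 0) at_top" by (simp add: F_def norm_divide)
    hence "(F \<longlongrightarrow> 0) at_top" by (rule tendsto_norm_zero_cancel)
    thus "((F \<circ> real_of_ereal) \<longlongrightarrow> 0) (at_left \<infinity>)" by (simp add: ereal_tendsto_simps)
  qed auto
  hence "(LBINT v:{0<..}. exp (- z * of_real v)) = 1 / z"
    by (simp add: interval_integral_to_infinity_eq F_def)
  also have "(LBINT v:{0<..}. exp (- z * of_real v)) = (\<integral>v. indicator {0..} v * exp (- z * of_real v) \<partial>lborel)"
    unfolding set_lebesgue_integral_def
    by (intro integral_cong_AE) (use AE_lborel_singleton [of "0::real"] in \<open>auto simp: indicator_def elim!: eventually_mono\<close>)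
  finally show ?thesis .
qed

lemma lap_Er:
  assumes w: "w \<in> rhp"
  shows "lap lborel (max 0) (\<lambda>v. if v < 0 then 0 else of_real (Er j l v)) w = Dr j l w"
proof -
  have w': "Re w > 0" using w by (simp add: rhp_def)
  define f where "f = (\<lambda>v r. indicator {0..} v * exp (- w * of_real v) * of_real (mlog j l r * exp (- r * v)) :: complex)"
  have "lap lborel (max 0) (\<lambda>v. if v < 0 then 0 else of_real (Er j l v)) w = (\<integral>v. (\<integral>r. f v r \<partial>lborel) \<partial>lborel)"
    unfolding lap_def
  proof (rule Bochner_Integration.integral_cong [OF refl])
    fix v :: real
    have "(\<integral>r. f v r \<partial>lborel) = indicator {0..} v * exp (- w * of_real v) * of_real (Er j l v)"
      unfolding f_def Er_def by (simp del: of_real_mult)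
    thus "(if v < 0 then 0 else of_real (Er j l v)) * exp (- w * of_real (max 0 v)) = (\<integral>r. f v r \<partial>lborel)"
      by (auto simp: indicator_def)
  qed
  also have "\<dots> = (\<integral>r. (\<integral>v. f v r \<partial>lborel) \<partial>lborel)"
  proof (rule fubini_dominated)
    show "case_prod f \<in> borel_measurable (lborel \<Otimes>\<^sub>M lborel)" unfolding f_def by measurable
    show "integrable lborel (\<lambda>v. indicator {0..} v * exp (- Re w * v))" by (rule exp_integrable_lborel [OF w'])
    show "integrable lborel (mlog j l)" by simp
    fix v r
    show "norm (f v r) \<le> indicator {0..} v * exp (- Re w * v) * mlog j l r"
    proof (cases "mlog j l r = 0 \<or> v < 0")
      case False
      hence r: "r > 0" "v \<ge> 0" using mlog_supp by auto
      hence "exp (- (r * v)) \<le> 1" by simp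
      hence "exp (- Re w * v) * (mlog j l r * exp (- (r * v))) \<le> exp (- Re w * v) * (mlog j l r * 1)"
        by (intro mult_left_mono) auto
      thus ?thesis using r by (simp add: f_def norm_mult)
    qed (auto simp: f_def)
  qed (auto intro: sigma_finite_lborel)
  also have "\<dots> = Dr j l w"
    unfolding Dr_def
  proof (rule Bochner_Integration.integral_cong [OF refl])
    fix r
    show "(\<integral>v. f v r \<partial>lborel) = of_real (mlog j l r) / (w + of_real r)"
    proof (cases "mlog j l r = 0")
      case False
      hence r: "r > 0" using mlog_supp by blast
      have "f v r = of_real (mlog j l r) * (indicator {0..} v * exp (- (w + of_real r) * of_real v))" for v
      proof -
        have "exp (- w * of_real v) * complex_of_real (exp (- r * v)) = exp (- (w + of_real r) * of_real v)"
          unfolding exp_of_real [symmetric] exp_add [symmetric] by (simp add: algebra_simps)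
        thus ?thesis unfolding f_def of_real_mult by (simp only: mult_ac)
      qed
      thus ?thesis using integral_exp_complex [of "w + of_real r"] w' r by simp
    qed (simp add: f_def)
  qed
  finally show ?thesis .
qed

text \<open>This is \<open>(-1) ^ i\<close> times the \<open>i\<close>th derivative of the Gamma
  function at \<open>j + 1\<close>.\<close>

definition gam :: "nat \<Rightarrow> nat \<Rightarrow> real" where
  "gam j i = (\<integral>y. indicator {0<..} y * (exp (- y) * y ^ j * (- ln y) ^ i) \<partial>lborel)"

lemma abs_ln_le: "y \<ge> 1 \<Longrightarrow> \<bar>ln y\<bar> \<le> (y::real)"
  using ln_le_minus_one [of y] by auto

lemma integrable_gam: "integrable lborel (\<lambda>y. indicator {0<..} y * (exp (- y) * y ^ j * (- ln y) ^ i) :: real)"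
proof (rule Bochner_Integration.integrable_bound)
  define C where "C = (fact (j + i) / (1/2) ^ (j + i) :: real)"
  have C: "C \<ge> 0" by (simp add: C_def)
  show "integrable lborel (\<lambda>y. mlog j i y + C * (indicator {0..} y * exp (- (1/2) * y)))"
    using exp_integrable_lborel [of "1/2"] by (intro Bochner_Integration.integrable_add integrable_mult_right) auto
  show "AE y in lborel. norm (indicator {0<..} y * (exp (- y) * y ^ j * (- ln y) ^ i) :: real)
      \<le> norm (mlog j i y + C * (indicator {0..} y * exp (- (1/2) * y)))"
  proof (rule AE_I2)
    fix y :: real
    show "norm (indicator {0<..} y * (exp (- y) * y ^ j * (- ln y) ^ i) :: real)
      \<le> norm (mlog j i y + C * (indicator {0..} y * exp (- (1/2) * y)))"
    proof -
      have sum: "norm (mlog j i y + C * (indicator {0..} y * exp (- (1/2) * y))) = mlog j i y + C * (indicator {0..} y * exp (- (1/2) * y))"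
        using C by (simp add: add_nonneg_nonneg)
      consider "y \<le> 0" | "0 < y" "y < 1" | "y \<ge> 1" by linarith
      thus ?thesis
      proof cases
        case 1
        thus ?thesis using C by (simp add: sum add_nonneg_nonneg)
      next
        case 2
        have "exp (- y) * (y ^ j * (- ln y) ^ i) \<le> 1 * (y ^ j * (- ln y) ^ i)"
          using 2 by (intro mult_right_mono) auto
        moreover have "0 \<le> exp (- y) * (y ^ j * (- ln y) ^ i)" using 2 by auto
        ultimately show ?thesis using 2 C unfolding sum by (simp add: mlog_def mult_ac add_increasing2 abs_mult power_abs)
      next
        case 3
        have "y ^ j * \<bar>ln y\<bar> ^ i \<le> y ^ j * y ^ i" using 3 abs_ln_le by (intro mult_left_mono power_mono) auto
        also have "\<dots> \<le> C * exp ((1/2) * y)"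
          unfolding power_add [symmetric] C_def using 3 by (intro power_le_exp) auto
        finally have "exp (- y) * (y ^ j * \<bar>ln y\<bar> ^ i) \<le> exp (- y) * (C * exp ((1/2) * y))"
          by (rule mult_left_mono) auto
        also have "\<dots> = C * (exp (- y) * exp ((1/2) * y))" by simp
        also have "exp (- y) * exp ((1/2) * y) = exp (- (1/2) * y)" unfolding exp_add [symmetric] by simp
        finally have "exp (- y) * (y ^ j * \<bar>ln y\<bar> ^ i) \<le> C * exp (- (1/2) * y)" .
        thus ?thesis using 3 unfolding sum by (simp add: abs_mult power_abs mult_ac mlog_def)
      qed
    qed
  qed
qed measurable

text \<open>Substituting \<open>r = y / X\<close> in \<open>Er j l X\<close> and expanding \<open>(ln X - ln y) ^ l\<close>.\<close>

definition Pr :: "nat \<Rightarrow> nat \<Rightarrow> real poly" where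
  "Pr j l = (\<Sum>i\<le>l. monom (of_nat (l choose i) * gam j i) (l - i))"

lemma degree_Pr: "degree (Pr j l) \<le> l"
  unfolding Pr_def by (rule degree_sum_le) (auto intro: order_trans [OF degree_monom_le])

lemma gam_0_0: "gam 0 0 = 1"
proof -
  have "gam 0 0 = (\<integral>y. indicator {0..} y * exp (- 1 * y) \<partial>lborel)"
    unfolding gam_def
    by (intro integral_cong_AE) (use AE_lborel_singleton [of "0::real"] in \<open>auto simp: indicator_def elim!: eventually_mono\<close>)
  thus ?thesis using exp_integrable_lborel(2) [of 1] by simp
qed

lemma coeff_Pr: "coeff (Pr 0 l) l = 1"
proof -
  have "coeff (Pr 0 l) l = (\<Sum>i\<le>l. if i = 0 then 1 else 0)"
    unfolding Pr_def coeff_sum by (rule sum.cong) (auto simp: gam_0_0)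
  thus ?thesis by simp
qed

text \<open>After the substitution \<open>r = y / X\<close> the integral extends over
  \<open>0 < y < X\<close>. Over all positive \<open>y\<close> it would be exactly the polynomial in
  \<open>ln X\<close>, so the error is the tail \<open>y \<ge> X\<close>, which is exponentially
  small.\<close>

lemma Er_asymp:
  obtains B where "\<And>X. X \<ge> 1 \<Longrightarrow> \<bar>Er j l X - poly (Pr j l) (ln X) / X ^ Suc j\<bar> \<le> B * exp (- X / 2)"
proof -
  \<comment> \<open>Powers of \<open>y\<close> are absorbed by \<open>exp (y / 4)\<close>. For
    \<open>y \<ge> X\<close> the remaining \<open>exp (- 3/4 * y)\<close> splits into
    \<open>exp (- X / 2)\<close> and the integrable \<open>exp (- y / 4)\<close>, whose integral 4
    accounts for the constant \<open>4 * C\<close>.\<close>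
  define C where "C = (fact (j + l) / (1/4) ^ (j + l) :: real)"
  have C: "C \<ge> 0" by (simp add: C_def)
  have "\<bar>Er j l X - poly (Pr j l) (ln X) / X ^ Suc j\<bar> \<le> (4 * C) * exp (- X / 2)" if X: "X \<ge> 1" for X
  proof -
    have X0: "X > 0" using X by simp
    define q where "q = (\<lambda>y. exp (- y) * y ^ j * (ln X - ln y) ^ l)"
    have q_eq: "indicator {0<..} y * q y = (\<Sum>i\<le>l. of_nat (l choose i) * ln X ^ (l - i) * (indicator {0<..} y * (exp (- y) * y ^ j * (- ln y) ^ i)))" for y
    proof -
      have "(ln X - ln y) ^ l = (- ln y + ln X) ^ l" by simp
      also have "\<dots> = (\<Sum>i\<le>l. of_nat (l choose i) * (- ln y) ^ i * ln X ^ (l - i))" by (rule binomial_ring)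
      finally show ?thesis unfolding q_def by (simp add: sum_distrib_left mult_ac)
    qed
    have int_q: "integrable lborel (\<lambda>y. indicator {0<..} y * q y)"
      unfolding q_eq by (intro Bochner_Integration.integrable_sum integrable_mult_right integrable_gam)
    have "(\<integral>y. indicator {0<..} y * q y \<partial>lborel) = (\<Sum>i\<le>l. of_nat (l choose i) * ln X ^ (l - i) * gam j i)"
      unfolding q_eq gam_def integral_mult_right_zero [symmetric]
      by (rule Bochner_Integration.integral_sum) (intro integrable_mult_right integrable_gam)
    also have "\<dots> = poly (Pr j l) (ln X)"
      by (simp add: Pr_def poly_sum poly_monom mult_ac)
    finally have full: "(\<integral>y. indicator {0<..} y * q y \<partial>lborel) = poly (Pr j l) (ln X)" .
    have "Er j l X = \<bar>1 / X\<bar> *\<^sub>R (\<integral>y. mlog j l (0 + (1 / X) * y) * exp (- (0 + (1 / X) * y) * X) \<partial>lborel)"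
      unfolding Er_def using X by (intro lborel_integral_real_affine) auto
    also have "(\<lambda>y. mlog j l (0 + (1 / X) * y) * exp (- (0 + (1 / X) * y) * X)) = (\<lambda>y. (1 / X ^ j) * (indicator {0<..<X} y * q y))"
    proof
      fix y
      show "mlog j l (0 + (1 / X) * y) * exp (- (0 + (1 / X) * y) * X) = (1 / X ^ j) * (indicator {0<..<X} y * q y)"
      proof (cases "0 < y \<and> y < X")
        case True
        hence "(- ln (y / X)) ^ l = (ln X - ln y) ^ l" using X0 by (simp add: ln_div)
        thus ?thesis using True X0 by (simp add: mlog_def q_def indicator_def power_divide field_simps)
      next
        case False
        hence "\<not> (0 < y / X \<and> y / X < 1)" using X0 by (auto simp: field_simps)
        thus ?thesis using False by (auto simp: mlog_def indicator_def)
      qed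
    qed
    finally have E: "Er j l X = (\<integral>y. indicator {0<..<X} y * q y \<partial>lborel) / X ^ Suc j"
      using X0 by (simp add: field_simps)
    have int_q': "integrable lborel (\<lambda>y. indicator {0<..<X} y * q y)"
    proof (rule Bochner_Integration.integrable_bound [OF int_q])
      show "AE y in lborel. norm (indicator {0<..<X} y * q y) \<le> norm (indicator {0<..} y * q y)"
        by (intro AE_I2) (auto simp: indicator_def)
    qed (auto simp: q_def)
    have "norm (\<integral>y. indicator {0<..<X} y * q y - indicator {0<..} y * q y \<partial>lborel) \<le>
       (\<integral>y. C * exp (- X / 2) * (indicator {0..} y * exp (- (1/4) * y)) \<partial>lborel)"
    proof (rule norm_integral_le)
      show "integrable lborel (\<lambda>y. indicator {0<..<X} y * q y - indicator {0<..} y * q y)"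
        by (intro Bochner_Integration.integrable_diff int_q int_q')
      show "integrable lborel (\<lambda>y. C * exp (- X / 2) * (indicator {0..} y * exp (- (1/4) * y)))"
        using exp_integrable_lborel [of "1/4"] by (intro integrable_mult_right) auto
      fix y :: real
      show "norm (indicator {0<..<X} y * q y - indicator {0<..} y * q y) \<le> C * exp (- X / 2) * (indicator {0..} y * exp (- (1/4) * y))"
      proof (cases "y \<ge> X")
        case True
        have "ln X \<le> ln y" "0 \<le> ln X" "ln y \<le> y" using True X0 X abs_ln_le [of y] by auto
        hence lnle: "0 \<le> ln y - ln X" "ln y - ln X \<le> y" by linarith+
        have "norm (q y) = exp (- y) * (y ^ j * \<bar>ln X - ln y\<bar> ^ l)"
          using True X0 by (simp add: q_def abs_mult power_abs)
        also have "\<dots> \<le> exp (- y) * (y ^ j * y ^ l)"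
          using True X0 lnle by (intro mult_left_mono power_mono) auto
        also have "\<dots> \<le> exp (- y) * (C * exp ((1/4) * y))"
          unfolding power_add [symmetric] C_def using True X0 by (intro mult_left_mono power_le_exp) auto
        also have "\<dots> = C * exp (- y + (1/4) * y)" by (simp only: exp_add mult_ac)
        also have "\<dots> \<le> C * exp (- X / 2 + - (1/4) * y)"
          using True C by (intro mult_left_mono) auto
        also have "\<dots> = C * exp (- X / 2) * exp (- (1/4) * y)" by (simp only: exp_add mult.assoc)
        finally show ?thesis using True X0 by (simp add: indicator_def)
      next
        case False
        hence "indicator {0<..<X} y = (indicator {0<..} y :: real)" by (auto simp: indicator_def)
        thus ?thesis using C by (simp add: indicator_def)
      qed
    qed
    also have "\<dots> = 4 * C * exp (- X / 2)"
      using exp_integrable_lborel(2) [of "1/4"] by simp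
    also have "(\<integral>y. indicator {0<..<X} y * q y - indicator {0<..} y * q y \<partial>lborel) =
        (\<integral>y. indicator {0<..<X} y * q y \<partial>lborel) - poly (Pr j l) (ln X)"
      using int_q int_q' by (simp add: Bochner_Integration.integral_diff full)
    finally have b: "\<bar>(\<integral>y. indicator {0<..<X} y * q y \<partial>lborel) - poly (Pr j l) (ln X)\<bar> \<le> 4 * C * exp (- X / 2)" by simp
    have "\<bar>Er j l X - poly (Pr j l) (ln X) / X ^ Suc j\<bar> = \<bar>(\<integral>y. indicator {0<..<X} y * q y \<partial>lborel) - poly (Pr j l) (ln X)\<bar> / X ^ Suc j"
      unfolding E diff_divide_distrib [symmetric] abs_divide using X0 by simp
    also have "\<dots> \<le> \<bar>(\<integral>y. indicator {0<..<X} y * q y \<partial>lborel) - poly (Pr j l) (ln X)\<bar> / 1"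
      using X by (intro divide_left_mono one_le_power) auto
    finally show ?thesis using b by simp
  qed
  thus ?thesis using that by blast
qed

section \<open>The transforms on the plane without the nonpositive real axis\<close>

definition slit :: "complex set" where
  "slit = {w. Re w > 0} \<union> {w. Im w > 0} \<union> {w. Im w < 0}"

lemma open_slit: "open slit"
  unfolding slit_def by (intro open_Un open_halfspace_Re_gt open_halfspace_Im_gt open_halfspace_Im_lt)

lemma rhp_subset_slit: "rhp \<subseteq> slit"
  by (auto simp: rhp_def slit_def)

lemma slit_gap:
  assumes "w \<in> slit"
  obtains d where "d > 0" "\<And>r. r \<ge> 0 \<Longrightarrow> norm (w + of_real r) \<ge> d"
proof (cases "Re w > 0")
  case True
  have "norm (w + of_real r) \<ge> Re w" if "r \<ge> 0" for r
    using abs_Re_le_cmod [of "w + of_real r"] that True by simp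
  thus ?thesis using True that by blast
next
  case False
  hence "\<bar>Im w\<bar> > 0" using assms by (auto simp: slit_def)
  moreover have "norm (w + of_real r) \<ge> \<bar>Im w\<bar>" for r
    using abs_Im_le_cmod [of "w + of_real r"] by simp
  ultimately show ?thesis using that by blast
qed

lemma integrable_Dr:
  fixes w :: complex
  assumes d: "d > 0" "\<And>r. r \<ge> 0 \<Longrightarrow> norm (w + of_real r) \<ge> d"
  shows "integrable lborel (\<lambda>r. of_real (mlog j l r) / (w + of_real r) ^ n)"
proof (rule Bochner_Integration.integrable_bound)
  show "integrable lborel (\<lambda>r. mlog j l r / d ^ n)" by simp
  show "AE r in lborel. norm (of_real (mlog j l r) / (w + of_real r) ^ n) \<le> norm (mlog j l r / d ^ n)"
  proof (rule AE_I2)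
    fix r
    show "norm (of_real (mlog j l r) / (w + of_real r) ^ n) \<le> norm (mlog j l r / d ^ n)"
    proof (cases "mlog j l r = 0")
      case False
      hence "r \<ge> 0" using mlog_supp [of j l r] by simp
      hence "d ^ n \<le> norm (w + of_real r) ^ n" using d by (intro power_mono) auto
      thus ?thesis using d(1) by (simp add: norm_divide norm_power frac_le)
    qed auto
  qed
qed measurable

lemma norm_Dr_le:
  assumes d: "d > 0" "\<And>r. r \<ge> 0 \<Longrightarrow> norm (w + of_real r) \<ge> d"
  shows "norm (Dr j l w) \<le> Im1 j l / d"
proof -
  have "norm (Dr j l w) \<le> (\<integral>r. mlog j l r / d \<partial>lborel)"
    unfolding Dr_def
  proof (rule norm_integral_le)
    show "integrable lborel (\<lambda>r. of_real (mlog j l r) / (w + of_real r))"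
      using integrable_Dr [OF d, of j l 1] by simp
    fix r
    show "norm (of_real (mlog j l r) / (w + of_real r)) \<le> mlog j l r / d"
    proof (cases "mlog j l r = 0")
      case False
      hence "r \<ge> 0" using mlog_supp [of j l r] by simp
      thus ?thesis using d by (simp add: norm_divide frac_le)
    qed auto
  qed simp
  thus ?thesis by (simp add: Im1_def)
qed

lemma Dr_has_field_derivative:
  assumes w: "w \<in> slit"
  shows "(Dr j l has_field_derivative - (\<integral>r. of_real (mlog j l r) / (w + of_real r) ^ 2 \<partial>lborel)) (at w)"
proof -
  obtain d where d: "d > 0" "\<And>r. r \<ge> 0 \<Longrightarrow> norm (w + of_real r) \<ge> d" using slit_gap [OF w] by blast
  define P where "P = (\<integral>r. of_real (mlog j l r) / (w + of_real r) ^ 2 \<partial>lborel)"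
  have bound: "norm ((Dr j l (w + h) - Dr j l w) / h + P) \<le> norm h * (Im1 j l / (d / 2 * d ^ 2))"
    if h: "h \<noteq> 0" "norm h < d / 2" for h
  proof -
    have dh: "norm (w + h + of_real r) \<ge> d / 2" if "r \<ge> 0" for r
      using d(2) [OF that] norm_triangle_ineq2 [of "w + of_real r" "- h"] h(2) by (simp add: algebra_simps)
    have d2: "d / 2 > 0" using d by simp
    let ?f = "\<lambda>r. (of_real (mlog j l r) / (w + h + of_real r) - of_real (mlog j l r) / (w + of_real r)) / h + of_real (mlog j l r) / (w + of_real r) ^ 2"
    note i1 = integrable_Dr [OF d2 dh, of j l 1, simplified]
    note i2 = integrable_Dr [OF d, of j l 1, simplified]
    note i3 = integrable_Dr [OF d, of j l 2]
    have i12: "integrable lborel (\<lambda>r. (of_real (mlog j l r) / (w + h + of_real r) - of_real (mlog j l r) / (w + of_real r)) / h)"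
      by (intro integrable_divide Bochner_Integration.integrable_diff i1 i2)
    have "(Dr j l (w + h) - Dr j l w) / h + P = (\<integral>r. ?f r \<partial>lborel)"
      unfolding P_def Dr_def
      by (simp only: Bochner_Integration.integral_add [OF i12 i3] integral_divide_zero
          Bochner_Integration.integral_diff [OF i1 i2])
    also have "norm \<dots> \<le> (\<integral>r. norm h * (mlog j l r / (d / 2 * d ^ 2)) \<partial>lborel)"
    proof (rule norm_integral_le)
      show "integrable lborel ?f" by (rule Bochner_Integration.integrable_add [OF i12 i3])
      show "integrable lborel (\<lambda>r. norm h * (mlog j l r / (d / 2 * d ^ 2)))" by simp
      fix r
      show "norm (?f r) \<le> norm h * (mlog j l r / (d / 2 * d ^ 2))"
      proof (cases "mlog j l r = 0")
        case False
        hence r: "r \<ge> 0" using mlog_supp [of j l r] by simp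
        define x where "x = w + of_real r"
        define y where "y = w + h + of_real r"
        have xy: "norm x \<ge> d" "norm y \<ge> d / 2" using d(2) dh r by (auto simp: x_def y_def)
        have nz: "x \<noteq> 0" "y \<noteq> 0" using xy d by auto
        have yx: "y = x + h" by (simp add: x_def y_def)
        have "(of_real (mlog j l r) / y - of_real (mlog j l r) / x) / h + of_real (mlog j l r) / x ^ 2 = h * (of_real (mlog j l r) / (y * x ^ 2))"
          using nz h unfolding yx by (simp add: divide_simps power2_eq_square) (simp add: algebra_simps)
        also have "norm \<dots> = norm h * (mlog j l r / (norm y * norm x ^ 2))"
          by (simp add: norm_mult norm_divide norm_power)
        also have "\<dots> \<le> norm h * (mlog j l r / (d / 2 * d ^ 2))"
          using xy d by (intro mult_left_mono divide_left_mono mult_mono power_mono mult_pos_pos) auto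
        finally show ?thesis by (simp add: x_def y_def)
      qed auto
    qed
    also have "\<dots> = norm h * (Im1 j l / (d / 2 * d ^ 2))" by (simp add: Im1_def)
    finally show ?thesis .
  qed
  define K where "K = Im1 j l / (d / 2 * d ^ 2)"
  have "((\<lambda>h. (Dr j l (w + h) - Dr j l w) / h + P) \<longlongrightarrow> 0) (at 0)"
  proof (rule Lim_null_comparison)
    show "\<forall>\<^sub>F h in at 0. norm ((Dr j l (w + h) - Dr j l w) / h + P) \<le> norm h * K"
      unfolding eventually_at using d by (intro exI[of _ "d/2"]) (auto intro!: bound [folded K_def])
    show "((\<lambda>h. norm h * K) \<longlongrightarrow> 0) (at (0::complex))"
      by (auto intro!: tendsto_eq_intros)
  qed
  hence "((\<lambda>h. ((Dr j l (w + h) - Dr j l w) / h + P) - P) \<longlongrightarrow> 0 - P) (at 0)"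
    by (rule tendsto_diff) simp
  thus ?thesis unfolding DERIV_def P_def by simp
qed

lemma Dr_holomorphic: "Dr j l holomorphic_on slit"
  unfolding holomorphic_on_open [OF open_slit] using Dr_has_field_derivative by blast

text \<open>From \<open>w / (w + r) = 1 - r / (w + r)\<close>: multiplication by \<open>w\<close>
  raises \<open>j\<close> by one and changes the sign, up to a constant.\<close>

lemma Dr_Suc:
  assumes w: "w \<in> rhp"
  shows "w * Dr j l w = of_real (Im1 j l) - Dr (Suc j) l w"
proof -
  obtain d where d: "d > 0" "\<And>r. r \<ge> 0 \<Longrightarrow> norm (w + of_real r) \<ge> d"
    using slit_gap w rhp_subset_slit by blast
  note i = integrable_Dr [OF d, of _ _ 1, simplified]
  have "Dr (Suc j) l w + w * Dr j l w = (\<integral>r. of_real (mlog (Suc j) l r) / (w + of_real r) + w * (of_real (mlog j l r) / (w + of_real r)) \<partial>lborel)"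
    unfolding Dr_def
    by (simp only: Bochner_Integration.integral_add [OF i integrable_mult_right [OF i]] integral_mult_right_zero)
  also have "\<dots> = (\<integral>r. of_real (mlog j l r) \<partial>lborel)"
  proof (rule Bochner_Integration.integral_cong [OF refl])
    fix r
    show "of_real (mlog (Suc j) l r) / (w + of_real r) + w * (of_real (mlog j l r) / (w + of_real r)) = complex_of_real (mlog j l r)"
    proof (cases "mlog j l r = 0")
      case False
      hence "r \<ge> 0" using mlog_supp [of j l r] by simp
      hence nz: "w + of_real r \<noteq> 0" using d by force
      have "of_real (mlog (Suc j) l r) / (w + of_real r) + w * (of_real (mlog j l r) / (w + of_real r)) =
         of_real (mlog j l r) * (w + of_real r) / (w + of_real r)"
        by (simp add: mlog_Suc [symmetric] add_divide_distrib [symmetric] algebra_simps)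
      thus ?thesis using nz by simp
    qed (simp add: mlog_Suc [symmetric])
  qed
  also have "\<dots> = of_real (Im1 j l)" by (simp add: Im1_def)
  finally show ?thesis by (simp add: algebra_simps)
qed

lemma mlog_integral_FTC:
  fixes F f :: "real \<Rightarrow> complex"
  assumes int: "integrable lborel (\<lambda>r. indicator {0<..<1} r *\<^sub>R f r)"
    and F: "\<And>r. 0 < r \<Longrightarrow> r < 1 \<Longrightarrow> (F has_vector_derivative f r) (at r)"
    and c: "continuous_on {0..1} F"
  shows "(\<integral>r. indicator {0<..<1} r *\<^sub>R f r \<partial>lborel) = F 1 - F 0"
proof -
  have "(f has_integral (F 1 - F 0)) {0..1}"
    by (rule fundamental_theorem_of_calculus_interior) (use F c in auto)
  hence "(f has_integral (F 1 - F 0)) {0<..<1}" by (simp add: has_integral_Icc_iff_Ioo)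
  moreover have "(LINT r:{0<..<1}|lborel. f r) = integral {0<..<1} f"
    by (rule set_borel_integral_eq_integral) (use int in \<open>simp add: set_integrable_def\<close>)
  ultimately show ?thesis by (simp add: set_lebesgue_integral_def integral_unique)
qed

lemma Dr_0_0_deriv:
  assumes w: "w \<in> rhp"
  shows "(Dr 0 0 has_field_derivative 1 / (1 + w) - 1 / w) (at w)"
proof -
  have ws: "w \<in> slit" using w rhp_subset_slit by blast
  obtain d where d: "d > 0" "\<And>r. r \<ge> 0 \<Longrightarrow> norm (w + of_real r) \<ge> d" using slit_gap [OF ws] by blast
  have nz: "w + of_real r \<noteq> 0" if "r \<ge> 0" for r using d that by force
  have "(\<integral>r. of_real (mlog 0 0 r) / (w + of_real r) ^ 2 \<partial>lborel) = (\<integral>r. indicator {0<..<1} r *\<^sub>R (1 / (w + of_real r) ^ 2) \<partial>lborel)"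
    by (rule Bochner_Integration.integral_cong) (auto simp: mlog_def indicator_def)
  also have "\<dots> = (- 1 / (w + of_real 1)) - (- 1 / (w + of_real 0))"
  proof (rule mlog_integral_FTC)
    show "integrable lborel (\<lambda>r. indicator {0<..<1} r *\<^sub>R (1 / (w + of_real r) ^ 2))"
      using integrable_Dr [OF d, of 0 0 2]
      by (rule Bochner_Integration.integrable_cong [THEN iffD1, rotated -1]) (auto simp: mlog_def indicator_def)
    show "((\<lambda>r. - 1 / (w + of_real r)) has_vector_derivative 1 / (w + of_real r) ^ 2) (at r)" if "0 < r" for r
    proof -
      have "((\<lambda>z. - 1 / (w + z)) has_field_derivative 1 / (w + of_real r) ^ 2) (at (of_real r))"
        using nz [of r] that by (auto intro!: derivative_eq_intros simp: power2_eq_square field_simps)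
      thus ?thesis by (rule has_vector_derivative_real_field)
    qed
    show "continuous_on {0..1} (\<lambda>r. - 1 / (w + complex_of_real r))"
      by (intro continuous_intros) (use nz in auto)
  qed
  also have "\<dots> = - (1 / (1 + w) - 1 / w)" by (simp add: add.commute)
  finally show ?thesis using Dr_has_field_derivative [OF ws, of 0 0] by simp
qed

lemma r_power_ln_tendsto: "((\<lambda>r. r * (- ln r) ^ l) \<longlongrightarrow> 0) (at_right (0::real))"
proof (rule Lim_null_comparison)
  show "((\<lambda>r::real. fact l * 2 ^ l * sqrt r) \<longlongrightarrow> 0) (at_right 0)"
    by (auto intro!: tendsto_eq_intros)
  have "\<forall>\<^sub>F r::real in at_right 0. 0 < r \<and> r < 1"
    using eventually_at_right_less [of "0::real"] eventually_at_right_real [of 0 "1::real"]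
    by (auto elim: eventually_mono)
  thus "\<forall>\<^sub>F r::real in at_right 0. norm (r * (- ln r) ^ l) \<le> fact l * 2 ^ l * sqrt r"
  proof eventually_elim
    case (elim r)
    have "norm (r * (- ln r) ^ l) = r * (- ln r) ^ l"
      using elim by (simp add: abs_mult power_abs)
    also have "\<dots> \<le> r * (fact l * 2 ^ l * r powr (- 1/2))"
      using elim by (intro mult_left_mono power_neg_ln_le) auto
    also have "r * (fact l * 2 ^ l * r powr (- 1/2)) = fact l * 2 ^ l * (r powr 1 * r powr (- 1/2))"
      using elim by simp
    also have "r powr 1 * r powr (- 1/2) = sqrt r"
      unfolding powr_add [symmetric] using elim by (simp add: powr_half_sqrt)
    finally show ?case .
  qed
qed

text \<open>Integration by parts with \<open>r * (- ln r) ^ Suc l / (w + r)\<close>, which vanishes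
  at both ends of the interval. The resulting relation is the one satisfied by the powers of
  \<open>Lg\<close> (\<open>Lg_power_deriv\<close>), and this makes the two families comparable by
  induction.\<close>

lemma Dr_0_Suc_deriv:
  assumes w: "w \<in> rhp"
  shows "(Dr 0 (Suc l) has_field_derivative - (of_nat (Suc l) / w * Dr 0 l w)) (at w)"
proof -
  have ws: "w \<in> slit" using w rhp_subset_slit by blast
  have w0: "w \<noteq> 0" using w by (auto simp: rhp_def)
  obtain d where d: "d > 0" "\<And>r. r \<ge> 0 \<Longrightarrow> norm (w + of_real r) \<ge> d" using slit_gap [OF ws] by blast
  have nz: "w + of_real r \<noteq> 0" if "r \<ge> 0" for r using d that by force
  define P where "P = (\<integral>r. of_real (mlog 0 (Suc l) r) / (w + of_real r) ^ 2 \<partial>lborel)"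
  \<comment> \<open>The factor \<open>r\<close> makes the boundary value at 0 vanish in spite of the
    logarithms; at 1 the logarithm vanishes. Since \<open>r / (w + r)\<close> has derivative
    \<open>w / (w + r) ^ 2\<close>, the integrand of the derivative of \<open>Dr\<close> appears
    multiplied by \<open>w\<close>.\<close>
  define F where "F = (\<lambda>r. of_real (r * (- ln r) ^ Suc l) / (w + complex_of_real r))"
  define f where "f = (\<lambda>r. w * (of_real ((- ln r) ^ Suc l) / (w + of_real r) ^ 2) - of_nat (Suc l) * (of_real ((- ln r) ^ l) / (w + complex_of_real r)))"
  note i1 = integrable_Dr [OF d, of 0 "Suc l" 2]
  note i2 = integrable_Dr [OF d, of 0 l 1, simplified]
  have eq: "indicator {0<..<1} r *\<^sub>R f r = w * (of_real (mlog 0 (Suc l) r) / (w + of_real r) ^ 2) - of_nat (Suc l) * (of_real (mlog 0 l r) / (w + of_real r))" for r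
    by (auto simp: f_def mlog_def indicator_def)
  have "w * P - of_nat (Suc l) * Dr 0 l w = (\<integral>r. indicator {0<..<1} r *\<^sub>R f r \<partial>lborel)"
    unfolding eq P_def Dr_def
    by (simp only: Bochner_Integration.integral_diff [OF integrable_mult_right [OF i1] integrable_mult_right [OF i2]]
        integral_mult_right_zero)
  also have "\<dots> = F 1 - F 0"
  proof (rule mlog_integral_FTC)
    show "integrable lborel (\<lambda>r. indicator {0<..<1} r *\<^sub>R f r)"
      unfolding eq using i1 i2 by (intro Bochner_Integration.integrable_diff integrable_mult_right)
    show "(F has_vector_derivative f r) (at r)" if r: "0 < r" "r < 1" for r
    proof -
      have 1: "((\<lambda>r. complex_of_real (r * (- ln r) ^ Suc l)) has_vector_derivative of_real ((- ln r) ^ Suc l - of_nat (Suc l) * (- ln r) ^ l)) (at r)"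
      proof (rule has_vector_derivative_of_real)
        have "((\<lambda>r. - ln r) has_real_derivative - (1 / r)) (at r)"
          using r by (auto intro!: derivative_eq_intros)
        from DERIV_mult [OF DERIV_ident DERIV_power_Suc [OF this, of l]]
        show "((\<lambda>r. r * (- ln r) ^ Suc l) has_real_derivative ((- ln r) ^ Suc l - of_nat (Suc l) * (- ln r) ^ l)) (at r)"
          by (rule DERIV_cong) (use r in \<open>simp add: field_simps\<close>)
      qed
      have 2: "((\<lambda>r. 1 / (w + complex_of_real r)) has_vector_derivative - (1 / (w + of_real r) ^ 2)) (at r)"
      proof -
        have "((\<lambda>z. 1 / (w + z)) has_field_derivative - (1 / (w + of_real r) ^ 2)) (at (of_real r))"
          using nz [of r] r by (auto intro!: derivative_eq_intros simp: power2_eq_square field_simps)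
        thus ?thesis by (rule has_vector_derivative_real_field)
      qed
      have "((\<lambda>r. of_real (r * (- ln r) ^ Suc l) * (1 / (w + complex_of_real r))) has_vector_derivative
         of_real (r * (- ln r) ^ Suc l) * - (1 / (w + of_real r) ^ 2) + of_real ((- ln r) ^ Suc l - of_nat (Suc l) * (- ln r) ^ l) * (1 / (w + complex_of_real r))) (at r)"
        by (rule has_vector_derivative_mult [OF 1 2])
      also have "of_real (r * (- ln r) ^ Suc l) * - (1 / (w + of_real r) ^ 2) + of_real ((- ln r) ^ Suc l - of_nat (Suc l) * (- ln r) ^ l) * (1 / (w + complex_of_real r)) = f r"
      proof -
        have *: "of_real (x * y) * - (1 / z ^ 2) + of_real (y - n * q) * (1 / z) = w * (of_real y / z ^ 2) - of_real n * (of_real q / z)"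
          if "z = w + of_real x" "z \<noteq> 0" for x y n q :: real and z
          using that(2) unfolding of_real_mult of_real_diff
          by (simp add: divide_simps power2_eq_square) (simp add: that(1) algebra_simps)
        show ?thesis unfolding f_def by (subst *) (use nz r in auto)
      qed
      finally show ?thesis unfolding F_def by (simp add: field_simps)
    qed
    show "continuous_on {0..1} F"
    proof -
      have "continuous_on {0..1} (\<lambda>r::real. r * (- ln r) ^ Suc l)"
        unfolding continuous_on_eq_continuous_within
      proof
        fix x :: real assume x: "x \<in> {0..1}"
        show "continuous (at x within {0..1}) (\<lambda>r. r * (- ln r) ^ Suc l)"
        proof (cases "x = 0")
          case True
          have "((\<lambda>r. r * (- ln r) ^ Suc l) \<longlongrightarrow> 0) (at (0::real) within {0..1})"
            by (rule tendsto_mono [OF _ r_power_ln_tendsto [of "Suc l"]])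
               (auto simp: at_within_Icc_at_right)
          thus ?thesis using True by (simp add: continuous_within)
        next
          case False
          hence "isCont (\<lambda>r. r * (- ln r) ^ Suc l) x" using x by (intro continuous_intros) auto
          thus ?thesis by (rule continuous_at_imp_continuous_at_within)
        qed
      qed
      hence c1: "continuous_on {0..1} (\<lambda>r. complex_of_real (r * (- ln r) ^ Suc l))" by (rule continuous_on_of_real)
      have c2: "continuous_on {0..1} (\<lambda>r. w + complex_of_real r)" by (intro continuous_intros)
      show ?thesis unfolding F_def by (rule continuous_on_divide [OF c1 c2]) (use nz in auto)
    qed
  qed
  also have "F 1 - F 0 = 0" by (simp add: F_def)
  finally have "P = of_nat (Suc l) / w * Dr 0 l w" using w0 by (simp add: field_simps)
  thus ?thesis using Dr_has_field_derivative [OF ws, of 0 "Suc l"] by (simp add: P_def)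
qed

subsection \<open>Matching the singularity at the origin\<close>

definition near0 :: "(complex \<Rightarrow> complex) \<Rightarrow> (complex \<Rightarrow> complex) \<Rightarrow> bool" where
  "near0 f g \<longleftrightarrow> (\<forall>\<^sub>F w in nhds 0. w \<in> rhp \<longrightarrow> f w = g w)"

lemma near0I: "(\<And>w. w \<in> rhp \<Longrightarrow> f w = g w) \<Longrightarrow> near0 f g"
  by (simp add: near0_def)

lemma near0_trans: "near0 f g \<Longrightarrow> near0 g h \<Longrightarrow> near0 f h"
  unfolding near0_def by (auto elim: eventually_elim2)

lemma near0_add: "near0 f f' \<Longrightarrow> near0 g g' \<Longrightarrow> near0 (\<lambda>w. f w + g w) (\<lambda>w. f' w + g' w)"
  unfolding near0_def by (auto elim: eventually_elim2)

lemma near0_mult: "near0 f f' \<Longrightarrow> near0 g g' \<Longrightarrow> near0 (\<lambda>w. f w * g w) (\<lambda>w. f' w * g' w)"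
  unfolding near0_def by (auto elim: eventually_elim2)

lemma near0_refl: "near0 f f"
  by (simp add: near0_def)

lemma near0_sum:
  assumes "\<And>i. i \<in> I \<Longrightarrow> near0 (f i) (g i)"
  shows "near0 (\<lambda>w. \<Sum>i\<in>I. f i w) (\<lambda>w. \<Sum>i\<in>I. g i w)"
  using assms by (induction I rule: infinite_finite_induct) (auto intro: near0_add near0_refl)

text \<open>Removing the singularity of the difference quotient supplies the analytic factor
  \<open>g\<close>; each use trades a constant term for a power of \<open>w\<close>.\<close>

lemma analytic0_quotient:
  assumes "h analytic_on {0}"
  obtains g where "g analytic_on {0}" "\<And>w. h w = h 0 + w * g w"
proof -
  obtain S where S: "open S" "0 \<in> S" "h holomorphic_on S" using assms by (auto simp: analytic_at)
  define g where "g = (\<lambda>z. if z = 0 then deriv h 0 else (h z - h 0) / (z - 0))"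
  have "g holomorphic_on S" unfolding g_def by (rule pole_lemma_open [OF S(3,1)])
  hence "g analytic_on {0}" using S by (auto simp: analytic_at)
  moreover have "h w = h 0 + w * g w" for w by (simp add: g_def)
  ultimately show ?thesis using that by blast
qed

text \<open>Relations between derivatives can be integrated, because the constant of integration is
  absorbed into the analytic part \<open>h\<close>.\<close>

lemma near0_primitive:
  assumes f: "\<And>w. w \<in> rhp \<Longrightarrow> (f has_field_derivative f' w) (at w)"
    and u: "\<And>w. w \<in> rhp \<Longrightarrow> (u has_field_derivative u' w) (at w)"
    and g: "g analytic_on {0}" and eq: "near0 f' (\<lambda>w. u' w + g w)"
  obtains h where "h analytic_on {0}" "near0 f (\<lambda>w. u w + h w)"
proof -
  obtain S1 where S1: "open S1" "0 \<in> S1" "g holomorphic_on S1" using g by (auto simp: analytic_at)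
  obtain S2 where S2: "open S2" "0 \<in> S2" "\<And>w. w \<in> S2 \<Longrightarrow> w \<in> rhp \<Longrightarrow> f' w = u' w + g w"
    using eq unfolding near0_def eventually_nhds by blast
  have "open (S1 \<inter> S2)" "0 \<in> S1 \<inter> S2" using S1 S2 by auto
  then obtain r where r: "r > 0" "ball 0 r \<subseteq> S1 \<inter> S2" by (rule openE)
  have "g holomorphic_on ball 0 r" using S1(3) r(2) by (auto intro: holomorphic_on_subset)
  then obtain p where p: "\<And>w. w \<in> ball 0 r \<Longrightarrow> (p has_field_derivative g w) (at w within ball 0 r)"
    using holomorphic_convex_primitive' [OF convex_ball open_ball] by blast
  have p': "(p has_field_derivative g w) (at w)" if "w \<in> ball 0 r" for w
    using p [OF that] at_within_open [OF that open_ball] by simp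
  have "\<exists>c. \<forall>w\<in>rhp \<inter> ball 0 r. f w - u w - p w = c"
  proof (rule has_field_derivative_zero_constant)
    show "convex (rhp \<inter> ball 0 r)" by (intro convex_Int convex_rhp convex_ball)
    fix w assume w: "w \<in> rhp \<inter> ball 0 r"
    have "((\<lambda>w. f w - u w - p w) has_field_derivative f' w - u' w - g w) (at w)"
      using f [of w] u [of w] p' [of w] w by (intro DERIV_diff) auto
    moreover have "f' w - u' w - g w = 0" using S2(3) [of w] w r by auto
    ultimately show "((\<lambda>w. f w - u w - p w) has_field_derivative 0) (at w within rhp \<inter> ball 0 r)"
      by (simp add: has_field_derivative_at_within)
  qed
  then obtain c where c: "\<And>w. w \<in> rhp \<inter> ball 0 r \<Longrightarrow> f w - u w - p w = c" by blast
  have "p holomorphic_on ball 0 r" unfolding holomorphic_on_open [OF open_ball] using p' by blast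
  hence "p analytic_on {0}" using r by (auto simp: analytic_at intro!: exI[of _ "ball 0 r"])
  hence "(\<lambda>w. p w + c) analytic_on {0}" by (intro analytic_intros) auto
  moreover have "near0 f (\<lambda>w. u w + (p w + c))"
    unfolding near0_def eventually_nhds
    by (intro exI[of _ "ball 0 r"]) (use c r in \<open>auto simp: algebra_simps\<close>)
  ultimately show ?thesis using that by blast
qed

lemma Lg_power_deriv:
  assumes "w \<in> rhp"
  shows "((\<lambda>w. Lg w ^ Suc n) has_field_derivative - (of_nat (Suc n) / w * Lg w ^ n)) (at w)"
proof -
  have "((\<lambda>w. Lg w ^ Suc n) has_field_derivative (1 + of_nat n) * (- (1 / w) * Lg w ^ n)) (at w)"
    by (rule DERIV_power_Suc [OF Lg_has_field_derivative [OF assms]])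
  thus ?thesis by simp
qed

text \<open>Induction by integrating \<open>Dr_0_Suc_deriv\<close>: \<open>Lg ^ i / w\<close> has
  the primitive \<open>- Lg ^ Suc i / Suc i\<close>, so each step raises the degree by one and turns
  the leading coefficient \<open>1 / Suc l\<close> into \<open>1 / Suc (Suc l)\<close>.\<close>

lemma Dr_0_near0:
  "\<exists>a h. h analytic_on {0} \<and> a (Suc l) = 1 / of_nat (Suc l) \<and>
     near0 (Dr 0 l) (\<lambda>w. (\<Sum>i\<le>Suc l. a i * Lg w ^ i) + h w)"
proof (induction l)
  case 0
  have "(\<lambda>w. 1 / (1 + w)) analytic_on {0}" by (intro analytic_intros) auto
  from near0_primitive [OF Dr_0_0_deriv Lg_has_field_derivative this near0I]
  obtain h where h: "h analytic_on {0}" "near0 (Dr 0 0) (\<lambda>w. Lg w + h w)"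
    by (auto simp: algebra_simps)
  show ?case
    by (intro exI[of _ "\<lambda>i. if i = 1 then 1 else 0"] exI[of _ h]) (use h in simp)
next
  case (Suc l)
  then obtain a h where ah: "h analytic_on {0}" "a (Suc l) = 1 / of_nat (Suc l)"
     "near0 (Dr 0 l) (\<lambda>w. (\<Sum>i\<le>Suc l. a i * Lg w ^ i) + h w)" by blast
  obtain g where g: "g analytic_on {0}" "\<And>w. h w = h 0 + w * g w" using analytic0_quotient [OF ah(1)] by blast
  \<comment> \<open>The coefficients of the primitive. The additional summand at
    \<open>i = 1\<close> integrates \<open>h 0 / w\<close>, the part of \<open>h w / w\<close> that
    is singular; the rest \<open>g\<close> is analytic.\<close>
  define b where "b = (\<lambda>i. (if i = 0 then 0 else of_nat (Suc l) * a (i - 1) / of_nat i) + (if i = 1 then of_nat (Suc l) * h 0 else 0))"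
  define u where "u = (\<lambda>w. \<Sum>i\<le>Suc (Suc l). b i * Lg w ^ i)"
  have u_eq: "u w = (\<Sum>i\<le>Suc l. b (Suc i) * Lg w ^ Suc i)" for w
    unfolding u_def by (subst sum.atMost_Suc_shift) (simp add: b_def)
  have bS: "b (Suc i) * of_nat (Suc i) = of_nat (Suc l) * a i + (if i = 0 then of_nat (Suc l) * h 0 else 0)" for i
  proof -
    have "of_nat (Suc i) \<noteq> (0 :: complex)" by (simp only: of_nat_eq_0_iff)
    thus ?thesis by (simp add: b_def field_simps del: of_nat_Suc)
  qed
  have der_u: "(u has_field_derivative - (of_nat (Suc l) / w * ((\<Sum>i\<le>Suc l. a i * Lg w ^ i) + h 0))) (at w)" if w: "w \<in> rhp" for w
  proof -
    have "(u has_field_derivative (\<Sum>i\<le>Suc l. b (Suc i) * - (of_nat (Suc i) / w * Lg w ^ i))) (at w)"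
      unfolding u_eq [abs_def] by (intro DERIV_sum DERIV_cmult Lg_power_deriv w)
    also have "(\<Sum>i\<le>Suc l. b (Suc i) * - (of_nat (Suc i) / w * Lg w ^ i)) = - (\<Sum>i\<le>Suc l. (b (Suc i) * of_nat (Suc i)) * Lg w ^ i) / w"
      by (simp add: sum_negf sum_divide_distrib mult_ac del: of_nat_Suc sum.atMost_Suc)
    also have "(\<Sum>i\<le>Suc l. (b (Suc i) * of_nat (Suc i)) * Lg w ^ i) = of_nat (Suc l) * ((\<Sum>i\<le>Suc l. a i * Lg w ^ i) + h 0)"
    proof -
      have "(\<Sum>i\<le>Suc l. (b (Suc i) * of_nat (Suc i)) * Lg w ^ i) =
        (\<Sum>i\<le>Suc l. of_nat (Suc l) * (a i * Lg w ^ i)) + (\<Sum>i\<le>Suc l. (if i = 0 then of_nat (Suc l) * h 0 else 0))"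
        unfolding bS sum.distrib [symmetric] by (rule sum.cong) (auto simp: algebra_simps)
      also have "(\<Sum>i\<le>Suc l. (if i = 0 then of_nat (Suc l) * h 0 else 0)) = of_nat (Suc l) * h 0"
        by (subst sum.delta) auto
      finally show ?thesis by (simp only: sum_distrib_left distrib_left)
    qed
    finally show ?thesis by simp
  qed
  have eq: "near0 (\<lambda>w. - (of_nat (Suc l) / w * Dr 0 l w))
    (\<lambda>w. - (of_nat (Suc l) / w * ((\<Sum>i\<le>Suc l. a i * Lg w ^ i) + h 0)) + (- of_nat (Suc l) * g w))"
  proof -
    have "\<forall>\<^sub>F w in nhds 0. w \<in> rhp \<longrightarrow> Dr 0 l w = (\<Sum>i\<le>Suc l. a i * Lg w ^ i) + h w"
      using ah(3) by (simp add: near0_def)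
    thus ?thesis unfolding near0_def
    proof (rule eventually_mono, intro impI)
      fix w assume "w \<in> rhp \<longrightarrow> Dr 0 l w = (\<Sum>i\<le>Suc l. a i * Lg w ^ i) + h w" and w: "w \<in> rhp"
      hence D: "Dr 0 l w = (\<Sum>i\<le>Suc l. a i * Lg w ^ i) + h w" by blast
      have w0: "w \<noteq> 0" using w by (auto simp: rhp_def)
      have *: "- (n / w * (s + (x + w * y))) = - (n / w * (s + x)) + (- n * y)" for n s x y
        using w0 by (simp add: field_simps)
      show "- (of_nat (Suc l) / w * Dr 0 l w) =
        - (of_nat (Suc l) / w * ((\<Sum>i\<le>Suc l. a i * Lg w ^ i) + h 0)) + (- of_nat (Suc l) * g w)"
        unfolding D g(2) [of w] by (rule *)
    qed
  qed
  have "(\<lambda>w. - of_nat (Suc l) * g w) analytic_on {0}" using g(1) by (intro analytic_intros)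
  from near0_primitive [OF Dr_0_Suc_deriv der_u this eq]
  obtain h' where h': "h' analytic_on {0}" "near0 (Dr 0 (Suc l)) (\<lambda>w. u w + h' w)" by blast
  have "b (Suc (Suc l)) = 1 / of_nat (Suc (Suc l))"
    using ah(2) by (simp add: b_def del: of_nat_Suc)
  thus ?case using h' unfolding u_def by blast
qed

text \<open>Triangular inversion of \<open>Dr_0_near0\<close> from the top degree downwards. The
  factor \<open>of_nat k\<close> in the top coefficient undoes the leading coefficient
  \<open>1 / k\<close> of \<open>Dr 0 (k - 1)\<close>.\<close>

lemma Lg_poly_near0:
  "\<exists>e h. h analytic_on {0} \<and> (k \<ge> 1 \<longrightarrow> e (k - 1) = of_nat k * a k) \<and>
     near0 (\<lambda>w. \<Sum>l\<le>k. a l * Lg w ^ l) (\<lambda>w. (\<Sum>l<k. e l * Dr 0 l w) + h w)"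
proof (induction k arbitrary: a)
  case 0
  show ?case by (intro exI[of _ "\<lambda>_. 0"] exI[of _ "\<lambda>_. a 0"]) (simp add: near0_refl analytic_on_const)
next
  case (Suc k)
  obtain b h where bh: "h analytic_on {0}" "b (Suc k) = 1 / of_nat (Suc k)"
     "near0 (Dr 0 k) (\<lambda>w. (\<Sum>i\<le>Suc k. b i * Lg w ^ i) + h w)" using Dr_0_near0 [of k] by blast
  define c where "c = of_nat (Suc k) * a (Suc k)"
  obtain e h' where eh: "h' analytic_on {0}"
     "near0 (\<lambda>w. \<Sum>l\<le>k. (a l - c * b l) * Lg w ^ l) (\<lambda>w. (\<Sum>l<k. e l * Dr 0 l w) + h' w)"
    using Suc [of "\<lambda>l. a l - c * b l"] by blast
  have cb: "c * b (Suc k) = a (Suc k)" unfolding c_def bh(2) by (simp del: of_nat_Suc)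
  have "near0 (\<lambda>w. \<Sum>l\<le>Suc k. a l * Lg w ^ l) (\<lambda>w. (\<Sum>l<Suc k. (e(k := c)) l * Dr 0 l w) + (h' w - c * h w))"
    using bh(3) eh(2) unfolding near0_def
  proof eventually_elim
    case (elim w)
    show ?case
    proof
      assume w: "w \<in> rhp"
      have D: "Dr 0 k w = (\<Sum>i\<le>k. b i * Lg w ^ i) + b (Suc k) * Lg w ^ Suc k + h w" using elim(1) w by simp
      have E: "(\<Sum>l\<le>k. (a l - c * b l) * Lg w ^ l) = (\<Sum>l<k. e l * Dr 0 l w) + h' w" using elim(2) w by blast
      have S: "(\<Sum>l\<le>k. (a l - c * b l) * Lg w ^ l) = (\<Sum>l\<le>k. a l * Lg w ^ l) - c * (\<Sum>i\<le>k. b i * Lg w ^ i)"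
        by (simp add: left_diff_distrib sum_subtractf sum_distrib_left mult.assoc)
      have "(\<Sum>l<k. (e(k := c)) l * Dr 0 l w) = (\<Sum>l<k. e l * Dr 0 l w)" by (rule sum.cong) auto
      hence "(\<Sum>l<Suc k. (e(k := c)) l * Dr 0 l w) + (h' w - c * h w) =
         (\<Sum>l<k. e l * Dr 0 l w) + c * Dr 0 k w + (h' w - c * h w)" by simp
      also have "\<dots> = (\<Sum>l\<le>k. a l * Lg w ^ l) + (c * b (Suc k)) * Lg w ^ Suc k"
        unfolding D using E S by (simp add: algebra_simps)
      finally show "(\<Sum>l\<le>Suc k. a l * Lg w ^ l) = (\<Sum>l<Suc k. (e(k := c)) l * Dr 0 l w) + (h' w - c * h w)"
        unfolding cb by simp
    qed
  qed
  moreover have "(\<lambda>w. h' w - c * h w) analytic_on {0}" using bh(1) eh(1) by (intro analytic_intros)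
  ultimately show ?case
    by (intro exI[of _ "e(k := c)"] exI[of _ "\<lambda>w. h' w - c * h w"]) (simp add: c_def)
qed

text \<open>The values of the coefficients at the origin are matched by transforms; what remains of
  each coefficient has a factor \<open>w\<close>, and the same form recurs one order higher.\<close>

lemma singular_step:
  assumes g: "\<And>l. l \<le> k \<Longrightarrow> g l analytic_on {0}"
  shows "\<exists>e h g'. h analytic_on {0} \<and> (\<forall>l\<le>k. g' l analytic_on {0}) \<and>
     (k \<ge> 1 \<longrightarrow> e (k - 1) = of_nat k * g k 0) \<and>
     near0 (\<lambda>w. \<Sum>l\<le>k. Lg w ^ l * g l w) (\<lambda>w. (\<Sum>l<k. e l * Dr 0 l w) + h w + w * (\<Sum>l\<le>k. Lg w ^ l * g' l w))"
proof -
  have "\<forall>l. \<exists>q. l \<le> k \<longrightarrow> q analytic_on {0} \<and> (\<forall>w. g l w = g l 0 + w * q w)"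
    using analytic0_quotient g by metis
  then obtain q where q: "\<And>l. l \<le> k \<Longrightarrow> q l analytic_on {0}" "\<And>l w. l \<le> k \<Longrightarrow> g l w = g l 0 + w * q l w"
    by metis
  obtain e h where eh: "h analytic_on {0}" "k \<ge> 1 \<longrightarrow> e (k - 1) = of_nat k * g k 0"
     "near0 (\<lambda>w. \<Sum>l\<le>k. g l 0 * Lg w ^ l) (\<lambda>w. (\<Sum>l<k. e l * Dr 0 l w) + h w)"
    using Lg_poly_near0 [of k "\<lambda>l. g l 0"] by blast
  have "(\<Sum>l\<le>k. Lg w ^ l * g l w) = (\<Sum>l\<le>k. g l 0 * Lg w ^ l) + w * (\<Sum>l\<le>k. Lg w ^ l * q l w)" for w
    unfolding sum_distrib_left sum.distrib [symmetric]
  proof (rule sum.cong [OF refl])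
    fix l assume "l \<in> {..k}"
    hence e: "g l w = g l 0 + w * q l w" by (intro q(2)) simp
    show "Lg w ^ l * g l w = g l 0 * Lg w ^ l + w * (Lg w ^ l * q l w)"
      by (subst e) (simp add: algebra_simps)
  qed
  hence "near0 (\<lambda>w. \<Sum>l\<le>k. Lg w ^ l * g l w) (\<lambda>w. (\<Sum>l<k. e l * Dr 0 l w) + h w + w * (\<Sum>l\<le>k. Lg w ^ l * q l w))"
    using near0_add [OF eh(3) near0_refl [of "\<lambda>w. w * (\<Sum>l\<le>k. Lg w ^ l * q l w)"]] by simp
  thus ?thesis using q(1) eh by blast
qed

lemma Dr_shift:
  "\<exists>p. p analytic_on {0} \<and> (\<forall>w\<in>rhp. w ^ j * Dr 0 l w = (-1) ^ j * Dr j l w + p w)"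
proof (induction j)
  case 0
  show ?case by (intro exI[of _ "\<lambda>_. 0"]) (simp add: analytic_on_const)
next
  case (Suc j)
  then obtain p where p: "p analytic_on {0}" "\<And>w. w \<in> rhp \<Longrightarrow> w ^ j * Dr 0 l w = (-1) ^ j * Dr j l w + p w" by blast
  have "w ^ Suc j * Dr 0 l w = (-1) ^ Suc j * Dr (Suc j) l w + ((-1) ^ j * of_real (Im1 j l) + w * p w)" if w: "w \<in> rhp" for w
  proof -
    have "w ^ Suc j * Dr 0 l w = w * ((-1) ^ j * Dr j l w + p w)" using p(2) [OF w] by simp
    also have "\<dots> = (-1) ^ j * (w * Dr j l w) + w * p w" by (simp add: algebra_simps)
    finally show ?thesis unfolding Dr_Suc [OF w] by (simp add: algebra_simps)
  qed
  moreover have "(\<lambda>w. (-1) ^ j * of_real (Im1 j l) + w * p w) analytic_on {0}"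
    using p(1) by (intro analytic_intros)
  ultimately show ?case by blast
qed

text \<open>Iteration of \<open>singular_step\<close>, where \<open>Dr_shift\<close> turns
  \<open>w ^ j * Dr 0 l\<close> into \<open>Dr j l\<close> with the sign \<open>(-1) ^ j\<close>. A
  single family \<open>e\<close> serves all \<open>J\<close>, so that the polynomials obtained later
  do not depend on the order of truncation.\<close>

lemma singular_expansion:
  assumes g: "\<And>l. l \<le> k \<Longrightarrow> g l analytic_on {0}"
  shows "\<exists>e. (k \<ge> 1 \<longrightarrow> e 0 (k - 1) = of_nat k * g k 0) \<and>
     (\<forall>J. \<exists>h g'. h analytic_on {0} \<and> (\<forall>l\<le>k. g' l analytic_on {0}) \<and>
        near0 (\<lambda>w. \<Sum>l\<le>k. Lg w ^ l * g l w)
              (\<lambda>w. (\<Sum>j<J. \<Sum>l<k. e j l * Dr j l w) + h w + w ^ J * (\<Sum>l\<le>k. Lg w ^ l * g' l w)))"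
proof -
  define A where "A = {g. \<forall>l\<le>k. g l analytic_on {0::complex}}"
  define P where "P = (\<lambda>g e h g'. h analytic_on {0::complex} \<and> g' \<in> A \<and>
     (k \<ge> 1 \<longrightarrow> e (k - 1) = of_nat k * g k 0) \<and>
     near0 (\<lambda>w. \<Sum>l\<le>k. Lg w ^ l * g l w) (\<lambda>w. (\<Sum>l<k. e l * Dr 0 l w) + h w + w * (\<Sum>l\<le>k. Lg w ^ l * g' l w)))"
  have "\<forall>g\<in>A. \<exists>t. P g (fst t) (fst (snd t)) (snd (snd t))"
  proof
    fix g assume "g \<in> A"
    hence g: "\<And>l. l \<le> k \<Longrightarrow> g l analytic_on {0}" unfolding A_def by blast
    have "\<exists>e h g'. P g e h g'"
      using singular_step [OF g] unfolding P_def A_def mem_Collect_eq .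
    then obtain e h g' where "P g e h g'" by blast
    hence "P g (fst (e, h, g')) (fst (snd (e, h, g'))) (snd (snd (e, h, g')))" by (simp only: fst_conv snd_conv)
    thus "\<exists>t. P g (fst t) (fst (snd t)) (snd (snd t))" by (rule exI)
  qed
  \<comment> \<open>One choice function for the step determines the whole sequence of coefficient
    functions, and with it an \<open>e\<close> independent of \<open>J\<close>.\<close>
  from bchoice [OF this] obtain T where T: "\<forall>g\<in>A. P g (fst (T g)) (fst (snd (T g))) (snd (snd (T g)))" by blast
  define E where "E = (\<lambda>g. fst (T g))"
  define H where "H = (\<lambda>g. fst (snd (T g)))"
  define N where "N = (\<lambda>g. snd (snd (T g)))"
  have PN: "P g (E g) (H g) (N g)" if "g \<in> A" for g using T that unfolding E_def H_def N_def by blast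
  have N: "\<And>g. g \<in> A \<Longrightarrow> H g analytic_on {0}" "\<And>g. g \<in> A \<Longrightarrow> N g \<in> A"
     "\<And>g. g \<in> A \<Longrightarrow> k \<ge> 1 \<Longrightarrow> E g (k - 1) = of_nat k * g k 0"
     "\<And>g. g \<in> A \<Longrightarrow> near0 (\<lambda>w. \<Sum>l\<le>k. Lg w ^ l * g l w)
        (\<lambda>w. (\<Sum>l<k. E g l * Dr 0 l w) + H g w + w * (\<Sum>l\<le>k. Lg w ^ l * N g l w))"
    using PN unfolding P_def by blast+
  define G where "G = (\<lambda>j. (N ^^ j) g)"
  have GA: "G j \<in> A" for j unfolding G_def by (induction j) (use N(2) g in \<open>auto simp: A_def\<close>)
  define e where "e = (\<lambda>j l. E (G j) l * (-1) ^ j)"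
  have exp: "\<exists>h. h analytic_on {0} \<and> near0 (\<lambda>w. \<Sum>l\<le>k. Lg w ^ l * g l w)
              (\<lambda>w. (\<Sum>j<J. \<Sum>l<k. e j l * Dr j l w) + h w + w ^ J * (\<Sum>l\<le>k. Lg w ^ l * G J l w))" for J
  proof (induction J)
    case 0
    show ?case by (intro exI[of _ "\<lambda>_. 0"]) (simp add: near0_refl analytic_on_const G_def)
  next
    case (Suc J)
    then obtain h where h: "h analytic_on {0}" "near0 (\<lambda>w. \<Sum>l\<le>k. Lg w ^ l * g l w)
              (\<lambda>w. (\<Sum>j<J. \<Sum>l<k. e j l * Dr j l w) + h w + w ^ J * (\<Sum>l\<le>k. Lg w ^ l * G J l w))" by blast
    obtain p where p: "\<And>l. p l analytic_on {0}" "\<And>l w. w \<in> rhp \<Longrightarrow> w ^ J * Dr 0 l w = (-1) ^ J * Dr J l w + p l w"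
      using Dr_shift [of J] by metis
    define h' where "h' = (\<lambda>w. h w + (\<Sum>l<k. E (G J) l * p l w) + w ^ J * H (G J) w)"
    have "h' analytic_on {0}" unfolding h'_def
      by (intro analytic_intros h p N GA)
    moreover have "near0 (\<lambda>w. \<Sum>l\<le>k. Lg w ^ l * g l w)
              (\<lambda>w. (\<Sum>j<Suc J. \<Sum>l<k. e j l * Dr j l w) + h' w + w ^ Suc J * (\<Sum>l\<le>k. Lg w ^ l * G (Suc J) l w))"
      using h(2) N(4) [OF GA [of J]] unfolding near0_def
    proof eventually_elim
      case (elim w)
      show ?case
      proof
        assume w: "w \<in> rhp"
        have 1: "(\<Sum>l\<le>k. Lg w ^ l * g l w) = (\<Sum>j<J. \<Sum>l<k. e j l * Dr j l w) + h w + w ^ J * (\<Sum>l\<le>k. Lg w ^ l * G J l w)"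
          using elim(1) w by blast
        have 2: "(\<Sum>l\<le>k. Lg w ^ l * G J l w) = (\<Sum>l<k. E (G J) l * Dr 0 l w) + H (G J) w + w * (\<Sum>l\<le>k. Lg w ^ l * G (Suc J) l w)"
          using elim(2) w by (simp add: G_def)
        have "w ^ J * (\<Sum>l<k. E (G J) l * Dr 0 l w) = (\<Sum>l<k. E (G J) l * (w ^ J * Dr 0 l w))"
          by (simp add: sum_distrib_left mult_ac)
        also have "\<dots> = (\<Sum>l<k. e J l * Dr J l w) + (\<Sum>l<k. E (G J) l * p l w)"
          unfolding p(2) [OF w] e_def by (simp add: distrib_left sum.distrib mult_ac)
        finally have 3: "w ^ J * (\<Sum>l<k. E (G J) l * Dr 0 l w) = (\<Sum>l<k. e J l * Dr J l w) + (\<Sum>l<k. E (G J) l * p l w)" .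
        show "(\<Sum>l\<le>k. Lg w ^ l * g l w) =
          (\<Sum>j<Suc J. \<Sum>l<k. e j l * Dr j l w) + h' w + w ^ Suc J * (\<Sum>l\<le>k. Lg w ^ l * G (Suc J) l w)"
          unfolding 1 2 distrib_left 3 h'_def by (simp add: mult_ac)
      qed
    qed
    ultimately show ?case by blast
  qed
  have "G 0 = g" by (simp add: G_def)
  moreover have "k \<ge> 1 \<longrightarrow> e 0 (k - 1) = of_nat k * g k 0"
    using N(3) [OF GA [of 0]] by (simp add: e_def G_def)
  ultimately show ?thesis
  proof (intro exI[of _ e] conjI allI)
    fix J
    show "\<exists>h g'. h analytic_on {0} \<and> (\<forall>l\<le>k. g' l analytic_on {0}) \<and>
        near0 (\<lambda>w. \<Sum>l\<le>k. Lg w ^ l * g l w)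
              (\<lambda>w. (\<Sum>j<J. \<Sum>l<k. e j l * Dr j l w) + h w + w ^ J * (\<Sum>l\<le>k. Lg w ^ l * g' l w))"
      using exp [of J] GA [of J] unfolding A_def by blast
  qed auto
qed

text \<open>Discs around points close to the imaginary axis reach into \<open>Re w < 0\<close>, so
  Cauchy's estimate is applied on \<open>slit\<close>. At distance at least \<open>\<rho>\<close>
  from the origin, radius \<open>\<rho> / 2\<close> keeps them off the cut, where the denominators
  \<open>w + r\<close> could vanish.\<close>

lemma tame_Dr:
  assumes "\<rho> > 0"
  shows "tame {w\<in>strip. norm w \<ge> \<rho>} (Dr j l)"
proof (rule tame_Cauchy [where S = slit])
  show "{w\<in>strip. norm w \<ge> \<rho>} \<subseteq> rhp" using strip_subset_rhp by blast
  show "Dr j l holomorphic_on rhp" "Dr j l holomorphic_on slit"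
    using Dr_holomorphic holomorphic_on_subset rhp_subset_slit by blast+
  fix e :: real assume e: "e > 0"
  show "\<exists>r>0. \<exists>C. \<forall>w\<in>{w\<in>strip. norm w \<ge> \<rho>}. cball w r \<subseteq> slit \<and>
      (\<forall>z\<in>cball w r. norm (Dr j l z) \<le> C * (1 + \<bar>Im w\<bar>) powr e)"
  proof (rule exI[of _ "\<rho>/2"], intro conjI, use assms in simp, rule exI[of _ "Im1 j l / (\<rho>/2)"], intro ballI)
    fix w assume w: "w \<in> {w\<in>strip. norm w \<ge> \<rho>}"
    have wr: "norm (w + of_real r) \<ge> \<rho>" if "r \<ge> 0" for r
    proof -
      have "norm w ^ 2 \<le> norm (w + of_real r) ^ 2"
        unfolding cmod_power2 using w that by (simp add: strip_def power_mono)
      hence "norm w \<le> norm (w + of_real r)" by (rule power2_le_imp_le) simp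
      thus ?thesis using w by simp
    qed
    have zr: "norm (z + of_real r) \<ge> \<rho>/2" if "r \<ge> 0" "z \<in> cball w (\<rho>/2)" for z r
      using wr [OF that(1)] norm_triangle_ineq2 [of "w + of_real r" "w - z"] that(2) by (simp add: dist_norm add.commute)
    show "cball w (\<rho>/2) \<subseteq> slit \<and> (\<forall>z\<in>cball w (\<rho>/2). norm (Dr j l z) \<le> Im1 j l / (\<rho>/2) * (1 + \<bar>Im w\<bar>) powr e)"
    proof (intro conjI ballI subsetI)
      fix z assume z: "z \<in> cball w (\<rho>/2)"
      show "z \<in> slit"
      proof (rule ccontr)
        assume "z \<notin> slit"
        hence "Re z \<le> 0" "z + of_real (- Re z) = 0" by (auto simp: slit_def complex_eq_iff)
        thus False using zr [OF _ z, of "- Re z"] assms by simp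
      qed
      have "norm (Dr j l z) \<le> Im1 j l / (\<rho>/2) * 1"
        using norm_Dr_le [of "\<rho>/2" z j l] zr [OF _ z] assms by simp
      also have "\<dots> \<le> Im1 j l / (\<rho>/2) * (1 + \<bar>Im w\<bar>) powr e"
        using e assms Im1_nonneg by (intro mult_left_mono ge_one_powr_ge_zero) auto
      finally show "norm (Dr j l z) \<le> Im1 j l / (\<rho>/2) * (1 + \<bar>Im w\<bar>) powr e" .
    qed
  qed
qed

lemma Lg_holomorphic: "Lg holomorphic_on slit"
  unfolding Lg_def
  by (intro holomorphic_intros) (auto simp: slit_def complex_nonpos_Reals_iff)

lemma slit_cball:
  assumes "Re w > 0" "d < norm w"
  shows "cball w d \<subseteq> slit"
proof
  fix z assume z: "z \<in> cball w d"
  show "z \<in> slit"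
  proof (rule ccontr)
    assume "z \<notin> slit"
    hence z': "Re z \<le> 0" "Im z = 0" by (auto simp: slit_def)
    have "(Re w)\<^sup>2 \<le> (Re w - Re z)\<^sup>2" using z' assms by (intro power_mono) auto
    hence "norm w ^ 2 \<le> norm (w - z) ^ 2"
      unfolding cmod_power2 using z' by simp
    hence "norm w \<le> norm (w - z)" by (rule power2_le_imp_le) simp
    thus False using z assms by (simp add: dist_norm)
  qed
qed

lemma tame_Lg:
  assumes \<rho>: "0 < \<rho>" "\<rho> \<le> 1"
  shows "tame {w\<in>strip. norm w \<ge> \<rho>} Lg"
proof (rule tame_Cauchy [where S = slit])
  show "{w\<in>strip. norm w \<ge> \<rho>} \<subseteq> rhp" using strip_subset_rhp by blast
  show "Lg holomorphic_on rhp" "Lg holomorphic_on slit"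
    using Lg_holomorphic holomorphic_on_subset rhp_subset_slit by blast+
  fix e :: real assume e: "e > 0"
  have "\<rho>/2 > 0" using \<rho> by simp
  then obtain C where C: "C \<ge> 0" "\<And>z. norm z \<ge> \<rho>/2 \<Longrightarrow> \<bar>Re z\<bar> \<le> 2 \<Longrightarrow> norm (Ln z) \<le> C * (1 + \<bar>Im z\<bar>) powr e"
    using slow_Ln [OF _ e] by blast
  show "\<exists>r>0. \<exists>C. \<forall>w\<in>{w\<in>strip. norm w \<ge> \<rho>}. cball w r \<subseteq> slit \<and>
      (\<forall>z\<in>cball w r. norm (Lg z) \<le> C * (1 + \<bar>Im w\<bar>) powr e)"
  proof (rule exI[of _ "\<rho>/2"], intro conjI, use \<rho> in simp, rule exI[of _ "C * 2 powr e"], intro ballI conjI)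
    fix w assume w: "w \<in> {w\<in>strip. norm w \<ge> \<rho>}"
    show "cball w (\<rho>/2) \<subseteq> slit" by (rule slit_cball) (use w \<rho> in \<open>auto simp: strip_def\<close>)
    fix z assume z: "z \<in> cball w (\<rho>/2)"
    have n: "norm z \<ge> \<rho>/2" using w z norm_triangle_ineq2 [of w "w - z"] by (simp add: dist_norm)
    have re: "\<bar>Re z\<bar> \<le> 2" and im: "\<bar>Im z\<bar> \<le> \<bar>Im w\<bar> + 1"
      using w z \<rho> abs_Re_le_cmod [of "w - z"] abs_Im_le_cmod [of "w - z"] by (auto simp: dist_norm strip_def)
    have "norm (Lg z) \<le> C * (1 + \<bar>Im z\<bar>) powr e" using C(2) [OF n re] by (simp add: Lg_def)
    also have "\<dots> \<le> C * (2 * (1 + \<bar>Im w\<bar>)) powr e" using im e C by (intro mult_left_mono powr_mono2) auto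
    also have "\<dots> = C * 2 powr e * (1 + \<bar>Im w\<bar>) powr e" by (simp only: powr_mult mult.assoc)
    finally show "norm (Lg z) \<le> C * 2 powr e * (1 + \<bar>Im w\<bar>) powr e" .
  qed
qed

text \<open>On the disc of radius \<open>|w| / 2\<close> around \<open>w\<close> the function is \<open>O(|w| ^ N)\<close>; apply Cauchy's estimate.\<close>

lemma singular_remainder_bound:
  assumes g: "\<And>l. l \<le> k \<Longrightarrow> g l analytic_on {0}" and JN: "J > N"
  obtains r C where "r > 0" "\<And>w. Re w > 0 \<Longrightarrow> norm w < r \<Longrightarrow>
    norm ((deriv ^^ N) (\<lambda>w. w ^ J * (\<Sum>l\<le>k. Lg w ^ l * g l w)) w) \<le> C"
proof -
  define F where "F = (\<lambda>w. w ^ J * (\<Sum>l\<le>k. Lg w ^ l * g l w))"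
  have "\<forall>l. \<exists>s B. l \<le> k \<longrightarrow> s > 0 \<and> g l holomorphic_on ball 0 s \<and> (\<forall>w\<in>ball 0 s. norm (g l w) \<le> B)"
  proof
    fix l
    show "\<exists>s B. l \<le> k \<longrightarrow> s > 0 \<and> g l holomorphic_on ball 0 s \<and> (\<forall>w\<in>ball 0 s. norm (g l w) \<le> B)"
    proof (cases "l \<le> k")
      case True
      obtain s where s: "s > 0" "g l holomorphic_on ball 0 s"
        using g [OF True] by (auto simp: analytic_on_def)
      have "g l holomorphic_on cball 0 (s/2)" using s by (auto intro: holomorphic_on_subset)
      hence "compact (g l ` cball 0 (s/2))"
        by (intro compact_continuous_image holomorphic_on_imp_continuous_on) auto
      then obtain B where B: "\<And>w. w \<in> cball 0 (s/2) \<Longrightarrow> norm (g l w) \<le> B"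
        using compact_imp_bounded bounded_iff by (metis (no_types, lifting) imageI)
      show ?thesis by (intro exI[of _ "s/2"] exI[of _ B]) (use s B in \<open>auto intro: holomorphic_on_subset\<close>)
    qed auto
  qed
  then obtain s B where sB: "\<And>l. l \<le> k \<Longrightarrow> s l > 0" "\<And>l. l \<le> k \<Longrightarrow> g l holomorphic_on ball 0 (s l)"
     "\<And>l w. l \<le> k \<Longrightarrow> w \<in> ball 0 (s l) \<Longrightarrow> norm (g l w) \<le> B l" by metis
  \<comment> \<open>For \<open>norm w < r\<close> the disc of radius \<open>norm w / 2\<close>
    around \<open>w\<close> stays below \<open>3/2 * r\<close> in norm, hence inside the unit disc
    and inside the domain of every \<open>g l\<close>.\<close>
  define r where "r = min (1/2) (Min (s ` {..k}) / 2)"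
  have r: "r > 0" "r \<le> 1/2" using sB(1) by (auto simp: r_def)
  have rs: "2 * r \<le> s l" if "l \<le> k" for l
  proof -
    have "Min (s ` {..k}) \<le> s l" using that by (intro Min_le) auto
    thus ?thesis by (simp add: r_def)
  qed
  define M where "M = (\<Sum>l\<le>k. 4 ^ l * fact l * 3 * \<bar>B l\<bar>)"
  have M: "M \<ge> 0" unfolding M_def by (intro sum_nonneg) auto
  \<comment> \<open>One factor \<open>z\<close> outweighs any power of the logarithm: with
    \<open>y = 1 - ln (norm z)\<close> one has \<open>exp y = exp 1 / norm z\<close> and
    \<open>y ^ l \<le> fact l * exp y\<close>. This consumes one of the \<open>J\<close> powers,
    hence the hypothesis \<open>J > N\<close>.\<close>
  have lnb: "norm z * norm (Lg z) ^ l \<le> 4 ^ l * fact l * 3" if z: "z \<noteq> 0" "norm z \<le> 1" for z l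
  proof -
    define y where "y = 1 - ln (norm z)"
    have "ln (norm z) \<le> 0" using z by simp
    hence y: "y \<ge> 1" and ay: "\<bar>ln (norm z)\<bar> + pi \<le> 4 * y" using pi_less_4 by (auto simp: y_def)
    have "norm (Lg z) \<le> \<bar>ln (norm z)\<bar> + pi" unfolding Lg_def norm_minus_cancel by (rule norm_Ln_le [OF z(1)])
    hence "norm (Lg z) ^ l \<le> (4 * y) ^ l" using ay by (intro power_mono) auto
    also have "\<dots> = 4 ^ l * y ^ l" by (rule power_mult_distrib)
    also have "\<dots> \<le> 4 ^ l * (fact l * exp y)" using y by (intro mult_left_mono power_le_fact_exp) auto
    also have "exp y = exp 1 / norm z" using z by (simp add: y_def exp_diff)
    also have "4 ^ l * (fact l * (exp 1 / norm z)) = (4 ^ l * fact l * exp 1) / norm z" by simp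
    finally have "norm z * norm (Lg z) ^ l \<le> 4 ^ l * fact l * exp 1" using z by (simp add: field_simps)
    also have "\<dots> \<le> 4 ^ l * fact l * 3" using exp_le by (intro mult_left_mono) auto
    finally show ?thesis .
  qed
  have Fb: "norm (F z) \<le> M * norm z ^ (J - 1)" if z: "z \<noteq> 0" "norm z \<le> 1" "norm z < 2 * r" for z
  proof -
    have J: "J = Suc (J - 1)" using JN by simp
    have "norm (F z) \<le> norm z ^ J * (\<Sum>l\<le>k. norm (Lg z ^ l * g l z))"
      unfolding F_def norm_mult [of "z ^ J"] norm_power [of z J] by (intro mult_left_mono norm_sum) auto
    also have "\<dots> = norm z ^ (J - 1) * (\<Sum>l\<le>k. (norm z * norm (Lg z) ^ l) * norm (g l z))"
      by (subst J) (simp add: norm_mult norm_power sum_distrib_left mult_ac)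
    also have "\<dots> \<le> norm z ^ (J - 1) * M"
      unfolding M_def
    proof (intro mult_left_mono sum_mono)
      fix l assume "l \<in> {..k}"
      hence l: "l \<le> k" by simp
      have "z \<in> ball 0 (s l)" using rs [OF l] z by simp
      from sB(3) [OF l this] have "norm (g l z) \<le> \<bar>B l\<bar>" by simp
      thus "norm z * norm (Lg z) ^ l * norm (g l z) \<le> 4 ^ l * fact l * 3 * \<bar>B l\<bar>"
        by (rule mult_mono [OF lnb [OF z(1,2)]]) auto
    qed auto
    finally show ?thesis by (simp add: mult.commute)
  qed
  have "norm ((deriv ^^ N) F w) \<le> fact N * M * 3 ^ N" if w: "Re w > 0" "norm w < r" for w
  proof -
    define d where "d = norm w / 2"
    have w0: "norm w > 0" using w by auto
    hence d: "d > 0" "d < norm w" by (auto simp: d_def)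
    have sub: "cball w d \<subseteq> slit" by (rule slit_cball) (use w d in auto)
    have nz: "norm z \<le> 3 * d" if "z \<in> cball w d" for z
      using that norm_triangle_ineq2 [of z w] by (simp add: dist_norm norm_minus_commute d_def)
    have d1: "3 * d \<le> 1" using w(2) r w0 unfolding d_def by linarith
    have d2: "3 * d < 2 * r" using w(2) r w0 unfolding d_def by linarith
    have "F holomorphic_on cball w d"
      unfolding F_def
    proof (intro holomorphic_intros)
      show "Lg holomorphic_on cball w d" using Lg_holomorphic sub by (rule holomorphic_on_subset)
      fix l assume "l \<in> {..k}"
      hence l: "l \<le> k" by simp
      have "cball w d \<subseteq> ball 0 (s l)" using nz d2 rs [OF l] by fastforce
      thus "g l holomorphic_on cball w d" using sB(2) [OF l] by (rule holomorphic_on_subset [rotated])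
    qed
    hence "norm ((deriv ^^ N) F w) \<le> fact N * (M * (3 * d) ^ N) / d ^ N"
    proof (intro Cauchy_inequality d(1))
      fix z assume "norm (w - z) = d"
      hence z: "z \<in> cball w d" by (simp add: dist_norm)
      have z0: "z \<noteq> 0" using z d by (auto simp: dist_norm)
      have "norm (F z) \<le> M * norm z ^ (J - 1)" using Fb [OF z0] nz [OF z] d1 d2 by simp
      also have "\<dots> \<le> M * norm z ^ N"
        using JN nz [OF z] d1 M by (intro mult_left_mono power_decreasing) auto
      also have "\<dots> \<le> M * (3 * d) ^ N" using nz [OF z] M by (intro mult_left_mono power_mono) auto
      finally show "norm (F z) \<le> M * (3 * d) ^ N" .
    qed (auto intro: holomorphic_on_imp_continuous_on elim: holomorphic_on_subset)
    also have "\<dots> = fact N * M * 3 ^ N" using d by (simp add: power_mult_distrib)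
    finally show ?thesis .
  qed
  thus ?thesis using that [OF r(1)] unfolding F_def by blast
qed

subsection \<open>The expansion\<close>

lemma sum_inverse_le_ln:
  assumes "p \<ge> 1" "p \<le> q"
  shows "(\<Sum>n=p..q. 1 / real n) \<le> 1 / real p + ln (real q) - ln (real p)"
  using assms(2)
proof (induction q rule: dec_induct)
  case (step q)
  have q: "real q > 0" using assms step by simp
  have "ln (real q / real (Suc q)) \<le> real q / real (Suc q) - 1"
    using q by (intro ln_le_minus_one) auto
  also have "\<dots> = - (1 / real (Suc q))" by (simp add: field_simps)
  also have "ln (real q / real (Suc q)) = ln (real q) - ln (real (Suc q))" using q by (subst ln_div) auto
  finally have "1 / real (Suc q) \<le> ln (real (Suc q)) - ln (real q)" by linarith
  moreover have "(\<Sum>n=p..Suc q. 1 / real n) = (\<Sum>n=p..q. 1 / real n) + 1 / real (Suc q)"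
    using step by simp
  ultimately show ?case using step.IH by linarith
qed auto

text \<open>The summand \<open>exp (- a)\<close> stands for one single term: however short the
  interval is, it may contain an integer. It is the origin of the term \<open>exp (- X / 2)\<close>
  in the Tauberian hypothesis.\<close>

lemma sum_inverse_exp_le:
  assumes "0 \<le> a" "a \<le> b"
  shows "(\<Sum>n | exp a < real n \<and> real n \<le> exp b. 1 / real n) \<le> (b - a) + exp (- a)"
proof -
  define p where "p = nat \<lfloor>exp a\<rfloor> + 1"
  define q where "q = nat \<lfloor>exp b\<rfloor>"
  have set: "{n. exp a < real n \<and> real n \<le> exp b} = {p..q}"
  proof (intro set_eqI iffI)
    fix n assume "n \<in> {n. exp a < real n \<and> real n \<le> exp b}"
    hence "\<lfloor>exp a\<rfloor> < int n" "int n \<le> \<lfloor>exp b\<rfloor>" by (simp_all add: floor_less_iff le_floor_iff)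
    thus "n \<in> {p..q}" by (auto simp: p_def q_def le_nat_iff nat_less_iff Suc_le_eq)
  next
    fix n assume "n \<in> {p..q}"
    moreover have "\<lfloor>exp a\<rfloor> \<ge> 0" "\<lfloor>exp b\<rfloor> \<ge> 0" by simp_all
    ultimately have "\<lfloor>exp a\<rfloor> < int n" "int n \<le> \<lfloor>exp b\<rfloor>" by (auto simp: p_def q_def)
    thus "n \<in> {n. exp a < real n \<and> real n \<le> exp b}" by (simp add: floor_less_iff le_floor_iff)
  qed
  show ?thesis
  proof (cases "p \<le> q")
    case False
    hence "{p..q} = {}" by simp
    thus ?thesis unfolding set using assms by simp
  next
    case True
    have "p \<in> {p..q}" "q \<in> {p..q}" using True by auto
    hence p: "exp a < real p" and q: "real q \<le> exp b" unfolding set [symmetric] by auto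
    have p0: "real p > 0" "real q > 0" using p True less_trans [OF exp_gt_zero [of a] p] by auto
    have "a \<le> ln (real p)" using p p0 by (simp add: ln_ge_iff)
    moreover have "ln (real q) \<le> b" using q p0 ln_le_cancel_iff [of "real q" "exp b"] by simp
    moreover have "1 / real p \<le> exp (- a)"
      using p p0 by (simp add: exp_minus field_simps)
    moreover have "p \<ge> 1" by (simp add: p_def)
    ultimately show ?thesis unfolding set using sum_inverse_le_ln [OF _ True] by force
  qed
qed

lemma finite_nat_le_real: "finite {n. P n \<and> real n \<le> x}"
proof (rule finite_subset)
  show "{n. P n \<and> real n \<le> x} \<subseteq> {..nat \<lfloor>x\<rfloor>}" by (auto simp: le_nat_floor)
qed auto

lemma m_omega_diff_le:
  assumes "0 \<le> a" "a \<le> b"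
  shows "\<bar>m_omega k (exp b) - m_omega k (exp a)\<bar> \<le> 2 ^ k * (1 + b) ^ k * ((b - a) + exp (- a))"
proof -
  define A where "A = {n. 1 \<le> n \<and> real n \<le> exp a}"
  define B where "B = {n. exp a < real n \<and> real n \<le> exp b}"
  have fin: "finite A" "finite B" unfolding A_def B_def by (rule finite_nat_le_real)+
  have pos: "n \<ge> 1" if "n \<in> B" for n
    using that less_trans [OF exp_gt_zero [of a]] by (auto simp: B_def Suc_le_eq intro: Nat.gr0I)
  have "{n. 1 \<le> n \<and> real n \<le> exp b} = A \<union> B"
    using assms pos order_trans [of "real _" "exp a" "exp b"] by (auto simp: A_def B_def)
  moreover have "A \<inter> B = {}" by (auto simp: A_def B_def)
  ultimately have "m_omega k (exp b) = m_omega k (exp a) + (\<Sum>n\<in>B. mu_omega_term k n)"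
    unfolding m_omega_def using fin by (simp add: sum.union_disjoint A_def)
  hence "\<bar>m_omega k (exp b) - m_omega k (exp a)\<bar> \<le> (\<Sum>n\<in>B. \<bar>mu_omega_term k n\<bar>)" by (simp add: sum_abs)
  also have "\<dots> \<le> (\<Sum>n\<in>B. 2 ^ k * (1 + b) ^ k * (1 / real n))"
  proof (rule sum_mono)
    fix n assume n: "n \<in> B"
    have n0: "n > 0" using pos [OF n] by simp
    have "ln (real n) \<le> b" using n n0 ln_le_cancel_iff [of "real n" "exp b"] by (simp add: B_def)
    hence "2 ^ k * (1 + ln (real n)) ^ k / real n \<le> 2 ^ k * (1 + b) ^ k / real n"
      by (intro divide_right_mono mult_left_mono power_mono) (auto simp: add_nonneg_nonneg)
    thus "\<bar>mu_omega_term k n\<bar> \<le> 2 ^ k * (1 + b) ^ k * (1 / real n)"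
      using abs_mu_omega_term_le [OF n0, of k] by simp
  qed
  also have "\<dots> = 2 ^ k * (1 + b) ^ k * (\<Sum>n\<in>B. 1 / real n)" by (simp only: sum_distrib_left)
  also have "\<dots> \<le> 2 ^ k * (1 + b) ^ k * ((b - a) + exp (- a))"
    unfolding B_def using assms by (intro mult_left_mono sum_inverse_exp_le) auto
  finally show ?thesis .
qed

lemma omega_1 [simp]: "omega (Suc 0) = 0"
  by (simp add: omega_def)

lemma m_omega_1: "k \<ge> 1 \<Longrightarrow> m_omega k 1 = 0"
proof -
  assume k: "k \<ge> 1"
  have "{n. 1 \<le> n \<and> real n \<le> 1} = {1::nat}" by auto
  thus ?thesis using k by (simp add: m_omega_def mu_omega_term_def)
qed

lemma m_omega_bound:
  assumes "k \<ge> 1" "0 \<le> v"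
  shows "\<bar>m_omega k (exp v)\<bar> \<le> 2 ^ k * (1 + v) ^ Suc k"
  using m_omega_diff_le [of 0 v k] assms m_omega_1 by (simp add: mult_ac add.commute)

section \<open>The partial sums as a function of the logarithm of the bound\<close>

definition Afun :: "nat \<Rightarrow> real \<Rightarrow> complex" where
  "Afun k v = (if v < 0 then 0 else of_real (m_omega k (exp v)))"

lemma Afun_measurable [measurable]: "Afun k \<in> borel_measurable borel"
proof -
  have "m_omega k x = (\<Sum>n\<in>{1..nat \<lfloor>x\<rfloor>}. mu_omega_term k n)" if "x \<ge> 0" for x
    unfolding m_omega_def by (rule sum.cong) (use that in \<open>auto simp: le_nat_floor nat_le_iff le_floor_iff le_nat_iff\<close>)
  hence eq: "Afun k = (\<lambda>v. if v < 0 then 0 else of_real (\<Sum>n\<in>{1..nat \<lfloor>exp v\<rfloor>}. mu_omega_term k n))"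
    by (auto simp: Afun_def)
  have "(\<lambda>v::real. (\<lambda>i. complex_of_real (\<Sum>n\<in>{1..nat i}. mu_omega_term k n)) \<lfloor>exp v\<rfloor>) \<in> borel_measurable borel"
    by (rule measurable_compose [where N = "count_space UNIV"]) auto
  thus ?thesis unfolding eq by (intro measurable_If) auto
qed

lemma integral_exp_shift:
  assumes w: "Re w > 0"
  shows "(\<integral>v. indicator {a..} v * exp (- w * of_real v) \<partial>lborel) = exp (- w * of_real a) / w"
proof -
  have "(\<integral>v. indicator {a..} v * exp (- w * of_real v) \<partial>lborel) =
     \<bar>1\<bar> *\<^sub>R (\<integral>v. indicator {a..} (a + 1 * v) * exp (- w * of_real (a + 1 * v)) \<partial>lborel)"
    by (rule lborel_integral_real_affine) simp
  also have "\<dots> = (\<integral>v. exp (- w * of_real a) * (indicator {0..} v * exp (- w * of_real v)) \<partial>lborel)"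
    by (simp add: indicator_def exp_add [symmetric] algebra_simps cong: if_cong)
  also have "\<dots> = exp (- w * of_real a) / w"
    by (simp only: integral_mult_right_zero integral_exp_complex [OF w]) simp
  finally show ?thesis .
qed

text \<open>The coefficient with index \<open>n\<close> is present from \<open>v = ln n\<close>
  onwards, and the integral of \<open>exp (- w * v)\<close> from there is
  \<open>exp (- w * ln n) / w\<close>; exchanging sum and integral gives the Dirichlet series over
  \<open>w\<close>.\<close>

lemma lap_Afun:
  assumes w: "w \<in> rhp"
  shows "lap lborel (max 0) (Afun k) w = muom k w / w"
proof -
  have u: "Re w > 0" using w by (simp add: rhp_def)
  define c where "c = (\<lambda>n. complex_of_real (mu_omega_term k n))"
  have c0: "c 0 = 0" by (simp add: c_def mu_omega_term_def)
  define f where "f = (\<lambda>(n::nat) v. c n * (indicator {ln (real n)..} v * exp (- w * of_real v)))"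
  have "lap lborel (max 0) (Afun k) w = (\<integral>v. (\<integral>n. f n v \<partial>count_space UNIV) \<partial>lborel)"
    unfolding lap_def
  proof (rule Bochner_Integration.integral_cong [OF refl])
    fix v :: real
    define B where "B = {n. 1 \<le> n \<and> real n \<le> exp v}"
    have B: "finite B" unfolding B_def by (rule finite_nat_le_real)
    have iff: "ln (real n) \<le> v \<longleftrightarrow> real n \<le> exp v" if "n \<ge> 1" for n
      using that ln_le_cancel_iff [of "real n" "exp v"] by simp
    have sub: "{n. f n v \<noteq> 0} \<subseteq> B"
    proof
      fix n assume "n \<in> {n. f n v \<noteq> 0}"
      hence "n \<noteq> 0" "ln (real n) \<le> v" using c0 by (auto simp: f_def indicator_def split: if_splits intro: gr0I)
      thus "n \<in> B" using iff [of n] by (simp add: B_def)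
    qed
    have "(\<integral>n. f n v \<partial>count_space UNIV) = (\<Sum>n | n \<in> UNIV \<and> f n v \<noteq> 0. f n v)"
      by (rule lebesgue_integral_count_space_finite_support) (use finite_subset [OF sub B] in simp)
    also have "\<dots> = (\<Sum>n\<in>B. f n v)" by (rule sum.mono_neutral_left [OF B]) (use sub in auto)
    also have "\<dots> = (\<Sum>n\<in>B. c n * exp (- w * of_real v))"
      by (rule sum.cong) (use iff in \<open>auto simp: f_def B_def\<close>)
    also have "\<dots> = of_real (m_omega k (exp v)) * exp (- w * of_real v)"
      by (simp add: sum_distrib_right [symmetric] c_def m_omega_def B_def)
    also have "\<dots> = Afun k v * exp (- w * of_real (max 0 v))"
    proof (cases "v < 0")
      case True
      hence "exp v < 1" by simp
      hence "{n. 1 \<le> n \<and> real n \<le> exp v} = {}" by (auto simp: not_le intro: less_le_trans)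
      hence "m_omega k (exp v) = 0" by (simp only: m_omega_def sum.empty)
      thus ?thesis using True by (simp add: Afun_def)
    qed (simp add: Afun_def)
    finally show "Afun k v * exp (- w * of_real (max 0 v)) = (\<integral>n. f n v \<partial>count_space UNIV)" ..
  qed
  also have "\<dots> = (\<integral>n. (\<integral>v. f n v \<partial>lborel) \<partial>count_space UNIV)"
  proof (rule fubini_dominated [symmetric])
    show "case_prod f \<in> borel_measurable (count_space UNIV \<Otimes>\<^sub>M lborel)"
      by (rule measurable_pair_measure_countable1) (auto simp: f_def)
    show "integrable (count_space UNIV) (\<lambda>n. norm (c n) * exp (- (Re w / 2) * ln (real n)))"
      using dir_ok_muom [of k] half_gt_zero [OF u] unfolding lap_ok_def c_def by blast
    show "integrable lborel (\<lambda>v. indicator {0..} v * exp (- (Re w / 2) * v))"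
      using half_gt_zero [OF u] by (rule exp_integrable_lborel)
    fix n :: nat and v :: real
    \<comment> \<open>The decay \<open>Re w\<close> is divided evenly between \<open>ln n\<close>
      and \<open>v\<close>, which is possible because \<open>f n v\<close> vanishes unless
      \<open>ln n \<le> v\<close>. This makes the majorant a product.\<close>
    show "norm (f n v) \<le> norm (c n) * exp (- (Re w / 2) * ln (real n)) * (indicator {0..} v * exp (- (Re w / 2) * v))"
    proof (cases "ln (real n) \<le> v")
      case True
      have "0 \<le> v" using True ln_real_nonneg [of n] by linarith
      have "Re w / 2 * ln (real n) \<le> Re w / 2 * v" using True u by (intro mult_left_mono) auto
      hence "- Re w * v \<le> - (Re w / 2) * ln (real n) + - (Re w / 2) * v" by (simp add: algebra_simps)
      hence "exp (- Re w * v) \<le> exp (- (Re w / 2) * ln (real n)) * exp (- (Re w / 2) * v)"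
        unfolding exp_add [symmetric] exp_le_cancel_iff .
      hence "norm (c n) * exp (- Re w * v) \<le> norm (c n) * (exp (- (Re w / 2) * ln (real n)) * exp (- (Re w / 2) * v))"
        by (rule mult_left_mono) auto
      thus ?thesis using True \<open>0 \<le> v\<close> by (simp add: f_def norm_mult mult.assoc)
    qed (simp add: f_def)
  qed (auto intro!: sigma_finite_lborel sigma_finite_measure_count_space_countable)
  also have "\<dots> = (\<integral>n. (c n * exp (- w * of_real (ln (real n)))) / w \<partial>count_space UNIV)"
    unfolding f_def by (simp only: integral_mult_right_zero integral_exp_shift [OF u]) simp
  also have "\<dots> = muom k w / w"
    by (simp add: muom_def dir_def lap_def c_def)
  finally show ?thesis .
qed

text \<open>If \<open>v \<ge> X / 2\<close>, both points are at least \<open>X / 2\<close> and the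
  single-term error is at most \<open>exp (- X / 2)\<close>. Otherwise
  \<open>\<bar>v - X\<bar> > 1\<close>, and the bound for the two values themselves is
  enough.\<close>

lemma Afun_osc:
  assumes k: "k \<ge> 1" and v: "v \<ge> 0" and X: "X \<ge> 2"
  shows "norm (Afun k v - Afun k X) \<le> 2 * 2 ^ k * (1 + v + X) ^ Suc k * (\<bar>v - X\<bar> + exp (- X / 2))"
proof -
  have A: "norm (Afun k v - Afun k X) = \<bar>m_omega k (exp v) - m_omega k (exp X)\<bar>"
    using v X unfolding Afun_def by (simp del: of_real_diff add: of_real_diff [symmetric])
  show ?thesis
  proof (cases "v \<ge> X / 2")
    case True
    have ex: "exp (- v) \<le> exp (- X / 2)" "exp (- X) \<le> exp (- X / 2)" using True X by auto
    have le: "2 ^ k * (1 + b) ^ k * (d + e) \<le> 2 * 2 ^ k * (1 + v + X) ^ Suc k * (d + exp (- X / 2))"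
      if "b \<le> v + X" "b \<ge> 0" "d \<ge> 0" "0 \<le> e" "e \<le> exp (- X / 2)" for b d e
    proof -
      have "(1 + b) ^ k \<le> (1 + v + X) ^ k" using that by (intro power_mono) auto
      also have "\<dots> \<le> (1 + v + X) ^ Suc k" using v X by (intro power_increasing) auto
      finally have p: "(1 + b) ^ k \<le> (1 + v + X) ^ Suc k" .
      have "(2::real) ^ k \<le> 2 * 2 ^ k" by simp
      thus ?thesis using that v X p by (intro mult_mono add_mono) auto
    qed
    show ?thesis
    proof (cases "v \<le> X")
      case True
      have "\<bar>m_omega k (exp X) - m_omega k (exp v)\<bar> \<le> 2 ^ k * (1 + X) ^ k * ((X - v) + exp (- v))"
        using v True by (intro m_omega_diff_le) auto
      also have "\<dots> \<le> 2 * 2 ^ k * (1 + v + X) ^ Suc k * ((X - v) + exp (- X / 2))"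
        by (rule le) (use v X True ex exp_ge_zero [of "- v"] in linarith)+
      finally show ?thesis unfolding A using True by (simp add: abs_minus_commute)
    next
      case False
      have "\<bar>m_omega k (exp v) - m_omega k (exp X)\<bar> \<le> 2 ^ k * (1 + v) ^ k * ((v - X) + exp (- X))"
        using X False by (intro m_omega_diff_le) auto
      also have "\<dots> \<le> 2 * 2 ^ k * (1 + v + X) ^ Suc k * ((v - X) + exp (- X / 2))"
        by (rule le) (use v X False ex exp_ge_zero [of "- X"] in linarith)+
      finally show ?thesis unfolding A using False by simp
    qed
  next
    case False
    have "\<bar>m_omega k (exp v) - m_omega k (exp X)\<bar> \<le> 2 ^ k * (1 + v) ^ Suc k + 2 ^ k * (1 + X) ^ Suc k"
      using m_omega_bound [OF k v] m_omega_bound [OF k, of X] X by linarith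
    also have "\<dots> \<le> 2 ^ k * (1 + v + X) ^ Suc k + 2 ^ k * (1 + v + X) ^ Suc k"
      by (intro add_mono [OF mult_left_mono mult_left_mono] power_mono) (use v X in auto)
    also have "\<dots> = 2 * 2 ^ k * (1 + v + X) ^ Suc k * 1" by simp
    also have "\<dots> \<le> 2 * 2 ^ k * (1 + v + X) ^ Suc k * (\<bar>v - X\<bar> + exp (- X / 2))"
    proof (rule mult_left_mono)
      show "1 \<le> \<bar>v - X\<bar> + exp (- X / 2)" using False X by (intro add_increasing2) auto
    qed (use v X in auto)
    finally show ?thesis unfolding A .
  qed
qed

text \<open>The main terms are the functions \<open>Er j l\<close> themselves, whose transforms are
  exact and which are regular at \<open>v = 0\<close>. Their asymptotic polynomials are substituted
  only at the very end.\<close>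

definition Esum :: "(nat \<Rightarrow> nat \<Rightarrow> complex) \<Rightarrow> nat \<Rightarrow> nat \<Rightarrow> real \<Rightarrow> complex" where
  "Esum e J k v = (\<Sum>j<J. \<Sum>l<k. e j l * (if v < 0 then 0 else of_real (Er j l v)))"

definition Rfun :: "(nat \<Rightarrow> nat \<Rightarrow> complex) \<Rightarrow> nat \<Rightarrow> nat \<Rightarrow> real \<Rightarrow> complex" where
  "Rfun e J k v = Afun k v - Esum e J k v"

lemma lap_ok_Afun:
  assumes "k \<ge> 1"
  shows "lap_ok lborel (max 0) (Afun k)"
proof (rule lap_ok_halfline [of _ "2 ^ k" "Suc k"])
  show "norm (Afun k v) \<le> 2 ^ k * (1 + v) ^ Suc k" if "v \<ge> 0" for v
    using m_omega_bound [OF assms that] that by (simp add: Afun_def)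
qed (auto simp: Afun_def)

lemma lap_ok_Er: "lap_ok lborel (max 0) (\<lambda>v. if v < 0 then 0 else of_real (Er j l v))"
proof (rule lap_ok_halfline [of _ "Im1 j l" 0])
  show "norm (if v < 0 then 0 else complex_of_real (Er j l v)) \<le> Im1 j l * (1 + v) ^ 0" if "v \<ge> 0" for v
    using Er_bound [OF that] that by simp
qed auto

lemma lap_Rfun:
  assumes k: "k \<ge> 1" and w: "w \<in> rhp"
  shows "lap lborel (max 0) (Rfun e J k) w = muom k w / w - (\<Sum>j<J. \<Sum>l<k. e j l * Dr j l w)"
proof -
  let ?E = "\<lambda>j l v. (if v < 0 then 0 else complex_of_real (Er j l v))"
  have iE: "integrable lborel (\<lambda>v. ?E j l v * exp (- w * of_real (max 0 v)))" for j l
    by (rule lap_integrable [OF lap_ok_Er w])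
  have iE': "integrable lborel (\<lambda>v. e j l * (?E j l v * exp (- w * of_real (max 0 v))))" for j l
    by (rule integrable_mult_right [OF iE])
  have iA: "integrable lborel (\<lambda>v. Afun k v * exp (- w * of_real (max 0 v)))"
    by (rule lap_integrable [OF lap_ok_Afun [OF k] w])
  have eq: "Rfun e J k v * exp (- w * of_real (max 0 v)) = Afun k v * exp (- w * of_real (max 0 v)) -
      (\<Sum>j<J. \<Sum>l<k. e j l * (?E j l v * exp (- w * of_real (max 0 v))))" for v
    by (simp only: Rfun_def Esum_def left_diff_distrib sum_distrib_right mult.assoc)
  have iS': "integrable lborel (\<lambda>v. \<Sum>l<k. e j l * (?E j l v * exp (- w * of_real (max 0 v))))" for j
    by (rule Bochner_Integration.integrable_sum [OF iE'])
  have iS: "integrable lborel (\<lambda>v. \<Sum>j<J. \<Sum>l<k. e j l * (?E j l v * exp (- w * of_real (max 0 v))))"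
    by (rule Bochner_Integration.integrable_sum [OF iS'])
  have "lap lborel (max 0) (Rfun e J k) w = lap lborel (max 0) (Afun k) w - (\<Sum>j<J. \<Sum>l<k. e j l * lap lborel (max 0) (?E j l) w)"
    unfolding lap_def eq Bochner_Integration.integral_diff [OF iA iS]
    by (simp only: Bochner_Integration.integral_sum [OF iS'] Bochner_Integration.integral_sum [OF iE'] integral_mult_right_zero)
  thus ?thesis by (simp only: lap_Afun [OF w] lap_Er [OF w])
qed

lemma Rfun_growth:
  assumes k: "k \<ge> 1"
  obtains K where "K \<ge> 0" "\<And>v. v \<ge> 0 \<Longrightarrow> norm (Rfun e J k v) \<le> K * (1 + v) ^ Suc k"
    "\<And>v X. v \<ge> 0 \<Longrightarrow> X \<ge> 2 \<Longrightarrow> norm (Rfun e J k v - Rfun e J k X) \<le> K * (1 + v + X) ^ Suc k * (\<bar>v - X\<bar> + exp (- X / 2))"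
proof -
  define S1 where "S1 = (\<Sum>j<J. \<Sum>l<k. norm (e j l) * Im1 j l)"
  define S2 where "S2 = (\<Sum>j<J. \<Sum>l<k. norm (e j l) * Im1 (Suc j) l)"
  have S: "S1 \<ge> 0" "S2 \<ge> 0" unfolding S1_def S2_def using Im1_nonneg by (auto intro!: sum_nonneg)
  define K where "K = 2 * 2 ^ k + S1 + S2"
  have E1: "norm (Esum e J k v) \<le> S1" if "v \<ge> 0" for v
    unfolding Esum_def S1_def
  proof (intro order_trans [OF norm_sum] sum_mono)
    fix j l
    show "norm (e j l * (if v < 0 then 0 else of_real (Er j l v))) \<le> norm (e j l) * Im1 j l"
      unfolding norm_mult using Er_bound [OF that] that by (intro mult_left_mono) auto
  qed
  have E2: "norm (Esum e J k v - Esum e J k X) \<le> S2 * \<bar>v - X\<bar>" if "v \<ge> 0" "X \<ge> 0" for v X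
  proof -
    have "Esum e J k v - Esum e J k X = (\<Sum>j<J. \<Sum>l<k. e j l * of_real (Er j l v - Er j l X))"
      using that unfolding Esum_def by (simp add: sum_subtractf right_diff_distrib)
    also have "norm \<dots> \<le> (\<Sum>j<J. \<Sum>l<k. norm (e j l) * (Im1 (Suc j) l * \<bar>v - X\<bar>))"
    proof (intro order_trans [OF norm_sum] sum_mono)
      fix j l
      show "norm (e j l * of_real (Er j l v - Er j l X)) \<le> norm (e j l) * (Im1 (Suc j) l * \<bar>v - X\<bar>)"
        unfolding norm_mult norm_of_real by (intro mult_left_mono Er_lipschitz that) auto
    qed
    also have "\<dots> = S2 * \<bar>v - X\<bar>" by (simp add: S2_def sum_distrib_right mult.assoc)
    finally show ?thesis .
  qed
  show ?thesis
  proof (rule that [of K])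
    show "K \<ge> 0" using S by (simp add: K_def)
    fix v :: real assume v: "v \<ge> 0"
    have p: "(1 + v) ^ Suc k \<ge> 1" using v by (intro one_le_power) auto
    have "norm (Rfun e J k v) \<le> norm (Afun k v) + norm (Esum e J k v)" unfolding Rfun_def by (rule norm_triangle_ineq4)
    also have "\<dots> \<le> 2 ^ k * (1 + v) ^ Suc k + S1 * 1"
      using m_omega_bound [OF k v] E1 [OF v] v by (intro add_mono) (auto simp: Afun_def)
    also have "\<dots> \<le> 2 ^ k * (1 + v) ^ Suc k + S1 * (1 + v) ^ Suc k"
      using S p by (intro add_left_mono mult_left_mono) auto
    also have "\<dots> = (2 ^ k + S1) * (1 + v) ^ Suc k" by (rule distrib_right [symmetric])
    also have "\<dots> \<le> K * (1 + v) ^ Suc k" using S v by (intro mult_right_mono) (auto simp: K_def)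
    finally show "norm (Rfun e J k v) \<le> K * (1 + v) ^ Suc k" .
    fix X :: real assume X: "X \<ge> 2"
    define Q where "Q = (1 + v + X) ^ Suc k"
    define D where "D = \<bar>v - X\<bar> + exp (- X / 2)"
    have Q: "Q \<ge> 1" unfolding Q_def using v X by (intro one_le_power) auto
    have D: "D \<ge> 0" "\<bar>v - X\<bar> \<le> D" by (auto simp: D_def)
    have "norm (Rfun e J k v - Rfun e J k X) \<le> norm (Afun k v - Afun k X) + norm (Esum e J k v - Esum e J k X)"
      unfolding Rfun_def using norm_triangle_ineq4 [of "Afun k v - Afun k X" "Esum e J k v - Esum e J k X"]
      by (simp add: algebra_simps)
    also have "\<dots> \<le> 2 * 2 ^ k * Q * D + S2 * \<bar>v - X\<bar>"
      using Afun_osc [OF k v X] E2 [OF v, of X] X unfolding Q_def D_def by (intro add_mono) auto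
    also have "S2 * \<bar>v - X\<bar> \<le> S2 * D" using S D by (intro mult_left_mono) auto
    also have "S2 * D \<le> S2 * (Q * D)"
      using S D Q mult_right_mono [OF Q D(1)] by (intro mult_left_mono) auto
    also have "2 * 2 ^ k * Q * D + S2 * (Q * D) = (2 * 2 ^ k + S2) * (Q * D)" by (simp add: algebra_simps)
    also have "\<dots> \<le> K * (Q * D)" using S D Q by (intro mult_right_mono) (auto simp: K_def)
    finally show "norm (Rfun e J k v - Rfun e J k X) \<le> K * (1 + v + X) ^ Suc k * (\<bar>v - X\<bar> + exp (- X / 2))"
      by (simp add: Q_def D_def mult.assoc)
  qed
qed

lemma higher_deriv_bounded_near:
  assumes "h analytic_on {0}"
  obtains s B where "s > 0" "\<And>w. norm w < s \<Longrightarrow> norm ((deriv ^^ n) h w) \<le> B" "h holomorphic_on ball 0 s"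
proof -
  obtain s where s: "s > 0" "h holomorphic_on ball 0 s"
    using assms by (auto simp: analytic_on_def)
  have "(deriv ^^ n) h holomorphic_on ball 0 s" by (rule holomorphic_higher_deriv [OF s(2)]) auto
  hence hc: "(deriv ^^ n) h holomorphic_on cball 0 (s/2)"
    by (rule holomorphic_on_subset) (use s in auto)
  have "bounded ((deriv ^^ n) h ` cball 0 (s/2))"
    by (intro compact_imp_bounded compact_continuous_image holomorphic_on_imp_continuous_on hc compact_cball)
  then obtain B where B: "\<forall>y\<in>(deriv ^^ n) h ` cball 0 (s/2). norm y \<le> B"
    unfolding bounded_iff by (elim exE)
  show ?thesis
  proof (rule that)
    show "s / 2 > 0" using s by simp
    show "norm ((deriv ^^ n) h w) \<le> B" if "norm w < s / 2" for w using B that by simp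
    show "h holomorphic_on ball 0 (s / 2)" by (rule holomorphic_on_subset [OF s(2)]) (use s in auto)
  qed
qed

text \<open>The transform of the remainder has bounded derivatives of order \<open>3 * N\<close>
  near the origin, because the singularity was removed to order \<open>J\<close>; away from it the
  combination of tame functions is tame. Together this is the linear growth on the strip that the
  Tauberian theorem asks for.\<close>

theorem m_omega_expansion:
  assumes k: "k \<ge> 1"
  obtains e where "e 0 (k - 1) = of_nat k * (-1) ^ k"
    "\<And>N. N \<ge> 1 \<Longrightarrow> \<exists>B. \<forall>X\<ge>2. norm (Rfun e (Suc (3 * N)) k X) \<le> B * X ^ Suc k / X ^ N"
proof -
  obtain V V' where V: "\<And>l. l \<le> k \<Longrightarrow> good (V l) (V' l)" "V' k 0 = (-1) ^ k"
    "\<And>w. w \<in> rhp \<Longrightarrow> muom k w / w = (\<Sum>l\<le>k. Lg w ^ l * V l w)"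
    using lgpoly_muom [of k] unfolding lgpoly_def by blast
  obtain e where e: "k \<ge> 1 \<longrightarrow> e 0 (k - 1) = of_nat k * V' k 0"
    "\<And>J. \<exists>h g'. h analytic_on {0} \<and> (\<forall>l\<le>k. g' l analytic_on {0}) \<and>
        near0 (\<lambda>w. \<Sum>l\<le>k. Lg w ^ l * V' l w)
              (\<lambda>w. (\<Sum>j<J. \<Sum>l<k. e j l * Dr j l w) + h w + w ^ J * (\<Sum>l\<le>k. Lg w ^ l * g' l w))"
    using singular_expansion [of k V'] good_D(3) [OF V(1)] by blast
  have "\<exists>B. \<forall>X\<ge>2. norm (Rfun e (Suc (3 * N)) k X) \<le> B * X ^ Suc k / X ^ N" if N: "N \<ge> 1" for N
  proof -
    \<comment> \<open>One order more than the \<open>3 * N\<close> derivatives, as the logarithms in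
      the singular remainder consume one power of \<open>w\<close>.\<close>
    define J where "J = Suc (3 * N)"
    define n where "n = 3 * N"
    define \<Psi> where "\<Psi> = (\<lambda>w. muom k w / w - (\<Sum>j<J. \<Sum>l<k. e j l * Dr j l w))"
    define \<Phi> where "\<Phi> = lap lborel (max 0) (Rfun e J k)"
    have \<Phi>\<Psi>: "\<Phi> w = \<Psi> w" if "w \<in> rhp" for w
      unfolding \<Phi>_def \<Psi>_def by (rule lap_Rfun [OF k that])
    obtain h g' where hg: "h analytic_on {0}" "\<And>l. l \<le> k \<Longrightarrow> g' l analytic_on {0}"
        "near0 (\<lambda>w. \<Sum>l\<le>k. Lg w ^ l * V' l w)
              (\<lambda>w. (\<Sum>j<J. \<Sum>l<k. e j l * Dr j l w) + h w + w ^ J * (\<Sum>l\<le>k. Lg w ^ l * g' l w))"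
      using e(2) [of J] by blast
    define F where "F = (\<lambda>w. w ^ J * (\<Sum>l\<le>k. Lg w ^ l * g' l w))"
    have "near0 (\<lambda>w. muom k w / w) (\<lambda>w. \<Sum>l\<le>k. Lg w ^ l * V' l w)"
    proof (rule near0_trans [OF near0I near0_sum])
      show "muom k w / w = (\<Sum>l\<in>{..k}. Lg w ^ l * V l w)" if "w \<in> rhp" for w using V(3) [OF that] .
      fix l assume "l \<in> {..k}"
      hence "near0 (V l) (V' l)" using good_D(2) [OF V(1)] by (simp add: near0_def extends0_def)
      thus "near0 (\<lambda>w. Lg w ^ l * V l w) (\<lambda>w. Lg w ^ l * V' l w)" by (intro near0_mult near0_refl)
    qed
    from near0_trans [OF this hg(3)] have "near0 \<Psi> (\<lambda>w. h w + F w)"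
      unfolding near0_def \<Psi>_def F_def by (auto elim!: eventually_mono)
    then obtain S where S: "open S" "0 \<in> S" "\<And>w. w \<in> S \<Longrightarrow> w \<in> rhp \<Longrightarrow> \<Psi> w = h w + F w"
      unfolding near0_def eventually_nhds by blast
    obtain s0 where s0: "s0 > 0" "ball 0 s0 \<subseteq> S" using openE [OF S(1,2)] by blast
    obtain s1 B1 where s1: "s1 > 0" "\<And>w. norm w < s1 \<Longrightarrow> norm ((deriv ^^ n) h w) \<le> B1" "h holomorphic_on ball 0 s1"
      using higher_deriv_bounded_near [OF hg(1), of n] by blast
    have "J > n" by (simp add: J_def n_def)
    then obtain r C2 where r: "r > 0" "\<And>w. Re w > 0 \<Longrightarrow> norm w < r \<Longrightarrow> norm ((deriv ^^ n) F w) \<le> C2"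
      using singular_remainder_bound [of k g' n J, OF hg(2)] unfolding F_def by blast
    have "\<forall>l. \<exists>s>0. l \<le> k \<longrightarrow> g' l holomorphic_on ball 0 s"
      using hg(2) by (auto simp: analytic_on_def intro: zero_less_one)
    then obtain sg where sg: "\<And>l. sg l > 0" "\<And>l. l \<le> k \<Longrightarrow> g' l holomorphic_on ball 0 (sg l)" by metis
    define sm where "sm = Min (sg ` {..k})"
    have sm: "sm > 0" "\<And>l. l \<le> k \<Longrightarrow> sm \<le> sg l" using sg(1) by (auto simp: sm_def)
    define \<rho> where "\<rho> = Min {1, s0, s1, r, sm}"
    have \<rho>: "\<rho> > 0" "\<rho> \<le> 1" "\<rho> \<le> s0" "\<rho> \<le> s1" "\<rho> \<le> r" "\<rho> \<le> sm"
      using s0 s1 r sm by (auto simp: \<rho>_def)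
    have near: "norm ((deriv ^^ n) \<Psi> w) \<le> B1 + C2" if w: "w \<in> rhp" "norm w < \<rho>" for w
    proof -
      have op: "open (rhp \<inter> ball 0 \<rho>)" by auto
      have win: "w \<in> rhp \<inter> ball 0 \<rho>" using w by simp
      have hh: "h holomorphic_on rhp \<inter> ball 0 \<rho>"
        using s1(3) \<rho>(4) by (auto intro!: holomorphic_on_subset [of h "ball 0 s1"])
      have hF: "F holomorphic_on rhp \<inter> ball 0 \<rho>"
        unfolding F_def
      proof (intro holomorphic_intros)
        show "Lg holomorphic_on rhp \<inter> ball 0 \<rho>"
          using Lg_holomorphic rhp_subset_slit by (auto intro!: holomorphic_on_subset [of Lg slit])
        fix l assume "l \<in> {..k}"
        hence l: "l \<le> k" by simp
        show "g' l holomorphic_on rhp \<inter> ball 0 \<rho>"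
          using sg(2) [OF l] sm(2) [OF l] \<rho>(6) by (auto intro!: holomorphic_on_subset [of "g' l" "ball 0 (sg l)"])
      qed
      have eqS: "\<Psi> z = h z + F z" if "z \<in> rhp \<inter> ball 0 \<rho>" for z
        using that s0(2) \<rho>(3) by (intro S(3)) auto
      have h\<Psi>: "\<Psi> holomorphic_on rhp \<inter> ball 0 \<rho>"
        using holomorphic_on_add [OF hh hF] by (rule holomorphic_transform) (simp add: eqS)
      have "(deriv ^^ n) \<Psi> w = (deriv ^^ n) (\<lambda>w. h w + F w) w"
        by (rule higher_deriv_transform_within_open [OF h\<Psi> holomorphic_on_add [OF hh hF] op win eqS])
      also have "\<dots> = (deriv ^^ n) h w + (deriv ^^ n) F w"
        by (rule higher_deriv_add [OF hh hF op win])
      finally have "norm ((deriv ^^ n) \<Psi> w) \<le> norm ((deriv ^^ n) h w) + norm ((deriv ^^ n) F w)"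
        by (metis norm_triangle_ineq)
      thus ?thesis using s1(2) [of w] r(2) [of w] w \<rho> by (simp add: rhp_def)
    qed
    define A where "A = {w\<in>strip. norm w \<ge> \<rho>}"
    have Ar: "A \<subseteq> rhp" using strip_subset_rhp unfolding A_def by blast
    have tV: "tame A (V l)" if "l \<le> k" for l
      by (rule tame_mono [OF good_D(1) [OF V(1) [OF that]]]) (auto simp: A_def)
    have t1: "tame A (\<lambda>w. muom k w / w)"
    proof -
      have "tame A (\<lambda>w. \<Sum>l\<in>{..k}. Lg w ^ l * V l w)"
        using tV tame_Lg [OF \<rho>(1,2)] by (intro tame_sum Ar tame_mult tame_power) (auto simp: A_def)
      also have "?this \<longleftrightarrow> tame A (\<lambda>w. muom k w / w)" by (rule tame_cong) (simp add: V(3))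
      finally show ?thesis .
    qed
    have "tame A \<Psi>"
      unfolding \<Psi>_def
      by (intro tame_diff t1 tame_sum Ar tame_mult tame_const) (use tame_Dr [OF \<rho>(1)] in \<open>simp add: A_def\<close>)
    \<comment> \<open>Of all exponents available from tameness only 1 is used; linear growth is
      harmless against a Gaussian.\<close>
    then obtain C3 where C3: "C3 \<ge> 0" "\<And>w. w \<in> A \<Longrightarrow> norm ((deriv ^^ n) \<Psi> w) \<le> C3 * (1 + \<bar>Im w\<bar>) powr 1"
      using slow_nonneg_constE [OF tame_D(4) zero_less_one] by blast
    define C where "C = \<bar>B1 + C2\<bar> + C3"
    obtain K where K: "K \<ge> 0" "\<And>v. v \<ge> 0 \<Longrightarrow> norm (Rfun e J k v) \<le> K * (1 + v) ^ Suc k"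
      "\<And>v X. v \<ge> 0 \<Longrightarrow> X \<ge> 2 \<Longrightarrow> norm (Rfun e J k v - Rfun e J k X) \<le> K * (1 + v + X) ^ Suc k * (\<bar>v - X\<bar> + exp (- X / 2))"
      using Rfun_growth [OF k, of e J] by blast
    have supp: "Rfun e J k v = 0" if "v < 0" for v using that by (simp add: Rfun_def Afun_def Esum_def)
    have meas: "Rfun e J k \<in> borel_measurable lborel" unfolding Rfun_def Esum_def by measurable
    have ok: "lap_ok lborel (max 0) (Rfun e J k)" by (rule lap_ok_halfline [OF meas supp K(2)])
    have bd: "norm ((deriv ^^ (3 * N)) (lap lborel (max 0) (Rfun e J k)) w) \<le> C * (1 + \<bar>Im w\<bar>)" if w: "w \<in> strip" for w
    proof -
      have wr: "w \<in> rhp" using w strip_subset_rhp by blast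
      have h\<Phi>: "\<Phi> holomorphic_on rhp" unfolding \<Phi>_def by (rule lap_holomorphic [OF ok])
      have h\<Psi>: "\<Psi> holomorphic_on rhp" using h\<Phi> by (rule holomorphic_transform) (simp add: \<Phi>\<Psi>)
      have "(deriv ^^ n) \<Phi> w = (deriv ^^ n) \<Psi> w"
        by (rule higher_deriv_transform_within_open [OF h\<Phi> h\<Psi> open_rhp wr \<Phi>\<Psi>])
      moreover have "norm ((deriv ^^ n) \<Psi> w) \<le> C * (1 + \<bar>Im w\<bar>)"
      proof (cases "norm w < \<rho>")
        case True
        have "norm ((deriv ^^ n) \<Psi> w) \<le> C * 1" using near [OF wr True] C3(1) by (simp add: C_def)
        also have "\<dots> \<le> C * (1 + \<bar>Im w\<bar>)" using C3(1) by (intro mult_left_mono) (auto simp: C_def)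
        finally show ?thesis .
      next
        case False
        hence "w \<in> A" using w by (simp add: A_def)
        hence "norm ((deriv ^^ n) \<Psi> w) \<le> C3 * (1 + \<bar>Im w\<bar>)" using C3(2) [of w] by simp
        also have "\<dots> \<le> C * (1 + \<bar>Im w\<bar>)" by (intro mult_right_mono) (auto simp: C_def)
        finally show ?thesis .
      qed
      ultimately show ?thesis by (simp add: n_def \<Phi>_def)
    qed
    obtain B where "\<And>X. X \<ge> 2 \<Longrightarrow> norm (Rfun e J k X) \<le> B * X ^ Suc k / X ^ N"
      using tauberian_power_saving [OF meas supp K(2,3) bd N] by blast
    thus ?thesis unfolding J_def by blast
  qed
  moreover have "e 0 (k - 1) = of_nat k * (-1) ^ k" using e(1) k V(2) by simp
  ultimately show ?thesis using that by blast
qed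

lemma poly_abs_le_power:
  fixes p :: "real poly"
  assumes "degree p \<le> d"
  obtains C where "C \<ge> 0" "\<And>y. y \<ge> 1 \<Longrightarrow> \<bar>poly p y\<bar> \<le> C * y ^ d"
proof (rule that [of "\<Sum>i\<le>degree p. \<bar>coeff p i\<bar>"])
  fix y :: real assume y: "y \<ge> 1"
  have "\<bar>poly p y\<bar> \<le> (\<Sum>i\<le>degree p. \<bar>coeff p i\<bar> * y ^ d)"
    unfolding poly_altdef
  proof (rule order_trans [OF sum_abs sum_mono])
    fix i assume "i \<in> {..degree p}"
    hence "y ^ i \<le> y ^ d" using assms y by (intro power_increasing) auto
    thus "\<bar>coeff p i * y ^ i\<bar> \<le> \<bar>coeff p i\<bar> * y ^ d"
      using y by (simp add: abs_mult mult_left_mono)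
  qed
  thus "\<bar>poly p y\<bar> \<le> (\<Sum>i\<le>degree p. \<bar>coeff p i\<bar>) * y ^ d" by (simp only: sum_distrib_right)
qed (auto intro: sum_nonneg)

text \<open>The Tauberian estimate loses \<open>X ^ Suc k\<close>, so the remainder is taken with a
  correspondingly larger \<open>N\<close>. This brings in more main terms than wanted; those with
  index above \<open>\<nu>\<close> are moved into the error, where they determine its logarithmic
  power \<open>k - 1\<close>.\<close>

theorem m_omega_exp_expansion:
  assumes k: "k \<ge> 1"
  obtains F :: "nat \<Rightarrow> real poly" where "\<And>j. degree (F j) \<le> k - 1" "degree (F 1) = k - 1"
    "\<And>\<nu>. \<exists>C\<ge>0. \<forall>X\<ge>3. \<bar>m_omega k (exp X) - (\<Sum>j=1..\<nu>. poly (F j) (ln X) / X ^ j)\<bar> \<le> C * ln X ^ (k - 1) / X ^ (\<nu> + 1)"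
proof -
  obtain e where e0: "e 0 (k - 1) = of_nat k * (-1) ^ k"
    and e: "\<And>N. N \<ge> 1 \<Longrightarrow> \<exists>B. \<forall>X\<ge>2. norm (Rfun e (Suc (3 * N)) k X) \<le> B * X ^ Suc k / X ^ N"
    using m_omega_expansion [OF k] by blast
  \<comment> \<open>The index shifts because \<open>Er j l\<close> is of order
    \<open>X ^ (- Suc j)\<close> up to logarithms. Real parts are taken since the
    \<open>e j l\<close> are given as complex numbers only, while the sums are real.\<close>
  define F where "F = (\<lambda>j. \<Sum>l<k. smult (Re (e (j - 1) l)) (Pr (j - 1) l))"
  have deg: "degree (F j) \<le> k - 1" for j
    unfolding F_def
  proof (rule degree_sum_le)
    fix l assume "l \<in> {..<k}"
    thus "degree (smult (Re (e (j - 1) l)) (Pr (j - 1) l)) \<le> k - 1"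
      using degree_Pr [of "j - 1" l] degree_smult_le [of "Re (e (j - 1) l)" "Pr (j - 1) l"] by auto
  qed simp
  have "coeff (F 1) (k - 1) = (\<Sum>l<k. Re (e 0 l) * coeff (Pr 0 l) (k - 1))"
    by (simp add: F_def coeff_sum)
  also have "\<dots> = (\<Sum>l\<in>{k - 1}. Re (e 0 l) * coeff (Pr 0 l) (k - 1))"
  proof (rule sum.mono_neutral_right)
    show "\<forall>l\<in>{..<k} - {k - 1}. Re (e 0 l) * coeff (Pr 0 l) (k - 1) = 0"
    proof
      fix l assume "l \<in> {..<k} - {k - 1}"
      hence "degree (Pr 0 l) < k - 1" using degree_Pr [of 0 l] by auto
      thus "Re (e 0 l) * coeff (Pr 0 l) (k - 1) = 0" by (simp add: coeff_eq_0)
    qed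
  qed (use k in auto)
  also have "\<dots> = Re (e 0 (k - 1))" by (simp add: coeff_Pr)
  also have "\<dots> = Re (of_real (real k * (-1) ^ k))" unfolding e0 by simp
  also have "\<dots> = real k * (-1) ^ k" by (rule Re_complex_of_real)
  finally have "coeff (F 1) (k - 1) \<noteq> 0" using k by simp
  hence deg1: "degree (F 1) = k - 1" using le_degree [of "F 1" "k - 1"] deg [of 1] by simp
  have "\<exists>C\<ge>0. \<forall>X\<ge>3. \<bar>m_omega k (exp X) - (\<Sum>j=1..\<nu>. poly (F j) (ln X) / X ^ j)\<bar> \<le> C * ln X ^ (k - 1) / X ^ (\<nu> + 1)" for \<nu>
  proof -
    \<comment> \<open>\<open>Suc k\<close> compensates the loss in the Tauberian theorem, and
      \<open>\<nu> + 1\<close> is the order of the error.\<close>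
    define N where "N = Suc k + (\<nu> + 1)"
    define J where "J = Suc (3 * N)"
    obtain B where B: "\<And>X. X \<ge> 2 \<Longrightarrow> norm (Rfun e J k X) \<le> B * X ^ Suc k / X ^ N"
      using e [of N] by (auto simp: N_def J_def)
    have "\<forall>j l. \<exists>b. \<forall>X\<ge>1. \<bar>Er j l X - poly (Pr j l) (ln X) / X ^ Suc j\<bar> \<le> b * exp (- X / 2)"
      using Er_asymp by metis
    then obtain b where b: "\<And>j l X. X \<ge> 1 \<Longrightarrow> \<bar>Er j l X - poly (Pr j l) (ln X) / X ^ Suc j\<bar> \<le> b j l * exp (- X / 2)"
      by metis
    have "\<forall>j. \<exists>c\<ge>0. \<forall>y\<ge>1. \<bar>poly (F j) y\<bar> \<le> c * y ^ (k - 1)"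
      using poly_abs_le_power [OF deg] by metis
    then obtain c where c: "\<And>j. c j \<ge> 0" "\<And>j y. y \<ge> 1 \<Longrightarrow> \<bar>poly (F j) y\<bar> \<le> c j * y ^ (k - 1)" by metis
    define M where "M = fact (\<nu> + 1) / (1 / 2 :: real) ^ (\<nu> + 1)"
    define S where "S = (\<Sum>j<J. \<Sum>l<k. norm (e j l) * \<bar>b j l\<bar>)"
    define T where "T = (\<Sum>j=\<nu>+1..J. c j)"
    define C where "C = \<bar>B\<bar> + S * M + T"
    have nn: "M \<ge> 0" "S \<ge> 0" "T \<ge> 0" using c(1) by (auto simp: M_def S_def T_def intro!: sum_nonneg)
    show ?thesis
    proof (rule exI [of _ C], intro conjI allI impI)
      show "C \<ge> 0" using nn by (simp add: C_def)
      fix X :: real assume X: "X \<ge> 3"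
      define G where "G = (\<lambda>j. poly (F j) (ln X) / X ^ j)"
      define L where "L = ln X ^ (k - 1)"
      have X0: "X > 0" using X by simp
      \<comment> \<open>The threshold 3 lies above \<open>exp 1\<close>. Hence powers of
        \<open>ln X\<close> are at least 1 and can be inserted into error terms that carry no
        logarithm.\<close>
      have lnX: "ln X \<ge> 1" using X exp_le X0 by (subst ln_ge_iff) linarith+
      have L: "L \<ge> 1" unfolding L_def using lnX by (rule one_le_power)
      have ex: "exp (- X / 2) \<le> M / X ^ (\<nu> + 1)"
      proof -
        have "X ^ (\<nu> + 1) \<le> M * exp (1 / 2 * X)" unfolding M_def by (rule power_le_exp) (use X in auto)
        hence "X ^ (\<nu> + 1) * exp (- X / 2) \<le> M * exp (1 / 2 * X) * exp (- X / 2)" by (rule mult_right_mono) simp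
        also have "\<dots> = M" by (simp add: mult.assoc exp_add [symmetric])
        finally show ?thesis using X0 by (simp add: pos_le_divide_eq mult.commute)
      qed
      define D where "D = (\<Sum>j<J. \<Sum>l<k. Re (e j l) * (Er j l X - poly (Pr j l) (ln X) / X ^ Suc j))"
      have D: "\<bar>D\<bar> \<le> S * exp (- X / 2)"
      proof -
        have "\<bar>D\<bar> \<le> (\<Sum>j<J. \<Sum>l<k. norm (e j l) * \<bar>b j l\<bar> * exp (- X / 2))"
          unfolding D_def
        proof (intro order_trans [OF sum_abs] sum_mono)
          fix j l
          have "\<bar>Er j l X - poly (Pr j l) (ln X) / X ^ Suc j\<bar> \<le> b j l * exp (- X / 2)" using X by (intro b) simp
          also have "\<dots> \<le> \<bar>b j l\<bar> * exp (- X / 2)" by (intro mult_right_mono) auto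
          finally show "\<bar>Re (e j l) * (Er j l X - poly (Pr j l) (ln X) / X ^ Suc j)\<bar> \<le> norm (e j l) * \<bar>b j l\<bar> * exp (- X / 2)"
            unfolding abs_mult mult.assoc by (intro mult_mono abs_Re_le_cmod) auto
        qed
        thus ?thesis by (simp only: S_def sum_distrib_right)
      qed
      have GF: "G (Suc j) = (\<Sum>l<k. Re (e j l) * (poly (Pr j l) (ln X) / X ^ Suc j))" for j
        by (simp add: G_def F_def poly_sum sum_divide_distrib)
      have "Re (Rfun e J k X) = m_omega k (exp X) - (\<Sum>j<J. \<Sum>l<k. Re (e j l) * Er j l X)"
        using X by (simp add: Rfun_def Afun_def Esum_def)
      moreover have "(\<Sum>j<J. \<Sum>l<k. Re (e j l) * Er j l X) = D + (\<Sum>j<J. G (Suc j))"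
        by (simp add: D_def GF sum.distrib [symmetric] right_diff_distrib)
      moreover have "(\<Sum>j<J. G (Suc j)) = (\<Sum>j=1..\<nu>. G j) + (\<Sum>j=\<nu>+1..J. G j)"
      proof -
        have "(\<Sum>j<J. G (Suc j)) = (\<Sum>j=1..J. G j)"
          by (simp add: sum.atLeast1_atMost_eq)
        also have "J = \<nu> + (J - \<nu>)" by (simp add: J_def N_def)
        also have "(\<Sum>j=1..\<nu> + (J - \<nu>). G j) = (\<Sum>j=1..\<nu>. G j) + (\<Sum>j=\<nu>+1..\<nu> + (J - \<nu>). G j)"
          by (rule sum.ub_add_nat) simp
        also have "\<nu> + (J - \<nu>) = J" by (simp add: J_def N_def)
        finally show ?thesis .
      qed
      ultimately have "m_omega k (exp X) - (\<Sum>j=1..\<nu>. G j) = Re (Rfun e J k X) + D + (\<Sum>j=\<nu>+1..J. G j)" by linarith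
      hence "\<bar>m_omega k (exp X) - (\<Sum>j=1..\<nu>. G j)\<bar> \<le> \<bar>Re (Rfun e J k X)\<bar> + \<bar>D\<bar> + \<bar>\<Sum>j=\<nu>+1..J. G j\<bar>" by linarith
      moreover have "\<bar>Re (Rfun e J k X)\<bar> \<le> \<bar>B\<bar> / X ^ (\<nu> + 1)"
      proof -
        have "\<bar>Re (Rfun e J k X)\<bar> \<le> norm (Rfun e J k X)" by (rule abs_Re_le_cmod)
        also have "\<dots> \<le> B * X ^ Suc k / X ^ N" using X by (intro B) simp
        also have "\<dots> = B / X ^ (\<nu> + 1)" unfolding N_def power_add [of X "Suc k"] using X0 by simp
        also have "\<dots> \<le> \<bar>B\<bar> / X ^ (\<nu> + 1)" using X0 by (intro divide_right_mono) auto
        finally show ?thesis .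
      qed
      moreover have "\<bar>D\<bar> \<le> S * M / X ^ (\<nu> + 1)"
        using D mult_left_mono [OF ex nn(2)] by simp
      moreover have "\<bar>\<Sum>j=\<nu>+1..J. G j\<bar> \<le> T * L / X ^ (\<nu> + 1)"
      proof -
        have "\<bar>\<Sum>j=\<nu>+1..J. G j\<bar> \<le> (\<Sum>j=\<nu>+1..J. c j * (L / X ^ (\<nu> + 1)))"
        proof (intro order_trans [OF sum_abs] sum_mono)
          fix j assume "j \<in> {\<nu>+1..J}"
          hence "X ^ (\<nu> + 1) \<le> X ^ j" using X by (intro power_increasing) auto
          hence "\<bar>poly (F j) (ln X)\<bar> / X ^ j \<le> (c j * L) / X ^ (\<nu> + 1)"
            using c(1)[of j] c(2) [OF lnX, of j] L X0 unfolding L_def [symmetric] by (intro frac_le) auto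
          thus "\<bar>G j\<bar> \<le> c j * (L / X ^ (\<nu> + 1))" using X0 by (simp add: G_def)
        qed
        also have "\<dots> = T * (L / X ^ (\<nu> + 1))" by (simp only: T_def sum_distrib_right)
        finally show ?thesis by simp
      qed
      ultimately have "\<bar>m_omega k (exp X) - (\<Sum>j=1..\<nu>. G j)\<bar> \<le> (\<bar>B\<bar> * 1 + S * M * 1 + T * L) / X ^ (\<nu> + 1)"
        by (simp add: add_divide_distrib)
      also have "\<dots> \<le> (\<bar>B\<bar> * L + S * M * L + T * L) / X ^ (\<nu> + 1)"
        using L nn X0 by (intro divide_right_mono add_mono mult_left_mono) auto
      also have "\<bar>B\<bar> * L + S * M * L + T * L = C * L" by (simp add: C_def distrib_right)
      finally show "\<bar>m_omega k (exp X) - (\<Sum>j=1..\<nu>. poly (F j) (ln X) / X ^ j)\<bar> \<le> C * ln X ^ (k - 1) / X ^ (\<nu> + 1)"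
        by (simp only: G_def L_def)
    qed
  qed
  thus ?thesis using that [of F, OF deg deg1] by blast
qed

lemma sum_mu_omega_term: "(\<Sum>i<n. mu_omega_term k (i + 1)) = m_omega k (real n)"
proof -
  have "{m. 1 \<le> m \<and> real m \<le> real n} = {1..n}" by auto
  thus ?thesis by (simp add: m_omega_def sum.atLeast1_atMost_eq)
qed

lemma ln_power_le_sqrt: "eventually (\<lambda>X::real. ln X ^ m / X \<le> 1 / sqrt X) at_top"
proof -
  have "((\<lambda>X::real. ln X ^ m / X powr (1/2)) \<longlongrightarrow> 0) at_top" by real_asymp
  hence "eventually (\<lambda>X::real. ln X ^ m / X powr (1/2) < 1) at_top" by (rule order_tendstoD) simp
  thus ?thesis using eventually_gt_at_top [of 0]
  proof eventually_elim
    case (elim X)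
    hence "ln X ^ m \<le> sqrt X" by (simp add: powr_half_sqrt)
    hence "ln X ^ m / X \<le> sqrt X / X" using elim by (intro divide_right_mono) auto
    also have "\<dots> = 1 / sqrt X" using elim by (simp add: field_simps)
    finally show ?case .
  qed
qed

text \<open>All claims follow from the expansion with error
  \<open>ln X ^ (k - 1) / X ^ (\<nu> + 1)\<close> at \<open>X = ln x\<close>, which is sharper than
  required: \<open>k - 1\<close> is below both \<open>k * \<nu> + 3 * k\<close> and
  \<open>(2 * k - 1) / 2\<close>.\<close>

theorem theorem2:
  fixes k :: nat
  assumes "k \<ge> 3"
  shows "(m_omega k \<in> O[at_top](\<lambda>x. ln (ln x) powr ((2 * real k - 1) / 2) / ln x)
      \<and> (\<lambda>n. mu_omega_term k (n + 1)) sums 0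
      \<and> (\<lambda>n. mu_omega_term k (n + 2)) sums 0)
    \<and> (\<exists>F :: nat \<Rightarrow> real poly.
        (\<forall>j\<ge>1. degree (F j) \<le> k - 1) \<and> degree (F 1) = k - 1 \<and>
        (\<forall>\<nu>\<ge>1. (\<lambda>x. m_omega k x - (\<Sum>j = 1..\<nu>. poly (F j) (ln (ln x)) / ln x ^ j))
          \<in> O[at_top](\<lambda>x. ln (ln x) ^ (k * \<nu> + 3 * k) / ln x ^ (\<nu> + 1))))"
proof -
  have k: "k \<ge> 1" using assms by simp
  obtain F :: "nat \<Rightarrow> real poly" where F: "\<And>j. degree (F j) \<le> k - 1" "degree (F 1) = k - 1"
    "\<And>\<nu>. \<exists>C\<ge>0. \<forall>X\<ge>3. \<bar>m_omega k (exp X) - (\<Sum>j=1..\<nu>. poly (F j) (ln X) / X ^ j)\<bar> \<le> C * ln X ^ (k - 1) / X ^ (\<nu> + 1)"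
    using m_omega_exp_expansion [OF k] by blast
  have large: "eventually (\<lambda>x::real. x > 0 \<and> ln x \<ge> 3) at_top"
    using eventually_ge_at_top [of "exp 3"]
    by eventually_elim (metis exp_gt_zero less_le_trans ln_ge_iff)
  have lnln: "ln X \<ge> 1" if "X \<ge> 3" for X :: real
    using that exp_le by (subst ln_ge_iff) linarith+
  have ii: "(\<lambda>x. m_omega k x - (\<Sum>j = 1..\<nu>. poly (F j) (ln (ln x)) / ln x ^ j))
          \<in> O[at_top](\<lambda>x. ln (ln x) ^ (k * \<nu> + 3 * k) / ln x ^ (\<nu> + 1))" for \<nu>
  proof -
    obtain C where C: "C \<ge> 0" "\<And>X. X \<ge> 3 \<Longrightarrow> \<bar>m_omega k (exp X) - (\<Sum>j=1..\<nu>. poly (F j) (ln X) / X ^ j)\<bar> \<le> C * ln X ^ (k - 1) / X ^ (\<nu> + 1)"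
      using F(3) [of \<nu>] by blast
    show ?thesis
    proof (rule bigoI [where c = C], use large in eventually_elim)
      case (elim x)
      define X where "X = ln x"
      have X: "X \<ge> 3" "exp X = x" using elim by (auto simp: X_def)
      have "\<bar>m_omega k x - (\<Sum>j=1..\<nu>. poly (F j) (ln X) / X ^ j)\<bar> \<le> C * ln X ^ (k - 1) / X ^ (\<nu> + 1)"
        using C(2) [OF X(1)] by (simp only: X(2))
      also have "\<dots> \<le> C * ln X ^ (k * \<nu> + 3 * k) / X ^ (\<nu> + 1)"
        using C(1) X lnln [OF X(1)] by (intro divide_right_mono mult_left_mono power_increasing) auto
      also have "\<dots> = C * norm (ln X ^ (k * \<nu> + 3 * k) / X ^ (\<nu> + 1))"
        using X lnln [OF X(1)] by simp
      finally show ?case by (simp add: X_def)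
    qed
  qed
  \<comment> \<open>For \<open>\<nu> = 0\<close> the sum is empty, so the expansion bounds
    \<open>m_omega\<close> itself.\<close>
  obtain C0 where C0: "C0 \<ge> 0" "\<And>X. X \<ge> 3 \<Longrightarrow> \<bar>m_omega k (exp X)\<bar> \<le> C0 * ln X ^ (k - 1) / X"
    using F(3) [of 0] by auto
  have bd: "eventually (\<lambda>x. x > 0 \<and> ln x \<ge> 3 \<and> \<bar>m_omega k x\<bar> \<le> C0 * ln (ln x) ^ (k - 1) / ln x) at_top"
    using large
  proof eventually_elim
    case (elim x)
    thus ?case using C0(2) [of "ln x"] by simp
  qed
  have i: "m_omega k \<in> O[at_top](\<lambda>x. ln (ln x) powr ((2 * real k - 1) / 2) / ln x)"
  proof (rule bigoI [where c = C0], use bd in eventually_elim)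
    case (elim x)
    have l: "ln (ln x) \<ge> 1" using elim lnln by blast
    have x1: "x \<ge> 1" using elim ln_ge_zero_iff [of x] by linarith
    have "ln (ln x) ^ (k - 1) = ln (ln x) powr real (k - 1)" using l by (simp add: powr_realpow)
    also have "\<dots> \<le> ln (ln x) powr ((2 * real k - 1) / 2)" using l k by (intro powr_mono) (auto simp: of_nat_diff)
    finally have "C0 * ln (ln x) ^ (k - 1) / ln x \<le> C0 * (ln (ln x) powr ((2 * real k - 1) / 2)) / ln x"
      using elim C0(1) x1 by (intro divide_right_mono mult_left_mono) auto
    also have "\<dots> = C0 * norm (ln (ln x) powr ((2 * real k - 1) / 2) / ln x)" using elim x1 by auto
    finally show ?case using elim by simp
  qed
  have lim: "(m_omega k \<longlongrightarrow> 0) at_top"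
  proof (rule Lim_null_comparison)
    have "filterlim (ln :: real \<Rightarrow> real) at_top at_top" by (rule ln_at_top)
    hence "eventually (\<lambda>x::real. ln (ln x) ^ (k - 1) / ln x \<le> 1 / sqrt (ln x)) at_top"
      by (rule eventually_compose_filterlim [OF ln_power_le_sqrt])
    thus "eventually (\<lambda>x. norm (m_omega k x) \<le> C0 * (1 / sqrt (ln x))) at_top"
      using bd
    proof eventually_elim
      case (elim x)
      have "C0 * (ln (ln x) ^ (k - 1) / ln x) \<le> C0 * (1 / sqrt (ln x))" using elim C0(1) by (intro mult_left_mono) auto
      thus ?case using elim by simp
    qed
    show "((\<lambda>x. C0 * (1 / sqrt (ln x))) \<longlongrightarrow> 0) at_top" by real_asymp
  qed
  have s1: "(\<lambda>n. mu_omega_term k (n + 1)) sums 0"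
    unfolding sums_def sum_mu_omega_term by (rule filterlim_compose [OF lim filterlim_real_sequentially])
  \<comment> \<open>The term at 1 is 0 because \<open>omega 1 = 0\<close> and \<open>k\<close> is
    positive, so both series have the same partial sums up to the shift of the index.\<close>
  have "mu_omega_term k (0 + 1) = 0" using k by (simp add: mu_omega_term_def)
  hence s2: "(\<lambda>n. mu_omega_term k (n + 2)) sums 0"
    using s1 sums_Suc_iff [of "\<lambda>n. mu_omega_term k (n + 1)" 0] by simp
  show ?thesis using i s1 s2 F(1,2) ii by blast
qed

end
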